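(* Let $\pi$ be a set of primes, let $G$ be a finite $\pi$-separable group, and let $\mathcal{N}$ be a normal $\pi$-series for $G$. Let $\chi \in \mathrm{Irr}(G)$ be a character with self-stabilizing pair $(V,\gamma)$ with respect to $\mathcal{N}$. Assume that $\gamma = \alpha\beta$ where $\alpha$ is $\pi$-special and $\beta$ is $\pi'$-special. Then the following are equivalent: (1) $\chi$ is an $\mathcal{N}$-$\pi$-lift. (2) $(V,\gamma)$ is inductive for $\mathcal{N}$. (3) $(V,\alpha)$ is inductive for $\mathcal{N}$ and $\beta$ is linear.
   Context: All groups are finite; $\mathrm{Irr}(G)$ is the set of irreducible complex characters. $G^0$ is the set of $\pi$-elements of $G$; for a character $\chi$ of $G$, $\chi^0$ is the restriction of $\chi$ to $G^0$. The $\pi$-partial characters of $G$ are the functions $\chi^0$, $\chi$ a character of $G$; a $\pi$-partial character is irreducible if it is not a sum of other $\pi$-partial characters, and $\mathrm{I}_\pi(G)$ is the set of irreducible ones. A character $\chi$ is a $\pi$-lift if $\chi^0 \in \mathrm{I}_\pi(G)$. A normal $\pi$-series for $G$ is a set $\mathcal{N} = \{1 = N_0, N_1, \dots, N_n = G\}$ of normal subgroups of $G$ with $N_i \le N_{i+1}$ and each $N_{i+1}/N_i$ a $\pi$-group or a $\pi'$-group. A character $\chi \in \mathrm{Irr}(G)$ is an $\mathcal{N}$-$\pi$-lift if for each $N \in \mathcal{N}$ the irreducible constituents of $\chi_N$ are $\pi$-lifts. A character $\theta\in\mathrm{Irr}(H)$ is $\pi$-special if $\theta(1)$ is a $\pi$-number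 and, for every subnormal subgroup $S$ of $H$, every irreducible constituent of $\theta_S$ has determinantal order a $\pi$-number; $\pi'$-special is defined likewise with the complementary set of primes $\pi'$. A character pair $(T,\tau)$ in $G$ is a subgroup $T \le G$ with $\tau \in \mathrm{Irr}(T)$. A character tower for $\chi \in \mathrm{Irr}(G)$ with respect to $\mathcal{N}$ is a set $\mathcal{U} = \{1 = \nu_0, \nu_1, \dots, \nu_n = \chi\}$ with $\nu_i \in \mathrm{Irr}(N_i)$ and $\nu_i$ a constituent of $(\nu_{i+1})_{N_i}$ for $0\le i\le n-1$. Let $T = G_{\mathcal{U}}$ be the stabilizer in $G$ of all the $\nu_i$. There is a unique $\tau \in \mathrm{Irr}(T)$ such that $\tau^G = \chi$ and, for each $i$, $\tau_{T \cap N_i} = t_i\tau_i$ for some positive integer $t_i$ and $\tau_i \in \mathrm{Irr}(T \cap N_i)$ with $(\tau_i)^{N_i} = \nu_i$. The pair $(T,\tau)$ is the self-stabilizing pair determined by $\mathcal{U}$, and is called a self-stabilizing pair for $\chi$ with respect to $\mathcal{N}$; it is determined by $\chi$ up to $G$-conjugacy. A character pair $(V,\gamma)$ in $G$ is inductive for $\mathcal{N}$ (also: inductive with respect to $\mathcal{N}$) if for each $N \in \mathcal{N}$ we have $\gamma_{V \cap N} = a\eta$ for some positive integer $a$ and $\eta \in \mathrm{Irr}(V \cap N)$ such that $(\eta^N)^0 \in \mathrm{I}_\pi(N)$. *)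

theory Defs
  imports "HOL-Algebra.Multiplicative_Group" "Jordan_Normal_Form.VS_Connect"
begin

text \<open>A subgroup \<open>H\<close> of \<open>G\<close> is a subset of the carrier; as a group it is \<open>G\<lparr>carrier := H\<rparr>\<close>.
  Functions on a group or on a subset of it (characters, their restrictions, partial characters)
  are total functions that vanish outside their intended domain, so that equality of such
  functions is HOL equality and sums can be formed pointwise.\<close>

section \<open>Sets of primes\<close>

definition pi_number :: "nat set \<Rightarrow> nat \<Rightarrow> bool" where
  "pi_number \<pi> n \<longleftrightarrow> n > 0 \<and> (\<forall>p. prime p \<and> p dvd n \<longrightarrow> p \<in> \<pi>)"

definition pi_compl :: "nat set \<Rightarrow> nat set" where
  "pi_compl \<pi> = {p. prime p \<and> p \<notin> \<pi>}"

definition pi_group :: "nat set \<Rightarrow> ('a, 'b) monoid_scheme \<Rightarrow> bool" where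
  "pi_group \<pi> G \<longleftrightarrow> group G \<and> finite (carrier G) \<and> pi_number \<pi> (Coset.order G)"

definition pi_elements :: "nat set \<Rightarrow> ('a, 'b) monoid_scheme \<Rightarrow> 'a set" where
  "pi_elements \<pi> G = {g \<in> carrier G. pi_number \<pi> (group.ord G g)}"

section \<open>Complex representations and characters\<close>

definition general_linear :: "nat \<Rightarrow> complex mat monoid" where
  "general_linear n = units_of (ring_mat TYPE(complex) n ())"

definition representation ::
    "('a, 'b) monoid_scheme \<Rightarrow> nat \<Rightarrow> ('a \<Rightarrow> complex mat) \<Rightarrow> bool" where
  "representation G n \<rho> \<longleftrightarrow> n > 0 \<and> \<rho> \<in> hom G (general_linear n)"

definition invariant_subspace ::
    "('a, 'b) monoid_scheme \<Rightarrow> nat \<Rightarrow> ('a \<Rightarrow> complex mat) \<Rightarrow> complex vec set \<Rightarrow> bool" where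
  "invariant_subspace G n \<rho> W \<longleftrightarrow>
     VectorSpace.subspace class_ring W (module_vec TYPE(complex) n) \<and>
     (\<forall>g \<in> carrier G. \<forall>w \<in> W. \<rho> g *\<^sub>v w \<in> W)"

definition irreducible_representation ::
    "('a, 'b) monoid_scheme \<Rightarrow> nat \<Rightarrow> ('a \<Rightarrow> complex mat) \<Rightarrow> bool" where
  "irreducible_representation G n \<rho> \<longleftrightarrow>
     representation G n \<rho> \<and>
     (\<forall>W. invariant_subspace G n \<rho> W \<longrightarrow> W = {0\<^sub>v n} \<or> W = carrier_vec n)"

definition mat_trace :: "complex mat \<Rightarrow> complex" where
  "mat_trace A = (\<Sum>i<dim_row A. A $$ (i, i))"

definition afforded_char :: "('a, 'b) monoid_scheme \<Rightarrow> ('a \<Rightarrow> complex mat) \<Rightarrow> 'a \<Rightarrow> complex" where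
  "afforded_char G \<rho> = (\<lambda>g. if g \<in> carrier G then mat_trace (\<rho> g) else 0)"

definition characters :: "('a, 'b) monoid_scheme \<Rightarrow> ('a \<Rightarrow> complex) set" where
  "characters G = {afforded_char G \<rho> | n \<rho>. representation G n \<rho>}"

definition Irr :: "('a, 'b) monoid_scheme \<Rightarrow> ('a \<Rightarrow> complex) set" where
  "Irr G = {afforded_char G \<rho> | n \<rho>. irreducible_representation G n \<rho>}"

definition principal_char :: "('a, 'b) monoid_scheme \<Rightarrow> 'a \<Rightarrow> complex" where
  "principal_char G = (\<lambda>g. if g \<in> carrier G then 1 else 0)"

definition linear_char :: "('a, 'b) monoid_scheme \<Rightarrow> ('a \<Rightarrow> complex) \<Rightarrow> bool" where
  "linear_char G \<chi> \<longleftrightarrow> \<chi> \<in> characters G \<and> \<chi> \<one>\<^bsub>G\<^esub> = 1"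

definition restrict_to :: "'a set \<Rightarrow> ('a \<Rightarrow> complex) \<Rightarrow> 'a \<Rightarrow> complex" where
  "restrict_to S \<chi> = (\<lambda>g. if g \<in> S then \<chi> g else 0)"

text \<open>\<open>induced G H \<psi>\<close> is the class function of \<open>G\<close> induced from the class function \<open>\<psi>\<close> of the
  subgroup \<open>H\<close>.\<close>

definition induced ::
    "('a, 'b) monoid_scheme \<Rightarrow> 'a set \<Rightarrow> ('a \<Rightarrow> complex) \<Rightarrow> 'a \<Rightarrow> complex" where
  "induced G H \<psi> = (\<lambda>g. if g \<in> carrier G then
     (\<Sum>x \<in> {x \<in> carrier G. x \<otimes>\<^bsub>G\<^esub> g \<otimes>\<^bsub>G\<^esub> inv\<^bsub>G\<^esub> x \<in> H}. \<psi> (x \<otimes>\<^bsub>G\<^esub> g \<otimes>\<^bsub>G\<^esub> inv\<^bsub>G\<^esub> x))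
       / of_nat (card H) else 0)"

text \<open>\<open>\<psi>\<close> is a constituent of \<open>\<chi>\<close> if \<open>\<chi> - \<psi>\<close> is zero or a character.\<close>

definition irr_constituents ::
    "('a, 'b) monoid_scheme \<Rightarrow> ('a \<Rightarrow> complex) \<Rightarrow> ('a \<Rightarrow> complex) set" where
  "irr_constituents G \<chi> =
     {\<psi> \<in> Irr G. \<chi> = \<psi> \<or> (\<exists>\<phi> \<in> characters G. \<chi> = (\<lambda>g. \<psi> g + \<phi> g))}"

text \<open>The determinant of a character does not depend on the affording representation, since
  representations with the same character are similar; its order is that of an element of the
  group of linear characters.\<close>

definition det_char :: "('a, 'b) monoid_scheme \<Rightarrow> ('a \<Rightarrow> complex) \<Rightarrow> 'a \<Rightarrow> complex" where
  "det_char G \<chi> = (THE \<delta>. \<exists>n \<rho>. representation G n \<rho> \<and> \<chi> = afforded_char G \<rho> \<and>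
     \<delta> = (\<lambda>g. if g \<in> carrier G then Determinant.det (\<rho> g) else 0))"

definition det_order :: "('a, 'b) monoid_scheme \<Rightarrow> ('a \<Rightarrow> complex) \<Rightarrow> nat" where
  "det_order G \<chi> = (LEAST m. m > 0 \<and> (\<forall>g \<in> carrier G. det_char G \<chi> g ^ m = 1))"

section \<open>Special characters\<close>

inductive subnormal :: "('a, 'b) monoid_scheme \<Rightarrow> 'a set \<Rightarrow> bool" for G where
  self: "subnormal G (carrier G)"
| step: "subnormal G K \<Longrightarrow> S \<lhd> G\<lparr>carrier := K\<rparr> \<Longrightarrow> subnormal G S"

definition pi_special ::
    "nat set \<Rightarrow> ('a, 'b) monoid_scheme \<Rightarrow> ('a \<Rightarrow> complex) \<Rightarrow> bool" where
  "pi_special \<pi> H \<theta> \<longleftrightarrow>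
     \<theta> \<in> Irr H \<and>
     (\<exists>d. \<theta> \<one>\<^bsub>H\<^esub> = of_nat d \<and> pi_number \<pi> d) \<and>
     (\<forall>S. subnormal H S \<longrightarrow>
       (\<forall>\<psi> \<in> irr_constituents (H\<lparr>carrier := S\<rparr>) (restrict_to S \<theta>).
          pi_number \<pi> (det_order (H\<lparr>carrier := S\<rparr>) \<psi>)))"

section \<open>Partial characters and lifts\<close>

definition partial_chars ::
    "nat set \<Rightarrow> ('a, 'b) monoid_scheme \<Rightarrow> ('a \<Rightarrow> complex) set" where
  "partial_chars \<pi> G = restrict_to (pi_elements \<pi> G) ` characters G"

definition I_pi :: "nat set \<Rightarrow> ('a, 'b) monoid_scheme \<Rightarrow> ('a \<Rightarrow> complex) set" where
  "I_pi \<pi> G = {\<phi> \<in> partial_chars \<pi> G.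
     \<not> (\<exists>\<psi>s. set \<psi>s \<subseteq> partial_chars \<pi> G - {\<phi>} \<and> \<phi> = (\<lambda>g. \<Sum>\<psi>\<leftarrow>\<psi>s. \<psi> g))}"

definition pi_lift :: "nat set \<Rightarrow> ('a, 'b) monoid_scheme \<Rightarrow> ('a \<Rightarrow> complex) \<Rightarrow> bool" where
  "pi_lift \<pi> G \<chi> \<longleftrightarrow> \<chi> \<in> characters G \<and> restrict_to (pi_elements \<pi> G) \<chi> \<in> I_pi \<pi> G"

section \<open>Normal series, towers and self-stabilizing pairs\<close>

text \<open>A series is the list of its terms, from the trivial subgroup up to the whole group;
  repetitions are allowed.\<close>

definition normal_pi_series :: "nat set \<Rightarrow> ('a, 'b) monoid_scheme \<Rightarrow> 'a set list \<Rightarrow> bool" where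
  "normal_pi_series \<pi> G Ns \<longleftrightarrow>
     Ns \<noteq> [] \<and> hd Ns = {\<one>\<^bsub>G\<^esub>} \<and> last Ns = carrier G \<and>
     (\<forall>N \<in> set Ns. N \<lhd> G) \<and>
     (\<forall>i. Suc i < length Ns \<longrightarrow>
        Ns ! i \<subseteq> Ns ! Suc i \<and>
        (pi_group \<pi> (G\<lparr>carrier := Ns ! Suc i\<rparr> Mod (Ns ! i)) \<or>
         pi_group (pi_compl \<pi>) (G\<lparr>carrier := Ns ! Suc i\<rparr> Mod (Ns ! i))))"

definition pi_separable :: "nat set \<Rightarrow> ('a, 'b) monoid_scheme \<Rightarrow> bool" where
  "pi_separable \<pi> G \<longleftrightarrow> (\<exists>Ns. normal_pi_series \<pi> G Ns)"

definition series_pi_lift ::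
    "nat set \<Rightarrow> ('a, 'b) monoid_scheme \<Rightarrow> 'a set list \<Rightarrow> ('a \<Rightarrow> complex) \<Rightarrow> bool" where
  "series_pi_lift \<pi> G Ns \<chi> \<longleftrightarrow>
     \<chi> \<in> Irr G \<and>
     (\<forall>N \<in> set Ns. \<forall>\<psi> \<in> irr_constituents (G\<lparr>carrier := N\<rparr>) (restrict_to N \<chi>).
        pi_lift \<pi> (G\<lparr>carrier := N\<rparr>) \<psi>)"

definition character_pair ::
    "('a, 'b) monoid_scheme \<Rightarrow> 'a set \<Rightarrow> ('a \<Rightarrow> complex) \<Rightarrow> bool" where
  "character_pair G T \<tau> \<longleftrightarrow> subgroup T G \<and> \<tau> \<in> Irr (G\<lparr>carrier := T\<rparr>)"

definition character_tower ::
    "('a, 'b) monoid_scheme \<Rightarrow> 'a set list \<Rightarrow> ('a \<Rightarrow> complex) \<Rightarrow> ('a \<Rightarrow> complex) list \<Rightarrow> bool" where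
  "character_tower G Ns \<chi> \<nu>s \<longleftrightarrow>
     length \<nu>s = length Ns \<and>
     hd \<nu>s = principal_char (G\<lparr>carrier := hd Ns\<rparr>) \<and> last \<nu>s = \<chi> \<and>
     (\<forall>i < length Ns. \<nu>s ! i \<in> Irr (G\<lparr>carrier := Ns ! i\<rparr>)) \<and>
     (\<forall>i. Suc i < length Ns \<longrightarrow>
        \<nu>s ! i \<in> irr_constituents (G\<lparr>carrier := Ns ! i\<rparr>) (restrict_to (Ns ! i) (\<nu>s ! Suc i)))"

definition tower_stabilizer ::
    "('a, 'b) monoid_scheme \<Rightarrow> 'a set list \<Rightarrow> ('a \<Rightarrow> complex) list \<Rightarrow> 'a set" where
  "tower_stabilizer G Ns \<nu>s = {g \<in> carrier G. \<forall>i < length Ns. \<forall>x \<in> Ns ! i.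
     (\<nu>s ! i) (g \<otimes>\<^bsub>G\<^esub> x \<otimes>\<^bsub>G\<^esub> inv\<^bsub>G\<^esub> g) = (\<nu>s ! i) x}"

text \<open>For a tower \<open>\<nu>s\<close> the following conditions determine \<open>(T, \<tau>)\<close> uniquely.\<close>

definition tower_pair ::
    "('a, 'b) monoid_scheme \<Rightarrow> 'a set list \<Rightarrow> ('a \<Rightarrow> complex) \<Rightarrow> ('a \<Rightarrow> complex) list \<Rightarrow>
     'a set \<Rightarrow> ('a \<Rightarrow> complex) \<Rightarrow> bool" where
  "tower_pair G Ns \<chi> \<nu>s T \<tau> \<longleftrightarrow>
     T = tower_stabilizer G Ns \<nu>s \<and>
     \<tau> \<in> Irr (G\<lparr>carrier := T\<rparr>) \<and>
     induced G T \<tau> = \<chi> \<and>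
     (\<forall>i < length Ns. \<exists>t::nat. \<exists>\<tau>\<^sub>i \<in> Irr (G\<lparr>carrier := T \<inter> Ns ! i\<rparr>).
        t > 0 \<and> restrict_to (T \<inter> Ns ! i) \<tau> = (\<lambda>g. of_nat t * \<tau>\<^sub>i g) \<and>
        induced (G\<lparr>carrier := Ns ! i\<rparr>) (T \<inter> Ns ! i) \<tau>\<^sub>i = \<nu>s ! i)"

definition self_stabilizing_pair ::
    "('a, 'b) monoid_scheme \<Rightarrow> 'a set list \<Rightarrow> ('a \<Rightarrow> complex) \<Rightarrow> 'a set \<Rightarrow> ('a \<Rightarrow> complex) \<Rightarrow> bool"
  where
  "self_stabilizing_pair G Ns \<chi> T \<tau> \<longleftrightarrow>
     (\<exists>\<nu>s. character_tower G Ns \<chi> \<nu>s \<and> tower_pair G Ns \<chi> \<nu>s T \<tau>)"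

definition inductive_pair ::
    "nat set \<Rightarrow> ('a, 'b) monoid_scheme \<Rightarrow> 'a set list \<Rightarrow> 'a set \<Rightarrow> ('a \<Rightarrow> complex) \<Rightarrow> bool" where
  "inductive_pair \<pi> G Ns V \<gamma> \<longleftrightarrow>
     character_pair G V \<gamma> \<and>
     (\<forall>N \<in> set Ns. \<exists>a::nat. \<exists>\<eta> \<in> Irr (G\<lparr>carrier := V \<inter> N\<rparr>).
        a > 0 \<and> restrict_to (V \<inter> N) \<gamma> = (\<lambda>g. of_nat a * \<eta> g) \<and>
        restrict_to (pi_elements \<pi> (G\<lparr>carrier := N\<rparr>)) (induced (G\<lparr>carrier := N\<rparr>) (V \<inter> N) \<eta>)
          \<in> I_pi \<pi> (G\<lparr>carrier := N\<rparr>))"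

end

theory Submission
  imports Defs "Jordan_Normal_Form.Schur_Decomposition" "Jordan_Normal_Form.Spectral_Radius"
begin

text \<open>The equivalence of (1) and (2) follows from Clifford's theorem: the irreducible constituents of
  \<open>\<chi>\<close> on a term \<open>N\<close> of the series are the conjugates of the tower character \<open>\<nu>\<close>, which is induced
  from the irreducible character below \<open>\<gamma>\<close> on \<open>V \<inter> N\<close>. A linear \<open>\<beta>\<close> is trivial on \<open>\<pi>\<close>-elements, so
  twisting by \<open>\<beta>\<close> does not change the partial characters; this gives (3) from (2) once \<open>\<beta>\<close> is known to
  be linear, and (2) from (3).

  That (2) makes \<open>\<beta>\<close> linear is shown by climbing the series and proving \<open>\<bar>\<beta> x\<bar> = \<beta> 1\<close> on \<open>V \<inter> N\<close>.
  Let \<open>M < L\<close> be the intersections of \<open>V\<close> with consecutive terms, and let \<open>\<beta>\<close> be scalar on \<open>M\<close>. If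
  \<open>|L : M|\<close> is a \<open>\<pi>\<close>-number, the constituents of \<open>\<beta>\<close> on \<open>L\<close> have degree dividing both \<open>|L : M|\<close> and
  the \<open>\<pi>'\<close>-number \<open>\<beta> 1\<close>, hence are linear; they agree on \<open>M\<close> and have \<open>\<pi>'\<close>-order, hence coincide.
  If \<open>|L : M|\<close> is a \<open>\<pi>'\<close>-number, the character below \<open>\<alpha>\<close> on \<open>M\<close> extends to a character \<open>\<theta>\<close> of \<open>L\<close>,
  because \<open>\<alpha> 1\<close> is coprime to \<open>|L : M|\<close>. The \<open>\<pi>\<close>-elements of \<open>L\<close> lie in \<open>M\<close>, so there the character
  below \<open>\<gamma>\<close> is \<open>e \<theta>\<close>, and irreducibility of the induced partial character forces \<open>e = 1\<close>. Then
  comparing \<open>\<gamma> = \<alpha> \<beta>\<close> with \<open>\<theta>\<close> in the norm on each coset of \<open>M\<close> leaves no room for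
  \<open>\<bar>\<beta> x\<bar> < \<beta> 1\<close>.\<close>

section \<open>Matrices and traces\<close>

text \<open>The equality \<open>|\<beta> x| = \<beta> 1\<close> holds exactly when \<open>x\<close>
  acts as a scalar in a representation affording \<beta>. On a subgroup it makes \<beta> a multiple
  of a linear character; on all of \<open>V\<close>, where \<beta> is irreducible, it leaves degree
  one. The obstacle is a \<pi>'-section: the hypothesis speaks of \<pi>-elements, which all lie in
  \<open>M\<close>, the claim of elements outside \<open>M\<close>. The extension \<theta> carries
  the information across. The space of \<alpha> is a tensor product, and a suitable scaling makes
  both factors representations of \<open>L\<close>, one of them affording \<theta>; hence
  \<open>\<theta> 1 * |\<alpha> x| \<le> \<alpha> 1 * |\<theta> x|\<close> on \<open>L\<close>. If
  \<open>e = 1\<close>, the character below \<gamma> and \<theta> are both irreducible on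
  \<open>M\<close>, so their squared norms have the same sum \<open>|M|\<close> over each coset of
  \<open>M\<close>, and the inequality leaves \<open>|\<beta> x| \<ge> \<beta> 1\<close>. The
  extension exists because the obstruction, a 2-cocycle of \<open>L / M\<close>, is killed by the
  index \<open>|L : M|\<close> and also by \<open>\<alpha> 1\<close>, the latter through
  determinants, and these numbers are coprime.\<close>

lemma mat_trace_mult:
  assumes "A \<in> carrier_mat n m" "B \<in> carrier_mat m n"
  shows "mat_trace (A * B) = (\<Sum>i<n. \<Sum>j<m. A $$ (i, j) * B $$ (j, i))"
  using assms by (auto simp: mat_trace_def scalar_prod_def atLeast0LessThan intro!: sum.cong)

lemma mat_trace_comm:
  assumes "A \<in> carrier_mat n m" "B \<in> carrier_mat m n"
  shows "mat_trace (A * B) = mat_trace (B * A)"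
  unfolding mat_trace_mult[OF assms] mat_trace_mult[OF assms(2,1)]
  by (subst sum.swap) (simp add: mult.commute)

lemma mat_trace_add:
  assumes "A \<in> carrier_mat n n" "B \<in> carrier_mat n n"
  shows "mat_trace (A + B) = mat_trace A + mat_trace B"
  using assms by (auto simp: mat_trace_def sum.distrib)

lemma mat_trace_minus:
  assumes "A \<in> carrier_mat n n" "B \<in> carrier_mat n n"
  shows "mat_trace (A - B) = mat_trace A - mat_trace B"
  using assms by (auto simp: mat_trace_def sum_subtractf)

lemma mat_trace_smult [simp]:
  assumes "A \<in> carrier_mat n n"
  shows "mat_trace (c \<cdot>\<^sub>m A) = c * mat_trace A"
  using assms by (auto simp: mat_trace_def sum_distrib_left)

lemma mat_trace_one [simp]: "mat_trace (1\<^sub>m n) = of_nat n"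
  by (simp add: mat_trace_def)

lemma mat_trace_zero [simp]: "mat_trace (0\<^sub>m n n) = 0"
  by (simp add: mat_trace_def)

lemma mat_trace_diag_mat: "mat_trace A = sum_list (diag_mat A)"
  unfolding mat_trace_def diag_mat_def by (simp add: interv_sum_list_conv_sum_set_nat atLeast0LessThan)

lemma mat_trace_conj:
  assumes "A \<in> carrier_mat n n" "P \<in> carrier_mat n n" "Q \<in> carrier_mat n n" "Q * P = 1\<^sub>m n"
  shows "mat_trace (P * A * Q) = mat_trace A"
proof -
  have "mat_trace (P * A * Q) = mat_trace (Q * (P * A))"
    using assms by (intro mat_trace_comm[of _ n n]) auto
  also have "Q * (P * A) = A"
    using assms by (subst assoc_mult_mat[symmetric, of _ n n _ n _ n]) auto
  finally show ?thesis .
qed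

definition unit_mat :: "nat \<Rightarrow> nat \<Rightarrow> nat \<Rightarrow> nat \<Rightarrow> complex mat" where
  "unit_mat n m i j = mat n m (\<lambda>(k, l). if k = i \<and> l = j then 1 else 0)"

lemma unit_mat_carrier [simp]: "unit_mat n m i j \<in> carrier_mat n m"
  by (simp add: unit_mat_def)

lemma mat_trace_unit_mat_mult:
  assumes "A \<in> carrier_mat n m" "i < m" "j < n"
  shows "mat_trace (unit_mat m n i j * A) = A $$ (j, i)"
proof -
  have "mat_trace (unit_mat m n i j * A) = (\<Sum>k<m. \<Sum>l<n. if l = j then (if k = i then A $$ (j, i) else 0) else 0)"
    unfolding mat_trace_mult[OF unit_mat_carrier assms(1)]
    by (intro sum.cong refl) (auto simp: unit_mat_def)
  also have "\<dots> = A $$ (j, i)"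
    using assms by (simp add: sum.delta)
  finally show ?thesis .
qed

text \<open>The trace form is nondegenerate: testing against matrix units reads off every
  entry.\<close>

lemma mat_eq_by_trace:
  assumes "A \<in> carrier_mat n m" "B \<in> carrier_mat n m"
    and "\<And>Y. Y \<in> carrier_mat m n \<Longrightarrow> mat_trace (Y * A) = mat_trace (Y * B)"
  shows "A = B"
proof (rule eq_matI)
  fix i j assume "i < dim_row B" "j < dim_col B"
  hence "j < m" "i < n" using assms by auto
  thus "A $$ (i, j) = B $$ (i, j)"
    using mat_trace_unit_mat_mult[OF assms(1)] mat_trace_unit_mat_mult[OF assms(2)]
      assms(3)[OF unit_mat_carrier] by metis
qed (use assms in auto)

text \<open>Matrices of all sizes share one type, so there is no common zero to sum from. The size
  is passed explicitly, and an empty sum is the zero matrix of that size.\<close>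

definition mat_sum :: "nat \<Rightarrow> nat \<Rightarrow> 'i set \<Rightarrow> ('i \<Rightarrow> complex mat) \<Rightarrow> complex mat" where
  "mat_sum n m S F = mat n m (\<lambda>(i, j). \<Sum>s\<in>S. F s $$ (i, j))"

lemma mat_sum_carrier [simp]: "mat_sum n m S F \<in> carrier_mat n m"
  by (simp add: mat_sum_def)

lemma mat_sum_dim [simp]: "dim_row (mat_sum n m S F) = n" "dim_col (mat_sum n m S F) = m"
  by (simp_all add: mat_sum_def)

lemma mat_sum_cong: "(\<And>s. s \<in> S \<Longrightarrow> F s = F' s) \<Longrightarrow> mat_sum n m S F = mat_sum n m S F'"
  by (simp add: mat_sum_def)

lemma mat_sum_reindex_bij:
  "bij_betw h S T \<Longrightarrow> mat_sum n m T F = mat_sum n m S (\<lambda>s. F (h s))"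
  unfolding mat_sum_def by (intro eq_matI) (auto intro!: sum.reindex_bij_betw[symmetric])

lemma mult_mat_sum:
  assumes "A \<in> carrier_mat k n" "\<And>s. s \<in> S \<Longrightarrow> F s \<in> carrier_mat n m"
  shows "A * mat_sum n m S F = mat_sum k m S (\<lambda>s. A * F s)"
proof (rule eq_matI)
  fix i j assume ij: "i < dim_row (mat_sum k m S (\<lambda>s. A * F s))" "j < dim_col (mat_sum k m S (\<lambda>s. A * F s))"
  have "(A * mat_sum n m S F) $$ (i, j) = (\<Sum>l<n. A $$ (i, l) * (\<Sum>s\<in>S. F s $$ (l, j)))"
    using ij assms(1) by (auto simp: scalar_prod_def mat_sum_def atLeast0LessThan intro!: sum.cong)
  also have "\<dots> = (\<Sum>s\<in>S. \<Sum>l<n. A $$ (i, l) * F s $$ (l, j))"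
    by (subst sum.swap) (simp add: sum_distrib_left)
  also have "\<dots> = (\<Sum>s\<in>S. (A * F s) $$ (i, j))"
    using ij assms by (intro sum.cong refl) (force simp: scalar_prod_def atLeast0LessThan intro!: sum.cong)
  finally show "(A * mat_sum n m S F) $$ (i, j) = mat_sum k m S (\<lambda>s. A * F s) $$ (i, j)"
    using ij by (simp add: mat_sum_def)
qed (use assms in auto)

lemma mat_sum_mult:
  assumes "A \<in> carrier_mat m k" "\<And>s. s \<in> S \<Longrightarrow> F s \<in> carrier_mat n m"
  shows "mat_sum n m S F * A = mat_sum n k S (\<lambda>s. F s * A)"
proof (rule eq_matI)
  fix i j assume ij: "i < dim_row (mat_sum n k S (\<lambda>s. F s * A))" "j < dim_col (mat_sum n k S (\<lambda>s. F s * A))"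
  have "(mat_sum n m S F * A) $$ (i, j) = (\<Sum>l<m. (\<Sum>s\<in>S. F s $$ (i, l)) * A $$ (l, j))"
    using ij assms(1) by (auto simp: scalar_prod_def mat_sum_def atLeast0LessThan intro!: sum.cong)
  also have "\<dots> = (\<Sum>s\<in>S. \<Sum>l<m. F s $$ (i, l) * A $$ (l, j))"
    by (subst sum.swap) (simp add: sum_distrib_right)
  also have "\<dots> = (\<Sum>s\<in>S. (F s * A) $$ (i, j))"
    using ij assms by (intro sum.cong refl) (force simp: scalar_prod_def atLeast0LessThan intro!: sum.cong)
  finally show "(mat_sum n m S F * A) $$ (i, j) = mat_sum n k S (\<lambda>s. F s * A) $$ (i, j)"
    using ij by (simp add: mat_sum_def)
qed (use assms in auto)

lemma mat_trace_mat_sum: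
  assumes "\<And>s. s \<in> S \<Longrightarrow> F s \<in> carrier_mat n n"
  shows "mat_trace (mat_sum n n S F) = (\<Sum>s\<in>S. mat_trace (F s))"
proof -
  have "mat_trace (mat_sum n n S F) = (\<Sum>s\<in>S. \<Sum>i<n. F s $$ (i, i))"
    unfolding mat_trace_def mat_sum_def by (simp add: sum.swap[of _ S])
  also have "\<dots> = (\<Sum>s\<in>S. mat_trace (F s))"
    using assms by (intro sum.cong refl) (auto simp: mat_trace_def)
  finally show ?thesis .
qed

section \<open>Triangular forms, eigenvalues and idempotents\<close>

lemma diag_mult_upper_triangular:
  assumes "A \<in> carrier_mat n n" "B \<in> carrier_mat n n" "upper_triangular A" "upper_triangular B"
  shows "upper_triangular (A * B)"
    and "i < n \<Longrightarrow> (A * B) $$ (i, i) = A $$ (i, i) * (B $$ (i, i) :: 'a :: semiring_1)"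
proof -
  have *: "A $$ (i, l) * B $$ (l, j) = 0" if "l < n" "i < n" "j < n" "l < i \<or> j < l" for i j l
  proof (cases "l < i")
    case True
    thus ?thesis using assms that upper_triangularD[OF assms(3), of l i] by auto
  next
    case False
    thus ?thesis using assms that upper_triangularD[OF assms(4), of j l] by auto
  qed
  have ent: "(A * B) $$ (i, j) = (\<Sum>l<n. A $$ (i, l) * B $$ (l, j))" if "i < n" "j < n" for i j
    using that assms(1,2) by (auto simp: scalar_prod_def atLeast0LessThan intro!: sum.cong)
  show "upper_triangular (A * B)"
  proof
    fix i j assume "j < i" "i < dim_row (A * B)"
    hence ij: "i < n" "j < n" "j < i" using assms(1) by auto
    show "(A * B) $$ (i, j) = 0"
      unfolding ent[OF ij(1,2)]
    proof (intro sum.neutral ballI)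
      fix l assume "l \<in> {..<n}"
      thus "A $$ (i, l) * B $$ (l, j) = 0" using *[of l i j] ij by (cases "l < i") auto
    qed
  qed
  show "(A * B) $$ (i, i) = A $$ (i, i) * B $$ (i, i)" if i: "i < n"
  proof -
    have "(A * B) $$ (i, i) = (\<Sum>l\<in>{i}. A $$ (i, l) * B $$ (l, i))"
      unfolding ent[OF i i]
    proof (intro sum.mono_neutral_right ballI)
      fix l assume "l \<in> {..<n} - {i}"
      thus "A $$ (i, l) * B $$ (l, i) = 0" using *[of l i i] i by (cases "l < i") auto
    qed (use i in auto)
    thus ?thesis by simp
  qed
qed

lemma upper_triangular_pow:
  assumes "A \<in> carrier_mat n n" "upper_triangular A"
  shows "upper_triangular (A ^\<^sub>m k)"
    and "i < n \<Longrightarrow> (A ^\<^sub>m k) $$ (i, i) = (A $$ (i, i) :: 'a :: comm_semiring_1) ^ k"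
proof -
  have "upper_triangular (A ^\<^sub>m k) \<and> (\<forall>i<n. (A ^\<^sub>m k) $$ (i, i) = A $$ (i, i) ^ k)"
  proof (induction k)
    case 0
    show ?case using assms(1) by auto
  next
    case (Suc k)
    have "A ^\<^sub>m k \<in> carrier_mat n n" using assms(1) by auto
    from diag_mult_upper_triangular[OF this assms(1) _ assms(2)] Suc
    show ?case by (auto simp: mult.commute)
  qed
  thus "upper_triangular (A ^\<^sub>m k)" "i < n \<Longrightarrow> (A ^\<^sub>m k) $$ (i, i) = A $$ (i, i) ^ k" by auto
qed

text \<open>A complex characteristic polynomial splits, so a Schur decomposition exists. One
  conjugation serves all powers, which lets a finite order of \<open>A\<close> be read on the
  diagonal of \<open>B\<close>.\<close>

lemma triangularization:
  assumes A: "(A :: complex mat) \<in> carrier_mat n n"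
  obtains B P Q where "B \<in> carrier_mat n n" "P \<in> carrier_mat n n" "Q \<in> carrier_mat n n"
    "upper_triangular B" "P * Q = 1\<^sub>m n" "Q * P = 1\<^sub>m n" "\<And>k. A ^\<^sub>m k = P * B ^\<^sub>m k * Q"
proof -
  from char_poly_factorized[OF A] obtain es where es: "char_poly A = (\<Prod>a\<leftarrow>es. [:- a, 1:])" by auto
  obtain B P Q where sd: "schur_decomposition A es = (B, P, Q)" by (cases "schur_decomposition A es") auto
  from schur_decomposition[OF A es sd] have wit: "similar_mat_wit A B P Q" and ut: "upper_triangular B" by auto
  from similar_mat_witD2[OF A wit] ut similar_mat_wit_pow_id[OF wit] show ?thesis by (intro that[of B P Q])
qed

text \<open>The \<open>e i\<close> are the diagonal of a triangular form. Relations between powers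
  of \<open>A\<close> pass to them, so a matrix of finite order has roots of unity as
  eigenvalues.\<close>

lemma mat_trace_pow_eigenvalues:
  assumes A: "(A :: complex mat) \<in> carrier_mat n n"
  obtains e :: "nat \<Rightarrow> complex" where "\<And>k. mat_trace (A ^\<^sub>m k) = (\<Sum>i<n. e i ^ k)"
    "\<And>k l i. A ^\<^sub>m k = A ^\<^sub>m l \<Longrightarrow> i < n \<Longrightarrow> e i ^ k = e i ^ l"
proof -
  from triangularization[OF A] obtain B P Q where B: "B \<in> carrier_mat n n" "upper_triangular B"
    and P: "P \<in> carrier_mat n n" and Q: "Q \<in> carrier_mat n n"
    and PQ: "P * Q = 1\<^sub>m n" "Q * P = 1\<^sub>m n" and pow: "\<And>k. A ^\<^sub>m k = P * B ^\<^sub>m k * Q" by metis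
  have Bk: "B ^\<^sub>m k \<in> carrier_mat n n" for k using B by auto
  have Beq: "B ^\<^sub>m k = Q * A ^\<^sub>m k * P" for k
  proof -
    have "Q * (P * B ^\<^sub>m k * Q) * P = (Q * P) * B ^\<^sub>m k * (Q * P)"
      using P Q Bk by (simp add: assoc_mult_mat[of _ n n _ n _ n] mult_carrier_mat[of _ n n _ n])
    thus ?thesis using Bk[of k] by (simp add: PQ pow left_mult_one_mat[of _ n n] right_mult_one_mat[of _ n n])
  qed
  show ?thesis
  proof (rule that[of "\<lambda>i. B $$ (i, i)"])
    show "mat_trace (A ^\<^sub>m k) = (\<Sum>i<n. B $$ (i, i) ^ k)" for k
      unfolding pow mat_trace_conj[OF Bk P Q PQ(2)]
      using B(1) upper_triangular_pow(2)[OF B] by (simp add: mat_trace_def)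
    show "B $$ (i, i) ^ k = B $$ (i, i) ^ l" if "A ^\<^sub>m k = A ^\<^sub>m l" "i < n" for k l i
      using that Beq upper_triangular_pow(2)[OF B] by metis
  qed
qed

text \<open>A strictly upper triangular matrix is nilpotent, so an idempotent one vanishes.\<close>

lemma upper_triangular_idempotent_zero_diag:
  assumes B: "(B :: complex mat) \<in> carrier_mat n n" "upper_triangular B" "B * B = B"
    and "\<And>i. i < n \<Longrightarrow> B $$ (i, i) = 0"
  shows "B = 0\<^sub>m n n"
proof -
  \<comment> \<open>The induction clears one superdiagonal per step: \<open>d = 0\<close> covers the
    entries below the diagonal, \<open>d = n\<close> all of them. In each term of
    \<open>B * B\<close> at \<open>(i, j)\<close>, either the first factor lies on or below the
    diagonal or the second lies on a diagonal cleared before.\<close>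
  have "j < n \<Longrightarrow> j < i + d \<Longrightarrow> i < n \<Longrightarrow> B $$ (i, j) = 0" for d i j
  proof (induction d arbitrary: i j)
    case 0
    thus ?case using B by auto
  next
    case (Suc d)
    have "B $$ (i, j) = (B * B) $$ (i, j)" using B by simp
    also have "\<dots> = (\<Sum>l<n. B $$ (i, l) * B $$ (l, j))"
      using B(1) Suc.prems by (auto simp: scalar_prod_def atLeast0LessThan intro!: sum.cong)
    also have "\<dots> = 0"
    proof (intro sum.neutral ballI)
      fix l assume l: "l \<in> {..<n}"
      show "B $$ (i, l) * B $$ (l, j) = 0"
      proof (cases "l \<le> i")
        case True
        hence "B $$ (i, l) = 0" using B Suc.prems l assms(4) by (cases "l = i") auto
        thus ?thesis by simp
      next
        case False
        hence "B $$ (l, j) = 0" using Suc.IH[of j l] Suc.prems l by auto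
        thus ?thesis by simp
      qed
    qed
    finally show ?case .
  qed
  from this[of _ _ n] show ?thesis using B by (intro eq_matI) auto
qed

text \<open>The diagonal of a triangular form of an idempotent consists of zeros and ones, so the
  trace is a natural number that plays the part of the rank. Full trace is the case of trace zero
  for \<open>1 - A\<close>.\<close>

lemma idempotent_trace:
  assumes A: "(A :: complex mat) \<in> carrier_mat n n" "A * A = A"
  obtains k where "k \<le> n" "mat_trace A = of_nat k" "k = 0 \<Longrightarrow> A = 0\<^sub>m n n" "k = n \<Longrightarrow> A = 1\<^sub>m n"
proof -
  have zero: "\<exists>k\<le>n. mat_trace A = of_nat k \<and> (k = 0 \<longrightarrow> A = 0\<^sub>m n n)"
    if A: "(A :: complex mat) \<in> carrier_mat n n" "A * A = A" for A
  proof -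
    from triangularization[OF A(1)] obtain B P Q where B: "B \<in> carrier_mat n n" "upper_triangular B"
      and P: "P \<in> carrier_mat n n" and Q: "Q \<in> carrier_mat n n"
      and PQ: "P * Q = 1\<^sub>m n" "Q * P = 1\<^sub>m n" and pow: "\<And>k. A ^\<^sub>m k = P * B ^\<^sub>m k * Q" by metis
    have A': "A = P * B * Q" using pow[of 1] A B by auto
    have B': "B = Q * A * P"
    proof -
      have "Q * (P * B * Q) * P = (Q * P) * B * (Q * P)"
        using P Q B by (simp add: assoc_mult_mat[of _ n n _ n _ n] mult_carrier_mat[of _ n n _ n])
      thus ?thesis using B by (simp add: PQ A' left_mult_one_mat[of _ n n] right_mult_one_mat[of _ n n])
    qed
    have BB: "B * B = B"
    proof -
      have "B * B = Q * A * (P * Q) * A * P" unfolding B'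
        using P Q A by (simp add: assoc_mult_mat[of _ n n _ n _ n] mult_carrier_mat[of _ n n _ n])
      also have "\<dots> = Q * (A * A) * P" using P Q A(1) PQ
        by (simp add: assoc_mult_mat[of _ n n _ n _ n] mult_carrier_mat[of _ n n _ n])
      finally show ?thesis using A(2) B' by simp
    qed
    have d: "B $$ (i, i) = 0 \<or> B $$ (i, i) = 1" if "i < n" for i
      using diag_mult_upper_triangular(2)[OF B(1) B(1) B(2) B(2) that] BB by auto
    have tr: "mat_trace A = (\<Sum>i<n. B $$ (i, i))"
      unfolding A' mat_trace_conj[OF B(1) P Q PQ(2)] using B by (simp add: mat_trace_def)
    let ?K = "{i. i < n \<and> B $$ (i, i) = 1}"
    have "(\<Sum>i<n. B $$ (i, i)) = (\<Sum>i\<in>{..<n}. if i \<in> ?K then 1 else 0)"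
      using d by (intro sum.cong) auto
    also have "\<dots> = of_nat (card ({..<n} \<inter> ?K))" by (subst sum.If_cases) auto
    also have "{..<n} \<inter> ?K = ?K" by auto
    finally have tr': "mat_trace A = of_nat (card ?K)" using tr by simp
    moreover have "card ?K \<le> n" using card_mono[of "{..<n}" ?K] by auto
    moreover have "A = 0\<^sub>m n n" if "card ?K = 0"
    proof -
      have "?K = {}" using that by (simp add: card_eq_0_iff)
      hence "B $$ (i, i) = 0" if "i < n" for i using d[OF that] that by auto
      from upper_triangular_idempotent_zero_diag[OF B BB this] show ?thesis
        using A' P Q by simp
    qed
    ultimately show ?thesis by (intro exI[of _ "card ?K"] conjI impI)
  qed
  from zero[OF A] obtain k where k: "k \<le> n" "mat_trace A = of_nat k" "k = 0 \<longrightarrow> A = 0\<^sub>m n n" by auto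
  have "A = 1\<^sub>m n" if "k = n"
  proof -
    let ?C = "1\<^sub>m n - A"
    have C: "?C \<in> carrier_mat n n" using A by auto
    have "?C * ?C = 1\<^sub>m n * ?C - A * ?C" using A C by (intro minus_mult_distrib_mat) auto
    also have "A * ?C = A * 1\<^sub>m n - A * A" using A by (intro mult_minus_distrib_mat) auto
    also have "\<dots> = 0\<^sub>m n n" using A by (auto intro!: eq_matI)
    finally have CC: "?C * ?C = ?C" using A by (auto intro!: eq_matI)
    have "mat_trace ?C = 0" using mat_trace_minus[of "1\<^sub>m n" n A] A k that by simp
    with zero[OF C CC] have "?C = 0\<^sub>m n n" by auto
    show ?thesis
    proof (rule eq_matI)
      fix i j assume "i < dim_row (1\<^sub>m n :: complex mat)" "j < dim_col (1\<^sub>m n :: complex mat)"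
      hence ij: "i < n" "j < n" by auto
      from arg_cong[OF \<open>?C = 0\<^sub>m n n\<close>, of "\<lambda>M. M $$ (i, j)"]
      show "A $$ (i, j) = 1\<^sub>m n $$ (i, j)" using ij A by simp
    qed (use A in auto)
  qed
  with k that show ?thesis by blast
qed

lemma index_mult_mat_sum:
  assumes "A \<in> carrier_mat n m" "B \<in> carrier_mat m k" "i < n" "j < k"
  shows "(A * B) $$ (i, j) = (\<Sum>l<m. A $$ (i, l) * B $$ (l, j))"
  using assms by (auto simp: scalar_prod_def atLeast0LessThan intro!: sum.cong)

section \<open>Representations and Schur's lemma\<close>

lemma general_linear_carrier:
  "carrier (general_linear n) = {A \<in> carrier_mat n n. \<exists>B\<in>carrier_mat n n. A * B = 1\<^sub>m n \<and> B * A = 1\<^sub>m n}"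
  unfolding general_linear_def units_of_def Units_def by (simp add: ring_mat_simps conj_commute)

lemma general_linear_mult: "A \<otimes>\<^bsub>general_linear n\<^esub> B = A * B"
  by (simp add: general_linear_def units_of_def ring_mat_simps)

lemma representationI:
  fixes G (structure)
  assumes "group G" "n > 0"
    and "\<And>g. g \<in> carrier G \<Longrightarrow> \<rho> g \<in> carrier_mat n n"
    and "\<rho> \<one>\<^bsub>G\<^esub> = 1\<^sub>m n"
    and "\<And>g h. g \<in> carrier G \<Longrightarrow> h \<in> carrier G \<Longrightarrow> \<rho> (g \<otimes>\<^bsub>G\<^esub> h) = \<rho> g * \<rho> h"
  shows "representation G n \<rho>"
proof -
  interpret group G by fact
  have "\<rho> g \<in> carrier (general_linear n)" if "g \<in> carrier G" for g
    unfolding general_linear_carrier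
    using that assms(3)[of g] assms(3)[of "inv g"] assms(5)[of g "inv g"] assms(5)[of "inv g" g] assms(4)
    by (auto intro!: bexI[of _ "\<rho> (inv g)"])
  thus ?thesis using assms unfolding representation_def by (auto simp: hom_def general_linear_mult)
qed

lemma representationD:
  fixes G (structure)
  assumes "representation G n \<rho>" "group G"
  shows rep_dim_pos: "n > 0"
    and rep_carrier: "g \<in> carrier G \<Longrightarrow> \<rho> g \<in> carrier_mat n n"
    and rep_mult: "g \<in> carrier G \<Longrightarrow> h \<in> carrier G \<Longrightarrow> \<rho> (g \<otimes>\<^bsub>G\<^esub> h) = \<rho> g * \<rho> h"
    and rep_one: "\<rho> \<one>\<^bsub>G\<^esub> = 1\<^sub>m n"
proof -
  interpret group G by fact
  from assms have h: "\<rho> \<in> hom G (general_linear n)" and n: "n > 0" unfolding representation_def by auto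
  show "n > 0" by fact
  have inv: "\<rho> g \<in> carrier_mat n n \<and> (\<exists>B\<in>carrier_mat n n. \<rho> g * B = 1\<^sub>m n \<and> B * \<rho> g = 1\<^sub>m n)"
    if "g \<in> carrier G" for g
  proof -
    have "\<rho> g \<in> carrier (general_linear n)" using h that by (auto simp: hom_def)
    thus ?thesis by (simp only: general_linear_carrier mem_Collect_eq)
  qed
  show "g \<in> carrier G \<Longrightarrow> \<rho> g \<in> carrier_mat n n" using inv by auto
  show mult: "g \<in> carrier G \<Longrightarrow> h \<in> carrier G \<Longrightarrow> \<rho> (g \<otimes>\<^bsub>G\<^esub> h) = \<rho> g * \<rho> h" for g h
    using h by (simp add: hom_def general_linear_mult)
  \<comment> \<open>\<open>hom\<close> only demands multiplicativity, so
    \<open>\<rho> \<one>\<close> is at first just an idempotent; its invertibility makes it the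
    identity.\<close>
  have c1: "\<rho> \<one> \<in> carrier_mat n n" using inv[of \<one>] by auto
  from inv[of \<one>] obtain B where B: "B \<in> carrier_mat n n" "B * \<rho> \<one> = 1\<^sub>m n" by auto
  have "\<rho> \<one> = B * \<rho> \<one> * \<rho> \<one>" using B c1 by simp
  also have "\<dots> = B * (\<rho> \<one> * \<rho> \<one>)" using B c1 by (intro assoc_mult_mat) auto
  also have "\<dots> = 1\<^sub>m n" using B mult[of \<one> \<one>] by simp
  finally show "\<rho> \<one> = 1\<^sub>m n" .
qed

lemma rep_inv:
  fixes G (structure)
  assumes "representation G n \<rho>" "group G" "g \<in> carrier G"
  shows "\<rho> g * \<rho> (inv\<^bsub>G\<^esub> g) = 1\<^sub>m n" "\<rho> (inv\<^bsub>G\<^esub> g) * \<rho> g = 1\<^sub>m n"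
proof -
  interpret group G by fact
  show "\<rho> g * \<rho> (inv g) = 1\<^sub>m n" "\<rho> (inv g) * \<rho> g = 1\<^sub>m n"
    using rep_mult[OF assms(1,2), of g "inv g"] rep_mult[OF assms(1,2), of "inv g" g]
      rep_one[OF assms(1,2)] assms(3) by auto
qed

lemma rep_pow:
  fixes G (structure)
  assumes "representation G n \<rho>" "group G" "g \<in> carrier G"
  shows "\<rho> (g [^]\<^bsub>G\<^esub> (k :: nat)) = \<rho> g ^\<^sub>m k"
proof -
  interpret group G by fact
  show ?thesis
    using rep_carrier[OF assms] rep_one[OF assms(1,2)] rep_mult[OF assms(1,2)] assms(3)
    by (induction k) auto
qed

section \<open>Invariant subspaces and Schur's lemma\<close>

lemma subspaceI:
  assumes "W \<subseteq> carrier_vec n" "0\<^sub>v n \<in> W" "\<And>v w. v \<in> W \<Longrightarrow> w \<in> W \<Longrightarrow> v + w \<in> W"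
    and "\<And>c v. v \<in> W \<Longrightarrow> c \<cdot>\<^sub>v v \<in> W"
  shows "VectorSpace.subspace class_ring W (module_vec TYPE(complex) n)"
proof -
  interpret vec_space "TYPE(complex)" n .
  show ?thesis
    unfolding VectorSpace.subspace_def submodule_def
    using assms vec_vs vec_module by auto
qed

lemma subspaceD:
  assumes "VectorSpace.subspace class_ring W (module_vec TYPE(complex) n)"
  shows "W \<subseteq> carrier_vec n" "0\<^sub>v n \<in> W" "v \<in> W \<Longrightarrow> w \<in> W \<Longrightarrow> v + w \<in> W"
    "v \<in> W \<Longrightarrow> c \<cdot>\<^sub>v v \<in> W"
proof -
  interpret vec_space "TYPE(complex)" n .
  show "W \<subseteq> carrier_vec n" "0\<^sub>v n \<in> W" "v \<in> W \<Longrightarrow> w \<in> W \<Longrightarrow> v + w \<in> W"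
    "v \<in> W \<Longrightarrow> c \<cdot>\<^sub>v v \<in> W"
    using assms unfolding VectorSpace.subspace_def submodule_def by auto
qed

lemma irr_rep_rep: "irreducible_representation G n \<rho> \<Longrightarrow> representation G n \<rho>"
  by (simp add: irreducible_representation_def)

lemma irr_rep_invariant:
  assumes "irreducible_representation G n \<rho>" "W \<subseteq> carrier_vec n" "0\<^sub>v n \<in> W"
    and "\<And>v w. v \<in> W \<Longrightarrow> w \<in> W \<Longrightarrow> v + w \<in> W" "\<And>c v. v \<in> W \<Longrightarrow> c \<cdot>\<^sub>v v \<in> W"
    and "\<And>g v. g \<in> carrier G \<Longrightarrow> v \<in> W \<Longrightarrow> \<rho> g *\<^sub>v v \<in> W"
  shows "W = {0\<^sub>v n} \<or> W = carrier_vec n"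
proof -
  have "invariant_subspace G n \<rho> W"
    unfolding invariant_subspace_def using subspaceI[OF assms(2-5)] assms(6) by simp
  thus ?thesis using assms(1) unfolding irreducible_representation_def by simp
qed

text \<open>An eigenspace of \<open>X\<close> is invariant and nonzero, hence the whole space; an
  eigenvalue exists over the complex numbers because \<open>n > 0\<close>.\<close>

lemma schur_scalar:
  assumes irr: "irreducible_representation G n \<rho>" and G: "group G"
    and X: "X \<in> carrier_mat n n" and comm: "\<And>g. g \<in> carrier G \<Longrightarrow> X * \<rho> g = \<rho> g * X"
  obtains c where "X = c \<cdot>\<^sub>m 1\<^sub>m n"
proof -
  note rep = irr_rep_rep[OF irr]
  from spectrum_non_empty[OF X rep_dim_pos[OF rep G]] obtain c where c: "eigenvalue X c"
    by (auto simp: spectrum_def)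
  let ?W = "{v \<in> carrier_vec n. X *\<^sub>v v = c \<cdot>\<^sub>v v}"
  have "?W = {0\<^sub>v n} \<or> ?W = carrier_vec n"
  proof (rule irr_rep_invariant[OF irr])
    show "0\<^sub>v n \<in> ?W" using X by auto
    show "v + w \<in> ?W" if "v \<in> ?W" "w \<in> ?W" for v w
      using that X by (auto simp: mult_add_distrib_mat_vec[OF X] smult_add_distrib_vec[of _ n])
    show "k \<cdot>\<^sub>v v \<in> ?W" if "v \<in> ?W" for k v
      using that X by (auto simp: mult_mat_vec[OF X] smult_smult_assoc mult.commute)
    show "\<rho> g *\<^sub>v v \<in> ?W" if g: "g \<in> carrier G" and v: "v \<in> ?W" for g v
    proof -
      note R = rep_carrier[OF rep G g]
      have v': "v \<in> carrier_vec n" "X *\<^sub>v v = c \<cdot>\<^sub>v v" using v by auto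
      have "X *\<^sub>v (\<rho> g *\<^sub>v v) = (\<rho> g * X) *\<^sub>v v"
        using assoc_mult_mat_vec[OF X R v'(1)] comm[OF g] by simp
      also have "\<dots> = \<rho> g *\<^sub>v (c \<cdot>\<^sub>v v)" using assoc_mult_mat_vec[OF R X v'(1)] v'(2) by simp
      also have "\<dots> = c \<cdot>\<^sub>v (\<rho> g *\<^sub>v v)" using mult_mat_vec[OF R v'(1)] by simp
      finally show ?thesis using R v' by auto
    qed
  qed auto
  moreover from c obtain v where "v \<in> carrier_vec n" "v \<noteq> 0\<^sub>v n" "X *\<^sub>v v = c \<cdot>\<^sub>v v"
    using X unfolding eigenvalue_def eigenvector_def by auto
  ultimately have all: "X *\<^sub>v v = c \<cdot>\<^sub>v v" if "v \<in> carrier_vec n" for v using that by blast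
  have "X = c \<cdot>\<^sub>m 1\<^sub>m n"
  proof (rule eq_matI)
    fix i j assume ij: "i < dim_row (c \<cdot>\<^sub>m 1\<^sub>m n)" "j < dim_col (c \<cdot>\<^sub>m 1\<^sub>m n)"
    hence "(X *\<^sub>v unit_vec n j) $ i = X $$ (i, j)" using X by (auto simp: scalar_prod_right_unit)
    thus "X $$ (i, j) = (c \<cdot>\<^sub>m 1\<^sub>m n) $$ (i, j)" using all[of "unit_vec n j"] ij X by auto
  qed (use X in auto)
  thus ?thesis by (rule that)
qed

lemma mat_vec_ext:
  assumes "A \<in> carrier_mat n m" "B \<in> carrier_mat n m"
    and "\<And>v. v \<in> carrier_vec m \<Longrightarrow> A *\<^sub>v v = B *\<^sub>v (v :: complex vec)"
  shows "A = B"
proof (rule eq_matI)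
  fix i j assume ij: "i < dim_row B" "j < dim_col B"
  hence "(A *\<^sub>v unit_vec m j) $ i = A $$ (i, j)" "(B *\<^sub>v unit_vec m j) $ i = B $$ (i, j)"
    using assms(1,2) by (auto simp: scalar_prod_right_unit)
  thus "A $$ (i, j) = B $$ (i, j)" using assms(3)[of "unit_vec m j"] by simp
qed (simp_all add: carrier_matD[OF assms(1)] carrier_matD[OF assms(2)])

text \<open>Kernel and image of \<open>X\<close> are invariant, so a nonzero intertwiner is
  bijective; \<open>Y\<close> is its inverse.\<close>

lemma schur_intertwiner:
  assumes irr: "irreducible_representation G n \<rho>" and irr': "irreducible_representation G m \<rho>'"
    and G: "group G"
    and X: "X \<in> carrier_mat m n" and comm: "\<And>g. g \<in> carrier G \<Longrightarrow> X * \<rho> g = \<rho>' g * X"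
    and nz: "X \<noteq> 0\<^sub>m m n"
  obtains Y where "m = n" "Y \<in> carrier_mat n n" "X * Y = 1\<^sub>m n" "Y * X = 1\<^sub>m n"
proof -
  note rep = irr_rep_rep[OF irr] and rep' = irr_rep_rep[OF irr']
  let ?W = "{v \<in> carrier_vec n. X *\<^sub>v v = 0\<^sub>v m}"
  have "?W = {0\<^sub>v n} \<or> ?W = carrier_vec n"
  proof (rule irr_rep_invariant[OF irr])
    show "0\<^sub>v n \<in> ?W" using X by auto
    show "v + w \<in> ?W" if "v \<in> ?W" "w \<in> ?W" for v w
      using that X by (auto simp: mult_add_distrib_mat_vec[OF X])
    show "k \<cdot>\<^sub>v v \<in> ?W" if "v \<in> ?W" for k v
      using that X by (auto simp: mult_mat_vec[OF X])
    show "\<rho> g *\<^sub>v v \<in> ?W" if g: "g \<in> carrier G" and v: "v \<in> ?W" for g v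
    proof -
      note R = rep_carrier[OF rep G g] and R' = rep_carrier[OF rep' G g]
      have v': "v \<in> carrier_vec n" "X *\<^sub>v v = 0\<^sub>v m" using v by auto
      have "X *\<^sub>v (\<rho> g *\<^sub>v v) = \<rho>' g *\<^sub>v (X *\<^sub>v v)"
        using assoc_mult_mat_vec[OF X R v'(1)] assoc_mult_mat_vec[OF R' X v'(1)] comm[OF g] by simp
      thus ?thesis using R R' v' by auto
    qed
  qed auto
  moreover have "?W \<noteq> carrier_vec n"
  proof
    assume "?W = carrier_vec n"
    hence "X *\<^sub>v v = 0\<^sub>v m" if "v \<in> carrier_vec n" for v using that by blast
    hence "X = 0\<^sub>m m n" using X by (intro mat_vec_ext) auto
    thus False using nz by simp
  qed
  ultimately have ker: "v = 0\<^sub>v n" if "v \<in> carrier_vec n" "X *\<^sub>v v = 0\<^sub>v m" for v using that by blast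
  let ?U = "(\<lambda>v. X *\<^sub>v v) ` carrier_vec n"
  have "?U = {0\<^sub>v m} \<or> ?U = carrier_vec m"
  proof (rule irr_rep_invariant[OF irr'])
    show "0\<^sub>v m \<in> ?U" using X by (intro image_eqI[of _ _ "0\<^sub>v n"]) auto
    show "?U \<subseteq> carrier_vec m" using X by auto
    show "v + w \<in> ?U" if "v \<in> ?U" "w \<in> ?U" for v w
      using that by (auto simp: mult_add_distrib_mat_vec[OF X, symmetric])
    show "k \<cdot>\<^sub>v v \<in> ?U" if "v \<in> ?U" for k v
      using that by (auto simp: mult_mat_vec[OF X, symmetric])
    show "\<rho>' g *\<^sub>v v \<in> ?U" if g: "g \<in> carrier G" and v: "v \<in> ?U" for g v
    proof -
      note R = rep_carrier[OF rep G g] and R' = rep_carrier[OF rep' G g]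
      from v obtain w where w: "w \<in> carrier_vec n" "v = X *\<^sub>v w" by auto
      have "\<rho>' g *\<^sub>v v = X *\<^sub>v (\<rho> g *\<^sub>v w)"
        using assoc_mult_mat_vec[OF X R w(1)] assoc_mult_mat_vec[OF R' X w(1)] comm[OF g] w by simp
      thus ?thesis using R w by auto
    qed
  qed
  moreover have "?U \<noteq> {0\<^sub>v m}"
  proof
    assume U: "?U = {0\<^sub>v m}"
    have "X *\<^sub>v v = 0\<^sub>v m" if "v \<in> carrier_vec n" for v using U that by blast
    hence "X = 0\<^sub>m m n" using X by (intro mat_vec_ext) auto
    thus False using nz by simp
  qed
  ultimately have surj: "?U = carrier_vec m" by blast
  have "\<forall>j. \<exists>w. j < m \<longrightarrow> w \<in> carrier_vec n \<and> X *\<^sub>v w = unit_vec m j"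
  proof
    fix j
    have "unit_vec m j \<in> ?U" unfolding surj by simp
    thus "\<exists>w. j < m \<longrightarrow> w \<in> carrier_vec n \<and> X *\<^sub>v w = unit_vec m j" by auto
  qed
  then obtain w where w: "\<And>j. j < m \<Longrightarrow> w j \<in> carrier_vec n \<and> X *\<^sub>v w j = unit_vec m j" by metis
  \<comment> \<open>The columns of \<open>Y\<close> are preimages of the unit vectors under
    \<open>X\<close>.\<close>
  define Y where "Y = mat n m (\<lambda>(i, j). w j $ i)"
  have Y: "Y \<in> carrier_mat n m" by (simp add: Y_def)
  have XY: "X * Y = 1\<^sub>m m"
  proof (rule eq_matI)
    fix i j assume ij: "i < dim_row (1\<^sub>m m :: complex mat)" "j < dim_col (1\<^sub>m m :: complex mat)"
    have "col Y j = w j" using w[of j] ij unfolding Y_def by (intro eq_vecI) auto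
    hence "(X * Y) $$ (i, j) = (X *\<^sub>v w j) $ i" using X Y ij by auto
    thus "(X * Y) $$ (i, j) = 1\<^sub>m m $$ (i, j)" using w[of j] ij by auto
  qed (use X Y in auto)
  have YX: "Y * X = 1\<^sub>m n"
  proof (rule mat_vec_ext)
    fix v :: "complex vec" assume v: "v \<in> carrier_vec n"
    have Xv: "X *\<^sub>v v \<in> carrier_vec m" using X v by auto
    have YXv: "Y *\<^sub>v (X *\<^sub>v v) \<in> carrier_vec n" using Y Xv by auto
    have "X *\<^sub>v (Y *\<^sub>v (X *\<^sub>v v)) = (X * Y) *\<^sub>v (X *\<^sub>v v)"
      using assoc_mult_mat_vec[OF X Y Xv] by simp
    also have "\<dots> = X *\<^sub>v v" using XY Xv by simp
    finally have "X *\<^sub>v (Y *\<^sub>v (X *\<^sub>v v) - v) = 0\<^sub>v m"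
      using mult_minus_distrib_mat_vec[OF X YXv v] Xv by simp
    hence z: "Y *\<^sub>v (X *\<^sub>v v) - v = 0\<^sub>v n" using YXv v by (intro ker) auto
    have "Y *\<^sub>v (X *\<^sub>v v) = v"
    proof (rule eq_vecI)
      fix i assume i: "i < dim_vec v"
      from arg_cong[OF z, of "\<lambda>x. x $ i"] show "(Y *\<^sub>v (X *\<^sub>v v)) $ i = v $ i"
        using i v YXv by auto
    qed (use YXv v Y in auto)
    thus "Y * X *\<^sub>v v = 1\<^sub>m n *\<^sub>v v" using assoc_mult_mat_vec[OF Y X v] v by simp
  qed (use X Y in auto)
  \<comment> \<open>Equal traces of \<open>X * Y\<close> and \<open>Y * X\<close> give the equality
    of dimensions.\<close>
  have "of_nat m = mat_trace (X * Y)" using XY by simp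
  also have "\<dots> = mat_trace (Y * X)" using mat_trace_comm[OF X Y] .
  also have "\<dots> = of_nat n" using YX by simp
  finally have "m = n" by simp
  with that Y XY YX show ?thesis by auto
qed

section \<open>Averaging over the group and orthogonality of matrix coefficients\<close>

lemma (in group) bij_betw_lmult:
  assumes "x \<in> carrier G" shows "bij_betw (\<lambda>g. x \<otimes> g) (carrier G) (carrier G)"
proof (rule bij_betwI[where g = "\<lambda>g. inv x \<otimes> g"])
  show "inv x \<otimes> (x \<otimes> g) = g" "x \<otimes> (inv x \<otimes> g) = g" if "g \<in> carrier G" for g
    using that assms by (simp_all flip: m_assoc)
qed (use assms in auto)

lemma (in group) bij_betw_rmult:
  assumes "x \<in> carrier G" shows "bij_betw (\<lambda>g. g \<otimes> x) (carrier G) (carrier G)"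
proof (rule bij_betwI[where g = "\<lambda>g. g \<otimes> inv x"])
  show "g \<otimes> x \<otimes> inv x = g" "g \<otimes> inv x \<otimes> x = g" if "g \<in> carrier G" for g
    using that assms by (simp_all add: m_assoc)
qed (use assms in auto)

text \<open>The usual averaging of a linear map into an intertwiner from \<open>\<rho>\<close> to
  \<open>\<rho>'\<close>, without division by the group order.\<close>

definition rep_average ::
    "('a, 'b) monoid_scheme \<Rightarrow> nat \<Rightarrow> nat \<Rightarrow> ('a \<Rightarrow> complex mat) \<Rightarrow> ('a \<Rightarrow> complex mat) \<Rightarrow> complex mat \<Rightarrow> complex mat"
  where "rep_average G m n \<rho>' \<rho> X = mat_sum m n (carrier G) (\<lambda>g. \<rho>' g * X * \<rho> (inv\<^bsub>G\<^esub> g))"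

lemma triple_carrier:
  "A \<in> carrier_mat m m \<Longrightarrow> X \<in> carrier_mat m n \<Longrightarrow> B \<in> carrier_mat n n \<Longrightarrow> A * X * B \<in> carrier_mat m n"
  by auto

lemma rep_average_carrier [simp]: "rep_average G m n \<rho>' \<rho> X \<in> carrier_mat m n"
  by (simp add: rep_average_def)

lemma rep_average_intertwines:
  fixes G (structure)
  assumes rep: "representation G n \<rho>" and rep': "representation G m \<rho>'" and G: "group G"
    and X: "X \<in> carrier_mat m n" and x: "x \<in> carrier G"
  shows "rep_average G m n \<rho>' \<rho> X * \<rho> x = \<rho>' x * rep_average G m n \<rho>' \<rho> X"
proof -
  interpret group G by fact
  note c = rep_carrier[OF rep G] rep_carrier[OF rep' G]
  have "rep_average G m n \<rho>' \<rho> X * \<rho> x = mat_sum m n (carrier G) (\<lambda>g. \<rho>' g * X * \<rho> (inv g) * \<rho> x)"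
    unfolding rep_average_def using c X x by (intro mat_sum_mult) (auto intro!: triple_carrier)
  \<comment> \<open>Substituting \<open>x \<otimes> g\<close> for \<open>g\<close> moves
    \<open>x\<close> from the right end to the left.\<close>
  also have "\<dots> = mat_sum m n (carrier G) (\<lambda>g. \<rho>' (x \<otimes> g) * X * \<rho> (inv (x \<otimes> g)) * \<rho> x)"
    using mat_sum_reindex_bij[OF bij_betw_lmult[OF x], of m n "\<lambda>g. \<rho>' g * X * \<rho> (inv g) * \<rho> x"] .
  also have "\<dots> = mat_sum m n (carrier G) (\<lambda>g. \<rho>' x * (\<rho>' g * X * \<rho> (inv g)))"
  proof (rule mat_sum_cong)
    fix g assume g: "g \<in> carrier G"
    have c': "\<rho>' x \<in> carrier_mat m m" "\<rho>' g \<in> carrier_mat m m" "\<rho> (inv g) \<in> carrier_mat n n"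
      "\<rho> (inv x) \<in> carrier_mat n n" "\<rho> x \<in> carrier_mat n n"
      using c x g by auto
    have "\<rho> (inv g) * \<rho> (inv x) * \<rho> x = \<rho> (inv g) * (\<rho> (inv x) * \<rho> x)"
      using c' by (intro assoc_mult_mat) auto
    also have "\<dots> = \<rho> (inv g)" using rep_inv[OF rep G x] c' by simp
    finally have e: "\<rho> (inv g) * \<rho> (inv x) * \<rho> x = \<rho> (inv g)" .
    have "\<rho>' (x \<otimes> g) * X * \<rho> (inv (x \<otimes> g)) * \<rho> x
        = (\<rho>' x * \<rho>' g) * X * (\<rho> (inv g) * \<rho> (inv x)) * \<rho> x"
      using x g by (simp add: inv_mult_group rep_mult[OF rep G] rep_mult[OF rep' G])
    also have "\<dots> = (\<rho>' x * \<rho>' g) * X * (\<rho> (inv g) * \<rho> (inv x) * \<rho> x)"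
      using c' X by (intro assoc_mult_mat[of _ m n _ n _ n]) (auto simp: mult_carrier_mat[of _ n n _ n] mult_carrier_mat[of _ m m _ m])
    also have "\<dots> = (\<rho>' x * \<rho>' g * X) * \<rho> (inv g)" unfolding e ..
    also have "\<rho>' x * \<rho>' g * X = \<rho>' x * (\<rho>' g * X)" using c' X by (intro assoc_mult_mat) auto
    also have "\<rho>' x * (\<rho>' g * X) * \<rho> (inv g) = \<rho>' x * (\<rho>' g * X * \<rho> (inv g))"
      using c' X by (intro assoc_mult_mat[of _ m m _ n _ n]) auto
    finally show "\<rho>' (x \<otimes> g) * X * \<rho> (inv (x \<otimes> g)) * \<rho> x = \<rho>' x * (\<rho>' g * X * \<rho> (inv g))" .
  qed
  also have "\<dots> = \<rho>' x * rep_average G m n \<rho>' \<rho> X"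
    unfolding rep_average_def using c X x by (intro mult_mat_sum[symmetric]) (auto intro!: triple_carrier)
  finally show ?thesis .
qed

text \<open>Schur's lemma makes the average a scalar; its trace, which is the group order times the
  trace of \<open>X\<close>, determines the scalar.\<close>

lemma rep_average_irr:
  fixes G (structure)
  assumes irr: "irreducible_representation G n \<rho>" and G: "group G" and X: "X \<in> carrier_mat n n"
  shows "rep_average G n n \<rho> \<rho> X = (of_nat (card (carrier G)) * mat_trace X / of_nat n) \<cdot>\<^sub>m 1\<^sub>m n"
proof -
  interpret group G by fact
  note rep = irr_rep_rep[OF irr]
  note c = rep_carrier[OF rep G]
  obtain k where k: "rep_average G n n \<rho> \<rho> X = k \<cdot>\<^sub>m 1\<^sub>m n"
    using schur_scalar[OF irr G rep_average_carrier rep_average_intertwines[OF rep rep G X]] by blast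
  have "k * of_nat n = mat_trace (rep_average G n n \<rho> \<rho> X)" unfolding k by (subst mat_trace_smult[of _ n]) auto
  also have "\<dots> = (\<Sum>g\<in>carrier G. mat_trace (\<rho> g * X * \<rho> (inv g)))"
    unfolding rep_average_def using c X
    by (intro mat_trace_mat_sum) (auto intro!: triple_carrier)
  also have "\<dots> = (\<Sum>g\<in>carrier G. mat_trace X)"
    using c X rep_inv[OF rep G] by (intro sum.cong refl mat_trace_conj[of _ n]) auto
  finally have "k * of_nat n = of_nat (card (carrier G)) * mat_trace X" by simp
  hence "k = of_nat (card (carrier G)) * mat_trace X / of_nat n"
    using rep_dim_pos[OF rep G] by (simp add: field_simps)
  thus ?thesis using k by simp
qed

text \<open>Separates the variables: a product of two traces becomes linear in the matrices
  \<open>R * E * S\<close> with \<open>E\<close> a matrix unit, so that summing over the group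
  produces averages of matrix units.\<close>

lemma mat_trace_prod_expand:
  assumes A: "A \<in> carrier_mat m m" and B: "B \<in> carrier_mat n n"
    and R: "R \<in> carrier_mat m m" and S: "S \<in> carrier_mat n n"
  shows "mat_trace (A * R) * mat_trace (B * S)
    = (\<Sum>i<m. \<Sum>j<n. (A * (R * unit_mat m n i j * S) * B) $$ (i, j))"
proof -
  have ent: "(A * (R * unit_mat m n i j * S) * B) $$ (i, j) = (A * R) $$ (i, i) * (S * B) $$ (j, j)"
    if ij: "i < m" "j < n" for i j
  proof -
    let ?U = "unit_mat m n i j"
    have U: "?U \<in> carrier_mat m n" by simp
    have AR: "A * R \<in> carrier_mat m m" using A R by auto
    have SB: "S * B \<in> carrier_mat n n" using S B by auto
    have US: "?U * S \<in> carrier_mat m n" and RU: "R * ?U \<in> carrier_mat m n"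
      by (rule mult_carrier_mat[OF U S], rule mult_carrier_mat[OF R U])
    have "A * (R * ?U * S) * B = A * (R * (?U * S)) * B"
      by (simp only: assoc_mult_mat[OF R U S])
    also have "\<dots> = A * R * (?U * S) * B"
      by (simp only: assoc_mult_mat[OF A R US])
    also have "\<dots> = A * R * (?U * (S * B))"
      by (simp only: assoc_mult_mat[OF AR US B] assoc_mult_mat[OF U S B])
    also have "\<dots> = A * R * ?U * (S * B)"
      by (simp only: assoc_mult_mat[OF AR U SB])
    finally have "A * (R * ?U * S) * B = (A * R) * ?U * (S * B)" .
    hence "(A * (R * ?U * S) * B) $$ (i, j) = (\<Sum>l<n. ((A * R) * ?U) $$ (i, l) * (S * B) $$ (l, j))"
      using index_mult_mat_sum[OF mult_carrier_mat[OF AR U] SB ij] by (simp only:)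
    also have "\<dots> = (\<Sum>l<n. if l = j then (A * R) $$ (i, i) * (S * B) $$ (j, j) else 0)"
    proof (rule sum.cong)
      fix l assume l: "l \<in> {..<n}"
      have "((A * R) * ?U) $$ (i, l) = (\<Sum>k<m. (A * R) $$ (i, k) * ?U $$ (k, l))"
        using index_mult_mat_sum[OF AR U ij(1)] l by simp
      also have "\<dots> = (\<Sum>k<m. if k = i then (if l = j then (A * R) $$ (i, i) else 0) else 0)"
        using l by (intro sum.cong) (auto simp: unit_mat_def)
      also have "\<dots> = (if l = j then (A * R) $$ (i, i) else 0)" using ij by simp
      finally show "((A * R) * ?U) $$ (i, l) * (S * B) $$ (l, j) = (if l = j then (A * R) $$ (i, i) * (S * B) $$ (j, j) else 0)"
        by simp
    qed simp
    also have "\<dots> = (A * R) $$ (i, i) * (S * B) $$ (j, j)" using ij by simp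
    finally show ?thesis .
  qed
  have "mat_trace (A * R) * mat_trace (B * S) = mat_trace (A * R) * mat_trace (S * B)"
    using mat_trace_comm[OF B S] by simp
  also have "\<dots> = (\<Sum>i<m. \<Sum>j<n. (A * R) $$ (i, i) * (S * B) $$ (j, j))"
    using A R S B by (simp add: mat_trace_def sum_product)
  finally show ?thesis using ent by simp
qed

text \<open>The common source of both orthogonality relations; what remains is to know the averages
  of matrix units, which Schur's lemma decides.\<close>

lemma trace_product_sum:
  fixes G (structure)
  assumes rep: "representation G n \<rho>" and rep': "representation G m \<rho>'" and G: "group G"
    and A: "A \<in> carrier_mat m m" and B: "B \<in> carrier_mat n n"
  shows "(\<Sum>g\<in>carrier G. mat_trace (A * \<rho>' g) * mat_trace (B * \<rho> (inv\<^bsub>G\<^esub> g)))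
    = (\<Sum>i<m. \<Sum>j<n. (A * rep_average G m n \<rho>' \<rho> (unit_mat m n i j) * B) $$ (i, j))"
proof -
  interpret group G by fact
  note c = rep_carrier[OF rep G] rep_carrier[OF rep' G]
  have av: "A * rep_average G m n \<rho>' \<rho> X * B = mat_sum m n (carrier G) (\<lambda>g. A * (\<rho>' g * X * \<rho> (inv g)) * B)"
    if X: "X \<in> carrier_mat m n" for X
  proof -
    have "A * rep_average G m n \<rho>' \<rho> X = mat_sum m n (carrier G) (\<lambda>g. A * (\<rho>' g * X * \<rho> (inv g)))"
      unfolding rep_average_def using c X A by (intro mult_mat_sum) (auto intro!: triple_carrier)
    moreover have "A * (\<rho>' g * X * \<rho> (inv g)) \<in> carrier_mat m n" if "g \<in> carrier G" for g
      using that A X c by (intro mult_carrier_mat) auto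
    ultimately show ?thesis using B by (simp add: mat_sum_mult)
  qed
  have "(\<Sum>g\<in>carrier G. mat_trace (A * \<rho>' g) * mat_trace (B * \<rho> (inv g)))
    = (\<Sum>g\<in>carrier G. \<Sum>i<m. \<Sum>j<n. (A * (\<rho>' g * unit_mat m n i j * \<rho> (inv g)) * B) $$ (i, j))"
    using c by (intro sum.cong refl mat_trace_prod_expand A B) auto
  also have "\<dots> = (\<Sum>i<m. \<Sum>g\<in>carrier G. \<Sum>j<n. (A * (\<rho>' g * unit_mat m n i j * \<rho> (inv g)) * B) $$ (i, j))"
    by (rule sum.swap)
  also have "\<dots> = (\<Sum>i<m. \<Sum>j<n. \<Sum>g\<in>carrier G. (A * (\<rho>' g * unit_mat m n i j * \<rho> (inv g)) * B) $$ (i, j))"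
    by (intro sum.cong refl sum.swap)
  also have "\<dots> = (\<Sum>i<m. \<Sum>j<n. (A * rep_average G m n \<rho>' \<rho> (unit_mat m n i j) * B) $$ (i, j))"
    by (intro sum.cong refl) (simp add: av, simp add: mat_sum_def)
  finally show ?thesis .
qed

text \<open>Schur orthogonality of matrix coefficients, tested against arbitrary \<open>A\<close>
  and \<open>B\<close>. This freedom is used later to expand matrices in the image of a group, to
  sum squared norms over cosets and to pick out single entries.\<close>

lemma trace_orthogonality_same:
  assumes irr: "irreducible_representation G n \<rho>" and G: "group G"
    and A: "A \<in> carrier_mat n n" and B: "B \<in> carrier_mat n n"
  shows "(\<Sum>g\<in>carrier G. mat_trace (A * \<rho> g) * mat_trace (B * \<rho> (inv\<^bsub>G\<^esub> g)))
    = of_nat (card (carrier G)) / of_nat n * mat_trace (A * B)"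
proof -
  let ?k = "of_nat (card (carrier G)) / of_nat n :: complex"
  note rep = irr_rep_rep[OF irr]
  have tr: "mat_trace (unit_mat n n i j) = (if i = j then 1 else 0)" if "i < n" "j < n" for i j
  proof -
    have "mat_trace (unit_mat n n i j) = (\<Sum>k<n. if k = i then (if i = j then 1 else 0) else 0)"
      unfolding mat_trace_def by (rule sum.cong) (auto simp: unit_mat_def)
    thus ?thesis using that by simp
  qed
  have "(\<Sum>g\<in>carrier G. mat_trace (A * \<rho> g) * mat_trace (B * \<rho> (inv\<^bsub>G\<^esub> g)))
    = (\<Sum>i<n. \<Sum>j<n. (A * ((?k * mat_trace (unit_mat n n i j)) \<cdot>\<^sub>m 1\<^sub>m n) * B) $$ (i, j))"
    unfolding trace_product_sum[OF rep rep G A B] by (simp add: rep_average_irr[OF irr G])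
  also have "\<dots> = (\<Sum>i<n. \<Sum>j<n. if j = i then ?k * (A * B) $$ (i, i) else 0)"
  proof (intro sum.cong refl)
    fix i j assume ij: "i \<in> {..<n}" "j \<in> {..<n}"
    have "A * (x \<cdot>\<^sub>m 1\<^sub>m n) * B = x \<cdot>\<^sub>m (A * B)" for x
      using A B mult_smult_distrib[of A n n "1\<^sub>m n" n x] mult_smult_assoc_mat[of A n n B n x] by simp
    thus "(A * ((?k * mat_trace (unit_mat n n i j)) \<cdot>\<^sub>m 1\<^sub>m n) * B) $$ (i, j) = (if j = i then ?k * (A * B) $$ (i, i) else 0)"
      using ij A B tr[of i j] by auto
  qed
  also have "\<dots> = (\<Sum>i<n. ?k * (A * B) $$ (i, i))" by (intro sum.cong refl) simp
  also have "\<dots> = ?k * mat_trace (A * B)" using A by (simp add: mat_trace_def sum_distrib_left)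
  finally show ?thesis .
qed

text \<open>A nonzero average would be an invertible intertwiner and force equal characters, so all
  averages vanish.\<close>

lemma trace_orthogonality_distinct:
  fixes G (structure)
  assumes irr: "irreducible_representation G n \<rho>" and irr': "irreducible_representation G m \<rho>'"
    and G: "group G"
    and A: "A \<in> carrier_mat m m" and B: "B \<in> carrier_mat n n"
    and neq: "afforded_char G \<rho>' \<noteq> afforded_char G \<rho>"
  shows "(\<Sum>g\<in>carrier G. mat_trace (A * \<rho>' g) * mat_trace (B * \<rho> (inv\<^bsub>G\<^esub> g))) = 0"
proof -
  interpret group G by fact
  note rep = irr_rep_rep[OF irr] and rep' = irr_rep_rep[OF irr']
  note c = rep_carrier[OF rep G] rep_carrier[OF rep' G]
  have av: "rep_average G m n \<rho>' \<rho> X = 0\<^sub>m m n" if X: "X \<in> carrier_mat m n" for X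
  proof (rule ccontr)
    let ?T = "rep_average G m n \<rho>' \<rho> X"
    assume nz: "?T \<noteq> 0\<^sub>m m n"
    obtain Y where Y: "m = n" "Y \<in> carrier_mat n n" "?T * Y = 1\<^sub>m n" "Y * ?T = 1\<^sub>m n"
      using schur_intertwiner[OF irr irr' G rep_average_carrier rep_average_intertwines[OF rep rep' G X] nz] by blast
    have T: "?T \<in> carrier_mat n n" using Y(1) by simp
    have "mat_trace (\<rho>' g) = mat_trace (\<rho> g)" if g: "g \<in> carrier G" for g
    proof -
      have "mat_trace (\<rho> g) = mat_trace (?T * \<rho> g * Y)"
        using c[OF g] Y T by (intro mat_trace_conj[symmetric]) auto
      also have "?T * \<rho> g * Y = \<rho>' g * (?T * Y)"
        unfolding rep_average_intertwines[OF rep rep' G X g] using c[OF g] Y T by (intro assoc_mult_mat) auto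
      also have "\<dots> = \<rho>' g" using Y c[OF g] by simp
      finally show ?thesis by simp
    qed
    hence "afforded_char G \<rho>' = afforded_char G \<rho>" by (auto simp: afforded_char_def)
    thus False using neq by simp
  qed
  show ?thesis
    unfolding trace_product_sum[OF rep rep' G A B] using A B by (simp add: av)
qed

section \<open>Complete reducibility\<close>

lemma mult_mat_vec_eq_zero_dim:
  assumes "A \<in> carrier_mat n 0" "v \<in> carrier_vec 0"
  shows "A *\<^sub>v v = 0\<^sub>v n"
  using assms by (intro eq_vecI) (auto simp: scalar_prod_def)

text \<open>\<open>A * B\<close> is a projection onto \<open>W\<close>, obtained from a maximal \<open>k\<close>; this replaces the choice
  of a basis of \<open>W\<close>.\<close>

lemma subspace_factorization:
  assumes "W \<subseteq> carrier_vec n" "0\<^sub>v n \<in> W" "\<And>v w. v \<in> W \<Longrightarrow> w \<in> W \<Longrightarrow> v + w \<in> W"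
    and "\<And>c v. v \<in> W \<Longrightarrow> c \<cdot>\<^sub>v v \<in> W"
  obtains k A B where "A \<in> carrier_mat n k" "B \<in> carrier_mat k n" "B * A = (1\<^sub>m k :: complex mat)"
    "\<And>x. x \<in> carrier_vec k \<Longrightarrow> A *\<^sub>v x \<in> W" "\<And>w. w \<in> W \<Longrightarrow> A *\<^sub>v (B *\<^sub>v w) = w"
proof -
  define Q where "Q k A B \<longleftrightarrow> A \<in> carrier_mat n k \<and> B \<in> carrier_mat k n \<and> B * A = (1\<^sub>m k :: complex mat) \<and>
    (\<forall>x\<in>carrier_vec k. A *\<^sub>v x \<in> W)" for k A B
  have "Q 0 (0\<^sub>m n 0) (0\<^sub>m 0 n)"
    unfolding Q_def
  proof (intro conjI ballI)
    show "0\<^sub>m n 0 *\<^sub>v x \<in> W" if "x \<in> carrier_vec 0" for x :: "complex vec"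
      using mult_mat_vec_eq_zero_dim[OF zero_carrier_mat that, of n] assms(2) by metis
  qed auto
  \<comment> \<open>\<open>A * B\<close> is idempotent with trace \<open>k\<close>, and the trace of
    an idempotent is at most \<open>n\<close>.\<close>
  moreover have bound: "k \<le> n" if "Q k A B" for k A B
  proof -
    from that have A: "A \<in> carrier_mat n k" and B: "B \<in> carrier_mat k n" and BA: "B * A = 1\<^sub>m k"
      unfolding Q_def by blast+
    have AB: "A * B \<in> carrier_mat n n" by (rule mult_carrier_mat[OF A B])
    have "(A * B) * (A * B) = A * (B * (A * B))" by (rule assoc_mult_mat[OF A B AB])
    also have "B * (A * B) = B * A * B" by (rule assoc_mult_mat[OF B A B, symmetric])
    also have "\<dots> = B" using BA B by simp
    finally have "(A * B) * (A * B) = A * B" .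
    then obtain k' where "k' \<le> n" "mat_trace (A * B) = of_nat k'"
      by (rule idempotent_trace[OF AB])
    moreover have "mat_trace (A * B) = of_nat k"
      using mat_trace_comm[OF A B] BA by simp
    ultimately show "k \<le> n" by simp
  qed
  ultimately have fin: "finite {k. \<exists>A B. Q k A B}" and ne: "{k. \<exists>A B. Q k A B} \<noteq> {}"
    by (auto intro!: finite_subset[of _ "{..n}"])
  define k where "k = Max {k. \<exists>A B. Q k A B}"
  have k: "\<exists>A B. Q k A B" "\<And>k' A B. Q k' A B \<Longrightarrow> k' \<le> k"
    using Max_in[OF fin ne] Max_ge[OF fin] unfolding k_def by auto
  from k(1) obtain A B where Q: "Q k A B" by auto
  hence A: "A \<in> carrier_mat n k" and B: "B \<in> carrier_mat k n" and BA: "B * A = 1\<^sub>m k"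
    and AW: "\<And>x. x \<in> carrier_vec k \<Longrightarrow> A *\<^sub>v x \<in> W" unfolding Q_def by blast+
  have AB: "A * B \<in> carrier_mat n n" by (rule mult_carrier_mat[OF A B])
  have "A *\<^sub>v (B *\<^sub>v w) = w" if w: "w \<in> W" for w
  proof (rule ccontr)
    assume neq: "A *\<^sub>v (B *\<^sub>v w) \<noteq> w"
    have wc: "w \<in> carrier_vec n" using w assms(1) by auto
    have Bw: "B *\<^sub>v w \<in> carrier_vec k" using B wc by auto
    have ABw: "A *\<^sub>v (B *\<^sub>v w) \<in> carrier_vec n" using A Bw by auto
    \<comment> \<open>The part of \<open>w\<close> that \<open>A * B\<close> misses; it lies in
      \<open>W\<close> and is killed by \<open>B\<close>, so it can serve as a further
      column.\<close>
    define u where "u = w - A *\<^sub>v (B *\<^sub>v w)"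
    have uc: "u \<in> carrier_vec n" unfolding u_def using ABw wc by auto
    have "u = w + (-1) \<cdot>\<^sub>v (A *\<^sub>v (B *\<^sub>v w))" unfolding u_def using wc ABw by (intro eq_vecI) auto
    hence uW: "u \<in> W" using w AW[OF Bw] assms(3,4) by simp
    have u0: "u \<noteq> 0\<^sub>v n"
    proof
      assume z: "u = 0\<^sub>v n"
      have "A *\<^sub>v (B *\<^sub>v w) = w"
      proof (rule eq_vecI)
        fix i assume i: "i < dim_vec w"
        show "(A *\<^sub>v (B *\<^sub>v w)) $ i = w $ i"
          using arg_cong[OF z, of "\<lambda>x. x $ i"] i wc carrier_vecD[OF ABw]
              index_minus_vec(1)[of i "A *\<^sub>v (B *\<^sub>v w)" w] unfolding u_def by auto
      qed (use wc A in auto)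
      thus False using neq by simp
    qed
    then obtain i0 where i0: "i0 < n" "u $ i0 \<noteq> 0"
      using uc by (metis carrier_vecD eq_vecI index_zero_vec(1) index_zero_vec(2))
    have Bu: "B *\<^sub>v u = 0\<^sub>v k"
    proof -
      have "B *\<^sub>v u = B *\<^sub>v w - B *\<^sub>v (A *\<^sub>v (B *\<^sub>v w))"
        unfolding u_def by (rule mult_minus_distrib_mat_vec[OF B wc ABw])
      also have "B *\<^sub>v (A *\<^sub>v (B *\<^sub>v w)) = (B * A) *\<^sub>v (B *\<^sub>v w)"
        by (rule assoc_mult_mat_vec[OF B A Bw, symmetric])
      also have "\<dots> = B *\<^sub>v w" unfolding BA using Bw by simp
      finally show ?thesis using Bw by simp
    qed
    define C where "C = 1\<^sub>m n - A * B"
    have C: "C \<in> carrier_mat n n" unfolding C_def by (rule minus_carrier_mat[OF AB])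
    have Cu: "C *\<^sub>v u = u"
    proof -
      have "C *\<^sub>v u = 1\<^sub>m n *\<^sub>v u - (A * B) *\<^sub>v u"
        unfolding C_def by (rule minus_mult_distrib_mat_vec[OF one_carrier_mat AB uc])
      also have "(A * B) *\<^sub>v u = A *\<^sub>v (B *\<^sub>v u)" by (rule assoc_mult_mat_vec[OF A B uc])
      also have "\<dots> = 0\<^sub>v n" unfolding Bu using A by (intro eq_vecI) (auto simp: scalar_prod_def)
      finally show ?thesis using uc by simp
    qed
    have CA: "C * A = 0\<^sub>m n k"
    proof -
      have "C * A = 1\<^sub>m n * A - (A * B) * A"
        unfolding C_def by (rule minus_mult_distrib_mat[OF one_carrier_mat AB A])
      also have "(A * B) * A = A * (B * A)" by (rule assoc_mult_mat[OF A B A])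
      also have "\<dots> = A" using BA A by simp
      finally show ?thesis using A by simp
    qed
    define A' where "A' = mat n (Suc k) (\<lambda>(i, j). if j < k then A $$ (i, j) else u $ i)"
    \<comment> \<open>The new row is the coordinate \<open>i0\<close> of the projection
      \<open>C = 1 - A * B\<close>, scaled to take the value 1 on \<open>u\<close>; it vanishes on
      the columns of \<open>A\<close> because \<open>C * A = 0\<close>.\<close>
    define B' where "B' = mat (Suc k) n (\<lambda>(i, j). if i < k then B $$ (i, j) else C $$ (i0, j) / u $ i0)"
    have A': "A' \<in> carrier_mat n (Suc k)" and B': "B' \<in> carrier_mat (Suc k) n"
      by (simp_all add: A'_def B'_def)
    have mv: "(M *\<^sub>v x) $ i = (\<Sum>l<c. M $$ (i, l) * x $ l)"
      if "M \<in> carrier_mat r c" "x \<in> carrier_vec c" "i < r" for M :: "complex mat" and r c x i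
      using that by (auto simp: scalar_prod_def atLeast0LessThan intro!: sum.cong)
    have "B' * A' = 1\<^sub>m (Suc k)"
    proof (rule eq_matI)
      fix i j assume "i < dim_row (1\<^sub>m (Suc k) :: complex mat)" "j < dim_col (1\<^sub>m (Suc k) :: complex mat)"
      hence ij: "i < Suc k" "j < Suc k" by auto
      have *: "(B' * A') $$ (i, j) = (\<Sum>l<n. B' $$ (i, l) * A' $$ (l, j))"
        by (rule index_mult_mat_sum[OF B' A' ij])
      consider "i < k" "j < k" | "i < k" "j = k" | "i = k" "j < k" | "i = k" "j = k"
        using ij by linarith
      thus "(B' * A') $$ (i, j) = 1\<^sub>m (Suc k) $$ (i, j)"
      proof cases
        case 1
        have "(\<Sum>l<n. B' $$ (i, l) * A' $$ (l, j)) = (B * A) $$ (i, j)"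
          unfolding index_mult_mat_sum[OF B A 1] using 1 by (intro sum.cong) (auto simp: A'_def B'_def)
        thus ?thesis unfolding * BA using 1 by auto
      next
        case 2
        have "(\<Sum>l<n. B' $$ (i, l) * A' $$ (l, j)) = (B *\<^sub>v u) $ i"
          unfolding mv[OF B uc 2(1)] using 2 by (intro sum.cong) (auto simp: A'_def B'_def)
        thus ?thesis unfolding * Bu using 2 by auto
      next
        case 3
        have "(\<Sum>l<n. B' $$ (i, l) * A' $$ (l, j)) = (C * A) $$ (i0, j) / u $ i0"
          unfolding index_mult_mat_sum[OF C A i0(1) 3(2)] sum_divide_distrib
          using 3 by (intro sum.cong) (auto simp: A'_def B'_def)
        thus ?thesis unfolding * CA using 3 i0 by auto
      next
        case 4
        have "(\<Sum>l<n. B' $$ (i, l) * A' $$ (l, j)) = (C *\<^sub>v u) $ i0 / u $ i0"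
          unfolding mv[OF C uc i0(1)] sum_divide_distrib
          using 4 by (intro sum.cong) (auto simp: A'_def B'_def)
        thus ?thesis unfolding * Cu using 4 i0 by auto
      qed
    qed (use A' B' in auto)
    moreover have "A' *\<^sub>v x \<in> W" if x: "x \<in> carrier_vec (Suc k)" for x
    proof -
      let ?y = "vec k (\<lambda>i. x $ i)"
      have y: "?y \<in> carrier_vec k" by simp
      have Ay: "A *\<^sub>v ?y \<in> carrier_vec n" using A y by auto
      have "A' *\<^sub>v x = A *\<^sub>v ?y + x $ k \<cdot>\<^sub>v u"
      proof (rule eq_vecI)
        fix i assume "i < dim_vec (A *\<^sub>v ?y + x $ k \<cdot>\<^sub>v u)"
        hence i: "i < n" using uc by simp
        have "(A' *\<^sub>v x) $ i = (\<Sum>l<Suc k. A' $$ (i, l) * x $ l)" by (rule mv[OF A' x i])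
        also have "\<dots> = (\<Sum>l<k. A $$ (i, l) * ?y $ l) + u $ i * x $ k"
          using i by (simp add: A'_def)
        also have "\<dots> = (A *\<^sub>v ?y) $ i + u $ i * x $ k" using mv[OF A y i] by simp
        also have "\<dots> = (A *\<^sub>v ?y + x $ k \<cdot>\<^sub>v u) $ i" using i Ay uc by simp
        finally show "(A' *\<^sub>v x) $ i = (A *\<^sub>v ?y + x $ k \<cdot>\<^sub>v u) $ i" .
      qed (use A' uc in auto)
      thus ?thesis using assms(3)[OF AW[OF y] assms(4)[OF uW]] by simp
    qed
    ultimately have "Q (Suc k) A' B'" unfolding Q_def using A' B' by blast
    from k(2)[OF this] show False by simp
  qed
  thus ?thesis using that A B BA AW by blast
qed

text \<open>The summands are the action on an invariant subspace \<open>W\<close> and the action on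
  the quotient by \<open>W\<close>. The quotient is modelled on the kernel of a projection
  \<open>P\<close> onto \<open>W\<close> that may fail to commute with the group; for characters it
  is enough that the traces add up.\<close>

lemma reducible_decomposition:
  fixes G (structure)
  assumes rep: "representation G n \<rho>" and G: "group G" and red: "\<not> irreducible_representation G n \<rho>"
  obtains k l \<rho>1 \<rho>2 where "representation G k \<rho>1" "representation G l \<rho>2" "n = k + l"
    "\<And>g. g \<in> carrier G \<Longrightarrow> mat_trace (\<rho> g) = mat_trace (\<rho>1 g) + mat_trace (\<rho>2 g)"
proof -
  interpret group G by fact
  note R = rep_carrier[OF rep G]
  from red rep obtain W where W: "invariant_subspace G n \<rho> W" "W \<noteq> {0\<^sub>v n}" "W \<noteq> carrier_vec n"
    unfolding irreducible_representation_def by blast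
  hence sub: "VectorSpace.subspace class_ring W (module_vec TYPE(complex) n)"
    and inv: "\<And>g w. g \<in> carrier G \<Longrightarrow> w \<in> W \<Longrightarrow> \<rho> g *\<^sub>v w \<in> W"
    unfolding invariant_subspace_def by auto
  note S = subspaceD[OF sub]
  obtain k A B where A: "A \<in> carrier_mat n k" and B: "B \<in> carrier_mat k n" and BA: "B * A = (1\<^sub>m k :: complex mat)"
    and AW: "\<And>x. x \<in> carrier_vec k \<Longrightarrow> A *\<^sub>v x \<in> W" and WW: "\<And>w. w \<in> W \<Longrightarrow> A *\<^sub>v (B *\<^sub>v w) = w"
  proof -
    show ?thesis by (rule subspace_factorization[OF S]) (assumption+, rule that, assumption+)
  qed
  define P where "P = A * B"
  have P: "P \<in> carrier_mat n n" unfolding P_def by (rule mult_carrier_mat[OF A B])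
  have Pv: "P *\<^sub>v v = A *\<^sub>v (B *\<^sub>v v)" if "v \<in> carrier_vec n" for v
    unfolding P_def by (rule assoc_mult_mat_vec[OF A B that])
  have PW: "P *\<^sub>v v \<in> W" if "v \<in> carrier_vec n" for v
    unfolding Pv[OF that] using B that by (intro AW) auto
  have Pw: "P *\<^sub>v w = w" if "w \<in> W" for w
    using Pv[of w] WW[OF that] S(1) that by auto
  let ?W' = "{v \<in> carrier_vec n. P *\<^sub>v v = 0\<^sub>v n}"
  have "?W' \<subseteq> carrier_vec n" "0\<^sub>v n \<in> ?W'" "\<And>v w. v \<in> ?W' \<Longrightarrow> w \<in> ?W' \<Longrightarrow> v + w \<in> ?W'"
    "\<And>c v. v \<in> ?W' \<Longrightarrow> c \<cdot>\<^sub>v v \<in> ?W'"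
    using P by (auto simp: mult_add_distrib_mat_vec[OF P] mult_mat_vec[OF P])
  note F = subspace_factorization[OF this]
  obtain l A' B' where A': "A' \<in> carrier_mat n l" and B': "B' \<in> carrier_mat l n" and BA': "B' * A' = (1\<^sub>m l :: complex mat)"
    and AW': "\<And>x. x \<in> carrier_vec l \<Longrightarrow> A' *\<^sub>v x \<in> ?W'" and WW': "\<And>w. w \<in> ?W' \<Longrightarrow> A' *\<^sub>v (B' *\<^sub>v w) = w"
  proof -
    show ?thesis by (rule F) (assumption+, rule that, assumption+)
  qed
  define C where "C = 1\<^sub>m n - P"
  have C: "C \<in> carrier_mat n n" unfolding C_def by (rule minus_carrier_mat[OF P])
  have Cv: "C *\<^sub>v v = v - P *\<^sub>v v" if "v \<in> carrier_vec n" for v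
    unfolding C_def using minus_mult_distrib_mat_vec[OF one_carrier_mat P that] that by simp
  have CW: "C *\<^sub>v w = 0\<^sub>v n" if "w \<in> W" for w
    using Cv[of w] Pw[OF that] S(1) that by auto
  have CW': "C *\<^sub>v w = w" if "w \<in> ?W'" for w
    using Cv[of w] that by auto
  have CCW': "C *\<^sub>v v \<in> ?W'" if v: "v \<in> carrier_vec n" for v
  proof -
    have Pvc: "P *\<^sub>v v \<in> carrier_vec n" using P v by auto
    have "P *\<^sub>v (v - P *\<^sub>v v) = P *\<^sub>v v - P *\<^sub>v (P *\<^sub>v v)" by (rule mult_minus_distrib_mat_vec[OF P v Pvc])
    thus ?thesis using Cv[OF v] Pw[OF PW[OF v]] Pvc v by auto
  qed
  have PA: "P * (\<rho> g * A) = \<rho> g * A" if g: "g \<in> carrier G" for g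
  proof -
    have gA: "\<rho> g * A \<in> carrier_mat n k" by (rule mult_carrier_mat[OF R[OF g] A])
    show ?thesis
    proof (rule mat_vec_ext[of _ n k])
      fix v :: "complex vec" assume v: "v \<in> carrier_vec k"
      have "(P * (\<rho> g * A)) *\<^sub>v v = P *\<^sub>v (\<rho> g *\<^sub>v (A *\<^sub>v v))"
        unfolding assoc_mult_mat_vec[OF P gA v] assoc_mult_mat_vec[OF R[OF g] A v] ..
      also have "\<dots> = (\<rho> g * A) *\<^sub>v v"
        unfolding assoc_mult_mat_vec[OF R[OF g] A v] by (rule Pw[OF inv[OF g AW[OF v]]])
      finally show "(P * (\<rho> g * A)) *\<^sub>v v = (\<rho> g * A) *\<^sub>v v" .
    qed (use P gA in auto)
  qed
  have CA': "C * A' = A'"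
  proof (rule mat_vec_ext[of _ n l])
    fix v :: "complex vec" assume v: "v \<in> carrier_vec l"
    show "(C * A') *\<^sub>v v = A' *\<^sub>v v"
      unfolding assoc_mult_mat_vec[OF C A' v] by (rule CW'[OF AW'[OF v]])
  qed (use C A' in auto)
  \<comment> \<open>The range of \<open>P\<close> is the invariant subspace \<open>W\<close>, and
    \<open>C\<close> kills \<open>W\<close>. This makes the compression to the complement
    multiplicative.\<close>
  have CgP: "C * (\<rho> g * P) = 0\<^sub>m n n" if g: "g \<in> carrier G" for g
  proof (rule mat_vec_ext[of _ n n])
    have gP: "\<rho> g * P \<in> carrier_mat n n" by (rule mult_carrier_mat[OF R[OF g] P])
    show "C * (\<rho> g * P) \<in> carrier_mat n n" by (rule mult_carrier_mat[OF C gP])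
    fix v :: "complex vec" assume v: "v \<in> carrier_vec n"
    show "(C * (\<rho> g * P)) *\<^sub>v v = 0\<^sub>m n n *\<^sub>v v"
      unfolding assoc_mult_mat_vec[OF C gP v] assoc_mult_mat_vec[OF R[OF g] P v]
      using CW[OF inv[OF g PW[OF v]]] v by (intro eq_vecI) (auto simp: scalar_prod_def)
  qed auto
  have ABC: "A' * (B' * C) = C"
  proof (rule mat_vec_ext[of _ n n])
    have BC: "B' * C \<in> carrier_mat l n" by (rule mult_carrier_mat[OF B' C])
    show "A' * (B' * C) \<in> carrier_mat n n" by (rule mult_carrier_mat[OF A' BC])
    fix v :: "complex vec" assume v: "v \<in> carrier_vec n"
    show "(A' * (B' * C)) *\<^sub>v v = C *\<^sub>v v"
      unfolding assoc_mult_mat_vec[OF A' BC v] assoc_mult_mat_vec[OF B' C v] by (rule WW'[OF CCW'[OF v]])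
  qed (use C in auto)
  have PC: "P + C = 1\<^sub>m n" unfolding C_def using P by (intro eq_matI) auto
  \<comment> \<open>\<open>W\<close> is neither zero nor everything, so both degrees are positive,
    as \<open>representation\<close> demands.\<close>
  have k: "k > 0"
  proof (rule ccontr)
    assume "\<not> k > 0"
    have "w = 0\<^sub>v n" if w: "w \<in> W" for w
    proof -
      have "A \<in> carrier_mat n 0" "B *\<^sub>v w \<in> carrier_vec 0" using A mult_mat_vec_carrier[OF B, of w] w S(1) \<open>\<not> k > 0\<close> by auto
      from mult_mat_vec_eq_zero_dim[OF this] show ?thesis using WW[OF w] by simp
    qed
    hence "W = {0\<^sub>v n}" using S(2) by blast
    thus False using W(2) by contradiction
  qed
  have l: "l > 0"
  proof (rule ccontr)
    assume "\<not> l > 0"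
    have "v \<in> W" if v: "v \<in> carrier_vec n" for v
    proof -
      have "A' \<in> carrier_mat n 0" "B' *\<^sub>v (C *\<^sub>v v) \<in> carrier_vec 0" using A' mult_mat_vec_carrier[OF B' mult_mat_vec_carrier[OF C v]] \<open>\<not> l > 0\<close> by auto
      from mult_mat_vec_eq_zero_dim[OF this] WW'[OF CCW'[OF v]] have z: "C *\<^sub>v v = 0\<^sub>v n" by simp
      have Pvc: "P *\<^sub>v v \<in> carrier_vec n" using P v by auto
      have "v = P *\<^sub>v v"
      proof (rule eq_vecI)
        fix i assume i: "i < dim_vec (P *\<^sub>v v)"
        show "v $ i = (P *\<^sub>v v) $ i"
          using arg_cong[OF z, of "\<lambda>x. x $ i"] Cv[OF v] i Pvc v P by auto
      qed (use P v in auto)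
      thus ?thesis using PW[OF v] by simp
    qed
    hence "W = carrier_vec n" using S(1) by blast
    thus False using W(3) by contradiction
  qed
  have BC: "B' * C \<in> carrier_mat l n" by (rule mult_carrier_mat[OF B' C])
  let ?\<rho>1 = "\<lambda>g. B * (\<rho> g * A)" and ?\<rho>2 = "\<lambda>g. (B' * C) * (\<rho> g * A')"
  have gA: "\<rho> g * A \<in> carrier_mat n k" if "g \<in> carrier G" for g by (rule mult_carrier_mat[OF R[OF that] A])
  have gA': "\<rho> g * A' \<in> carrier_mat n l" if "g \<in> carrier G" for g by (rule mult_carrier_mat[OF R[OF that] A'])
  have r1: "representation G k ?\<rho>1"
  proof (rule representationI[OF G k])
    show "?\<rho>1 g \<in> carrier_mat k k" if "g \<in> carrier G" for g
      by (rule mult_carrier_mat[OF B gA[OF that]])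
    show "?\<rho>1 \<one> = 1\<^sub>m k" using rep_one[OF rep G] A BA by simp
    fix g h assume g: "g \<in> carrier G" and h: "h \<in> carrier G"
    have "?\<rho>1 g * ?\<rho>1 h = B * (\<rho> g * A * (B * (\<rho> h * A)))"
      by (rule assoc_mult_mat[OF B gA[OF g] mult_carrier_mat[OF B gA[OF h]]])
    also have "\<rho> g * A * (B * (\<rho> h * A)) = \<rho> g * (A * (B * (\<rho> h * A)))"
      by (rule assoc_mult_mat[OF R[OF g] A mult_carrier_mat[OF B gA[OF h]]])
    also have "A * (B * (\<rho> h * A)) = P * (\<rho> h * A)"
      unfolding P_def by (rule assoc_mult_mat[OF A B gA[OF h], symmetric])
    also have "\<dots> = \<rho> h * A" by (rule PA[OF h])
    also have "\<rho> g * (\<rho> h * A) = \<rho> g * \<rho> h * A" by (rule assoc_mult_mat[OF R[OF g] R[OF h] A, symmetric])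
    finally show "?\<rho>1 (g \<otimes> h) = ?\<rho>1 g * ?\<rho>1 h" using rep_mult[OF rep G g h] by simp
  qed
  have r2: "representation G l ?\<rho>2"
  proof (rule representationI[OF G l])
    show "?\<rho>2 g \<in> carrier_mat l l" if "g \<in> carrier G" for g
      by (rule mult_carrier_mat[OF BC gA'[OF that]])
    have "B' * C * A' = B' * (C * A')" by (rule assoc_mult_mat[OF B' C A'])
    thus "?\<rho>2 \<one> = 1\<^sub>m l" using rep_one[OF rep G] A' BA' CA' by simp
    fix g h assume g: "g \<in> carrier G" and h: "h \<in> carrier G"
    note h' = gA'[OF h]
    \<comment> \<open>Acting and then projecting along \<open>W\<close> sees a vector only modulo
      \<open>W\<close>.\<close>
    have CgC: "C * (\<rho> g * C) = C * \<rho> g"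
    proof -
      have gP: "\<rho> g * P \<in> carrier_mat n n" by (rule mult_carrier_mat[OF R[OF g] P])
      have gC: "\<rho> g * C \<in> carrier_mat n n" by (rule mult_carrier_mat[OF R[OF g] C])
      have CgCc: "C * (\<rho> g * C) \<in> carrier_mat n n" by (rule mult_carrier_mat[OF C gC])
      have "\<rho> g = \<rho> g * (P + C)" unfolding PC using R[OF g] by simp
      also have "\<dots> = \<rho> g * P + \<rho> g * C" by (rule mult_add_distrib_mat[OF R[OF g] P C])
      finally have "C * \<rho> g = C * (\<rho> g * P + \<rho> g * C)" by simp
      also have "\<dots> = C * (\<rho> g * P) + C * (\<rho> g * C)" by (rule mult_add_distrib_mat[OF C gP gC])
      also have "\<dots> = C * (\<rho> g * C)" unfolding CgP[OF g] by (rule left_add_zero_mat[OF CgCc])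
      finally show ?thesis by simp
    qed
    have "?\<rho>2 g * ?\<rho>2 h = (B' * C) * (\<rho> g * A' * ((B' * C) * (\<rho> h * A')))"
      by (rule assoc_mult_mat[OF BC gA'[OF g] mult_carrier_mat[OF BC h']])
    also have "\<rho> g * A' * ((B' * C) * (\<rho> h * A')) = \<rho> g * (A' * ((B' * C) * (\<rho> h * A')))"
      by (rule assoc_mult_mat[OF R[OF g] A' mult_carrier_mat[OF BC h']])
    also have "A' * ((B' * C) * (\<rho> h * A')) = A' * (B' * C) * (\<rho> h * A')"
      by (rule assoc_mult_mat[OF A' BC h', symmetric])
    also have "A' * (B' * C) = C" by (rule ABC)
    also have "\<rho> g * (C * (\<rho> h * A')) = \<rho> g * C * (\<rho> h * A')"
      by (rule assoc_mult_mat[OF R[OF g] C h', symmetric])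
    also have "(B' * C) * (\<rho> g * C * (\<rho> h * A')) = B' * (C * (\<rho> g * C * (\<rho> h * A')))"
      by (rule assoc_mult_mat[OF B' C mult_carrier_mat[OF mult_carrier_mat[OF R[OF g] C] h']])
    also have "C * (\<rho> g * C * (\<rho> h * A')) = C * (\<rho> g * C) * (\<rho> h * A')"
      by (rule assoc_mult_mat[OF C mult_carrier_mat[OF R[OF g] C] h', symmetric])
    also have "C * (\<rho> g * C) = C * \<rho> g" by (rule CgC)
    also have "C * \<rho> g * (\<rho> h * A') = C * (\<rho> g * (\<rho> h * A'))"
      by (rule assoc_mult_mat[OF C R[OF g] h'])
    also have "\<rho> g * (\<rho> h * A') = \<rho> g * \<rho> h * A'" by (rule assoc_mult_mat[OF R[OF g] R[OF h] A', symmetric])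
    also have "\<dots> = \<rho> (g \<otimes> h) * A'" using rep_mult[OF rep G g h] by simp
    also have "B' * (C * (\<rho> (g \<otimes> h) * A')) = (B' * C) * (\<rho> (g \<otimes> h) * A')"
      by (rule assoc_mult_mat[OF B' C gA'[OF m_closed[OF g h]], symmetric])
    finally show "?\<rho>2 (g \<otimes> h) = ?\<rho>2 g * ?\<rho>2 h" by simp
  qed
  have tr: "mat_trace (\<rho> g) = mat_trace (?\<rho>1 g) + mat_trace (?\<rho>2 g)" if g: "g \<in> carrier G" for g
  proof -
    have "mat_trace (?\<rho>1 g) = mat_trace (\<rho> g * A * B)" by (rule mat_trace_comm[OF B gA[OF g]])
    also have "\<rho> g * A * B = \<rho> g * P" unfolding P_def by (rule assoc_mult_mat[OF R[OF g] A B])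
    finally have 1: "mat_trace (?\<rho>1 g) = mat_trace (\<rho> g * P)" .
    have "mat_trace (?\<rho>2 g) = mat_trace (\<rho> g * A' * (B' * C))" by (rule mat_trace_comm[OF BC gA'[OF g]])
    also have "\<rho> g * A' * (B' * C) = \<rho> g * (A' * (B' * C))" by (rule assoc_mult_mat[OF R[OF g] A' BC])
    also have "\<dots> = \<rho> g * C" unfolding ABC ..
    finally have 2: "mat_trace (?\<rho>2 g) = mat_trace (\<rho> g * C)" .
    have "mat_trace (\<rho> g * P) + mat_trace (\<rho> g * C) = mat_trace (\<rho> g * P + \<rho> g * C)"
      by (rule mat_trace_add[OF mult_carrier_mat[OF R[OF g] P] mult_carrier_mat[OF R[OF g] C], symmetric])
    also have "\<rho> g * P + \<rho> g * C = \<rho> g * (P + C)" by (rule mult_add_distrib_mat[OF R[OF g] P C, symmetric])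
    also have "\<dots> = \<rho> g" unfolding PC using R[OF g] by simp
    finally show ?thesis unfolding 1 2 by simp
  qed
  have "of_nat n = (of_nat (k + l) :: complex)"
    using tr[OF one_closed] rep_one[OF rep G] rep_one[OF r1 G] rep_one[OF r2 G] by simp
  hence "n = k + l" using of_nat_eq_iff by blast
  with r1 r2 tr that show ?thesis by blast
qed

lemma char_is_sum_of_irr:
  assumes "\<chi> \<in> characters G" "group G"
  obtains \<psi>s where "\<psi>s \<noteq> []" "set \<psi>s \<subseteq> Irr G" "\<chi> = (\<lambda>g. \<Sum>\<psi>\<leftarrow>\<psi>s. \<psi> g)"
proof -
  have "\<exists>\<psi>s. \<psi>s \<noteq> [] \<and> set \<psi>s \<subseteq> Irr G \<and> afforded_char G \<rho> = (\<lambda>g. \<Sum>\<psi>\<leftarrow>\<psi>s. \<psi> g)"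
    if "representation G n \<rho>" for n \<rho>
    using that
  proof (induction n arbitrary: \<rho> rule: less_induct)
    case (less n)
    show ?case
    proof (cases "irreducible_representation G n \<rho>")
      case True
      thus ?thesis by (intro exI[of _ "[afforded_char G \<rho>]"]) (auto simp: Irr_def)
    next
      case False
      from reducible_decomposition[OF less.prems assms(2) False] obtain k l \<rho>1 \<rho>2 where
        r: "representation G k \<rho>1" "representation G l \<rho>2" "n = k + l"
          "\<And>g. g \<in> carrier G \<Longrightarrow> mat_trace (\<rho> g) = mat_trace (\<rho>1 g) + mat_trace (\<rho>2 g)" by metis
      have "k < n" "l < n" using r rep_dim_pos[OF r(1) assms(2)] rep_dim_pos[OF r(2) assms(2)] by auto
      with less.IH r obtain xs ys where
        "xs \<noteq> []" "set xs \<subseteq> Irr G" "afforded_char G \<rho>1 = (\<lambda>g. \<Sum>\<psi>\<leftarrow>xs. \<psi> g)"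
        "ys \<noteq> []" "set ys \<subseteq> Irr G" "afforded_char G \<rho>2 = (\<lambda>g. \<Sum>\<psi>\<leftarrow>ys. \<psi> g)" by metis
      moreover have "afforded_char G \<rho> = (\<lambda>g. afforded_char G \<rho>1 g + afforded_char G \<rho>2 g)"
        using r(4) by (auto simp: afforded_char_def)
      ultimately show ?thesis by (intro exI[of _ "xs @ ys"]) auto
    qed
  qed
  with assms(1) that show ?thesis unfolding characters_def by blast
qed

lemma Irr_subset_characters: "Irr G \<subseteq> characters G"
  by (auto simp: Irr_def characters_def irreducible_representation_def)

lemma char_add:
  fixes G (structure)
  assumes "\<phi> \<in> characters G" "\<psi> \<in> characters G" "group G"
  shows "(\<lambda>g. \<phi> g + \<psi> g) \<in> characters G"
proof -
  interpret group G by fact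
  from assms obtain n \<rho> m \<sigma> where r: "representation G n \<rho>" "\<phi> = afforded_char G \<rho>"
    and s: "representation G m \<sigma>" "\<psi> = afforded_char G \<sigma>"
    unfolding characters_def by blast
  note R = rep_carrier[OF r(1) assms(3)] and S = rep_carrier[OF s(1) assms(3)]
  let ?\<tau> = "\<lambda>g. four_block_mat (\<rho> g) (0\<^sub>m n m) (0\<^sub>m m n) (\<sigma> g)"
  have "representation G (n + m) ?\<tau>"
  proof (rule representationI[OF assms(3)])
    show "n + m > 0" using rep_dim_pos[OF r(1) assms(3)] by simp
    show "?\<tau> g \<in> carrier_mat (n + m) (n + m)" if "g \<in> carrier G" for g
      using R[OF that] S[OF that] by auto
    show "?\<tau> \<one> = 1\<^sub>m (n + m)" using rep_one[OF r(1) assms(3)] rep_one[OF s(1) assms(3)]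
      by simp
    fix g h assume gh: "g \<in> carrier G" "h \<in> carrier G"
    show "?\<tau> (g \<otimes> h) = ?\<tau> g * ?\<tau> h"
      using gh R[OF gh(1)] R[OF gh(2)] S[OF gh(1)] S[OF gh(2)]
        mult_carrier_mat[OF R[OF gh(1)] R[OF gh(2)]] mult_carrier_mat[OF S[OF gh(1)] S[OF gh(2)]]
        rep_mult[OF r(1) assms(3)] rep_mult[OF s(1) assms(3)]
      by (subst mult_four_block_mat[of _ n n _ m _ m]) auto
  qed
  moreover have "(\<lambda>g. \<phi> g + \<psi> g) = afforded_char G ?\<tau>"
  proof
    fix g show "\<phi> g + \<psi> g = afforded_char G ?\<tau> g"
      using diag_four_block_mat[OF R S, of g g "0\<^sub>m n m" "0\<^sub>m m n"]
      by (auto simp: r s afforded_char_def mat_trace_diag_mat)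
  qed
  ultimately show ?thesis unfolding characters_def by blast
qed

lemma char_sum_list:
  assumes "\<psi>s \<noteq> []" "set \<psi>s \<subseteq> characters G" "group G"
  shows "(\<lambda>g. \<Sum>\<psi>\<leftarrow>\<psi>s. \<psi> g) \<in> characters G"
  using assms(1,2)
proof (induction \<psi>s rule: list_nonempty_induct)
  case (cons x xs)
  thus ?case using char_add[OF _ _ assms(3), of x "\<lambda>g. \<Sum>\<psi>\<leftarrow>xs. \<psi> g"] by auto
qed auto

lemma smult_smult_mat: "a \<cdot>\<^sub>m (b \<cdot>\<^sub>m A) = (a * b) \<cdot>\<^sub>m (A :: 'a :: semigroup_mult mat)"
  by (rule eq_matI) (auto simp: mult.assoc)

section \<open>Characters\<close>

lemma Irr_eq_afforded:
  "\<chi> \<in> Irr G \<Longrightarrow> \<exists>n \<rho>. irreducible_representation G n \<rho> \<and> \<chi> = afforded_char G \<rho>"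
  by (auto simp: Irr_def)

lemma characters_eq_afforded:
  "\<chi> \<in> characters G \<Longrightarrow> \<exists>n \<rho>. representation G n \<rho> \<and> \<chi> = afforded_char G \<rho>"
  by (auto simp: characters_def)

lemma afforded_charI: "representation G n \<rho> \<Longrightarrow> afforded_char G \<rho> \<in> characters G"
  by (auto simp: characters_def)

lemma afforded_char_IrrI: "irreducible_representation G n \<rho> \<Longrightarrow> afforded_char G \<rho> \<in> Irr G"
  by (auto simp: Irr_def)

lemma afforded_char_in [simp]: "g \<in> carrier G \<Longrightarrow> afforded_char G \<rho> g = mat_trace (\<rho> g)"
  by (simp add: afforded_char_def)

lemma char_outside: "\<chi> \<in> characters G \<Longrightarrow> g \<notin> carrier G \<Longrightarrow> \<chi> g = 0"
  by (auto simp: characters_def afforded_char_def)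

lemma afforded_char_one:
  assumes "representation G n \<rho>" "group G"
  shows "afforded_char G \<rho> \<one>\<^bsub>G\<^esub> = of_nat n"
  using rep_one[OF assms] group.is_monoid[OF assms(2)] by (simp add: afforded_char_def monoid.one_closed)

lemma char_degree:
  assumes "\<chi> \<in> characters G" "group G"
  obtains n where "n > 0" "\<chi> \<one>\<^bsub>G\<^esub> = of_nat n"
proof -
  obtain n \<rho> where r: "representation G n \<rho>" "\<chi> = afforded_char G \<rho>"
    using characters_eq_afforded[OF assms(1)] by blast
  show ?thesis
    by (rule that[OF rep_dim_pos[OF r(1) assms(2)]]) (simp add: r(2) afforded_char_one[OF r(1) assms(2)])
qed

lemma char_conj:
  fixes G (structure)
  assumes "\<chi> \<in> characters G" "group G" "g \<in> carrier G" "x \<in> carrier G"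
  shows "\<chi> (g \<otimes> x \<otimes> inv g) = \<chi> x"
proof -
  interpret group G by fact
  obtain n \<rho> where r: "representation G n \<rho>" "\<chi> = afforded_char G \<rho>"
    using characters_eq_afforded[OF assms(1)] by blast
  note R = rep_carrier[OF r(1) assms(2)]
  have "\<rho> (g \<otimes> x \<otimes> inv g) = \<rho> g * \<rho> x * \<rho> (inv g)"
    using assms by (simp add: rep_mult[OF r(1) assms(2)])
  thus ?thesis
    using mat_trace_conj[OF R[OF assms(4)] R[OF assms(3)] R[of "inv g"]] rep_inv(2)[OF r(1) assms(2,3)] assms
    by (simp add: r(2))
qed

text \<open>The generalized orthogonality relation. With \<open>x = y = \<one>\<close> it is the
  usual one; the shift by \<open>x\<close> says that the convolution of distinct irreducible
  characters vanishes at every point, as used for Clifford's theorem.\<close>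

lemma irr_orthogonality:
  fixes G (structure)
  assumes "\<chi> \<in> Irr G" "\<psi> \<in> Irr G" "group G" "x \<in> carrier G" "y \<in> carrier G"
  shows "(\<Sum>g\<in>carrier G. \<chi> (x \<otimes> g) * \<psi> (inv g \<otimes> y))
    = (if \<chi> = \<psi> then of_nat (card (carrier G)) / \<chi> \<one> * \<chi> (x \<otimes> y) else 0)"
proof -
  interpret group G by fact
  obtain n \<rho> where r: "irreducible_representation G n \<rho>" "\<chi> = afforded_char G \<rho>"
    using Irr_eq_afforded[OF assms(1)] by blast
  obtain m \<sigma>' where s': "irreducible_representation G m \<sigma>'" "\<psi> = afforded_char G \<sigma>'"
    using Irr_eq_afforded[OF assms(2)] by blast
  note rr = irr_rep_rep[OF r(1)]
  \<comment> \<open>The representation affording \<open>\<psi>\<close> is left open: for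
    \<open>\<chi> = \<psi>\<close> both factors must come from the same one.\<close>
  have expand: "(\<Sum>g\<in>carrier G. \<chi> (x \<otimes> g) * \<psi> (inv g \<otimes> y))
      = (\<Sum>g\<in>carrier G. mat_trace (\<rho> x * \<rho> g) * mat_trace (\<sigma> y * \<sigma> (inv g)))"
    if s: "irreducible_representation G m \<sigma>" "\<psi> = afforded_char G \<sigma>" for m \<sigma>
  proof (rule sum.cong)
    note ss = irr_rep_rep[OF s(1)]
    fix g assume g: "g \<in> carrier G"
    have "mat_trace (\<sigma> (inv g \<otimes> y)) = mat_trace (\<sigma> y * \<sigma> (inv g))"
      using rep_mult[OF ss assms(3), of "inv g" y] g assms(5)
        mat_trace_comm[OF rep_carrier[OF ss assms(3), of "inv g"] rep_carrier[OF ss assms(3), of y]] by simp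
    thus "\<chi> (x \<otimes> g) * \<psi> (inv g \<otimes> y) = mat_trace (\<rho> x * \<rho> g) * mat_trace (\<sigma> y * \<sigma> (inv g))"
      using g assms(4,5) rep_mult[OF rr assms(3), of x g] by (simp add: r s)
  qed simp
  show ?thesis
  proof (cases "\<chi> = \<psi>")
    case True
    have "(\<Sum>g\<in>carrier G. \<chi> (x \<otimes> g) * \<psi> (inv g \<otimes> y))
      = of_nat (card (carrier G)) / of_nat n * mat_trace (\<rho> x * \<rho> y)"
      unfolding expand[OF r(1) r(2)[unfolded True]]
      using trace_orthogonality_same[OF r(1) assms(3)] rep_carrier[OF rr assms(3)] assms by simp
    moreover have "\<chi> (x \<otimes> y) = mat_trace (\<rho> x * \<rho> y)"
      using assms(4,5) rep_mult[OF rr assms(3), of x y] by (simp add: r(2))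
    moreover have "\<chi> \<one> = of_nat n" unfolding r(2) by (rule afforded_char_one[OF rr assms(3)])
    ultimately show ?thesis using True by simp
  next
    case False
    hence neq: "afforded_char G \<rho> \<noteq> afforded_char G \<sigma>'" using r s' by simp
    show ?thesis
      unfolding expand[OF s'] trace_orthogonality_distinct[OF s'(1) r(1) assms(3)
        rep_carrier[OF rr assms(3,4)] rep_carrier[OF irr_rep_rep[OF s'(1)] assms(3,5)] neq]
      using False by simp
  qed
qed

text \<open>The sum of the conjugates of \<open>y\<close> is central in the group algebra and acts
  as a scalar; the identity expresses this through \<open>\<chi>\<close> alone.\<close>

lemma irr_mult_values:
  fixes G (structure)
  assumes "\<chi> \<in> Irr G" "group G" "x \<in> carrier G" "y \<in> carrier G"
  shows "\<chi> \<one> * (\<Sum>g\<in>carrier G. \<chi> (x \<otimes> (g \<otimes> y \<otimes> inv g))) = of_nat (card (carrier G)) * \<chi> x * \<chi> y"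
proof -
  interpret group G by fact
  obtain n \<rho> where r: "irreducible_representation G n \<rho>" "\<chi> = afforded_char G \<rho>"
    using Irr_eq_afforded[OF assms(1)] by blast
  note rr = irr_rep_rep[OF r(1)]
  note R = rep_carrier[OF rr assms(2)]
  have c: "\<rho> g * \<rho> y * \<rho> (inv g) \<in> carrier_mat n n" if "g \<in> carrier G" for g
    using R that assms(4) by (intro triple_carrier) auto
  have "(\<Sum>g\<in>carrier G. \<chi> (x \<otimes> (g \<otimes> y \<otimes> inv g)))
      = (\<Sum>g\<in>carrier G. mat_trace (\<rho> x * (\<rho> g * \<rho> y * \<rho> (inv g))))"
    using assms by (intro sum.cong refl) (simp add: r rep_mult[OF rr assms(2)])
  also have "\<dots> = mat_trace (\<rho> x * rep_average G n n \<rho> \<rho> (\<rho> y))"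
    unfolding rep_average_def using R[OF assms(3)] c mult_carrier_mat[OF R[OF assms(3)] c]
    by (subst mult_mat_sum[of _ n n]) (auto simp: mat_trace_mat_sum)
  also have "\<dots> = of_nat (card (carrier G)) * mat_trace (\<rho> y) / of_nat n * mat_trace (\<rho> x)"
    unfolding rep_average_irr[OF r(1) assms(2) R[OF assms(4)]]
    using R[OF assms(3)] by (simp add: mult_smult_distrib[OF R[OF assms(3)] one_carrier_mat])
  finally show ?thesis
    using rep_dim_pos[OF rr assms(2)] afforded_char_one[OF rr assms(2)] assms by (simp add: r)
qed

section \<open>Eigenvalues of group elements and values of maximal modulus\<close>

lemma rep_eigenvalues:
  fixes G (structure)
  assumes rep: "representation G n \<rho>" and G: "group G" "finite (carrier G)" and g: "g \<in> carrier G"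
  obtains e :: "nat \<Rightarrow> complex" where "\<And>k::nat. mat_trace (\<rho> (g [^] k)) = (\<Sum>i<n. e i ^ k)"
    "\<And>i. i < n \<Longrightarrow> e i ^ card (carrier G) = 1"
proof -
  interpret group G by fact
  obtain e :: "nat \<Rightarrow> complex" where e: "\<And>k. mat_trace (\<rho> g ^\<^sub>m k) = (\<Sum>i<n. e i ^ k)"
    "\<And>k l i. \<rho> g ^\<^sub>m k = \<rho> g ^\<^sub>m l \<Longrightarrow> i < n \<Longrightarrow> e i ^ k = e i ^ l"
    using mat_trace_pow_eigenvalues[OF rep_carrier[OF rep G(1) g]] by metis
  have "\<rho> g ^\<^sub>m card (carrier G) = \<rho> g ^\<^sub>m 0"
    using rep_pow[OF rep G(1) g, of "card (carrier G)"] rep_pow[OF rep G(1) g, of 0] pow_order_eq_1[OF g]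
    by (simp add: Coset.order_def)
  from e(2)[OF this] e(1) that show ?thesis by (simp add: rep_pow[OF rep G(1) g])
qed

lemma root_of_unity_norm:
  assumes "(e :: complex) ^ k = 1" "k > 0"
  shows "cmod e = 1"
proof -
  have "cmod e ^ k = 1" using assms(1) by (metis norm_one norm_power)
  thus ?thesis using assms(2) power_eq_imp_eq_base[of "cmod e" k 1] by simp
qed

lemma char_eigenvalues:
  fixes G (structure)
  assumes "\<chi> \<in> characters G" and G: "group G" "finite (carrier G)" and g: "g \<in> carrier G"
  obtains n and e :: "nat \<Rightarrow> complex" where "\<chi> \<one> = of_nat n" "n > 0" "\<And>k::nat. \<chi> (g [^] k) = (\<Sum>i<n. e i ^ k)"
    "\<And>i. i < n \<Longrightarrow> e i ^ card (carrier G) = 1" "\<And>i. i < n \<Longrightarrow> cmod (e i) = 1"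
proof -
  interpret group G by fact
  obtain n \<rho> where r: "representation G n \<rho>" "\<chi> = afforded_char G \<rho>"
    using characters_eq_afforded[OF assms(1)] by blast
  obtain e :: "nat \<Rightarrow> complex" where e: "\<And>k::nat. mat_trace (\<rho> (g [^] k)) = (\<Sum>i<n. e i ^ k)"
    "\<And>i. i < n \<Longrightarrow> e i ^ card (carrier G) = 1"
    using rep_eigenvalues[OF r(1) G g] by metis
  have pos: "card (carrier G) > 0" using G(2) one_closed card_gt_0_iff by blast
  show ?thesis
  proof (rule that[of n e])
    show "cmod (e i) = 1" if "i < n" for i
      by (rule root_of_unity_norm[OF e(2)[OF that] pos])
  qed (use e r g afforded_char_one[OF r(1) G(1)] rep_dim_pos[OF r(1) G(1)] in auto)
qed

text \<open>The inverse is the power with exponent one less than the group order, and on the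
  eigenvalues, which are roots of unity, this power is complex conjugation.\<close>

lemma char_inv:
  fixes G (structure)
  assumes "\<chi> \<in> characters G" and G: "group G" "finite (carrier G)" and g: "g \<in> carrier G"
  shows "\<chi> (inv g) = cnj (\<chi> g)"
proof -
  interpret group G by fact
  obtain n and e :: "nat \<Rightarrow> complex" where e: "\<And>k::nat. \<chi> (g [^] k) = (\<Sum>i<n. e i ^ k)"
    "\<And>i. i < n \<Longrightarrow> e i ^ card (carrier G) = 1" "\<And>i. i < n \<Longrightarrow> cmod (e i) = 1"
    using char_eigenvalues[OF assms] by metis
  have pos: "card (carrier G) > 0" using G(2) one_closed card_gt_0_iff by blast
  then obtain N where N: "card (carrier G) = Suc N" using gr0_implies_Suc by blast
  have "g [^] N \<otimes> g = \<one>" using pow_order_eq_1[OF g] N by (simp add: Coset.order_def)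
  hence "inv g = g [^] N" using g by (metis inv_equality nat_pow_closed)
  moreover have "e i ^ N = cnj (e i)" if "i < n" for i
  proof -
    have "e i * e i ^ N = 1" using e(2)[OF that] N by simp
    moreover have "e i * cnj (e i) = 1"
      using e(3)[OF that] by (simp add: complex_norm_square[symmetric])
    ultimately show ?thesis by (metis mult.assoc mult.commute mult_1)
  qed
  ultimately have "\<chi> (inv g) = cnj (\<Sum>i<n. e i)" using e(1)[of N] by simp
  also have "(\<Sum>i<n. e i) = \<chi> g" using e(1)[of 1] g by simp
  finally show ?thesis .
qed

lemma char_norm_le:
  fixes G (structure)
  assumes "\<chi> \<in> characters G" and G: "group G" "finite (carrier G)" and g: "g \<in> carrier G"
  shows "cmod (\<chi> g) \<le> cmod (\<chi> \<one>)"
proof -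
  interpret group G by fact
  obtain n and e :: "nat \<Rightarrow> complex" where n: "\<chi> \<one> = of_nat n" and e: "\<And>k::nat. \<chi> (g [^] k) = (\<Sum>i<n. e i ^ k)"
    "\<And>i. i < n \<Longrightarrow> cmod (e i) = 1"
    using char_eigenvalues[OF assms] by metis
  have "\<chi> g = (\<Sum>i<n. e i)" using e(1)[of 1] g by simp
  hence "cmod (\<chi> g) \<le> (\<Sum>i<n. cmod (e i))" using norm_sum by metis
  thus ?thesis using n e(2) by simp
qed

text \<open>The equality case of the triangle inequality. After rotation by \<open>cnj u\<close>
  each real part is at most 1 and their mean is 1, so each rotated number is 1.\<close>

lemma sum_unit_complex_extremal:
  fixes e :: "nat \<Rightarrow> complex"
  assumes "\<And>i. i < n \<Longrightarrow> cmod (e i) = 1" "cmod (\<Sum>i<n. e i) = real n" "i < n"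
  shows "e i = (\<Sum>i<n. e i) / of_nat n"
proof -
  define u where "u = (\<Sum>i<n. e i) / of_nat n"
  have n: "n > 0" using assms(3) by simp
  have "cmod u = 1" using assms(2) n by (simp add: u_def norm_divide)
  hence uu: "u * cnj u = 1" by (simp add: complex_norm_square[symmetric])
  have le: "Re (e i * cnj u) \<le> 1" if "i < n" for i
    using complex_Re_le_cmod[of "e i * cnj u"] assms(1)[OF that] \<open>cmod u = 1\<close> by (simp add: norm_mult)
  have "(\<Sum>i<n. e i) = of_nat n * u" using n by (simp add: u_def)
  hence "(\<Sum>i<n. e i * cnj u) = of_nat n * (u * cnj u)"
    by (metis mult.assoc sum_distrib_right)
  hence "Re (\<Sum>i<n. e i * cnj u) = real n" using uu by simp
  hence "(\<Sum>i<n. 1 - Re (e i * cnj u)) = 0" by (simp add: sum_subtractf)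
  hence "\<forall>i\<in>{..<n}. 1 - Re (e i * cnj u) = 0"
    using le by (subst (asm) sum_nonneg_eq_0_iff) auto
  hence Re1: "Re (e i * cnj u) = 1" using assms(3) by auto
  have "cmod (e i * cnj u) = 1" using assms(1)[OF assms(3)] \<open>cmod u = 1\<close> by (simp add: norm_mult)
  hence "(Re (e i * cnj u))\<^sup>2 + (Im (e i * cnj u))\<^sup>2 = 1" by (simp add: cmod_def)
  hence "Im (e i * cnj u) = 0" using Re1 by simp
  hence "e i * cnj u = 1" using Re1 by (simp add: complex_eq_iff)
  moreover have "e i * cnj u * u = e i" using uu by (simp add: mult.assoc mult.commute[of "cnj u"])
  ultimately have "e i = u" by simp
  thus ?thesis by (simp add: u_def)
qed

text \<open>A matrix of finite order all of whose eigenvalues equal \<open>u\<close> is the projection onto its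
  \<open>u\<close>-eigenspace, which has full trace, hence is scalar.\<close>

lemma rep_scalar_of_norm:
  fixes G (structure)
  assumes rep: "representation G n \<rho>" and G: "group G" "finite (carrier G)" and g: "g \<in> carrier G"
    and ext: "cmod (mat_trace (\<rho> g)) = real n"
  shows "\<rho> g = (mat_trace (\<rho> g) / of_nat n) \<cdot>\<^sub>m 1\<^sub>m n"
proof -
  interpret group G by fact
  note R = rep_carrier[OF rep G(1)]
  note n = rep_dim_pos[OF rep G(1)]
  define N where "N = card (carrier G)"
  have N: "N > 0" unfolding N_def using G(2) one_closed card_gt_0_iff by blast
  obtain e :: "nat \<Rightarrow> complex" where e: "\<And>k::nat. mat_trace (\<rho> (g [^] k)) = (\<Sum>i<n. e i ^ k)"
    "\<And>i. i < n \<Longrightarrow> e i ^ N = 1"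
    using rep_eigenvalues[OF rep G g] unfolding N_def by metis
  have e1: "cmod (e i) = 1" if "i < n" for i by (rule root_of_unity_norm[OF e(2)[OF that] N])
  have tr: "mat_trace (\<rho> g) = (\<Sum>i<n. e i)" using e(1)[of 1] g by simp
  define u where "u = mat_trace (\<rho> g) / of_nat n"
  have eu: "e i = u" if "i < n" for i
    using sum_unit_complex_extremal[of n e, OF e1 _ that] ext unfolding u_def tr by simp
  have uN: "u ^ N = 1" and u1: "cmod u = 1" using eu e(2) e1 n by auto
  hence uu: "u * cnj u = 1" by (simp add: complex_norm_square[symmetric])
  have trk: "mat_trace (\<rho> (g [^] k)) = of_nat n * u ^ k" for k :: nat
    using e(1) eu by simp
  \<comment> \<open>The sum \<open>P\<close> of these terms averages the powers of
    \<open>\<rho> g\<close> divided by \<open>u\<close>; it is the projection onto the eigenspace of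
    \<open>u\<close>. The factor \<open>cnj u\<close> is the inverse of \<open>u\<close>.\<close>
  define A where "A = (\<lambda>k::nat. (cnj u ^ k / of_nat N) \<cdot>\<^sub>m \<rho> (g [^] k))"
  have A: "A k \<in> carrier_mat n n" for k unfolding A_def using R[of "g [^] k"] g by simp
  have AS: "\<rho> g * A k = u \<cdot>\<^sub>m A (Suc k)" for k
  proof -
    have gk: "g [^] k \<in> carrier G" using g by simp
    have e': "u * cnj u ^ Suc k = cnj u ^ k" using uu by (simp add: mult.assoc[symmetric])
    have "\<rho> g * A k = (cnj u ^ k / of_nat N) \<cdot>\<^sub>m (\<rho> g * \<rho> (g [^] k))"
      unfolding A_def by (rule mult_smult_distrib[OF R[OF g] R[OF gk]])
    also have "\<rho> g * \<rho> (g [^] k) = \<rho> (g [^] Suc k)"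
      using rep_mult[OF rep G(1) g gk] nat_pow_Suc2[OF g, of k] by (simp del: nat_pow_Suc)
    also have "(cnj u ^ k / of_nat N) \<cdot>\<^sub>m \<rho> (g [^] Suc k) = u \<cdot>\<^sub>m A (Suc k)"
    proof -
      have "u * (cnj u ^ Suc k / of_nat N) = cnj u ^ k / of_nat N"
        using e' by (simp only: times_divide_eq_right)
      thus ?thesis unfolding A_def smult_smult_mat by (simp only:)
    qed
    finally show ?thesis .
  qed
  define P where "P = mat_sum n n {..<N} A"
  have P: "P \<in> carrier_mat n n" by (simp add: P_def)
  have gP: "\<rho> g * P = u \<cdot>\<^sub>m P"
  proof (rule eq_matI)
    fix i j assume "i < dim_row (u \<cdot>\<^sub>m P)" "j < dim_col (u \<cdot>\<^sub>m P)"
    hence ij: "i < n" "j < n" using P by auto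
    \<comment> \<open>The terms are periodic with period \<open>N\<close>, so shifting the summation
      index leaves the sum unchanged.\<close>
    have A0: "A N $$ (i, j) = A 0 $$ (i, j)"
    proof -
      have "cnj u ^ N = 1" using uN by (metis complex_cnj_one complex_cnj_power)
      moreover have "g [^] N = \<one>" using pow_order_eq_1[OF g] by (simp add: N_def Coset.order_def)
      ultimately show ?thesis unfolding A_def by simp
    qed
    have "A 0 $$ (i, j) + (\<Sum>k<N. A (Suc k) $$ (i, j)) = (\<Sum>k<N. A k $$ (i, j)) + A N $$ (i, j)"
      using sum.lessThan_Suc_shift[of "\<lambda>k. A k $$ (i, j)" N] sum.lessThan_Suc[of "\<lambda>k. A k $$ (i, j)" N]
      by (simp only:)
    hence shift: "(\<Sum>k<N. A (Suc k) $$ (i, j)) = (\<Sum>k<N. A k $$ (i, j))"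
      unfolding A0 by (simp only: add.commute add_left_cancel)
    have "(\<rho> g * P) $$ (i, j) = (\<Sum>k<N. (\<rho> g * A k) $$ (i, j))"
      unfolding P_def mult_mat_sum[OF R[OF g] A] using ij by (simp add: mat_sum_def)
    also have "\<dots> = (\<Sum>k<N. u * A (Suc k) $$ (i, j))"
      unfolding AS using ij carrier_matD[OF A] by (intro sum.cong) auto
    also have "\<dots> = u * (\<Sum>k<N. A k $$ (i, j))"
      unfolding shift[symmetric] sum_distrib_left ..
    also have "\<dots> = (u \<cdot>\<^sub>m P) $$ (i, j)" using ij by (simp add: P_def mat_sum_def)
    finally show "(\<rho> g * P) $$ (i, j) = (u \<cdot>\<^sub>m P) $$ (i, j)" .
  qed (use R[OF g] P in auto)
  have gkP: "\<rho> (g [^] k) * P = u ^ k \<cdot>\<^sub>m P" for k :: nat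
  proof (induction k)
    case 0
    show ?case using rep_one[OF rep G(1)] P by (auto intro!: eq_matI)
  next
    case (Suc k)
    have gk: "g [^] k \<in> carrier G" using g by simp
    have "\<rho> (g [^] Suc k) * P = \<rho> (g [^] k) * \<rho> g * P" using rep_mult[OF rep G(1) gk g] by simp
    also have "\<dots> = \<rho> (g [^] k) * (\<rho> g * P)" by (rule assoc_mult_mat[OF R[OF gk] R[OF g] P])
    also have "\<dots> = u \<cdot>\<^sub>m (\<rho> (g [^] k) * P)" unfolding gP by (rule mult_smult_distrib[OF R[OF gk] P])
    also have "\<dots> = u ^ Suc k \<cdot>\<^sub>m P" unfolding Suc.IH by (simp add: smult_smult_mat)
    finally show ?case .
  qed
  have ukc: "cnj u ^ k * u ^ k = 1" for k
    unfolding power_mult_distrib[symmetric] using uu by (simp add: mult.commute)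
  have PP: "P * P = P"
  proof (rule eq_matI)
    fix i j assume "i < dim_row P" "j < dim_col P"
    hence ij: "i < n" "j < n" using P by auto
    have "(P * P) $$ (i, j) = (\<Sum>k<N. (A k * P) $$ (i, j))"
      by (subst (1) P_def, subst mat_sum_mult[OF P A]) (use ij in \<open>simp add: mat_sum_def\<close>)
    also have "\<dots> = (\<Sum>k<N. P $$ (i, j) / of_nat N)"
    proof (intro sum.cong refl)
      fix k :: nat
      have gk: "g [^] k \<in> carrier G" using g by simp
      have "A k * P = (cnj u ^ k / of_nat N) \<cdot>\<^sub>m (u ^ k \<cdot>\<^sub>m P)"
        unfolding A_def gkP[symmetric] by (rule mult_smult_assoc_mat[OF R[OF gk] P])
      also have "\<dots> = (1 / of_nat N) \<cdot>\<^sub>m P"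
        unfolding smult_smult_mat using ukc[of k] by (simp add: mult.commute)
      finally show "(A k * P) $$ (i, j) = P $$ (i, j) / of_nat N" using ij P by simp
    qed
    also have "\<dots> = P $$ (i, j)" using N by simp
    finally show "(P * P) $$ (i, j) = P $$ (i, j)" .
  qed (use P in auto)
  obtain k where k: "mat_trace P = of_nat k" "k = n \<Longrightarrow> P = 1\<^sub>m n"
  proof -
    show ?thesis by (rule idempotent_trace[OF P PP]) (rule that, assumption+)
  qed
  have "mat_trace P = (\<Sum>k<N. mat_trace (A k))" unfolding P_def by (rule mat_trace_mat_sum[OF A])
  also have "\<dots> = (\<Sum>k<N. of_nat n / of_nat N)"
  proof (intro sum.cong refl)
    fix k :: nat
    have "mat_trace (A k) = (cnj u ^ k / of_nat N) * (of_nat n * u ^ k)"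
      unfolding A_def using R[of "g [^] k"] g trk[of k] by (subst mat_trace_smult[of _ n]) auto
    also have "\<dots> = (cnj u ^ k * u ^ k) * of_nat n / of_nat N" by simp
    finally show "mat_trace (A k) = of_nat n / of_nat N" unfolding ukc by simp
  qed
  also have "\<dots> = of_nat n" using N by simp
  finally have "P = 1\<^sub>m n" using k by simp
  thus ?thesis using gP R[OF g] by (simp add: u_def)
qed

text \<open>The sum runs over the carrier only, so a character of a larger group can be paired with
  one of a subgroup without restricting it first.\<close>

definition char_ip :: "('a, 'b) monoid_scheme \<Rightarrow> ('a \<Rightarrow> complex) \<Rightarrow> ('a \<Rightarrow> complex) \<Rightarrow> complex" where
  "char_ip G \<chi> \<psi> = (\<Sum>g\<in>carrier G. \<chi> g * cnj (\<psi> g)) / of_nat (card (carrier G))"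

lemma char_ip_irr:
  fixes G (structure)
  assumes "\<chi> \<in> Irr G" "\<psi> \<in> Irr G" and G: "group G" "finite (carrier G)"
  shows "char_ip G \<chi> \<psi> = (if \<chi> = \<psi> then 1 else 0)"
proof -
  interpret group G by fact
  have \<psi>: "\<psi> \<in> characters G" "\<chi> \<in> characters G" using assms Irr_subset_characters by auto
  obtain n where n: "n > 0" "\<chi> \<one> = of_nat n" using char_degree[OF \<psi>(2) G(1)] .
  have pos: "card (carrier G) > 0" using G(2) one_closed card_gt_0_iff by blast
  have "(\<Sum>g\<in>carrier G. \<chi> g * cnj (\<psi> g)) = (\<Sum>g\<in>carrier G. \<chi> (\<one> \<otimes> g) * \<psi> (inv g \<otimes> \<one>))"
    by (intro sum.cong) (auto simp: char_inv[OF \<psi>(1) G])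
  also have "\<dots> = (if \<chi> = \<psi> then of_nat (card (carrier G)) else 0)"
    unfolding irr_orthogonality[OF assms(1,2) G(1) one_closed one_closed] using n
    by (cases "\<chi> = \<psi>") simp_all
  finally show ?thesis unfolding char_ip_def using pos by simp
qed

lemma char_ip_sum_list:
  "char_ip G (\<lambda>g. \<Sum>\<psi>\<leftarrow>\<psi>s. \<psi> g) \<chi> = (\<Sum>\<psi>\<leftarrow>\<psi>s. char_ip G \<psi> \<chi>)"
  by (induction \<psi>s) (simp_all add: char_ip_def sum.distrib distrib_right add_divide_distrib)

lemma char_ip_scale: "char_ip G (\<lambda>g. c * \<psi> g) \<chi> = c * char_ip G \<psi> \<chi>"
  by (simp add: char_ip_def sum_distrib_left mult.assoc)

lemma char_ip_count:
  assumes "set \<psi>s \<subseteq> Irr G" "\<chi> \<in> Irr G" and G: "group G" "finite (carrier G)"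
  shows "char_ip G (\<lambda>g. \<Sum>\<psi>\<leftarrow>\<psi>s. \<psi> g) \<chi> = of_nat (count_list \<psi>s \<chi>)"
  unfolding char_ip_sum_list using assms(1)
proof (induction \<psi>s)
  case (Cons \<psi> \<psi>s)
  thus ?case using char_ip_irr[OF _ assms(2) G, of \<psi>] by simp
qed simp

lemma char_ip_nat:
  assumes "\<phi> \<in> characters G" "\<chi> \<in> Irr G" and G: "group G" "finite (carrier G)"
  obtains k where "char_ip G \<phi> \<chi> = of_nat k"
proof -
  obtain \<psi>s where "set \<psi>s \<subseteq> Irr G" "\<phi> = (\<lambda>g. \<Sum>\<psi>\<leftarrow>\<psi>s. \<psi> g)"
    using char_is_sum_of_irr[OF assms(1) G(1)] by blast
  thus ?thesis using char_ip_count[OF _ assms(2) G] that by blast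
qed

text \<open>Multiplicities in characters are natural numbers, so the remainder cannot cancel the
  copy of \<open>\<psi>\<close>.\<close>

lemma constituent_ip:
  assumes "\<psi> \<in> irr_constituents G \<chi>" and G: "group G" "finite (carrier G)"
  shows "char_ip G \<chi> \<psi> \<noteq> 0"
proof -
  have \<psi>: "\<psi> \<in> Irr G" using assms(1) by (simp add: irr_constituents_def)
  consider "\<chi> = \<psi>" | \<phi> where "\<phi> \<in> characters G" "\<chi> = (\<lambda>g. \<psi> g + \<phi> g)"
    using assms(1) by (auto simp: irr_constituents_def)
  thus ?thesis
  proof cases
    case 1
    thus ?thesis using char_ip_irr[OF \<psi> \<psi> G] by simp
  next
    case 2
    obtain k where k: "char_ip G \<phi> \<psi> = of_nat k" using char_ip_nat[OF 2(1) \<psi> G] .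
    have "char_ip G \<chi> \<psi> = char_ip G \<psi> \<psi> + char_ip G \<phi> \<psi>"
      unfolding 2(2) by (simp add: char_ip_def sum.distrib distrib_right add_divide_distrib)
    also have "\<dots> = of_nat (Suc k)" using k char_ip_irr[OF \<psi> \<psi> G] by simp
    finally show ?thesis by (simp only: of_nat_eq_0_iff)
  qed
qed

text \<open>Degrees are positive, so the zero function is no character; the definition of
  constituents therefore separates an empty remainder, and so does this proof.\<close>

lemma irr_constituents_of_sum:
  assumes "set \<psi>s \<subseteq> Irr G" "\<psi> \<in> set \<psi>s" "\<chi> = (\<lambda>g. \<Sum>\<psi>\<leftarrow>\<psi>s. \<psi> g)" "group G"
  shows "\<psi> \<in> irr_constituents G \<chi>"
proof -
  have \<psi>: "\<psi> \<in> Irr G" using assms(1,2) by blast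
  have eq: "\<chi> = (\<lambda>g. \<psi> g + (\<Sum>\<psi>\<leftarrow>remove1 \<psi> \<psi>s. \<psi> g))"
  proof
    fix g
    have "(\<Sum>\<psi>\<leftarrow>\<psi>s. \<psi> g) = \<psi> g + (\<Sum>\<psi>\<leftarrow>remove1 \<psi> \<psi>s. \<psi> g)"
      using assms(2) by (rule sum_list_map_remove1)
    thus "\<chi> g = \<psi> g + (\<Sum>\<psi>\<leftarrow>remove1 \<psi> \<psi>s. \<psi> g)" unfolding assms(3) .
  qed
  show ?thesis
  proof (cases "remove1 \<psi> \<psi>s = []")
    case True
    have "\<chi> = \<psi>" unfolding eq True by simp
    thus ?thesis using \<psi> by (simp add: irr_constituents_def)
  next
    case False
    have "set (remove1 \<psi> \<psi>s) \<subseteq> characters G"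
      using set_remove1_subset[of \<psi> \<psi>s] assms(1) Irr_subset_characters by blast
    note ch = char_sum_list[OF False this assms(4)]
    have "\<exists>\<phi>\<in>characters G. \<chi> = (\<lambda>g. \<psi> g + \<phi> g)"
      by (rule bexI[OF _ ch]) (rule eq)
    thus ?thesis using \<psi> unfolding irr_constituents_def by simp
  qed
qed

lemma (in group) inv_cancel:
  assumes "g \<in> carrier G" "x \<in> carrier G"
  shows "g \<otimes> (inv g \<otimes> x) = x" "inv g \<otimes> (g \<otimes> x) = x"
  using assms by (simp_all flip: m_assoc)

section \<open>Restriction, transport and twisting of characters\<close>

lemma rep_hom_comp:
  assumes "representation G n \<rho>" "group G" "group H" "\<phi> \<in> hom H G"
  shows "representation H n (\<lambda>h. \<rho> (\<phi> h))"
proof (rule representationI[OF assms(3)])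
  show "n > 0" by (rule rep_dim_pos[OF assms(1,2)])
  show "\<rho> (\<phi> h) \<in> carrier_mat n n" if "h \<in> carrier H" for h
    using rep_carrier[OF assms(1,2)] hom_in_carrier[OF assms(4) that] by blast
  show "\<rho> (\<phi> \<one>\<^bsub>H\<^esub>) = 1\<^sub>m n"
    using rep_one[OF assms(1,2)] hom_one[OF assms(4,3,2)] by simp
  show "\<rho> (\<phi> (g \<otimes>\<^bsub>H\<^esub> h)) = \<rho> (\<phi> g) * \<rho> (\<phi> h)" if "g \<in> carrier H" "h \<in> carrier H" for g h
    using rep_mult[OF assms(1,2)] hom_in_carrier[OF assms(4)] hom_mult[OF assms(4)] that by simp
qed

lemma irr_rep_hom_comp:
  assumes "irreducible_representation G n \<rho>" "group G" "group H" "\<phi> \<in> hom H G" "\<phi> ` carrier H = carrier G"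
  shows "irreducible_representation H n (\<lambda>h. \<rho> (\<phi> h))"
proof -
  have "invariant_subspace G n \<rho> W" if "invariant_subspace H n (\<lambda>h. \<rho> (\<phi> h)) W" for W
    unfolding invariant_subspace_def
  proof (intro conjI ballI)
    show "VectorSpace.subspace class_ring W (module_vec TYPE(complex) n)"
      using that by (simp add: invariant_subspace_def)
    fix g w assume "g \<in> carrier G" "w \<in> W"
    moreover then obtain h where "h \<in> carrier H" "g = \<phi> h" using assms(5) by blast
    ultimately show "\<rho> g *\<^sub>v w \<in> W" using that by (simp add: invariant_subspace_def)
  qed
  thus ?thesis
    using assms(1) rep_hom_comp[OF irr_rep_rep[OF assms(1)] assms(2-4)]
    unfolding irreducible_representation_def by simp
qed

lemma char_hom_comp:
  assumes "\<chi> \<in> characters G" "group G" "group H" "\<phi> \<in> hom H G"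
  shows "(\<lambda>h. if h \<in> carrier H then \<chi> (\<phi> h) else 0) \<in> characters H"
proof -
  obtain n \<rho> where r: "representation G n \<rho>" "\<chi> = afforded_char G \<rho>"
    using characters_eq_afforded[OF assms(1)] by blast
  have "(\<lambda>h. if h \<in> carrier H then \<chi> (\<phi> h) else 0) = afforded_char H (\<lambda>h. \<rho> (\<phi> h))"
    using hom_in_carrier[OF assms(4)] by (auto simp: r(2) afforded_char_def)
  thus ?thesis using afforded_charI[OF rep_hom_comp[OF r(1) assms(2-4)]] by simp
qed

lemma Irr_hom_comp:
  assumes "\<chi> \<in> Irr G" "group G" "group H" "\<phi> \<in> hom H G" "\<phi> ` carrier H = carrier G"
  shows "(\<lambda>h. if h \<in> carrier H then \<chi> (\<phi> h) else 0) \<in> Irr H"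
proof -
  obtain n \<rho> where r: "irreducible_representation G n \<rho>" "\<chi> = afforded_char G \<rho>"
    using Irr_eq_afforded[OF assms(1)] by blast
  have "(\<lambda>h. if h \<in> carrier H then \<chi> (\<phi> h) else 0) = afforded_char H (\<lambda>h. \<rho> (\<phi> h))"
    using hom_in_carrier[OF assms(4)] by (auto simp: r(2) afforded_char_def)
  thus ?thesis using afforded_char_IrrI[OF irr_rep_hom_comp[OF r(1) assms(2-5)]] by simp
qed

lemma rep_restrict:
  assumes "representation G n \<rho>" "group G" "subgroup H G"
  shows "representation (G\<lparr>carrier := H\<rparr>) n \<rho>"
  using rep_hom_comp[OF assms(1,2) subgroup.subgroup_is_group[OF assms(3,2)], of "\<lambda>x. x"]
    subgroup.subset[OF assms(3)] by (simp add: hom_def Pi_iff subset_iff)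

lemma char_restrict:
  assumes "\<chi> \<in> characters G" "group G" "subgroup H G"
  shows "restrict_to H \<chi> \<in> characters (G\<lparr>carrier := H\<rparr>)"
  using char_hom_comp[OF assms(1,2) subgroup.subgroup_is_group[OF assms(3,2)], of "\<lambda>x. x"]
    subgroup.subset[OF assms(3)] unfolding restrict_to_def by (simp add: hom_def Pi_iff subset_iff)

lemma restrict_to_carrier:
  "\<chi> \<in> characters G \<Longrightarrow> restrict_to (carrier G) \<chi> = \<chi>"
  using char_outside by (fastforce simp: restrict_to_def)

lemma (in normal) conj_hom:
  assumes "g \<in> carrier G"
  shows "(\<lambda>x. g \<otimes> x \<otimes> inv g) \<in> hom (G\<lparr>carrier := H\<rparr>) (G\<lparr>carrier := H\<rparr>)"
    and "(\<lambda>x. g \<otimes> x \<otimes> inv g) ` H = H"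
proof -
  have HG: "x \<in> carrier G" if "x \<in> H" for x using that subset by blast
  show "(\<lambda>x. g \<otimes> x \<otimes> inv g) ` H = H"
  proof
    show "(\<lambda>x. g \<otimes> x \<otimes> inv g) ` H \<subseteq> H" using inv_op_closed2[OF assms] by blast
    show "H \<subseteq> (\<lambda>x. g \<otimes> x \<otimes> inv g) ` H"
    proof
      fix x assume x: "x \<in> H"
      have "x = g \<otimes> (inv g \<otimes> x \<otimes> g) \<otimes> inv g"
        using assms HG[OF x] by (simp add: m_assoc inv_cancel)
      thus "x \<in> (\<lambda>x. g \<otimes> x \<otimes> inv g) ` H" using inv_op_closed1[OF assms x] by blast
    qed
  qed
  show "(\<lambda>x. g \<otimes> x \<otimes> inv g) \<in> hom (G\<lparr>carrier := H\<rparr>) (G\<lparr>carrier := H\<rparr>)"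
  proof (rule homI)
    fix x y assume "x \<in> carrier (G\<lparr>carrier := H\<rparr>)" "y \<in> carrier (G\<lparr>carrier := H\<rparr>)"
    hence xy: "x \<in> H" "y \<in> H" "x \<in> carrier G" "y \<in> carrier G" using HG by auto
    show "g \<otimes> x \<otimes> inv g \<in> carrier (G\<lparr>carrier := H\<rparr>)" using inv_op_closed2[OF assms xy(1)] by simp
    show "g \<otimes> (x \<otimes>\<^bsub>G\<lparr>carrier := H\<rparr>\<^esub> y) \<otimes> inv g
        = (g \<otimes> x \<otimes> inv g) \<otimes>\<^bsub>G\<lparr>carrier := H\<rparr>\<^esub> (g \<otimes> y \<otimes> inv g)"
      using xy assms by (simp add: m_assoc inv_cancel)
  qed
qed

lemma conj_char_Irr:
  fixes G (structure)
  assumes "\<psi> \<in> Irr (G\<lparr>carrier := N\<rparr>)" "N \<lhd> G" "g \<in> carrier G"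
  shows "(\<lambda>x. if x \<in> N then \<psi> (g \<otimes> x \<otimes> inv g) else 0) \<in> Irr (G\<lparr>carrier := N\<rparr>)"
proof -
  interpret group G using assms(2) by (simp add: normal_def)
  interpret N: normal N G by fact
  have gr: "group (G\<lparr>carrier := N\<rparr>)" by (rule N.subgroup_is_group[OF is_group])
  show ?thesis
    using Irr_hom_comp[OF assms(1) gr gr N.conj_hom(1)[OF assms(3)]] N.conj_hom(2)[OF assms(3)] by simp
qed

lemma linear_twist_rep:
  assumes "representation G n \<rho>" "group G"
    and "lam \<one>\<^bsub>G\<^esub> = 1" "\<And>x y. x \<in> carrier G \<Longrightarrow> y \<in> carrier G \<Longrightarrow> lam (x \<otimes>\<^bsub>G\<^esub> y) = lam x * lam y"
  shows "representation G n (\<lambda>g. lam g \<cdot>\<^sub>m \<rho> g)"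
proof (rule representationI[OF assms(2) rep_dim_pos[OF assms(1,2)]])
  note R = rep_carrier[OF assms(1,2)]
  show "lam g \<cdot>\<^sub>m \<rho> g \<in> carrier_mat n n" if "g \<in> carrier G" for g using R[OF that] by simp
  show "lam \<one>\<^bsub>G\<^esub> \<cdot>\<^sub>m \<rho> \<one>\<^bsub>G\<^esub> = 1\<^sub>m n" using assms(3) rep_one[OF assms(1,2)] by (auto intro!: eq_matI)
  fix g h assume gh: "g \<in> carrier G" "h \<in> carrier G"
  have "(lam g \<cdot>\<^sub>m \<rho> g) * (lam h \<cdot>\<^sub>m \<rho> h) = lam h \<cdot>\<^sub>m ((lam g \<cdot>\<^sub>m \<rho> g) * \<rho> h)"
    using R gh by (intro mult_smult_distrib[of _ n n _ n]) auto
  also have "(lam g \<cdot>\<^sub>m \<rho> g) * \<rho> h = lam g \<cdot>\<^sub>m (\<rho> g * \<rho> h)"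
    using R gh by (intro mult_smult_assoc_mat[of _ n n _ n]) auto
  finally show "lam (g \<otimes>\<^bsub>G\<^esub> h) \<cdot>\<^sub>m \<rho> (g \<otimes>\<^bsub>G\<^esub> h) = (lam g \<cdot>\<^sub>m \<rho> g) * (lam h \<cdot>\<^sub>m \<rho> h)"
    using rep_mult[OF assms(1,2) gh] assms(4)[OF gh] by (simp add: smult_smult_mat mult.commute)
qed

text \<open>Multiplying the operators by nonzero scalars keeps the invariant subspaces. The
  homomorphism property is asked of \<open>lam\<close> on the carrier alone, which suits values of a
  character of a larger group.\<close>

lemma linear_twist_Irr:
  assumes "\<chi> \<in> Irr G" and G: "group G"
    and l: "lam \<one>\<^bsub>G\<^esub> = 1" "\<And>x y. x \<in> carrier G \<Longrightarrow> y \<in> carrier G \<Longrightarrow> lam (x \<otimes>\<^bsub>G\<^esub> y) = lam x * lam y"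
  shows "(\<lambda>g. lam g * \<chi> g) \<in> Irr G"
proof -
  obtain n \<rho> where r: "irreducible_representation G n \<rho>" "\<chi> = afforded_char G \<rho>"
    using Irr_eq_afforded[OF assms(1)] by blast
  note R = rep_carrier[OF irr_rep_rep[OF r(1)] G]
  let ?\<rho> = "\<lambda>g. lam g \<cdot>\<^sub>m \<rho> g"
  have nz: "lam g \<noteq> 0" if "g \<in> carrier G" for g
    using l that group.inv_closed[OF G that] group.r_inv[OF G that] by (metis mult_zero_left zero_neq_one)
  have "invariant_subspace G n \<rho> W" if W: "invariant_subspace G n ?\<rho> W" for W
    unfolding invariant_subspace_def
  proof (intro conjI ballI)
    show sub: "VectorSpace.subspace class_ring W (module_vec TYPE(complex) n)"
      using W by (simp add: invariant_subspace_def)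
    fix g w assume gw: "g \<in> carrier G" "w \<in> W"
    have wc: "w \<in> carrier_vec n" using subspaceD(1)[OF sub] gw(2) by blast
    have "(lam g \<cdot>\<^sub>m \<rho> g) *\<^sub>v w \<in> W" using W gw by (simp add: invariant_subspace_def)
    hence "(1 / lam g) \<cdot>\<^sub>v ((lam g \<cdot>\<^sub>m \<rho> g) *\<^sub>v w) \<in> W" using subspaceD(4)[OF sub] by blast
    moreover have "(1 / lam g) \<cdot>\<^sub>v ((lam g \<cdot>\<^sub>m \<rho> g) *\<^sub>v w) = \<rho> g *\<^sub>v w"
      using nz[OF gw(1)] R[OF gw(1)] wc by (intro eq_vecI) (auto simp: row_smult)
    ultimately show "\<rho> g *\<^sub>v w \<in> W" by simp
  qed
  hence "irreducible_representation G n ?\<rho>"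
    using r(1) linear_twist_rep[OF irr_rep_rep[OF r(1)] G l]
    unfolding irreducible_representation_def by simp
  moreover have "(\<lambda>g. lam g * \<chi> g) = afforded_char G ?\<rho>"
    using R by (fastforce simp: r(2) afforded_char_def)
  ultimately show ?thesis using afforded_char_IrrI by metis
qed

lemma char_ip_restrict:
  "char_ip (G\<lparr>carrier := H\<rparr>) (restrict_to H \<chi>) \<psi> = char_ip (G\<lparr>carrier := H\<rparr>) \<chi> \<psi>"
  by (simp add: char_ip_def restrict_to_def)

lemma constituent_trans:
  assumes "\<psi> \<in> irr_constituents G \<chi>" "\<phi> \<in> irr_constituents (G\<lparr>carrier := H\<rparr>) (restrict_to H \<psi>)"
    and G: "group G" "subgroup H G"
  shows "\<phi> \<in> irr_constituents (G\<lparr>carrier := H\<rparr>) (restrict_to H \<chi>)"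
proof -
  let ?H = "G\<lparr>carrier := H\<rparr>"
  have gr: "group ?H" by (rule subgroup.subgroup_is_group[OF G(2,1)])
  consider "\<chi> = \<psi>" | \<theta> where "\<theta> \<in> characters G" "\<chi> = (\<lambda>g. \<psi> g + \<theta> g)"
    using assms(1) by (auto simp: irr_constituents_def)
  thus ?thesis
  proof cases
    case 2
    have \<phi>: "\<phi> \<in> Irr ?H" using assms(2) by (simp add: irr_constituents_def)
    have \<theta>: "restrict_to H \<theta> \<in> characters ?H" by (rule char_restrict[OF 2(1) G])
    have \<chi>: "restrict_to H \<chi> = (\<lambda>g. restrict_to H \<psi> g + restrict_to H \<theta> g)"
      by (auto simp: restrict_to_def 2(2))
    have "\<exists>\<theta>'\<in>characters ?H. restrict_to H \<chi> = (\<lambda>g. \<phi> g + \<theta>' g)"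
    proof (cases "restrict_to H \<psi> = \<phi>")
      case True
      show ?thesis by (rule bexI[OF _ \<theta>]) (simp add: \<chi> True)
    next
      case False
      then obtain \<theta>' where t: "\<theta>' \<in> characters ?H" "restrict_to H \<psi> = (\<lambda>g. \<phi> g + \<theta>' g)"
        using assms(2) by (auto simp: irr_constituents_def)
      show ?thesis by (rule bexI[OF _ char_add[OF t(1) \<theta> gr]]) (simp add: \<chi> t(2) add.assoc)
    qed
    thus ?thesis using \<phi> by (simp add: irr_constituents_def)
  qed (use assms in simp)
qed

section \<open>Clifford's theorem\<close>

text \<open>Up to scalars, irreducible characters of \<open>N\<close> are central idempotents of its
  group algebra, orthogonal when distinct. If \<open>\<psi>'\<close> were no conjugate of
  \<open>\<psi>\<close>, its product with every conjugate of \<open>\<psi>\<close> would vanish; but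
  by \<open>irr_mult_values\<close> the sum over \<open>G\<close> of the values of
  \<open>\<chi>\<close> at these products is, up to a nonzero factor, the product of the two
  multiplicities.\<close>

lemma clifford_conjugate:
  fixes G (structure)
  assumes N: "N \<lhd> G" and fin: "finite (carrier G)" and \<chi>: "\<chi> \<in> Irr G"
    and \<psi>: "\<psi> \<in> Irr (G\<lparr>carrier := N\<rparr>)" "char_ip (G\<lparr>carrier := N\<rparr>) \<chi> \<psi> \<noteq> 0"
    and \<psi>': "\<psi>' \<in> Irr (G\<lparr>carrier := N\<rparr>)" "char_ip (G\<lparr>carrier := N\<rparr>) \<chi> \<psi>' \<noteq> 0"
  shows "\<exists>g\<in>carrier G. \<forall>x\<in>N. \<psi>' x = \<psi> (g \<otimes> x \<otimes> inv g)"
proof (rule ccontr)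
  assume not_conj: "\<not> ?thesis"
  interpret group G using N by (simp add: normal_def)
  interpret N: normal N G by fact
  let ?N = "G\<lparr>carrier := N\<rparr>"
  have gr: "group ?N" by (rule N.subgroup_is_group[OF is_group])
  interpret Ng: group ?N by (rule gr)
  have finN: "finite N" using fin N.subset finite_subset by blast
  have inv_eq: "inv\<^bsub>?N\<^esub> x = inv x" if "x \<in> N" for x
    by (rule m_inv_consistent[OF N.subgroup_axioms that])
  have NG: "x \<in> carrier G" if "x \<in> N" for x using that N.subset by blast
  have ip: "char_ip ?N \<chi> \<phi> = (\<Sum>k\<in>N. \<phi> (inv k) * \<chi> k) / of_nat (card N)" if "\<phi> \<in> Irr ?N" for \<phi>
  proof -
    have "\<phi> \<in> characters ?N" using that Irr_subset_characters by blast
    from char_inv[OF this gr] show ?thesis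
      using finN inv_eq by (simp add: char_ip_def mult.commute)
  qed
  define S where "S = (\<Sum>k\<in>N. \<psi> (inv k) * \<chi> k)"
  define S' where "S' = (\<Sum>k\<in>N. \<psi>' (inv k) * \<chi> k)"
  have nz: "S \<noteq> 0" "S' \<noteq> 0" using \<psi> \<psi>' by (auto simp: S_def S'_def ip)
  \<comment> \<open>For a fixed \<open>g\<close> the double sum is the value of
    \<open>\<chi>\<close> at the product of \<open>\<psi>'\<close> and a conjugate of
    \<open>\<psi>\<close> in the group algebra. The substitution of \<open>j\<close> for
    \<open>k \<otimes> m\<close> turns it into a convolution, which vanishes by
    orthogonality.\<close>
  have zero: "(\<Sum>k\<in>N. \<Sum>m\<in>N. \<psi>' (inv k) * \<psi> (inv m) * \<chi> (k \<otimes> (g \<otimes> m \<otimes> inv g))) = 0"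
    if g: "g \<in> carrier G" for g
  proof -
    define \<psi>g where "\<psi>g = (\<lambda>x. if x \<in> N then \<psi> (inv g \<otimes> x \<otimes> g) else 0)"
    have \<psi>g: "\<psi>g \<in> Irr ?N"
      using conj_char_Irr[OF \<psi>(1) N inv_closed[OF g]] g by (simp add: \<psi>g_def cong: if_cong)
    have neq: "\<psi>' \<noteq> \<psi>g"
    proof
      assume "\<psi>' = \<psi>g"
      hence "\<forall>x\<in>N. \<psi>' x = \<psi> (inv g \<otimes> x \<otimes> inv (inv g))" using g by (simp add: \<psi>g_def)
      thus False using not_conj inv_closed[OF g] by blast
    qed
    have bij: "bij_betw (\<lambda>m. g \<otimes> m \<otimes> inv g) N N"
    proof (rule bij_betwI[where g = "\<lambda>m. inv g \<otimes> m \<otimes> g"])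
      show "(\<lambda>m. g \<otimes> m \<otimes> inv g) \<in> N \<rightarrow> N" using N.inv_op_closed2[OF g] by blast
      show "(\<lambda>m. inv g \<otimes> m \<otimes> g) \<in> N \<rightarrow> N" using N.inv_op_closed1[OF g] by blast
      show "inv g \<otimes> (g \<otimes> m \<otimes> inv g) \<otimes> g = m" if "m \<in> N" for m
        using g NG[OF that] by (simp add: m_assoc inv_cancel)
      show "g \<otimes> (inv g \<otimes> m \<otimes> g) \<otimes> inv g = m" if "m \<in> N" for m
        using g NG[OF that] by (simp add: m_assoc inv_cancel)
    qed
    have "(\<Sum>m\<in>N. \<psi> (inv m) * \<chi> (k \<otimes> (g \<otimes> m \<otimes> inv g))) = (\<Sum>m\<in>N. \<psi>g (inv m) * \<chi> (k \<otimes> m))"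
      if k: "k \<in> N" for k
    proof -
      have "(\<Sum>m\<in>N. \<psi>g (inv m) * \<chi> (k \<otimes> m))
          = (\<Sum>m\<in>N. \<psi>g (inv (g \<otimes> m \<otimes> inv g)) * \<chi> (k \<otimes> (g \<otimes> m \<otimes> inv g)))"
        by (rule sum.reindex_bij_betw[OF bij, symmetric])
      also have "\<dots> = (\<Sum>m\<in>N. \<psi> (inv m) * \<chi> (k \<otimes> (g \<otimes> m \<otimes> inv g)))"
      proof (rule sum.cong)
        fix m assume m: "m \<in> N"
        have im: "inv (g \<otimes> m \<otimes> inv g) = g \<otimes> inv m \<otimes> inv g"
          using g NG[OF m] by (simp add: inv_mult_group m_assoc)
        have "inv g \<otimes> (g \<otimes> inv m \<otimes> inv g) \<otimes> g = inv m"
          using g NG[OF m] by (simp add: m_assoc inv_cancel)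
        hence "\<psi>g (inv (g \<otimes> m \<otimes> inv g)) = \<psi> (inv m)"
          unfolding \<psi>g_def im using N.inv_op_closed2[OF g N.m_inv_closed[OF m]] by simp
        thus "\<psi>g (inv (g \<otimes> m \<otimes> inv g)) * \<chi> (k \<otimes> (g \<otimes> m \<otimes> inv g)) = \<psi> (inv m) * \<chi> (k \<otimes> (g \<otimes> m \<otimes> inv g))"
          by simp
      qed simp
      finally show ?thesis by simp
    qed
    hence "(\<Sum>k\<in>N. \<Sum>m\<in>N. \<psi>' (inv k) * \<psi> (inv m) * \<chi> (k \<otimes> (g \<otimes> m \<otimes> inv g)))
        = (\<Sum>k\<in>N. \<psi>' (inv k) * (\<Sum>m\<in>N. \<psi>g (inv m) * \<chi> (k \<otimes> m)))"
      by (simp add: sum_distrib_left mult.assoc flip: sum_distrib_left)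
    also have "\<dots> = (\<Sum>k\<in>N. \<Sum>m\<in>N. \<psi>' (inv k) * \<psi>g (inv m) * \<chi> (k \<otimes> m))"
      by (simp add: sum_distrib_left mult.assoc)
    also have "\<dots> = (\<Sum>m\<in>N. \<Sum>k\<in>N. \<psi>' (inv k) * \<psi>g (inv m) * \<chi> (k \<otimes> m))"
      by (rule sum.swap)
    also have "\<dots> = (\<Sum>m\<in>N. \<Sum>j\<in>N. \<psi>' (inv j \<otimes> m) * \<psi>g (inv m) * \<chi> j)"
    proof (rule sum.cong)
      fix m assume m: "m \<in> N"
      have im: "inv m \<in> N" by (rule N.m_inv_closed[OF m])
      have "(\<Sum>k\<in>N. \<psi>' (inv k) * \<psi>g (inv m) * \<chi> (k \<otimes> m))
          = (\<Sum>j\<in>N. \<psi>' (inv (j \<otimes> inv m)) * \<psi>g (inv m) * \<chi> (j \<otimes> inv m \<otimes> m))"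
        using sum.reindex_bij_betw[OF Ng.bij_betw_rmult[of "inv m"], of "\<lambda>k. \<psi>' (inv k) * \<psi>g (inv m) * \<chi> (k \<otimes> m)"] im
        by simp
      also have "\<dots> = (\<Sum>j\<in>N. \<psi>' (inv j \<otimes> m) * \<psi>g (inv m) * \<chi> j)"
      proof (rule sum.cong)
        fix j assume j: "j \<in> N"
        have ij: "inv j \<in> N" by (rule N.m_inv_closed[OF j])
        have "inv (j \<otimes> inv m) = m \<otimes> (inv j \<otimes> m) \<otimes> inv m"
          using NG[OF m] NG[OF j] by (simp add: inv_mult_group m_assoc)
        moreover have "\<psi>' (m \<otimes> (inv j \<otimes> m) \<otimes> inv m) = \<psi>' (inv j \<otimes> m)"
          using char_conj[OF subsetD[OF Irr_subset_characters \<psi>'(1)] gr, of m "inv j \<otimes> m"] m ij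
          by (simp add: inv_eq)
        moreover have "j \<otimes> inv m \<otimes> m = j" using NG[OF m] NG[OF j] by (simp add: m_assoc)
        ultimately show "\<psi>' (inv (j \<otimes> inv m)) * \<psi>g (inv m) * \<chi> (j \<otimes> inv m \<otimes> m)
            = \<psi>' (inv j \<otimes> m) * \<psi>g (inv m) * \<chi> j" by simp
      qed simp
      finally show "(\<Sum>k\<in>N. \<psi>' (inv k) * \<psi>g (inv m) * \<chi> (k \<otimes> m))
          = (\<Sum>j\<in>N. \<psi>' (inv j \<otimes> m) * \<psi>g (inv m) * \<chi> j)" .
    qed simp
    also have "\<dots> = (\<Sum>j\<in>N. (\<Sum>m\<in>N. \<psi>' (inv j \<otimes> m) * \<psi>g (inv m)) * \<chi> j)"
      by (subst sum.swap) (simp add: sum_distrib_right)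
    also have "\<dots> = (\<Sum>j\<in>N. 0)"
    proof (rule sum.cong)
      fix j assume j: "j \<in> N"
      have ij: "inv j \<in> N" by (rule N.m_inv_closed[OF j])
      have "(\<Sum>m\<in>N. \<psi>' (inv j \<otimes> m) * \<psi>g (inv m))
          = (\<Sum>m\<in>carrier ?N. \<psi>' (inv j \<otimes>\<^bsub>?N\<^esub> m) * \<psi>g (inv\<^bsub>?N\<^esub> m \<otimes>\<^bsub>?N\<^esub> \<one>\<^bsub>?N\<^esub>))"
        using NG by (simp add: inv_eq)
      also have "\<dots> = 0"
        using irr_orthogonality[OF \<psi>'(1) \<psi>g gr, of "inv j" "\<one>\<^bsub>?N\<^esub>"] neq ij by simp
      finally show "(\<Sum>m\<in>N. \<psi>' (inv j \<otimes> m) * \<psi>g (inv m)) * \<chi> j = 0" by simp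
    qed simp
    finally show ?thesis by simp
  qed
  \<comment> \<open>\<open>irr_mult_values\<close> replaces each product
    \<open>\<chi> k * \<chi> m\<close> by an average over the conjugates of
    \<open>m\<close>.\<close>
  have "of_nat (card (carrier G)) * (S' * S)
      = (\<Sum>k\<in>N. \<Sum>m\<in>N. \<psi>' (inv k) * \<psi> (inv m) * (of_nat (card (carrier G)) * \<chi> k * \<chi> m))"
    by (simp add: S_def S'_def sum_product sum_distrib_left mult_ac)
  also have "\<dots> = (\<Sum>k\<in>N. \<Sum>m\<in>N. \<psi>' (inv k) * \<psi> (inv m) *
      (\<chi> \<one> * (\<Sum>g\<in>carrier G. \<chi> (k \<otimes> (g \<otimes> m \<otimes> inv g)))))"
    using irr_mult_values[OF \<chi> is_group] NG by (intro sum.cong refl) simp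
  also have "\<dots> = \<chi> \<one> * (\<Sum>k\<in>N. \<Sum>m\<in>N. \<Sum>g\<in>carrier G. \<psi>' (inv k) * \<psi> (inv m) * \<chi> (k \<otimes> (g \<otimes> m \<otimes> inv g)))"
    by (simp add: sum_distrib_left mult_ac)
  also have "(\<Sum>k\<in>N. \<Sum>m\<in>N. \<Sum>g\<in>carrier G. \<psi>' (inv k) * \<psi> (inv m) * \<chi> (k \<otimes> (g \<otimes> m \<otimes> inv g)))
      = (\<Sum>k\<in>N. \<Sum>g\<in>carrier G. \<Sum>m\<in>N. \<psi>' (inv k) * \<psi> (inv m) * \<chi> (k \<otimes> (g \<otimes> m \<otimes> inv g)))"
    by (intro sum.cong refl sum.swap)
  also have "\<dots> = (\<Sum>g\<in>carrier G. \<Sum>k\<in>N. \<Sum>m\<in>N. \<psi>' (inv k) * \<psi> (inv m) * \<chi> (k \<otimes> (g \<otimes> m \<otimes> inv g)))"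
    by (rule sum.swap)
  also have "\<dots> = 0" using zero by simp
  finally have "of_nat (card (carrier G)) * (S' * S) = 0" by simp
  moreover have "card (carrier G) \<noteq> 0" using fin one_closed by (auto simp: card_eq_0_iff)
  ultimately show False using nz by simp
qed

section \<open>Degrees\<close>

text \<open>Representatives of the right cosets \<open>H #> x\<close>; the map onto the group is
  injective by counting.\<close>

lemma transversal_exists:
  fixes G (structure)
  assumes "group G" "finite (carrier G)" "subgroup H G"
  obtains R where "R \<subseteq> carrier G" "finite R" "card R * card H = card (carrier G)"
    "bij_betw (\<lambda>(r, h). h \<otimes> r) (R \<times> H) (carrier G)"
proof -
  interpret group G by fact
  interpret H: subgroup H G by fact
  have finH: "finite H" using assms(2) H.subset finite_subset by blast
  define R where "R = (\<lambda>C. SOME x. x \<in> C) ` (rcosets H)"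
  have pick: "(SOME x. x \<in> C) \<in> C" if C: "C \<in> rcosets H" for C
  proof -
    obtain x where "x \<in> carrier G" "C = H #> x" using C unfolding RCOSETS_def by blast
    hence "x \<in> C" using rcos_self[OF _ assms(3)] by simp
    thus ?thesis by (rule someI)
  qed
  have sub: "C \<subseteq> carrier G" if "C \<in> rcosets H" for C
    using rcosets_part_G[OF assms(3)] that by blast
  have RG: "R \<subseteq> carrier G" unfolding R_def using pick sub by blast
  have inj: "inj_on (\<lambda>C. SOME x. x \<in> C) (rcosets H)"
  proof (rule inj_onI)
    fix C D assume CD: "C \<in> rcosets H" "D \<in> rcosets H" "(SOME x. x \<in> C) = (SOME x. x \<in> D)"
    hence "C \<inter> D \<noteq> {}" using pick by (metis IntI empty_iff)
    thus "C = D" using rcos_disjoint[OF assms(3)] CD(1,2) by (auto simp: pairwise_def disjnt_def)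
  qed
  have cardR: "card R * card H = card (carrier G)"
    using lagrange[OF assms(3)] card_image[OF inj] by (simp add: R_def Coset.order_def)
  have finR: "finite R" by (rule finite_subset[OF RG assms(2)])
  have surj: "(\<lambda>(r, h). h \<otimes> r) ` (R \<times> H) = carrier G"
  proof
    show "(\<lambda>(r, h). h \<otimes> r) ` (R \<times> H) \<subseteq> carrier G" using RG H.subset by auto
    show "carrier G \<subseteq> (\<lambda>(r, h). h \<otimes> r) ` (R \<times> H)"
    proof
      fix x assume x: "x \<in> carrier G"
      let ?r = "SOME y. y \<in> H #> x"
      have C: "H #> x \<in> rcosets H" using rcosetsI[OF H.subset x] .
      have r: "?r \<in> H #> x" by (rule pick[OF C])
      have rG: "?r \<in> carrier G" using r sub[OF C] by blast
      have "x \<in> H #> ?r"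
        using repr_independence[OF r x assms(3)] rcos_self[OF x assms(3)] by simp
      then obtain h where "h \<in> H" "x = h \<otimes> ?r" by (auto simp: r_coset_def)
      moreover have "?r \<in> R" unfolding R_def using C by blast
      ultimately show "x \<in> (\<lambda>(r, h). h \<otimes> r) ` (R \<times> H)" by force
    qed
  qed
  have "card ((\<lambda>(r, h). h \<otimes> r) ` (R \<times> H)) = card (R \<times> H)"
    unfolding surj using cardR by (simp add: card_cartesian_product)
  hence "inj_on (\<lambda>(r, h). h \<otimes> r) (R \<times> H)"
    using finR finH by (intro eq_card_imp_inj_on) auto
  hence "bij_betw (\<lambda>(r, h). h \<otimes> r) (R \<times> H) (carrier G)" using surj by (simp add: bij_betw_def)
  with that RG finR cardR show ?thesis by blast
qed

lemma sum_transversal: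
  fixes G (structure)
  assumes "bij_betw (\<lambda>(r, h). h \<otimes> r) (R \<times> H) (carrier G)"
  shows "(\<Sum>g\<in>carrier G. f g) = (\<Sum>r\<in>R. \<Sum>h\<in>H. f (h \<otimes> r))"
  using sum.reindex_bij_betw[OF assms, of f] by (simp add: sum.cartesian_product case_prod_beta)

text \<open>\<open>x\<close> is an eigenvalue of the integer matrix whose entry at
  \<open>(s, t)\<close> counts the \<open>p\<close> with \<open>f s p = t\<close>, and hence a root
  of its monic integral characteristic polynomial.\<close>

lemma algebraic_int_eigenvalue:
  fixes v :: "'s \<Rightarrow> complex"
  assumes fin: "finite S" "finite P" and f: "\<And>s p. s \<in> S \<Longrightarrow> p \<in> P \<Longrightarrow> f s p \<in> S"
    and eig: "\<And>s. s \<in> S \<Longrightarrow> x * v s = (\<Sum>p\<in>P. v (f s p))"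
    and s0: "s0 \<in> S" "v s0 \<noteq> 0"
  shows "algebraic_int x"
proof -
  define N where "N = card S"
  obtain b where b: "bij_betw b {..<N} S"
    using ex_bij_betw_nat_finite[OF fin(1)] by (auto simp: N_def atLeast0LessThan)
  define A :: "int mat" where "A = mat N N (\<lambda>(i, j). int (card {p \<in> P. f (b i) p = b j}))"
  have A: "A \<in> carrier_mat N N" by (simp add: A_def)
  let ?A = "map_mat of_int A :: complex mat"
  have A': "?A \<in> carrier_mat N N" using A by simp
  define w where "w = vec N (\<lambda>i. v (b i))"
  have bS: "b i \<in> S" if "i < N" for i using b that by (auto simp: bij_betw_def)
  have "?A *\<^sub>v w = x \<cdot>\<^sub>v w"
  proof (rule eq_vecI)
    fix i assume "i < dim_vec (x \<cdot>\<^sub>v w)"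
    hence i: "i < N" by (simp add: w_def)
    have "(?A *\<^sub>v w) $ i = (\<Sum>j<N. of_nat (card {p \<in> P. f (b i) p = b j}) * v (b j))"
      using i by (auto simp: scalar_prod_def A_def w_def atLeast0LessThan intro!: sum.cong)
    also have "\<dots> = (\<Sum>t\<in>S. of_nat (card {p \<in> P. f (b i) p = t}) * v t)"
      using sum.reindex_bij_betw[OF b, of "\<lambda>t. of_nat (card {p \<in> P. f (b i) p = t}) * v t"] by simp
    also have "\<dots> = (\<Sum>t\<in>S. \<Sum>p\<in>{p \<in> P. f (b i) p = t}. v (f (b i) p))"
      by (intro sum.cong refl) simp
    also have "\<dots> = (\<Sum>p\<in>P. v (f (b i) p))"
      by (rule sum.group) (use fin f bS[OF i] in auto)
    also have "\<dots> = (x \<cdot>\<^sub>v w) $ i" using eig[OF bS[OF i]] i by (simp add: w_def)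
    finally show "(?A *\<^sub>v w) $ i = (x \<cdot>\<^sub>v w) $ i" .
  qed (simp add: A_def w_def)
  moreover have "w \<noteq> 0\<^sub>v N"
  proof
    assume w0: "w = 0\<^sub>v N"
    obtain i where "i < N" "b i = s0" using b s0(1) by (auto simp: bij_betw_def)
    thus False using arg_cong[OF w0, of "\<lambda>u. u $ i"] s0(2) by (simp add: w_def)
  qed
  ultimately have "eigenvalue ?A x"
    unfolding eigenvalue_def eigenvector_def using A' by (intro exI[of _ w]) (simp add: w_def)
  hence "poly (char_poly ?A) x = 0" using eigenvalue_root_char_poly[OF A'] by simp
  also have "char_poly ?A = map_poly of_int (char_poly A)"
    by (rule of_int_hom.char_poly_hom[OF A])
  finally show ?thesis
    unfolding algebraic_int_altdef_ipoly using degree_monic_char_poly[OF A] by auto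
qed

text \<open>The sum of \<open>\<chi> (g\<inverse>) \<cdot> \<rho> g\<close> over coset representatives is the scalar \<open>|G : M| / \<chi> 1\<close>, so this
  scalar stabilizes the finitely generated group spanned by the numbers \<open>z \<cdot> \<rho> h $$ (0, 0)\<close> with
  \<open>z\<close> a root of unity.\<close>

lemma irr_degree_dvd_index:
  fixes G (structure)
  assumes \<chi>: "\<chi> \<in> Irr G" and G: "group G" "finite (carrier G)" and M: "subgroup M G"
    and ext: "\<And>m. m \<in> M \<Longrightarrow> cmod (\<chi> m) = cmod (\<chi> \<one>)"
    and n: "\<chi> \<one> = of_nat n" and q: "card (carrier G) = q * card M"
  shows "n dvd q"
proof -
  interpret group G by fact
  interpret M: subgroup M G by fact
  obtain n' \<rho> where r: "irreducible_representation G n' \<rho>" "\<chi> = afforded_char G \<rho>"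
    using Irr_eq_afforded[OF \<chi>] by blast
  note rep = irr_rep_rep[OF r(1)]
  note R = rep_carrier[OF rep G(1)]
  have n': "n' = n" using afforded_char_one[OF rep G(1)] n r(2) by simp
  have npos: "n > 0" using rep_dim_pos[OF rep G(1)] n' by simp
  have finM: "finite M" using G(2) M.subset finite_subset by blast
  have cM: "card M > 0" using finM M.one_closed card_gt_0_iff by blast
  obtain T where T: "T \<subseteq> carrier G" "finite T" "card T * card M = card (carrier G)"
    "bij_betw (\<lambda>(r, h). h \<otimes> r) (T \<times> M) (carrier G)"
    using transversal_exists[OF G M] by blast
  have cT: "card T = q" using T(3) q cM by simp
  \<comment> \<open>Elements of \<open>M\<close> act by scalars; \<open>l\<close> is the linear
    character formed by these scalars.\<close>
  define l where "l = (\<lambda>m. \<chi> m / of_nat n)"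
  have scal: "\<rho> m = l m \<cdot>\<^sub>m 1\<^sub>m n" if m: "m \<in> M" for m
  proof -
    have mG: "m \<in> carrier G" using m M.subset by blast
    have "cmod (mat_trace (\<rho> m)) = real n'" using ext[OF m] n n' mG by (simp add: r(2))
    from rep_scalar_of_norm[OF rep G mG this] show ?thesis using n' mG by (simp add: l_def r(2))
  qed
  have lM: "l m * l (inv m) = 1" if m: "m \<in> M" for m
  proof -
    have mG: "m \<in> carrier G" using m M.subset by blast
    have "\<rho> m * \<rho> (inv m) = (l m * l (inv m)) \<cdot>\<^sub>m 1\<^sub>m n"
      unfolding scal[OF m] scal[OF M.m_inv_closed[OF m]]
      by (subst mult_smult_distrib[of _ n n _ n]) (auto simp: smult_smult_mat mult.commute)
    hence "1\<^sub>m n = (l m * l (inv m)) \<cdot>\<^sub>m 1\<^sub>m n" using rep_inv(1)[OF rep G(1) mG] n' by simp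
    from arg_cong[OF this, of "\<lambda>A. A $$ (0, 0)"] npos show ?thesis by simp
  qed
  have sm: "\<rho> (m \<otimes> g) = l m \<cdot>\<^sub>m \<rho> g" if "m \<in> M" "g \<in> carrier G" for m g
  proof -
    have "\<rho> (m \<otimes> g) = \<rho> m * \<rho> g" using that M.subset by (intro rep_mult[OF rep G(1)]) auto
    also have "\<dots> = l m \<cdot>\<^sub>m (1\<^sub>m n * \<rho> g)"
      unfolding scal[OF that(1)] using R[OF that(2)] n' by (intro mult_smult_assoc_mat) auto
    finally show ?thesis using R[OF that(2)] n' by simp
  qed
  have sm': "\<rho> (g \<otimes> m) = l m \<cdot>\<^sub>m \<rho> g" if "m \<in> M" "g \<in> carrier G" for m g
  proof -
    have "\<rho> (g \<otimes> m) = \<rho> g * \<rho> m" using that M.subset by (intro rep_mult[OF rep G(1)]) auto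
    also have "\<dots> = l m \<cdot>\<^sub>m (\<rho> g * 1\<^sub>m n)"
      unfolding scal[OF that(1)] using R[OF that(2)] n' by (intro mult_smult_distrib) auto
    finally show ?thesis using R[OF that(2)] n' by simp
  qed
  \<comment> \<open>Schur orthogonality read at the matrix entry \<open>(0, 0)\<close>. Within a
    coset of \<open>M\<close> the scalars \<open>l m\<close> and \<open>l (inv m)\<close> cancel, so
    the sum over the group collapses to \<open>card M\<close> times a sum over the
    transversal.\<close>
  have avg: "of_nat q / of_nat n * \<rho> h $$ (0, 0) = (\<Sum>r\<in>T. \<chi> (inv r) * \<rho> (r \<otimes> h) $$ (0, 0))"
    if h: "h \<in> carrier G" for h
  proof -
    let ?E = "unit_mat n n 0 0"
    have E: "?E \<in> carrier_mat n n" by simp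
    have ent: "mat_trace (?E * A) = A $$ (0, 0)" if "A \<in> carrier_mat n n" for A
      using mat_trace_unit_mat_mult[OF that, of 0 0] npos by simp
    have Rn: "\<rho> g \<in> carrier_mat n n" if "g \<in> carrier G" for g using R[OF that] n' by simp
    have hE: "\<rho> h * ?E \<in> carrier_mat n n" by (rule mult_carrier_mat[OF Rn[OF h] E])
    have "of_nat (card (carrier G)) / of_nat n * mat_trace (\<rho> h * ?E * 1\<^sub>m n)
        = (\<Sum>g\<in>carrier G. mat_trace (\<rho> h * ?E * \<rho> g) * mat_trace (1\<^sub>m n * \<rho> (inv g)))"
      using trace_orthogonality_same[OF r(1) G(1), of "\<rho> h * ?E" "1\<^sub>m n"] hE n' by simp
    also have "\<dots> = (\<Sum>g\<in>carrier G. \<chi> (inv g) * \<rho> (g \<otimes> h) $$ (0, 0))"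
    proof (rule sum.cong)
      fix g assume g: "g \<in> carrier G"
      have "mat_trace (\<rho> h * ?E * \<rho> g) = mat_trace (?E * \<rho> g * \<rho> h)"
        using mat_trace_comm[OF Rn[OF h] mult_carrier_mat[OF E Rn[OF g]]]
          assoc_mult_mat[OF Rn[OF h] E Rn[OF g]] by simp
      also have "?E * \<rho> g * \<rho> h = ?E * \<rho> (g \<otimes> h)"
        using assoc_mult_mat[OF E Rn[OF g] Rn[OF h]] rep_mult[OF rep G(1) g h] by simp
      finally have "mat_trace (\<rho> h * ?E * \<rho> g) = \<rho> (g \<otimes> h) $$ (0, 0)"
        using ent Rn g h by simp
      moreover have "mat_trace (1\<^sub>m n * \<rho> (inv g)) = \<chi> (inv g)"
        using Rn[of "inv g"] g by (simp add: r(2))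
      ultimately show "mat_trace (\<rho> h * ?E * \<rho> g) * mat_trace (1\<^sub>m n * \<rho> (inv g))
          = \<chi> (inv g) * \<rho> (g \<otimes> h) $$ (0, 0)" by simp
    qed simp
    also have "\<dots> = (\<Sum>r\<in>T. \<Sum>m\<in>M. \<chi> (inv (m \<otimes> r)) * \<rho> (m \<otimes> r \<otimes> h) $$ (0, 0))"
      by (rule sum_transversal[OF T(4)])
    also have "\<dots> = (\<Sum>r\<in>T. \<Sum>m\<in>M. \<chi> (inv r) * \<rho> (r \<otimes> h) $$ (0, 0))"
    proof (intro sum.cong refl)
      fix r m assume rm: "r \<in> T" "m \<in> M"
      have rG: "r \<in> carrier G" and mG: "m \<in> carrier G" using rm T(1) M.subset by auto
      have "\<chi> (inv (m \<otimes> r)) = mat_trace (\<rho> (inv r \<otimes> inv m))"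
        using rG mG by (simp add: r(2) inv_mult_group)
      also have "\<dots> = l (inv m) * \<chi> (inv r)"
        unfolding sm'[OF M.m_inv_closed[OF rm(2)] inv_closed[OF rG]]
        using Rn[of "inv r"] rG by (simp add: r(2))
      finally have 1: "\<chi> (inv (m \<otimes> r)) = l (inv m) * \<chi> (inv r)" .
      have rh: "r \<otimes> h \<in> carrier G" using rG h by simp
      have "\<rho> (m \<otimes> r \<otimes> h) = l m \<cdot>\<^sub>m \<rho> (r \<otimes> h)"
        using sm[OF rm(2) rh] rG mG h by (simp add: m_assoc)
      hence 2: "\<rho> (m \<otimes> r \<otimes> h) $$ (0, 0) = l m * \<rho> (r \<otimes> h) $$ (0, 0)"
        using Rn[OF rh] npos by simp
      have "\<chi> (inv (m \<otimes> r)) * \<rho> (m \<otimes> r \<otimes> h) $$ (0, 0)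
          = (l m * l (inv m)) * (\<chi> (inv r) * \<rho> (r \<otimes> h) $$ (0, 0))"
        unfolding 1 2 by simp
      thus "\<chi> (inv (m \<otimes> r)) * \<rho> (m \<otimes> r \<otimes> h) $$ (0, 0) = \<chi> (inv r) * \<rho> (r \<otimes> h) $$ (0, 0)"
        unfolding lM[OF rm(2)] by simp
    qed
    also have "\<dots> = of_nat (card M) * (\<Sum>r\<in>T. \<chi> (inv r) * \<rho> (r \<otimes> h) $$ (0, 0))"
      by (simp add: sum_distrib_left)
    also have "mat_trace (\<rho> h * ?E * 1\<^sub>m n) = \<rho> h $$ (0, 0)"
      using mat_trace_comm[OF Rn[OF h] E] ent[OF Rn[OF h]] right_mult_one_mat[OF hE] by simp
    finally have "of_nat (card M) * (of_nat q / of_nat n * \<rho> h $$ (0, 0))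
        = of_nat (card M) * (\<Sum>r\<in>T. \<chi> (inv r) * \<rho> (r \<otimes> h) $$ (0, 0))"
      using q by (simp add: mult_ac)
    thus ?thesis using cM by (simp only: mult_left_cancel of_nat_eq_0_iff)
  qed
  have "\<forall>r. \<exists>e :: nat \<Rightarrow> complex. r \<in> T \<longrightarrow> \<chi> (inv r) = (\<Sum>i<n. e i) \<and> (\<forall>i<n. e i ^ card (carrier G) = 1)"
  proof
    fix r
    show "\<exists>e :: nat \<Rightarrow> complex. r \<in> T \<longrightarrow> \<chi> (inv r) = (\<Sum>i<n. e i) \<and> (\<forall>i<n. e i ^ card (carrier G) = 1)"
    proof (cases "r \<in> T")
      case True
      hence ir: "inv r \<in> carrier G" using T(1) by auto
      obtain e :: "nat \<Rightarrow> complex" where e: "\<And>k::nat. mat_trace (\<rho> (inv r [^] k)) = (\<Sum>i<n'. e i ^ k)"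
        "\<And>i. i < n' \<Longrightarrow> e i ^ card (carrier G) = 1"
        using rep_eigenvalues[OF rep G ir] by metis
      have "\<chi> (inv r) = (\<Sum>i<n. e i)" using e(1)[of 1] ir n' by (simp add: r(2))
      thus ?thesis using e(2) n' by blast
    qed simp
  qed
  then obtain e :: "'a \<Rightarrow> nat \<Rightarrow> complex" where
    e: "\<And>r. r \<in> T \<Longrightarrow> \<chi> (inv r) = (\<Sum>i<n. e r i)" "\<And>r i. r \<in> T \<Longrightarrow> i < n \<Longrightarrow> e r i ^ card (carrier G) = 1"
    by metis
  \<comment> \<open>The roots of unity absorb the eigenvalues \<open>e r i\<close>, so that
    \<open>U \<times> carrier G\<close> is a finite index set stable under the moves.\<close>
  define U where "U = {z :: complex. z ^ card (carrier G) = 1}"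
  have "card (carrier G) > 0" using G(2) one_closed card_gt_0_iff by blast
  hence finU: "finite U" unfolding U_def by (intro finite_roots_unity) simp
  \<comment> \<open>The move \<open>(r, i)\<close> comes from expanding
    \<open>\<chi> (inv r)\<close> into its eigenvalues; at the start \<open>(1, \<one>)\<close> the
    vector is the entry \<open>(0, 0)\<close> of the identity matrix, which is nonzero.\<close>
  have "algebraic_int (of_nat q / of_nat n :: complex)"
  proof (rule algebraic_int_eigenvalue[where S = "U \<times> carrier G" and P = "T \<times> {..<n}"
        and v = "\<lambda>(z, h). z * \<rho> h $$ (0, 0)" and f = "\<lambda>(z, h) (r, i). (e r i * z, r \<otimes> h)" and ?s0.0 = "(1, \<one>)"])
    show "finite (U \<times> carrier G)" "finite (T \<times> {..<n})" using finU G(2) T(2) by auto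
    show "(case s of (z, h) \<Rightarrow> \<lambda>(r, i). (e r i * z, r \<otimes> h)) p \<in> U \<times> carrier G"
      if "s \<in> U \<times> carrier G" "p \<in> T \<times> {..<n}" for s p
      using that e(2) T(1) by (auto simp: U_def power_mult_distrib)
    show "(1, \<one>) \<in> U \<times> carrier G" by (simp add: U_def)
    show "(case (1, \<one>) of (z, h) \<Rightarrow> z * \<rho> h $$ (0, 0)) \<noteq> 0" using rep_one[OF rep G(1)] npos n' by simp
    show "of_nat q / of_nat n * (case s of (z, h) \<Rightarrow> z * \<rho> h $$ (0, 0))
        = (\<Sum>p\<in>T \<times> {..<n}. case (case s of (z, h) \<Rightarrow> \<lambda>(r, i). (e r i * z, r \<otimes> h)) p of (z, h) \<Rightarrow> z * \<rho> h $$ (0, 0))"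
      if "s \<in> U \<times> carrier G" for s
    proof -
      obtain z h where s: "s = (z, h)" "h \<in> carrier G" using \<open>s \<in> U \<times> carrier G\<close> by auto
      have "of_nat q / of_nat n * (z * \<rho> h $$ (0, 0)) = z * (\<Sum>r\<in>T. \<chi> (inv r) * \<rho> (r \<otimes> h) $$ (0, 0))"
        using avg[OF s(2)] by (metis mult.left_commute)
      also have "\<dots> = (\<Sum>r\<in>T. \<Sum>i<n. e r i * z * \<rho> (r \<otimes> h) $$ (0, 0))"
        unfolding sum_distrib_left by (intro sum.cong refl) (simp add: e(1) sum_distrib_left sum_distrib_right mult_ac)
      also have "\<dots> = (\<Sum>p\<in>T \<times> {..<n}. case (case s of (z, h) \<Rightarrow> \<lambda>(r, i). (e r i * z, r \<otimes> h)) p of (z, h) \<Rightarrow> z * \<rho> h $$ (0, 0))"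
        unfolding sum.cartesian_product by (intro sum.cong refl) (auto simp: s)
      finally show ?thesis by (simp add: s)
    qed
  qed
  hence "(of_nat q / of_nat n :: complex) \<in> \<int>"
    by (rule rational_algebraic_int_is_int) auto
  then obtain z :: int where "of_nat q / of_nat n = (of_int z :: complex)" by (auto elim: Ints_cases)
  hence "(of_nat q :: complex) = of_int z * of_nat n" using npos by (simp add: field_simps)
  hence "(of_int (int q) :: complex) = of_int (z * int n)" by simp
  hence "int q = z * int n" by (simp only: of_int_eq_iff)
  thus ?thesis by (metis dvd_triv_right int_dvd_int_iff)
qed

section \<open>Induced characters\<close>

text \<open>An index of a block matrix with blocks of size \<open>d\<close> is read as a pair of
  block number and position in the block.\<close>

lemma sum_div_mod:
  fixes F :: "nat \<Rightarrow> nat \<Rightarrow> complex"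
  assumes "d > 0"
  shows "(\<Sum>a<q * d. F (a div d) (a mod d)) = (\<Sum>i<q. \<Sum>s<d. F i s)"
proof -
  have less: "i * d + s < q * d" if "i < q" "s < d" for i s
  proof -
    have "i * d + s < Suc i * d" using that by simp
    also have "Suc i * d \<le> q * d" using that by (intro mult_le_mono1) simp
    finally show ?thesis .
  qed
  have "(\<Sum>i<q. \<Sum>s<d. F i s) = (\<Sum>(i, s)\<in>{..<q} \<times> {..<d}. F i s)" by (rule sum.cartesian_product)
  also have "\<dots> = (\<Sum>a<q * d. F (a div d) (a mod d))"
    by (rule sum.reindex_bij_witness[where i = "\<lambda>a. (a div d, a mod d)" and j = "\<lambda>(i, s). i * d + s"])
      (use assms less in \<open>auto simp: less_mult_imp_div_less\<close>)
  finally show ?thesis by simp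
qed

text \<open>\<open>\<psi>\<close> vanishes off \<open>H\<close> and is invariant under conjugation
  by \<open>H\<close>, so the sum defining \<open>induced\<close> is constant on right cosets and
  the division by \<open>card H\<close> leaves one term per coset.\<close>

lemma induced_transversal:
  fixes G (structure)
  assumes G: "group G" "finite (carrier G)" and H: "subgroup H G"
    and \<psi>: "\<psi> \<in> characters (G\<lparr>carrier := H\<rparr>)"
    and T: "T \<subseteq> carrier G" "bij_betw (\<lambda>(r, h). h \<otimes> r) (T \<times> H) (carrier G)" and g: "g \<in> carrier G"
  shows "induced G H \<psi> g = (\<Sum>r\<in>T. \<psi> (r \<otimes> g \<otimes> inv r))"
proof -
  interpret group G by fact
  interpret H: subgroup H G by fact
  have gr: "group (G\<lparr>carrier := H\<rparr>)" by (rule H.subgroup_is_group[OF G(1)])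
  have finH: "finite H" using G(2) H.subset finite_subset by blast
  have cH: "card H > 0" using finH H.one_closed card_gt_0_iff by blast
  have "(\<Sum>x\<in>{x \<in> carrier G. x \<otimes> g \<otimes> inv x \<in> H}. \<psi> (x \<otimes> g \<otimes> inv x)) = (\<Sum>x\<in>carrier G. \<psi> (x \<otimes> g \<otimes> inv x))"
    using G(2) char_outside[OF \<psi>] by (intro sum.mono_neutral_left) auto
  also have "\<dots> = (\<Sum>r\<in>T. \<Sum>h\<in>H. \<psi> (h \<otimes> r \<otimes> g \<otimes> inv (h \<otimes> r)))"
    by (rule sum_transversal[OF T(2)])
  also have "\<dots> = (\<Sum>r\<in>T. \<Sum>h\<in>H. \<psi> (r \<otimes> g \<otimes> inv r))"
  proof (intro sum.cong refl)
    fix r h assume rh: "r \<in> T" "h \<in> H"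
    have rG: "r \<in> carrier G" and hG: "h \<in> carrier G" using rh T(1) H.subset by auto
    let ?y = "r \<otimes> g \<otimes> inv r"
    have yG: "?y \<in> carrier G" using rG g by simp
    have eq: "h \<otimes> r \<otimes> g \<otimes> inv (h \<otimes> r) = h \<otimes> ?y \<otimes> inv h"
      using rG hG g by (simp add: inv_mult_group m_assoc)
    show "\<psi> (h \<otimes> r \<otimes> g \<otimes> inv (h \<otimes> r)) = \<psi> ?y"
    proof (cases "?y \<in> H")
      case True
      thus ?thesis unfolding eq
        using char_conj[OF \<psi> gr, of h ?y] rh(2) m_inv_consistent[OF H rh(2)] by simp
    next
      case False
      have "h \<otimes> ?y \<otimes> inv h \<notin> H"
      proof
        assume a: "h \<otimes> ?y \<otimes> inv h \<in> H"
        have "inv h \<otimes> (h \<otimes> ?y \<otimes> inv h) \<otimes> h \<in> H"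
          by (rule H.m_closed[OF H.m_closed[OF H.m_inv_closed[OF rh(2)] a] rh(2)])
        moreover have "inv h \<otimes> (h \<otimes> ?y \<otimes> inv h) \<otimes> h = inv h \<otimes> (h \<otimes> ?y)"
          using hG yG m_assoc[of "h \<otimes> ?y" "inv h" h] m_assoc[of "inv h" "h \<otimes> ?y \<otimes> inv h" h] by simp
        ultimately show False using False inv_cancel(2)[OF hG yG] by simp
      qed
      thus ?thesis unfolding eq using char_outside[OF \<psi>] False by simp
    qed
  qed
  also have "\<dots> = of_nat (card H) * (\<Sum>r\<in>T. \<psi> (r \<otimes> g \<otimes> inv r))"
    by (simp add: sum_distrib_left)
  finally show ?thesis unfolding induced_def using g cH by simp
qed

text \<open>The representation consists of block matrices: with \<open>\<sigma>0\<close> extending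
  \<open>\<sigma>\<close> by zero, the block \<open>(i, j)\<close> at \<open>g\<close> is
  \<open>\<sigma>0 (b i \<otimes> g \<otimes> inv (b j))\<close>. Each block row has exactly one
  block with argument in \<open>H\<close>, so these matrices multiply like the group.\<close>

lemma induced_character:
  fixes G (structure)
  assumes G: "group G" "finite (carrier G)" and H: "subgroup H G"
    and \<psi>: "\<psi> \<in> characters (G\<lparr>carrier := H\<rparr>)"
  shows "induced G H \<psi> \<in> characters G"
proof -
  interpret group G by fact
  interpret H: subgroup H G by fact
  let ?H = "G\<lparr>carrier := H\<rparr>"
  have gr: "group ?H" by (rule H.subgroup_is_group[OF G(1)])
  obtain T where T: "T \<subseteq> carrier G" "finite T" "card T * card H = card (carrier G)"
    "bij_betw (\<lambda>(r, h). h \<otimes> r) (T \<times> H) (carrier G)"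
    using transversal_exists[OF G H] by blast
  obtain d \<sigma> where s: "representation ?H d \<sigma>" "\<psi> = afforded_char ?H \<sigma>"
    using characters_eq_afforded[OF \<psi>] by blast
  note d = rep_dim_pos[OF s(1) gr]
  have S: "\<sigma> x \<in> carrier_mat d d" if "x \<in> H" for x using rep_carrier[OF s(1) gr] that by simp
  define q where "q = card T"
  obtain b where b: "bij_betw b {..<q} T"
    using ex_bij_betw_nat_finite[OF T(2)] by (auto simp: q_def atLeast0LessThan)
  have bT: "b i \<in> T" if "i < q" for i using b that by (auto simp: bij_betw_def)
  have bG: "b i \<in> carrier G" if "i < q" for i using bT[OF that] T(1) by blast
  define \<sigma>0 where "\<sigma>0 = (\<lambda>y. if y \<in> H then \<sigma> y else 0\<^sub>m d d)"
  have S0: "\<sigma>0 y \<in> carrier_mat d d" for y using S by (simp add: \<sigma>0_def)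
  have tr0: "mat_trace (\<sigma>0 y) = \<psi> y" for y
    by (simp add: \<sigma>0_def s(2) afforded_char_def)
  define M where "M = (\<lambda>g. mat (q * d) (q * d)
    (\<lambda>(x, y). \<sigma>0 (b (x div d) \<otimes> g \<otimes> inv (b (y div d))) $$ (x mod d, y mod d)))"
  have Mc: "M g \<in> carrier_mat (q * d) (q * d)" for g by (simp add: M_def)
  have idx: "x div d < q" "x mod d < d" if "x < q * d" for x
    using that d by (auto simp: less_mult_imp_div_less)
  have "carrier G \<noteq> {}" using one_closed by blast
  hence "T \<noteq> {}" using T(4) by (auto simp: bij_betw_def)
  hence q: "q > 0" using T(2) by (simp add: q_def card_gt_0_iff)
  have uniq: "i = j" if ij: "i < q" "j < q" and h: "a \<otimes> inv (b i) \<in> H" "a \<otimes> inv (b j) \<in> H"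
    and a: "a \<in> carrier G" for a i j
  proof -
    have "(a \<otimes> inv (b i)) \<otimes> b i = a" "(a \<otimes> inv (b j)) \<otimes> b j = a"
      using a bG ij by (simp_all add: m_assoc)
    hence "(b i, a \<otimes> inv (b i)) = (b j, a \<otimes> inv (b j))"
      using h bT ij T(4) by (intro inj_onD[of "\<lambda>(r, h). h \<otimes> r" "T \<times> H"]) (auto simp: bij_betw_def)
    thus ?thesis using b ij by (auto simp: bij_betw_def inj_on_def)
  qed
  have ex: "\<exists>i<q. a \<otimes> inv (b i) \<in> H" if a: "a \<in> carrier G" for a
  proof -
    have "a \<in> (\<lambda>(r, h). h \<otimes> r) ` (T \<times> H)" using T(4) a by (simp add: bij_betw_def)
    then obtain r h where rh: "r \<in> T" "h \<in> H" "a = h \<otimes> r" by auto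
    obtain i where i: "i < q" "b i = r" using b rh(1) by (auto simp: bij_betw_def)
    have "a \<otimes> inv (b i) = h" using rh i T(1) H.subset by (auto simp: m_assoc)
    thus ?thesis using i rh by blast
  qed
  have "representation G (q * d) M"
  proof (rule representationI[OF G(1)])
    show "q * d > 0" using q d by simp
    show "M g \<in> carrier_mat (q * d) (q * d)" for g by (rule Mc)
    show "M \<one> = 1\<^sub>m (q * d)"
    proof (rule eq_matI)
      fix x y assume "x < dim_row (1\<^sub>m (q * d) :: complex mat)" "y < dim_col (1\<^sub>m (q * d) :: complex mat)"
      hence xy: "x < q * d" "y < q * d" by auto
      note i = idx[OF xy(1)] and j = idx[OF xy(2)]
      have e: "M \<one> $$ (x, y) = \<sigma>0 (b (x div d) \<otimes> inv (b (y div d))) $$ (x mod d, y mod d)"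
        using xy bG[OF i(1)] by (simp add: M_def)
      show "M \<one> $$ (x, y) = 1\<^sub>m (q * d) $$ (x, y)"
      proof (cases "x div d = y div d")
        case True
        have "\<sigma>0 (b (x div d) \<otimes> inv (b (y div d))) = 1\<^sub>m d"
          using bG[OF j(1)] rep_one[OF s(1) gr] H.one_closed by (simp add: True \<sigma>0_def)
        moreover have "x = y \<longleftrightarrow> x mod d = y mod d" using True by (metis div_mult_mod_eq)
        ultimately show ?thesis unfolding e using i j xy by simp
      next
        case False
        have "b (x div d) \<otimes> inv (b (y div d)) \<notin> H"
          using uniq[OF i(1) j(1), of "b (x div d)"] False bG[OF i(1)] H.one_closed by auto
        thus ?thesis unfolding e using i j xy False by (auto simp: \<sigma>0_def)
      qed
    qed (simp_all add: M_def)
    fix g h assume gh: "g \<in> carrier G" "h \<in> carrier G"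
    show "M (g \<otimes> h) = M g * M h"
    proof (rule eq_matI)
      fix x y assume "x < dim_row (M g * M h)" "y < dim_col (M g * M h)"
      hence xy: "x < q * d" "y < q * d" using carrier_matD[OF Mc] by simp_all
      note i = idx[OF xy(1)] and j = idx[OF xy(2)]
      define A where "A = b (x div d)"
      define C where "C = b (y div d)"
      have AG: "A \<in> carrier G" and CG: "C \<in> carrier G" using bG i j by (auto simp: A_def C_def)
      have AgG: "A \<otimes> g \<in> carrier G" using AG gh by simp
      let ?P = "\<lambda>k. \<sigma>0 (A \<otimes> g \<otimes> inv (b k)) * \<sigma>0 (b k \<otimes> h \<otimes> inv C)"
      have P: "?P k \<in> carrier_mat d d" for k using S0 by (intro mult_carrier_mat)
      have "(M g * M h) $$ (x, y) = (\<Sum>z<q * d. M g $$ (x, z) * M h $$ (z, y))"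
        by (rule index_mult_mat_sum[OF Mc Mc xy])
      also have "\<dots> = (\<Sum>z<q * d. \<sigma>0 (A \<otimes> g \<otimes> inv (b (z div d))) $$ (x mod d, z mod d)
          * \<sigma>0 (b (z div d) \<otimes> h \<otimes> inv C) $$ (z mod d, y mod d))"
        using xy by (intro sum.cong) (auto simp: M_def A_def C_def)
      also have "\<dots> = (\<Sum>k<q. \<Sum>t<d. \<sigma>0 (A \<otimes> g \<otimes> inv (b k)) $$ (x mod d, t)
          * \<sigma>0 (b k \<otimes> h \<otimes> inv C) $$ (t, y mod d))"
        by (rule sum_div_mod[OF d])
      also have "\<dots> = (\<Sum>k<q. ?P k $$ (x mod d, y mod d))"
        by (intro sum.cong refl index_mult_mat_sum[OF S0 S0 i(2) j(2), symmetric])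
      \<comment> \<open>Exactly one coset \<open>k\<close> has
        \<open>A \<otimes> g \<otimes> inv (b k)\<close> in \<open>H\<close>; the other summands
        vanish. For this \<open>k\<close> the argument of the second factor lies in \<open>H\<close>
        if and only if that of the product does.\<close>
      also have "\<dots> = \<sigma>0 (A \<otimes> (g \<otimes> h) \<otimes> inv C) $$ (x mod d, y mod d)"
      proof -
        obtain k where k: "k < q" "A \<otimes> g \<otimes> inv (b k) \<in> H" using ex[OF AgG] by blast
        have "?P l $$ (x mod d, y mod d) = 0" if l: "l < q" "l \<noteq> k" for l
        proof -
          have "A \<otimes> g \<otimes> inv (b l) \<notin> H" using uniq[OF l(1) k(1) _ k(2) AgG] l(2) by blast
          hence z: "\<sigma>0 (A \<otimes> g \<otimes> inv (b l)) = 0\<^sub>m d d" by (simp add: \<sigma>0_def)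
          have "?P l = 0\<^sub>m d d" unfolding z by (rule left_mult_zero_mat[OF S0])
          thus ?thesis using i j by simp
        qed
        hence "(\<Sum>l<q. ?P l $$ (x mod d, y mod d)) = (\<Sum>l\<in>{k}. ?P l $$ (x mod d, y mod d))"
          using k(1) by (intro sum.mono_neutral_right) auto
        also have "\<dots> = ?P k $$ (x mod d, y mod d)" by simp
        also have "?P k = \<sigma>0 (A \<otimes> (g \<otimes> h) \<otimes> inv C)"
        proof -
          note bk = bG[OF k(1)]
          have prod: "(A \<otimes> g \<otimes> inv (b k)) \<otimes> (b k \<otimes> h \<otimes> inv C) = A \<otimes> (g \<otimes> h) \<otimes> inv C"
            using AG CG gh bk by (simp add: m_assoc inv_cancel)
          show ?thesis
          proof (cases "b k \<otimes> h \<otimes> inv C \<in> H")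
            case True
            thus ?thesis using k(2) rep_mult[OF s(1) gr, of "A \<otimes> g \<otimes> inv (b k)" "b k \<otimes> h \<otimes> inv C"]
              H.m_closed[OF k(2) True] by (simp add: \<sigma>0_def prod)
          next
            case False
            have "A \<otimes> (g \<otimes> h) \<otimes> inv C \<notin> H"
            proof
              assume a: "A \<otimes> (g \<otimes> h) \<otimes> inv C \<in> H"
              have "inv (A \<otimes> g \<otimes> inv (b k)) \<otimes> ((A \<otimes> g \<otimes> inv (b k)) \<otimes> (b k \<otimes> h \<otimes> inv C)) \<in> H"
                unfolding prod by (rule H.m_closed[OF H.m_inv_closed[OF k(2)] a])
              thus False using False AG CG gh bk by (simp only: inv_cancel(2) m_closed inv_closed)
            qed
            hence z: "\<sigma>0 (b k \<otimes> h \<otimes> inv C) = 0\<^sub>m d d" "\<sigma>0 (A \<otimes> (g \<otimes> h) \<otimes> inv C) = 0\<^sub>m d d"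
              using False by (simp_all add: \<sigma>0_def)
            show ?thesis unfolding z by (rule right_mult_zero_mat[OF S0])
          qed
        qed
        finally show ?thesis .
      qed
      also have "\<dots> = M (g \<otimes> h) $$ (x, y)" using xy by (simp add: M_def A_def C_def)
      finally show "M (g \<otimes> h) $$ (x, y) = (M g * M h) $$ (x, y)" by simp
    qed (simp_all add: carrier_matD[OF Mc])
  qed
  moreover have "induced G H \<psi> = afforded_char G M"
  proof
    fix g
    show "induced G H \<psi> g = afforded_char G M g"
    proof (cases "g \<in> carrier G")
      case True
      have "mat_trace (M g) = (\<Sum>z<q * d. \<sigma>0 (b (z div d) \<otimes> g \<otimes> inv (b (z div d))) $$ (z mod d, z mod d))"
        unfolding mat_trace_def by (rule sum.cong) (auto simp: M_def)
      also have "\<dots> = (\<Sum>k<q. \<Sum>t<d. \<sigma>0 (b k \<otimes> g \<otimes> inv (b k)) $$ (t, t))"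
        by (rule sum_div_mod[OF d])
      also have "\<dots> = (\<Sum>k<q. \<psi> (b k \<otimes> g \<otimes> inv (b k)))"
        using S0 by (intro sum.cong refl) (simp add: mat_trace_def carrier_matD(1)[OF S0] flip: tr0)
      also have "\<dots> = (\<Sum>r\<in>T. \<psi> (r \<otimes> g \<otimes> inv r))"
        by (rule sum.reindex_bij_betw[OF b])
      finally show ?thesis using induced_transversal[OF G H \<psi> T(1,4) True] True by simp
    qed (simp add: induced_def afforded_char_def)
  qed
  ultimately show ?thesis using afforded_charI by metis
qed

section \<open>Partial characters\<close>

lemma pi_number_dvd: "pi_number \<pi> n \<Longrightarrow> m dvd n \<Longrightarrow> pi_number \<pi> m"
  unfolding pi_number_def by (metis dvd_0_left_iff dvd_trans gr0I)

lemma pi_number_mult: "pi_number \<pi> m \<Longrightarrow> pi_number \<pi> n \<Longrightarrow> pi_number \<pi> (m * n)"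
  unfolding pi_number_def by (auto simp: prime_dvd_mult_iff)

lemma pi_number_coprime:
  assumes "pi_number \<pi> m" "pi_number (pi_compl \<pi>) n"
  shows "coprime m n"
proof (rule ccontr)
  assume "\<not> coprime m n"
  hence "gcd m n \<noteq> 1" by (simp add: coprime_iff_gcd_eq_1)
  then obtain p where "prime p" "p dvd gcd m n" using prime_factor_nat by blast
  hence "prime p" "p dvd m" "p dvd n" by simp_all
  thus False using assms by (auto simp: pi_number_def pi_compl_def)
qed

text \<open>Any annihilating exponent that is a \<pi>-number witnesses a \<pi>-element. Such an
  exponent passes to conjugates and subgroups directly, without a comparison of orders.\<close>

lemma (in group) pi_elements_iff:
  assumes "finite (carrier G)"
  shows "g \<in> pi_elements \<pi> G \<longleftrightarrow> g \<in> carrier G \<and> (\<exists>k. pi_number \<pi> k \<and> g [^] k = \<one>)"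
proof (cases "g \<in> carrier G")
  case True
  have "pi_number \<pi> (ord g)" if "pi_number \<pi> k" "g [^] k = \<one>" for k
    using that pow_eq_id[OF True] pi_number_dvd by blast
  thus ?thesis using True pow_ord_eq_1[OF True] unfolding pi_elements_def by blast
qed (simp add: pi_elements_def)

lemma (in group) conj_pow:
  assumes "g \<in> carrier G" "x \<in> carrier G"
  shows "(x \<otimes> g \<otimes> inv x) [^] (k :: nat) = x \<otimes> g [^] k \<otimes> inv x"
proof (induction k)
  case (Suc k)
  have "(x \<otimes> g [^] k \<otimes> inv x) \<otimes> (x \<otimes> g \<otimes> inv x) = x \<otimes> (g [^] k \<otimes> g) \<otimes> inv x"
    using assms by (simp add: m_assoc inv_cancel)
  thus ?case using Suc by simp
qed (use assms in simp)

lemma (in group) pi_elements_conj: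
  assumes "finite (carrier G)" "g \<in> pi_elements \<pi> G" "x \<in> carrier G"
  shows "x \<otimes> g \<otimes> inv x \<in> pi_elements \<pi> G"
proof -
  obtain k where k: "g \<in> carrier G" "pi_number \<pi> k" "g [^] k = \<one>"
    using assms by (auto simp: pi_elements_iff)
  have "(x \<otimes> g \<otimes> inv x) [^] k = \<one>" using k assms by (simp add: conj_pow)
  thus ?thesis using k assms by (auto simp: pi_elements_iff)
qed

lemma (in group) pi_elements_conj_iff:
  assumes "finite (carrier G)" "x \<in> carrier G" "g \<in> carrier G"
  shows "g \<otimes> x \<otimes> inv g \<in> pi_elements \<pi> G \<longleftrightarrow> x \<in> pi_elements \<pi> G"
proof
  assume "g \<otimes> x \<otimes> inv g \<in> pi_elements \<pi> G"
  from pi_elements_conj[OF assms(1) this, of "inv g"] show "x \<in> pi_elements \<pi> G"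
    using assms(2,3) by (simp add: m_assoc inv_cancel)
qed (rule pi_elements_conj[OF assms(1) _ assms(3)])

lemma (in group) pi_elements_subgroup:
  assumes "finite (carrier G)" "subgroup H G"
  shows "pi_elements \<pi> (G\<lparr>carrier := H\<rparr>) = pi_elements \<pi> G \<inter> H"
proof -
  have gr: "group (G\<lparr>carrier := H\<rparr>)" by (rule subgroup.subgroup_is_group[OF assms(2) is_group])
  have fin: "finite (carrier (G\<lparr>carrier := H\<rparr>))"
    using assms(1) subgroup.subset[OF assms(2)] finite_subset by auto
  show ?thesis
    using group.pi_elements_iff[OF gr fin] pi_elements_iff[OF assms(1)] subgroup.subset[OF assms(2)]
    by (auto simp: nat_pow_consistent[symmetric])
qed

lemma (in group) one_pi_element: "finite (carrier G) \<Longrightarrow> \<one> \<in> pi_elements \<pi> G"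
  by (auto simp: pi_elements_iff pi_number_def intro!: exI[of _ 1])

text \<open>Conjugates of \<pi>-elements are \<pi>-elements, so an induced function at a
  \<pi>-element depends only on the \<pi>-elements of \<open>H\<close>.\<close>

lemma induced_cong_on_pi_elements:
  fixes G (structure)
  assumes G: "group G" "finite (carrier G)"
    and eq: "\<And>x. x \<in> H \<Longrightarrow> x \<in> pi_elements \<pi> G \<Longrightarrow> \<phi> x = c * \<psi> x" and g: "g \<in> pi_elements \<pi> G"
  shows "induced G H \<phi> g = c * induced G H \<psi> g"
proof -
  interpret group G by fact
  have "(\<Sum>x\<in>{x \<in> carrier G. x \<otimes> g \<otimes> inv x \<in> H}. \<phi> (x \<otimes> g \<otimes> inv x))
      = (\<Sum>x\<in>{x \<in> carrier G. x \<otimes> g \<otimes> inv x \<in> H}. c * \<psi> (x \<otimes> g \<otimes> inv x))"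
    using eq pi_elements_conj[OF G(2) g] by (intro sum.cong refl) auto
  thus ?thesis unfolding induced_def by (simp add: sum_distrib_left)
qed

text \<open>On \<pi>-elements the induced character is \<open>e\<close> copies of the one induced
  from \<open>\<kappa>\<close>, a decomposition that \<open>I_pi\<close> excludes unless
  \<open>e = 1\<close>.\<close>

lemma induced_multiple_reducible:
  fixes G (structure)
  assumes G: "group G" "finite (carrier G)" and H: "subgroup H G"
    and \<kappa>: "\<kappa> \<in> characters (G\<lparr>carrier := H\<rparr>)"
    and eq: "\<And>x. x \<in> H \<Longrightarrow> x \<in> pi_elements \<pi> G \<Longrightarrow> \<tau> x = of_nat e * \<kappa> x"
    and I: "restrict_to (pi_elements \<pi> G) (induced G H \<tau>) \<in> I_pi \<pi> G" and e: "e > 0"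
  shows "e = 1"
proof (rule ccontr)
  interpret group G by fact
  assume e1: "e \<noteq> 1"
  let ?\<phi> = "restrict_to (pi_elements \<pi> G) (induced G H \<tau>)"
  let ?\<psi> = "restrict_to (pi_elements \<pi> G) (induced G H \<kappa>)"
  have ind: "induced G H \<kappa> \<in> characters G" by (rule induced_character[OF G H \<kappa>])
  have eq': "?\<phi> g = of_nat e * ?\<psi> g" for g
    using induced_cong_on_pi_elements[OF G eq, where g = g] by (simp add: restrict_to_def)
  obtain n where n: "n > 0" "induced G H \<kappa> \<one> = of_nat n" using char_degree[OF ind G(1)] .
  have "?\<psi> \<one> = of_nat n" using one_pi_element[OF G(2)] n by (simp add: restrict_to_def)
  \<comment> \<open>\<open>I_pi\<close> forbids only sums of other partial characters, so the copies
    must differ from their sum; the positive degree shows this for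
    \<open>e \<noteq> 1\<close>.\<close>
  hence "?\<psi> \<one> \<noteq> of_nat e * ?\<psi> \<one>" using n(1) e1 by simp
  hence neq: "?\<psi> \<noteq> ?\<phi>" using eq'[of \<one>] by metis
  have "?\<phi> = (\<lambda>g. \<Sum>\<psi>\<leftarrow>replicate e ?\<psi>. \<psi> g)"
    using eq' by (auto simp: sum_list_replicate)
  moreover have "set (replicate e ?\<psi>) \<subseteq> partial_chars \<pi> G - {?\<phi>}"
    using neq ind by (auto simp: partial_chars_def)
  ultimately show False using I unfolding I_pi_def by blast
qed

section \<open>Extending an invariant character\<close>

text \<open>An invertible idempotent is the identity, so a right inverse at \<open>\<one>\<close>
  replaces the condition there. This suits rescaled projective representations, whose value at
  \<open>\<one>\<close> is not visible.\<close>

lemma representationI_invertible: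
  fixes G (structure)
  assumes G: "group G" and n: "n > 0" and c: "\<And>g. g \<in> carrier G \<Longrightarrow> f g \<in> carrier_mat n n"
    and inv: "Y \<in> carrier_mat n n" "f \<one> * Y = 1\<^sub>m n"
    and mult: "\<And>g h. g \<in> carrier G \<Longrightarrow> h \<in> carrier G \<Longrightarrow> f (g \<otimes> h) = f g * f h"
  shows "representation G n f"
proof (rule representationI[OF G n c _ mult])
  interpret group G by fact
  have c1: "f \<one> \<in> carrier_mat n n" by (rule c[OF one_closed])
  have "f \<one> = f \<one> * (f \<one> * Y)" using inv c1 by simp
  also have "\<dots> = f \<one> * f \<one> * Y" by (rule assoc_mult_mat[OF c1 c1 inv(1), symmetric])
  also have "f \<one> * f \<one> = f \<one>" using mult[OF one_closed one_closed] by simp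
  finally show "f \<one> = 1\<^sub>m n" using inv(2) by simp
qed

text \<open>If the averages of all matrix units vanished, the sum of the products
  \<open>mat_trace (\<rho>' g) * mat_trace (\<rho> (inv g))\<close> would be zero, but it is the
  group order. A nonzero average is the intertwiner.\<close>

lemma same_char_intertwiner:
  assumes irr: "irreducible_representation G n \<rho>" and irr': "irreducible_representation G n \<rho>'"
    and G: "group G" "finite (carrier G)"
    and eq: "\<And>g. g \<in> carrier G \<Longrightarrow> mat_trace (\<rho>' g) = mat_trace (\<rho> g)"
  shows "\<exists>X Y. X \<in> carrier_mat n n \<and> Y \<in> carrier_mat n n \<and> X * Y = 1\<^sub>m n \<and> Y * X = 1\<^sub>m n
    \<and> (\<forall>g\<in>carrier G. X * \<rho> g = \<rho>' g * X)"
proof -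
  note rep = irr_rep_rep[OF irr] and rep' = irr_rep_rep[OF irr']
  note n = rep_dim_pos[OF rep G(1)]
  have one: "1\<^sub>m n \<in> carrier_mat n n" by simp
  have card: "card (carrier G) > 0"
    using G group.is_monoid monoid.one_closed card_gt_0_iff by fastforce
  have "\<exists>i j. i < n \<and> j < n \<and> rep_average G n n \<rho>' \<rho> (unit_mat n n i j) \<noteq> 0\<^sub>m n n"
  proof (rule ccontr)
    assume "\<not> ?thesis"
    hence z: "rep_average G n n \<rho>' \<rho> (unit_mat n n i j) = 0\<^sub>m n n" if "i < n" "j < n" for i j
      using that by blast
    have "(\<Sum>g\<in>carrier G. mat_trace (1\<^sub>m n * \<rho>' g) * mat_trace (1\<^sub>m n * \<rho> (inv\<^bsub>G\<^esub> g))) = 0"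
      unfolding trace_product_sum[OF rep rep' G(1) one one] by (simp add: z)
    moreover have "(\<Sum>g\<in>carrier G. mat_trace (1\<^sub>m n * \<rho>' g) * mat_trace (1\<^sub>m n * \<rho> (inv\<^bsub>G\<^esub> g)))
        = (\<Sum>g\<in>carrier G. mat_trace (1\<^sub>m n * \<rho> g) * mat_trace (1\<^sub>m n * \<rho> (inv\<^bsub>G\<^esub> g)))"
    proof (rule sum.cong)
      fix g assume g: "g \<in> carrier G"
      show "mat_trace (1\<^sub>m n * \<rho>' g) * mat_trace (1\<^sub>m n * \<rho> (inv\<^bsub>G\<^esub> g))
          = mat_trace (1\<^sub>m n * \<rho> g) * mat_trace (1\<^sub>m n * \<rho> (inv\<^bsub>G\<^esub> g))"
        using left_mult_one_mat[OF rep_carrier[OF rep G(1) g]] left_mult_one_mat[OF rep_carrier[OF rep' G(1) g]]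
          eq[OF g] by simp
    qed simp
    moreover have "\<dots> = of_nat (card (carrier G))"
      unfolding trace_orthogonality_same[OF irr G(1) one one] using n by simp
    ultimately show False using card by simp
  qed
  then obtain i j where nz: "rep_average G n n \<rho>' \<rho> (unit_mat n n i j) \<noteq> 0\<^sub>m n n" by blast
  let ?X = "rep_average G n n \<rho>' \<rho> (unit_mat n n i j)"
  have comm: "?X * \<rho> g = \<rho>' g * ?X" if "g \<in> carrier G" for g
    by (rule rep_average_intertwines[OF rep rep' G(1) unit_mat_carrier that])
  obtain Y where Y: "Y \<in> carrier_mat n n" "?X * Y = 1\<^sub>m n" "Y * ?X = 1\<^sub>m n"
    by (rule schur_intertwiner[OF irr irr' G(1) rep_average_carrier comm nz])
  show ?thesis
    by (rule exI[of _ ?X], rule exI[of _ Y]) (simp add: Y comm)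
qed

lemma mat_trace_mult_mat_sum:
  assumes "X \<in> carrier_mat n n" "\<And>s. s \<in> S \<Longrightarrow> F s \<in> carrier_mat n n"
  shows "mat_trace (X * mat_sum n n S F) = (\<Sum>s\<in>S. mat_trace (X * F s))"
    and "mat_trace (mat_sum n n S F * X) = (\<Sum>s\<in>S. mat_trace (F s * X))"
  using assms by (simp_all add: mult_mat_sum[of X n n] mat_sum_mult[of X n n] mat_trace_mat_sum mult_carrier_mat[of _ n n _ n])

text \<open>The setting of a representation whose restriction to \<open>M\<close> is a multiple of
  \<open>\<sigma>\<close>, expressed by traces alone. The multiplicity \<open>a\<close> is a complex
  number because it arises as a quotient of two natural numbers.\<close>

locale homogeneous_restriction = normal M L for M and L (structure) +
  fixes \<rho> \<sigma> :: "'a \<Rightarrow> complex mat" and n d :: nat and a :: complex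
  assumes finite_L: "finite (carrier L)"
    and rep: "representation L n \<rho>"
    and irr: "irreducible_representation (L\<lparr>carrier := M\<rparr>) d \<sigma>"
    and trace_eq: "\<And>m. m \<in> M \<Longrightarrow> mat_trace (\<rho> m) = a * mat_trace (\<sigma> m)"
begin

abbreviation "K \<equiv> L\<lparr>carrier := M\<rparr>"

lemma grp: "group L" by (rule is_group)
lemma grpK: "group K" by (rule subgroup_is_group[OF grp])
lemma finite_M: "finite M" using finite_L subset finite_subset by blast
lemma card_M: "card M > 0" using finite_M subgroup.one_closed[OF subgroup_axioms] card_gt_0_iff by blast
lemma M_L: "m \<in> M \<Longrightarrow> m \<in> carrier L" using subset by blast

lemmas \<rho>_carrier = rep_carrier[OF rep grp]
lemmas \<rho>_mult = rep_mult[OF rep grp]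
lemmas repK = irr_rep_rep[OF irr]

lemma \<sigma>_carrier: "m \<in> M \<Longrightarrow> \<sigma> m \<in> carrier_mat d d" using rep_carrier[OF repK grpK] by simp
lemma \<sigma>_mult: "m \<in> M \<Longrightarrow> k \<in> M \<Longrightarrow> \<sigma> (m \<otimes> k) = \<sigma> m * \<sigma> k" using rep_mult[OF repK grpK] by simp
lemma \<sigma>_one: "\<sigma> \<one> = 1\<^sub>m d" using rep_one[OF repK grpK] by simp
lemma invK: "m \<in> M \<Longrightarrow> inv\<^bsub>K\<^esub> m = inv m" by (rule m_inv_consistent[OF subgroup_axioms])
lemma \<sigma>_inv: "m \<in> M \<Longrightarrow> \<sigma> m * \<sigma> (inv m) = 1\<^sub>m d" "m \<in> M \<Longrightarrow> \<sigma> (inv m) * \<sigma> m = 1\<^sub>m d"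
  using rep_inv[OF repK grpK] invK by simp_all
lemma n_pos: "n > 0" by (rule rep_dim_pos[OF rep grp])
lemma d_pos: "d > 0" by (rule rep_dim_pos[OF repK grpK])
lemma a_eq: "a * of_nat d = of_nat n"
  using trace_eq[OF subgroup.one_closed[OF subgroup_axioms]] rep_one[OF rep grp] \<sigma>_one by simp

lemma conj_M: "x \<in> carrier L \<Longrightarrow> m \<in> M \<Longrightarrow> x \<otimes> m \<otimes> inv x \<in> M" by (rule inv_op_closed2)

text \<open>The algebra homomorphism from all \<open>d \<times> d\<close> matrices to the span of \<open>\<rho> ` M\<close> that takes
  \<open>\<sigma> m\<close> to \<open>\<rho> m\<close>.\<close>

definition coef :: "complex mat \<Rightarrow> 'a \<Rightarrow> complex" where
  "coef Y m = of_nat d / of_nat (card M) * mat_trace (Y * \<sigma> (inv m))"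

definition \<Phi> :: "complex mat \<Rightarrow> complex mat" where
  "\<Phi> Y = mat_sum n n M (\<lambda>m. coef Y m \<cdot>\<^sub>m \<rho> m)"

lemma \<Phi>_carrier [simp]: "\<Phi> Y \<in> carrier_mat n n" by (simp add: \<Phi>_def)

lemma term_carrier: "m \<in> M \<Longrightarrow> c \<cdot>\<^sub>m \<rho> m \<in> carrier_mat n n" using \<rho>_carrier M_L by simp

lemma \<Phi>_index: "i < n \<Longrightarrow> j < n \<Longrightarrow> \<Phi> Y $$ (i, j) = (\<Sum>m\<in>M. coef Y m * \<rho> m $$ (i, j))"
  unfolding \<Phi>_def mat_sum_def using carrier_matD[OF \<rho>_carrier[OF M_L]] by (auto intro!: sum.cong)

text \<open>Shifting the summation by \<open>k\<close> moves \<open>\<sigma> k\<close> out of the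
  coefficient, since the trace is invariant under conjugation.\<close>

lemma \<Phi>_left:
  assumes k: "k \<in> M" and Z: "Z \<in> carrier_mat d d"
  shows "\<rho> k * \<Phi> Z = \<Phi> (\<sigma> k * Z)"
proof -
  have "\<Phi> (\<sigma> k * Z) = mat_sum n n M (\<lambda>m. coef (\<sigma> k * Z) (k \<otimes> m) \<cdot>\<^sub>m \<rho> (k \<otimes> m))"
    unfolding \<Phi>_def
    using mat_sum_reindex_bij[OF group.bij_betw_lmult[OF grpK], of k n n "\<lambda>m. coef (\<sigma> k * Z) m \<cdot>\<^sub>m \<rho> m"] k by simp
  also have "\<dots> = mat_sum n n M (\<lambda>m. \<rho> k * (coef Z m \<cdot>\<^sub>m \<rho> m))"
  proof (rule mat_sum_cong)
    fix m assume m: "m \<in> M"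
    have im: "inv m \<in> M" and ik: "inv k \<in> M" using m k by auto
    note c = \<sigma>_carrier[OF k] \<sigma>_carrier[OF im] \<sigma>_carrier[OF ik]
    have Zm: "Z * \<sigma> (inv m) \<in> carrier_mat d d" by (rule mult_carrier_mat[OF Z c(2)])
    have "\<sigma> (inv (k \<otimes> m)) = \<sigma> (inv m) * \<sigma> (inv k)"
      using \<sigma>_mult[OF im ik] M_L[OF m] M_L[OF k] by (simp add: inv_mult_group)
    hence "\<sigma> k * Z * \<sigma> (inv (k \<otimes> m)) = \<sigma> k * Z * \<sigma> (inv m) * \<sigma> (inv k)"
      using assoc_mult_mat[OF mult_carrier_mat[OF c(1) Z] c(2) c(3)] by simp
    also have "\<dots> = \<sigma> k * (Z * \<sigma> (inv m)) * \<sigma> (inv k)"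
      using assoc_mult_mat[OF c(1) Z c(2)] by simp
    finally have "coef (\<sigma> k * Z) (k \<otimes> m) = coef Z m"
      unfolding coef_def using mat_trace_conj[OF Zm c(1) c(3) \<sigma>_inv(2)[OF k]] by simp
    thus "coef (\<sigma> k * Z) (k \<otimes> m) \<cdot>\<^sub>m \<rho> (k \<otimes> m) = \<rho> k * (coef Z m \<cdot>\<^sub>m \<rho> m)"
      using \<rho>_mult[OF M_L[OF k] M_L[OF m]] mult_smult_distrib[OF \<rho>_carrier[OF M_L[OF k]] \<rho>_carrier[OF M_L[OF m]]]
      by simp
  qed
  also have "\<dots> = \<rho> k * \<Phi> Z"
    unfolding \<Phi>_def by (rule mult_mat_sum[OF \<rho>_carrier[OF M_L[OF k]] term_carrier, symmetric])
  finally show ?thesis by simp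
qed

text \<open>Fourier inversion: Schur orthogonality shows that both sides have the same trace against
  every \<open>X\<close>. In particular the \<open>\<sigma> m\<close> span all matrices.\<close>

lemma \<sigma>_expansion:
  assumes Y: "Y \<in> carrier_mat d d"
  shows "Y = mat_sum d d M (\<lambda>m. coef Y m \<cdot>\<^sub>m \<sigma> m)"
proof (rule mat_eq_by_trace[OF Y mat_sum_carrier])
  fix X :: "complex mat" assume X: "X \<in> carrier_mat d d"
  have c: "coef Y m \<cdot>\<^sub>m \<sigma> m \<in> carrier_mat d d" if "m \<in> M" for m using \<sigma>_carrier[OF that] by simp
  have "mat_trace (X * mat_sum d d M (\<lambda>m. coef Y m \<cdot>\<^sub>m \<sigma> m)) = (\<Sum>m\<in>M. mat_trace (X * (coef Y m \<cdot>\<^sub>m \<sigma> m)))"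
    by (rule mat_trace_mult_mat_sum(1)[OF X c])
  also have "\<dots> = (\<Sum>m\<in>M. of_nat d / of_nat (card M) * (mat_trace (X * \<sigma> m) * mat_trace (Y * \<sigma> (inv m))))"
  proof (rule sum.cong)
    fix m assume m: "m \<in> M"
    show "mat_trace (X * (coef Y m \<cdot>\<^sub>m \<sigma> m)) = of_nat d / of_nat (card M) * (mat_trace (X * \<sigma> m) * mat_trace (Y * \<sigma> (inv m)))"
      unfolding mult_smult_distrib[OF X \<sigma>_carrier[OF m]] mat_trace_smult[OF mult_carrier_mat[OF X \<sigma>_carrier[OF m]]] coef_def
      by simp
  qed simp
  also have "\<dots> = of_nat d / of_nat (card M) * (\<Sum>m\<in>carrier K. mat_trace (X * \<sigma> m) * mat_trace (Y * \<sigma> (inv\<^bsub>K\<^esub> m)))"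
    unfolding sum_distrib_left by (simp add: invK)
  also have "\<dots> = mat_trace (X * Y)"
    unfolding trace_orthogonality_same[OF irr grpK X Y] using d_pos card_M by simp
  finally show "mat_trace (X * Y) = mat_trace (X * mat_sum d d M (\<lambda>m. coef Y m \<cdot>\<^sub>m \<sigma> m))" by simp
qed

text \<open>Expanding \<open>Y\<close> by \<open>\<sigma>_expansion\<close> reduces the claim to
  left multiplication by a single \<open>\<sigma> m\<close>, which is
  \<open>\<Phi>_left\<close>.\<close>

lemma \<Phi>_mult:
  assumes Y: "Y \<in> carrier_mat d d" and Z: "Z \<in> carrier_mat d d"
  shows "\<Phi> Y * \<Phi> Z = \<Phi> (Y * Z)"
proof (rule eq_matI)
  fix i j assume "i < dim_row (\<Phi> (Y * Z))" "j < dim_col (\<Phi> (Y * Z))"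
  hence ij: "i < n" "j < n" by (simp_all add: \<Phi>_def)
  have cf: "coef (Y * Z) k = (\<Sum>m\<in>M. coef Y m * coef (\<sigma> m * Z) k)" if k: "k \<in> M" for k
  proof -
    have ik: "inv k \<in> M" using k by simp
    have ZK: "Z * \<sigma> (inv k) \<in> carrier_mat d d" by (rule mult_carrier_mat[OF Z \<sigma>_carrier[OF ik]])
    have c: "coef Y m \<cdot>\<^sub>m \<sigma> m \<in> carrier_mat d d" if "m \<in> M" for m using \<sigma>_carrier[OF that] by simp
    have "mat_trace (Y * Z * \<sigma> (inv k)) = mat_trace (Y * (Z * \<sigma> (inv k)))"
      using assoc_mult_mat[OF Y Z \<sigma>_carrier[OF ik]] by simp
    also have "\<dots> = mat_trace (mat_sum d d M (\<lambda>m. coef Y m \<cdot>\<^sub>m \<sigma> m) * (Z * \<sigma> (inv k)))"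
      using \<sigma>_expansion[OF Y] by simp
    also have "\<dots> = (\<Sum>m\<in>M. mat_trace (coef Y m \<cdot>\<^sub>m \<sigma> m * (Z * \<sigma> (inv k))))"
      by (rule mat_trace_mult_mat_sum(2)[OF ZK c])
    also have "\<dots> = (\<Sum>m\<in>M. coef Y m * mat_trace (\<sigma> m * Z * \<sigma> (inv k)))"
    proof (rule sum.cong)
      fix m assume m: "m \<in> M"
      show "mat_trace (coef Y m \<cdot>\<^sub>m \<sigma> m * (Z * \<sigma> (inv k))) = coef Y m * mat_trace (\<sigma> m * Z * \<sigma> (inv k))"
        unfolding mult_smult_assoc_mat[OF \<sigma>_carrier[OF m] ZK]
          mat_trace_smult[OF mult_carrier_mat[OF \<sigma>_carrier[OF m] ZK]]
          assoc_mult_mat[OF \<sigma>_carrier[OF m] Z \<sigma>_carrier[OF ik]] ..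
    qed simp
    finally show ?thesis unfolding coef_def[of "Y * Z"] coef_def[of "\<sigma> _ * Z"]
      by (simp add: sum_distrib_left mult_ac)
  qed
  have "\<Phi> Y * \<Phi> Z = mat_sum n n M (\<lambda>m. coef Y m \<cdot>\<^sub>m \<rho> m * \<Phi> Z)"
    unfolding \<Phi>_def[of Y] by (rule mat_sum_mult[OF \<Phi>_carrier term_carrier])
  also have "\<dots> = mat_sum n n M (\<lambda>m. coef Y m \<cdot>\<^sub>m \<Phi> (\<sigma> m * Z))"
  proof (rule mat_sum_cong)
    fix m assume m: "m \<in> M"
    show "coef Y m \<cdot>\<^sub>m \<rho> m * \<Phi> Z = coef Y m \<cdot>\<^sub>m \<Phi> (\<sigma> m * Z)"
      unfolding mult_smult_assoc_mat[OF \<rho>_carrier[OF M_L[OF m]] \<Phi>_carrier] \<Phi>_left[OF m Z] ..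
  qed
  finally have "(\<Phi> Y * \<Phi> Z) $$ (i, j) = (\<Sum>m\<in>M. coef Y m * \<Phi> (\<sigma> m * Z) $$ (i, j))"
    using ij carrier_matD[OF \<Phi>_carrier] by (simp add: mat_sum_def)
  also have "\<dots> = (\<Sum>m\<in>M. \<Sum>k\<in>M. coef Y m * coef (\<sigma> m * Z) k * \<rho> k $$ (i, j))"
    by (simp add: \<Phi>_index[OF ij] sum_distrib_left mult.assoc)
  also have "\<dots> = (\<Sum>k\<in>M. \<Sum>m\<in>M. coef Y m * coef (\<sigma> m * Z) k * \<rho> k $$ (i, j))"
    by (rule sum.swap)
  also have "\<dots> = \<Phi> (Y * Z) $$ (i, j)"
    unfolding \<Phi>_index[OF ij] by (intro sum.cong refl) (simp add: cf sum_distrib_right)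
  finally show "(\<Phi> Y * \<Phi> Z) $$ (i, j) = \<Phi> (Y * Z) $$ (i, j)" .
qed (simp_all add: \<Phi>_def)

text \<open>An idempotent of trace \<open>n\<close>, hence the identity. The trace is computed from
  \<open>trace_eq\<close>: this is where it matters that \<open>\<sigma>\<close> is the only
  constituent of \<open>\<rho>\<close> on \<open>M\<close>.\<close>

lemma \<Phi>_one: "\<Phi> (1\<^sub>m d) = 1\<^sub>m n"
proof -
  have one: "1\<^sub>m d \<in> carrier_mat d d" by simp
  have idem: "\<Phi> (1\<^sub>m d) * \<Phi> (1\<^sub>m d) = \<Phi> (1\<^sub>m d)" using \<Phi>_mult[OF one one] by simp
  have "mat_trace (\<Phi> (1\<^sub>m d)) = (\<Sum>m\<in>M. mat_trace (coef (1\<^sub>m d) m \<cdot>\<^sub>m \<rho> m))"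
    unfolding \<Phi>_def by (rule mat_trace_mat_sum[OF term_carrier])
  also have "\<dots> = (\<Sum>m\<in>M. a * of_nat d / of_nat (card M) * (mat_trace (1\<^sub>m d * \<sigma> m) * mat_trace (1\<^sub>m d * \<sigma> (inv m))))"
  proof (rule sum.cong)
    fix m assume m: "m \<in> M"
    show "mat_trace (coef (1\<^sub>m d) m \<cdot>\<^sub>m \<rho> m)
        = a * of_nat d / of_nat (card M) * (mat_trace (1\<^sub>m d * \<sigma> m) * mat_trace (1\<^sub>m d * \<sigma> (inv m)))"
      unfolding mat_trace_smult[OF \<rho>_carrier[OF M_L[OF m]]] coef_def trace_eq[OF m] left_mult_one_mat[OF \<sigma>_carrier[OF m]]
      by simp
  qed simp
  also have "\<dots> = a * of_nat d / of_nat (card M) * (\<Sum>m\<in>carrier K. mat_trace (1\<^sub>m d * \<sigma> m) * mat_trace (1\<^sub>m d * \<sigma> (inv\<^bsub>K\<^esub> m)))"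
    unfolding sum_distrib_left by (simp add: invK)
  also have "\<dots> = of_nat n"
    unfolding trace_orthogonality_same[OF irr grpK one one] using d_pos card_M a_eq by simp
  finally have tr: "mat_trace (\<Phi> (1\<^sub>m d)) = of_nat n" .
  obtain k where k: "mat_trace (\<Phi> (1\<^sub>m d)) = of_nat k" "k = n \<Longrightarrow> \<Phi> (1\<^sub>m d) = 1\<^sub>m n"
  proof -
    show ?thesis by (rule idempotent_trace[OF \<Phi>_carrier idem]) (rule that, assumption+)
  qed
  show ?thesis using k tr by simp
qed

lemma \<Phi>_\<sigma>: "m \<in> M \<Longrightarrow> \<Phi> (\<sigma> m) = \<rho> m"
  using \<Phi>_left[of m "1\<^sub>m d"] \<Phi>_one right_mult_one_mat[OF \<sigma>_carrier] right_mult_one_mat[OF \<rho>_carrier[OF M_L]] by simp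

lemma \<Phi>_smult:
  assumes "Y \<in> carrier_mat d d"
  shows "\<Phi> (c \<cdot>\<^sub>m Y) = c \<cdot>\<^sub>m \<Phi> Y"
proof (rule eq_matI)
  fix i j assume "i < dim_row (c \<cdot>\<^sub>m \<Phi> Y)" "j < dim_col (c \<cdot>\<^sub>m \<Phi> Y)"
  hence ij: "i < n" "j < n" by (simp_all add: \<Phi>_def)
  have "coef (c \<cdot>\<^sub>m Y) m = c * coef Y m" if m: "m \<in> M" for m
  proof -
    have im: "inv m \<in> M" using m by simp
    show ?thesis unfolding coef_def mult_smult_assoc_mat[OF assms \<sigma>_carrier[OF im]]
        mat_trace_smult[OF mult_carrier_mat[OF assms \<sigma>_carrier[OF im]]] by simp
  qed
  thus "\<Phi> (c \<cdot>\<^sub>m Y) $$ (i, j) = (c \<cdot>\<^sub>m \<Phi> Y) $$ (i, j)"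
    using ij carrier_matD[OF \<Phi>_carrier] by (simp add: \<Phi>_index sum_distrib_left mult.assoc)
qed (simp_all add: \<Phi>_def)

lemma \<Phi>_commutes:
  assumes X: "X \<in> carrier_mat n n" and comm: "\<And>m. m \<in> M \<Longrightarrow> X * \<rho> m = \<rho> m * X"
  shows "X * \<Phi> Y = \<Phi> Y * X"
proof -
  have "X * \<Phi> Y = mat_sum n n M (\<lambda>m. X * (coef Y m \<cdot>\<^sub>m \<rho> m))"
    unfolding \<Phi>_def by (rule mult_mat_sum[OF X term_carrier])
  also have "\<dots> = mat_sum n n M (\<lambda>m. coef Y m \<cdot>\<^sub>m \<rho> m * X)"
  proof (rule mat_sum_cong)
    fix m assume m: "m \<in> M"
    note R = \<rho>_carrier[OF M_L[OF m]]
    show "X * (coef Y m \<cdot>\<^sub>m \<rho> m) = coef Y m \<cdot>\<^sub>m \<rho> m * X"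
      unfolding mult_smult_distrib[OF X R] mult_smult_assoc_mat[OF R X] comm[OF m] ..
  qed
  also have "\<dots> = \<Phi> Y * X" unfolding \<Phi>_def by (rule mat_sum_mult[OF X term_carrier, symmetric])
  finally show ?thesis .
qed

text \<open>The space of \<open>\<rho>\<close> is a tensor product on which \<open>\<Phi> Y\<close>
  acts through the second factor and the commutant of \<open>\<rho>\<close> on \<open>M\<close>
  through the first, and traces of tensor products multiply. The proof averages \<open>Y\<close>
  over conjugation by the \<open>\<sigma> k\<close>: the left trace is unchanged and
  \<open>Y\<close> becomes the scalar \<open>mat_trace Y / d\<close>.\<close>

lemma trace_commutant_mult:
  assumes X: "X \<in> carrier_mat n n" and comm: "\<And>m. m \<in> M \<Longrightarrow> X * \<rho> m = \<rho> m * X"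
    and Y: "Y \<in> carrier_mat d d"
  shows "of_nat d * mat_trace (X * \<Phi> Y) = mat_trace X * mat_trace Y"
proof -
  have ex: "mat_trace (X * \<Phi> Z) = (\<Sum>m\<in>M. coef Z m * mat_trace (X * \<rho> m))" for Z
  proof -
    have "mat_trace (X * \<Phi> Z) = (\<Sum>m\<in>M. mat_trace (X * (coef Z m \<cdot>\<^sub>m \<rho> m)))"
      unfolding \<Phi>_def by (rule mat_trace_mult_mat_sum(1)[OF X term_carrier])
    also have "\<dots> = (\<Sum>m\<in>M. coef Z m * mat_trace (X * \<rho> m))"
    proof (rule sum.cong)
      fix m assume m: "m \<in> M"
      note R = \<rho>_carrier[OF M_L[OF m]]
      show "mat_trace (X * (coef Z m \<cdot>\<^sub>m \<rho> m)) = coef Z m * mat_trace (X * \<rho> m)"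
        unfolding mult_smult_distrib[OF X R] mat_trace_smult[OF mult_carrier_mat[OF X R]] ..
    qed simp
    finally show ?thesis .
  qed
  let ?Z = "\<lambda>k. \<sigma> k * Y * \<sigma> (inv k)"
  have Zc: "?Z k \<in> carrier_mat d d" if "k \<in> M" for k
    using \<sigma>_carrier[OF that] Y \<sigma>_carrier[of "inv k"] that by (intro triple_carrier) auto
  have inv_tr: "mat_trace (X * \<Phi> (?Z k)) = mat_trace (X * \<Phi> Y)" if k: "k \<in> M" for k
  proof -
    have ik: "inv k \<in> M" using k by simp
    note R = \<rho>_carrier[OF M_L[OF k]] and Ri = \<rho>_carrier[OF M_L[OF ik]]
    note S = \<sigma>_carrier[OF k] and Si = \<sigma>_carrier[OF ik]
    have F: "\<Phi> (?Z k) = \<rho> k * \<Phi> Y * \<rho> (inv k)"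
      using \<Phi>_mult[OF mult_carrier_mat[OF S Y] Si] \<Phi>_left[OF k Y] \<Phi>_\<sigma>[OF ik] by simp
    have RF: "\<rho> k * \<Phi> Y \<in> carrier_mat n n" by (rule mult_carrier_mat[OF R \<Phi>_carrier])
    have XF: "X * \<Phi> Y \<in> carrier_mat n n" by (rule mult_carrier_mat[OF X \<Phi>_carrier])
    have "X * (\<rho> k * \<Phi> Y * \<rho> (inv k)) = X * (\<rho> k * \<Phi> Y) * \<rho> (inv k)"
      by (rule assoc_mult_mat[OF X RF Ri, symmetric])
    also have "X * (\<rho> k * \<Phi> Y) = X * \<rho> k * \<Phi> Y" by (rule assoc_mult_mat[OF X R \<Phi>_carrier, symmetric])
    also have "\<dots> = \<rho> k * (X * \<Phi> Y)" unfolding comm[OF k] by (rule assoc_mult_mat[OF R X \<Phi>_carrier])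
    finally have "mat_trace (X * \<Phi> (?Z k)) = mat_trace (\<rho> k * (X * \<Phi> Y) * \<rho> (inv k))" unfolding F by simp
    also have "\<dots> = mat_trace (X * \<Phi> Y)"
      by (rule mat_trace_conj[OF XF R Ri rep_inv(2)[OF rep grp M_L[OF k]]])
    finally show ?thesis .
  qed
  have avg: "(\<Sum>k\<in>M. coef (?Z k) m) = of_nat (card M) * mat_trace Y / of_nat d * coef (1\<^sub>m d) m" if m: "m \<in> M" for m
  proof -
    have im: "inv m \<in> M" using m by simp
    note Sm = \<sigma>_carrier[OF im]
    have "(\<Sum>k\<in>M. coef (?Z k) m) = of_nat d / of_nat (card M) * (\<Sum>k\<in>M. mat_trace (?Z k * \<sigma> (inv m)))"
      unfolding coef_def sum_distrib_left ..
    also have "(\<Sum>k\<in>M. mat_trace (?Z k * \<sigma> (inv m))) = mat_trace (mat_sum d d M ?Z * \<sigma> (inv m))"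
      by (rule mat_trace_mult_mat_sum(2)[OF Sm Zc, symmetric])
    also have "mat_sum d d M ?Z = rep_average K d d \<sigma> \<sigma> Y"
      unfolding rep_average_def using mat_sum_cong[of M ?Z "\<lambda>k. \<sigma> k * Y * \<sigma> (inv\<^bsub>K\<^esub> k)"] invK by simp
    also have "\<dots> = (of_nat (card M) * mat_trace Y / of_nat d) \<cdot>\<^sub>m 1\<^sub>m d"
      using rep_average_irr[OF irr grpK Y] by simp
    also have "mat_trace (\<dots> * \<sigma> (inv m)) = of_nat (card M) * mat_trace Y / of_nat d * mat_trace (1\<^sub>m d * \<sigma> (inv m))"
      unfolding mult_smult_assoc_mat[OF one_carrier_mat Sm] mat_trace_smult[OF mult_carrier_mat[OF one_carrier_mat Sm]] ..
    finally show ?thesis unfolding coef_def by simp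
  qed
  have "of_nat (card M) * mat_trace (X * \<Phi> Y) = (\<Sum>k\<in>M. mat_trace (X * \<Phi> (?Z k)))"
    using inv_tr by simp
  also have "\<dots> = (\<Sum>k\<in>M. \<Sum>m\<in>M. coef (?Z k) m * mat_trace (X * \<rho> m))" by (simp only: ex)
  also have "\<dots> = (\<Sum>m\<in>M. \<Sum>k\<in>M. coef (?Z k) m * mat_trace (X * \<rho> m))" by (rule sum.swap)
  also have "\<dots> = (\<Sum>m\<in>M. of_nat (card M) * mat_trace Y / of_nat d * (coef (1\<^sub>m d) m * mat_trace (X * \<rho> m)))"
    by (intro sum.cong refl) (simp only: avg mult.assoc flip: sum_distrib_right)
  also have "\<dots> = of_nat (card M) * mat_trace Y / of_nat d * mat_trace (X * \<Phi> (1\<^sub>m d))"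
    unfolding ex sum_distrib_left ..
  also have "mat_trace (X * \<Phi> (1\<^sub>m d)) = mat_trace X" unfolding \<Phi>_one using right_mult_one_mat[OF X] by simp
  finally have "of_nat (card M) * mat_trace (X * \<Phi> Y) = of_nat (card M) * (mat_trace Y / of_nat d * mat_trace X)"
    by simp
  hence "mat_trace (X * \<Phi> Y) = mat_trace Y / of_nat d * mat_trace X"
    using card_M by (simp only: mult_left_cancel of_nat_eq_0_iff)
  thus ?thesis using d_pos by simp
qed

text \<open>The character of \<open>\<rho>\<close> is invariant in \<open>L\<close>, so by
  proportionality the trace of \<open>\<sigma>\<close> on \<open>M\<close> is invariant too, and
  \<open>\<sigma>\<close> is equivalent to its conjugate by \<open>y\<close>.\<close>

lemma intertwiner_exists:
  assumes y: "y \<in> carrier L"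
  shows "\<exists>X Y. X \<in> carrier_mat d d \<and> Y \<in> carrier_mat d d \<and> X * Y = 1\<^sub>m d \<and> Y * X = 1\<^sub>m d
    \<and> (\<forall>m\<in>M. X * \<sigma> m = \<sigma> (y \<otimes> m \<otimes> inv y) * X)"
proof -
  have irr': "irreducible_representation K d (\<lambda>m. \<sigma> (y \<otimes> m \<otimes> inv y))"
    using irr_rep_hom_comp[OF irr grpK grpK conj_hom(1)[OF y]] conj_hom(2)[OF y] by simp
  have a0: "a \<noteq> 0" using a_eq n_pos by auto
  have "mat_trace (\<sigma> (y \<otimes> m \<otimes> inv y)) = mat_trace (\<sigma> m)" if m: "m \<in> M" for m
  proof -
    have "mat_trace (\<rho> (y \<otimes> m \<otimes> inv y)) = mat_trace (\<rho> m)"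
      using char_conj[OF afforded_charI[OF rep] grp y M_L[OF m]] y M_L[OF m] by simp
    thus ?thesis using trace_eq[OF m] trace_eq[OF conj_M[OF y m]] a0 by simp
  qed
  with same_char_intertwiner[OF irr irr' grpK] show ?thesis using finite_M by simp
qed

end

context homogeneous_restriction
begin

text \<open>The intertwiners are chosen on a transversal only and extended by
  \<open>B (h \<otimes> r) = \<sigma> h * X r\<close>. Thus left translation by \<open>M\<close>
  acts exactly as \<open>\<sigma>\<close>, which makes the cocycle a function of cosets.\<close>

lemma projective_extension:
  obtains T rr hh B Bi where
    "T \<subseteq> carrier L" "finite T" "card T * card M = card (carrier L)"
    "\<And>x. x \<in> carrier L \<Longrightarrow> rr x \<in> T \<and> hh x \<in> M \<and> x = hh x \<otimes> rr x"
    "\<And>h r. h \<in> M \<Longrightarrow> r \<in> T \<Longrightarrow> rr (h \<otimes> r) = r"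
    "\<And>x. x \<in> carrier L \<Longrightarrow> B x \<in> carrier_mat d d"
    "\<And>x. x \<in> carrier L \<Longrightarrow> Bi x \<in> carrier_mat d d"
    "\<And>x. x \<in> carrier L \<Longrightarrow> B x * Bi x = 1\<^sub>m d"
    "\<And>x. x \<in> carrier L \<Longrightarrow> Bi x * B x = 1\<^sub>m d"
    "\<And>x m. x \<in> carrier L \<Longrightarrow> m \<in> M \<Longrightarrow> B x * \<sigma> m = \<sigma> (x \<otimes> m \<otimes> inv x) * B x"
    "\<And>x m. x \<in> carrier L \<Longrightarrow> m \<in> M \<Longrightarrow> B (m \<otimes> x) = \<sigma> m * B x"
proof -
  obtain T where T: "T \<subseteq> carrier L" "finite T" "card T * card M = card (carrier L)"
    "bij_betw (\<lambda>(r, h). h \<otimes> r) (T \<times> M) (carrier L)"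
    by (rule transversal_exists[OF grp finite_L subgroup_axioms])
  have TL: "r \<in> carrier L" if "r \<in> T" for r using T(1) that by blast
  define rh where "rh = the_inv_into (T \<times> M) (\<lambda>(r, h). h \<otimes> r)"
  define rr where "rr = (\<lambda>x. fst (rh x))"
  define hh where "hh = (\<lambda>x. snd (rh x))"
  have inj: "inj_on (\<lambda>(r, h). h \<otimes> r) (T \<times> M)" and im: "(\<lambda>(r, h). h \<otimes> r) ` (T \<times> M) = carrier L"
    using T(4) by (auto simp: bij_betw_def)
  have dec: "rr x \<in> T \<and> hh x \<in> M \<and> x = hh x \<otimes> rr x" if x: "x \<in> carrier L" for x
  proof -
    have "rh x \<in> T \<times> M" unfolding rh_def by (rule the_inv_into_into[OF inj]) (use im x in auto)
    moreover have "(\<lambda>(r, h). h \<otimes> r) (rh x) = x"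
      unfolding rh_def by (rule f_the_inv_into_f[OF inj]) (use im x in auto)
    ultimately show ?thesis unfolding rr_def hh_def by (cases "rh x") auto
  qed
  have uni: "rr (h \<otimes> r) = r \<and> hh (h \<otimes> r) = h" if "h \<in> M" "r \<in> T" for h r
    using the_inv_into_f_f[OF inj, of "(r, h)"] that by (simp add: rr_def hh_def rh_def)
  obtain X Y where XY: "\<And>y. y \<in> carrier L \<Longrightarrow> X y \<in> carrier_mat d d"
    "\<And>y. y \<in> carrier L \<Longrightarrow> Y y \<in> carrier_mat d d"
    "\<And>y. y \<in> carrier L \<Longrightarrow> X y * Y y = 1\<^sub>m d" "\<And>y. y \<in> carrier L \<Longrightarrow> Y y * X y = 1\<^sub>m d"
    "\<And>y m. y \<in> carrier L \<Longrightarrow> m \<in> M \<Longrightarrow> X y * \<sigma> m = \<sigma> (y \<otimes> m \<otimes> inv y) * X y"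
    using intertwiner_exists by metis
  define B where "B = (\<lambda>x. \<sigma> (hh x) * X (rr x))"
  define Bi where "Bi = (\<lambda>x. Y (rr x) * \<sigma> (inv (hh x)))"
  have as: "P * Q * R = P * (Q * R)" if "P \<in> carrier_mat d d" "Q \<in> carrier_mat d d" "R \<in> carrier_mat d d"
    for P Q R :: "complex mat" using that by (rule assoc_mult_mat)
  have mc: "P * Q \<in> carrier_mat d d" if "P \<in> carrier_mat d d" "Q \<in> carrier_mat d d"
    for P Q :: "complex mat" using that by (rule mult_carrier_mat)
  have car: "\<sigma> (hh x) \<in> carrier_mat d d" "\<sigma> (inv (hh x)) \<in> carrier_mat d d" "X (rr x) \<in> carrier_mat d d" "Y (rr x) \<in> carrier_mat d d"
    "rr x \<in> carrier L" "hh x \<in> M" "hh x \<in> carrier L"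
    if "x \<in> carrier L" for x
    using dec[OF that] \<sigma>_carrier XY(1,2) TL M_L by auto
  show ?thesis
  proof (rule that[of T rr hh B Bi])
    show "B x \<in> carrier_mat d d" if "x \<in> carrier L" for x unfolding B_def by (rule mc) (use car[OF that] in auto)
    show "Bi x \<in> carrier_mat d d" if "x \<in> carrier L" for x unfolding Bi_def by (rule mc) (use car[OF that] in auto)
    show "B x * Bi x = 1\<^sub>m d" if x: "x \<in> carrier L" for x
    proof -
      note c = car[OF x]
      have "B x * Bi x = \<sigma> (hh x) * ((X (rr x) * Y (rr x)) * \<sigma> (inv (hh x)))"
        unfolding B_def Bi_def using c by (simp only: as mc)
      also have "(X (rr x) * Y (rr x)) * \<sigma> (inv (hh x)) = \<sigma> (inv (hh x))"
        using XY(3)[OF c(5)] left_mult_one_mat[OF c(2)] by simp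
      finally show ?thesis using \<sigma>_inv(1)[OF c(6)] by simp
    qed
    show "Bi x * B x = 1\<^sub>m d" if x: "x \<in> carrier L" for x
    proof -
      note c = car[OF x]
      have "Bi x * B x = Y (rr x) * ((\<sigma> (inv (hh x)) * \<sigma> (hh x)) * X (rr x))"
        unfolding B_def Bi_def using c by (simp only: as mc)
      also have "(\<sigma> (inv (hh x)) * \<sigma> (hh x)) * X (rr x) = X (rr x)"
        using \<sigma>_inv(2)[OF c(6)] left_mult_one_mat[OF c(3)] by simp
      finally show ?thesis using XY(4)[OF c(5)] by simp
    qed
    show "B x * \<sigma> m = \<sigma> (x \<otimes> m \<otimes> inv x) * B x" if x: "x \<in> carrier L" and m: "m \<in> M" for x m
    proof -
      note c = car[OF x]
      let ?m = "rr x \<otimes> m \<otimes> inv (rr x)"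
      have m': "?m \<in> M" by (rule conj_M[OF c(5) m])
      have hm: "hh x \<otimes> ?m = x \<otimes> m \<otimes> inv x \<otimes> hh x"
      proof -
        have "x \<otimes> m \<otimes> inv x \<otimes> hh x = (hh x \<otimes> rr x) \<otimes> m \<otimes> inv (hh x \<otimes> rr x) \<otimes> hh x"
          using dec[OF x] by metis
        also have "\<dots> = hh x \<otimes> ?m" using c M_L[OF m] by (simp add: inv_mult_group m_assoc)
        finally show ?thesis by simp
      qed
      have "B x * \<sigma> m = \<sigma> (hh x) * (X (rr x) * \<sigma> m)"
        unfolding B_def by (rule as[OF c(1,3) \<sigma>_carrier[OF m]])
      also have "\<dots> = \<sigma> (hh x) * \<sigma> ?m * X (rr x)"
        unfolding XY(5)[OF c(5) m] by (rule as[OF c(1) \<sigma>_carrier[OF m'] c(3), symmetric])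
      also have "\<sigma> (hh x) * \<sigma> ?m = \<sigma> (x \<otimes> m \<otimes> inv x) * \<sigma> (hh x)"
        using \<sigma>_mult[OF c(6) m'] \<sigma>_mult[OF conj_M[OF x m] c(6)] hm by simp
      also have "\<dots> * X (rr x) = \<sigma> (x \<otimes> m \<otimes> inv x) * B x"
        unfolding B_def by (rule as[OF \<sigma>_carrier[OF conj_M[OF x m]] c(1,3)])
      finally show ?thesis .
    qed
    show "B (m \<otimes> x) = \<sigma> m * B x" if x: "x \<in> carrier L" and m: "m \<in> M" for x m
    proof -
      note c = car[OF x]
      have "m \<otimes> x = m \<otimes> hh x \<otimes> rr x" using dec[OF x] m_assoc[OF M_L[OF m] c(7,5)] by metis
      moreover have mh: "m \<otimes> hh x \<in> M" using m c(6) by simp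
      ultimately have "rr (m \<otimes> x) = rr x \<and> hh (m \<otimes> x) = m \<otimes> hh x" using uni[OF mh] dec[OF x] by metis
      thus ?thesis unfolding B_def using \<sigma>_mult[OF m c(6)] as[OF \<sigma>_carrier[OF m] c(1,3)] by simp
    qed
  qed (use T dec uni in auto)
qed

text \<open>For a projective extension \<open>B\<close> of \<open>\<sigma>\<close> the matrices \<open>\<rho> x * \<Phi> (B x)\<inverse>\<close> commute with \<open>\<rho> ` M\<close>
  and form a projective representation of \<open>L / M\<close> with the inverse cocycle \<open>c\<close>. Determinants show
  that \<open>c\<^sup>n\<close> is a coboundary, and the product over a transversal shows the same of \<open>c\<^sup>q\<close>, where
  \<open>q = |L : M|\<close>; hence \<open>c\<close> itself is one.\<close>

theorem extension:
  assumes q: "card (carrier L) = q * card M" and cop: "coprime n q"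
  shows "\<exists>B. representation L d B \<and> (\<forall>m\<in>M. B m = \<sigma> m) \<and>
    (\<forall>x\<in>carrier L. real d * cmod (mat_trace (\<rho> x)) \<le> real n * cmod (mat_trace (B x)))"
proof -
  obtain T rr hh B Bi where
    T: "T \<subseteq> carrier L" "finite T" "card T * card M = card (carrier L)"
    and dec: "\<And>x. x \<in> carrier L \<Longrightarrow> rr x \<in> T \<and> hh x \<in> M \<and> x = hh x \<otimes> rr x"
    and uni: "\<And>h r. h \<in> M \<Longrightarrow> r \<in> T \<Longrightarrow> rr (h \<otimes> r) = r"
    and B: "\<And>x. x \<in> carrier L \<Longrightarrow> B x \<in> carrier_mat d d"
    and Bi: "\<And>x. x \<in> carrier L \<Longrightarrow> Bi x \<in> carrier_mat d d"
    and BBi: "\<And>x. x \<in> carrier L \<Longrightarrow> B x * Bi x = 1\<^sub>m d"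
    and BiB: "\<And>x. x \<in> carrier L \<Longrightarrow> Bi x * B x = 1\<^sub>m d"
    and B\<sigma>: "\<And>x m. x \<in> carrier L \<Longrightarrow> m \<in> M \<Longrightarrow> B x * \<sigma> m = \<sigma> (x \<otimes> m \<otimes> inv x) * B x"
    and Bm: "\<And>x m. x \<in> carrier L \<Longrightarrow> m \<in> M \<Longrightarrow> B (m \<otimes> x) = \<sigma> m * B x"
  proof -
    show ?thesis by (rule projective_extension) (rule that, assumption+)
  qed
  have TL: "r \<in> carrier L" if "r \<in> T" for r using T(1) that by blast
  have dT: "rr x \<in> T" and dM: "hh x \<in> M" and dE: "x = hh x \<otimes> rr x" if "x \<in> carrier L" for x
    using dec[OF that] by blast+
  have cT: "card T = q" using T(3) q card_M by simp
  have as: "P * Q * R = P * (Q * R)" if "P \<in> carrier_mat d d" "Q \<in> carrier_mat d d" "R \<in> carrier_mat d d"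
    for P Q R :: "complex mat" using that by (rule assoc_mult_mat)
  have mc: "P * Q \<in> carrier_mat d d" if "P \<in> carrier_mat d d" "Q \<in> carrier_mat d d"
    for P Q :: "complex mat" using that by (rule mult_carrier_mat)
  have asn: "P * Q * R = P * (Q * R)" if "P \<in> carrier_mat n n" "Q \<in> carrier_mat n n" "R \<in> carrier_mat n n"
    for P Q R :: "complex mat" using that by (rule assoc_mult_mat)
  have mcn: "P * Q \<in> carrier_mat n n" if "P \<in> carrier_mat n n" "Q \<in> carrier_mat n n"
    for P Q :: "complex mat" using that by (rule mult_carrier_mat)
  have unique_inv: "Bi x = W" if x: "x \<in> carrier L" and W: "W \<in> carrier_mat d d" "B x * W = 1\<^sub>m d" for x W
  proof -
    have "Bi x * (B x * W) = Bi x * B x * W" by (rule as[OF Bi[OF x] B[OF x] W(1), symmetric])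
    thus ?thesis using W BiB[OF x] right_mult_one_mat[OF Bi[OF x]] left_mult_one_mat[OF W(1)] by simp
  qed
  have Bi\<sigma>: "Bi x * \<sigma> (x \<otimes> m \<otimes> inv x) = \<sigma> m * Bi x" if x: "x \<in> carrier L" and m: "m \<in> M" for x m
  proof -
    note S = \<sigma>_carrier[OF m] and S' = \<sigma>_carrier[OF conj_M[OF x m]]
    have "\<sigma> m * Bi x = Bi x * (B x * \<sigma> m) * Bi x"
      using as[OF Bi[OF x] B[OF x] S] BiB[OF x] left_mult_one_mat[OF S] by simp
    also have "\<dots> = Bi x * (\<sigma> (x \<otimes> m \<otimes> inv x) * B x * Bi x)"
      unfolding B\<sigma>[OF x m] by (rule as[OF Bi[OF x] mc[OF S' B[OF x]] Bi[OF x]])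
    also have "\<sigma> (x \<otimes> m \<otimes> inv x) * B x * Bi x = \<sigma> (x \<otimes> m \<otimes> inv x)"
      using as[OF S' B[OF x] Bi[OF x]] BBi[OF x] right_mult_one_mat[OF S'] by simp
    finally show ?thesis by simp
  qed
  \<comment> \<open>Both \<open>B x * B y\<close> and \<open>B (x \<otimes> y)\<close> intertwine
    \<open>\<sigma>\<close> with the same conjugate, so by Schur's lemma they differ by a
    scalar.\<close>
  have "\<exists>c. B x * B y = c \<cdot>\<^sub>m B (x \<otimes> y)" if x: "x \<in> carrier L" and y: "y \<in> carrier L" for x y
  proof -
    have xy: "x \<otimes> y \<in> carrier L" using x y by simp
    let ?X = "Bi (x \<otimes> y) * (B x * B y)"
    have BB: "B x * B y \<in> carrier_mat d d" by (rule mc[OF B[OF x] B[OF y]])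
    have X: "?X \<in> carrier_mat d d" by (rule mc[OF Bi[OF xy] BB])
    have "?X * \<sigma> m = \<sigma> m * ?X" if "m \<in> carrier K" for m
    proof -
      have m: "m \<in> M" using that by simp
      let ?y = "y \<otimes> m \<otimes> inv y"
      let ?xy = "x \<otimes> ?y \<otimes> inv x"
      have ym: "?y \<in> M" by (rule conj_M[OF y m])
      have xym: "?xy \<in> M" by (rule conj_M[OF x ym])
      have e: "?xy = (x \<otimes> y) \<otimes> m \<otimes> inv (x \<otimes> y)"
        using x y M_L[OF m] by (simp add: inv_mult_group m_assoc)
      note S = \<sigma>_carrier[OF m] and Sy = \<sigma>_carrier[OF ym] and Sxy = \<sigma>_carrier[OF xym]
      have "B x * B y * \<sigma> m = B x * (\<sigma> ?y * B y)"
        unfolding as[OF B[OF x] B[OF y] S] B\<sigma>[OF y m] ..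
      also have "\<dots> = \<sigma> ?xy * B x * B y"
        unfolding as[OF B[OF x] Sy B[OF y], symmetric] B\<sigma>[OF x ym] ..
      also have "\<dots> = \<sigma> ?xy * (B x * B y)" by (rule as[OF Sxy B[OF x] B[OF y]])
      finally have "?X * \<sigma> m = Bi (x \<otimes> y) * (\<sigma> ?xy * (B x * B y))"
        unfolding as[OF Bi[OF xy] BB S] by simp
      also have "\<dots> = Bi (x \<otimes> y) * \<sigma> ?xy * (B x * B y)" by (rule as[OF Bi[OF xy] Sxy BB, symmetric])
      also have "Bi (x \<otimes> y) * \<sigma> ?xy = \<sigma> m * Bi (x \<otimes> y)" unfolding e by (rule Bi\<sigma>[OF xy m])
      also have "\<dots> * (B x * B y) = \<sigma> m * ?X" by (rule as[OF S Bi[OF xy] BB])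
      finally show ?thesis .
    qed
    then obtain c where c: "?X = c \<cdot>\<^sub>m 1\<^sub>m d" using schur_scalar[OF irr grpK X] by blast
    have "B x * B y = B (x \<otimes> y) * ?X"
      using as[OF B[OF xy] Bi[OF xy] BB] BBi[OF xy] left_mult_one_mat[OF BB] by simp
    also have "\<dots> = c \<cdot>\<^sub>m B (x \<otimes> y)"
      unfolding c mult_smult_distrib[OF B[OF xy] one_carrier_mat] right_mult_one_mat[OF B[OF xy]] ..
    finally show ?thesis ..
  qed
  then obtain c where c: "\<And>x y. x \<in> carrier L \<Longrightarrow> y \<in> carrier L \<Longrightarrow> B x * B y = c x y \<cdot>\<^sub>m B (x \<otimes> y)"
    by metis
  have detB: "det (B x) \<noteq> 0" if x: "x \<in> carrier L" for x
    using det_mult[OF B[OF x] Bi[OF x]] BBi[OF x] by auto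
  have c0: "c x y \<noteq> 0" if x: "x \<in> carrier L" and y: "y \<in> carrier L" for x y
  proof
    assume "c x y = 0"
    hence "det (c x y \<cdot>\<^sub>m B (x \<otimes> y)) = 0" using carrier_matD[OF B[of "x \<otimes> y"]] x y d_pos by simp
    thus False using det_mult[OF B[OF x] B[OF y]] c[OF x y] detB[OF x] detB[OF y] by (simp del: det_smult)
  qed
  have cancel: "s = t" if "s \<cdot>\<^sub>m B x = t \<cdot>\<^sub>m B x" and x: "x \<in> carrier L" for s t x
  proof -
    have "s \<cdot>\<^sub>m 1\<^sub>m d = t \<cdot>\<^sub>m 1\<^sub>m d"
      using that(1) mult_smult_assoc_mat[OF B[OF x] Bi[OF x]] BBi[OF x] by metis
    from arg_cong[OF this, of "\<lambda>A. A $$ (0, 0)"] show ?thesis using d_pos by simp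
  qed
  \<comment> \<open>This and \<open>c_right\<close> make \<open>c\<close> a function on pairs of
    cosets of \<open>M\<close>, so that a product over a transversal does not depend on its
    choice.\<close>
  have c_left: "c (m \<otimes> x) y = c x y" if x: "x \<in> carrier L" and y: "y \<in> carrier L" and m: "m \<in> M" for x y m
  proof (rule cancel[of _ "m \<otimes> x \<otimes> y"])
    have mx: "m \<otimes> x \<in> carrier L" and xy: "x \<otimes> y \<in> carrier L" using x y M_L[OF m] by auto
    have "c (m \<otimes> x) y \<cdot>\<^sub>m B (m \<otimes> x \<otimes> y) = \<sigma> m * (B x * B y)"
      using c[OF mx y] Bm[OF x m] as[OF \<sigma>_carrier[OF m] B[OF x] B[OF y]] by simp
    also have "\<dots> = c x y \<cdot>\<^sub>m (\<sigma> m * B (x \<otimes> y))"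
      unfolding c[OF x y] by (rule mult_smult_distrib[OF \<sigma>_carrier[OF m] B[OF xy]])
    also have "\<sigma> m * B (x \<otimes> y) = B (m \<otimes> x \<otimes> y)"
      using Bm[OF xy m] x y M_L[OF m] by (simp add: m_assoc)
    finally show "c (m \<otimes> x) y \<cdot>\<^sub>m B (m \<otimes> x \<otimes> y) = c x y \<cdot>\<^sub>m B (m \<otimes> x \<otimes> y)" .
  qed (use x y M_L[OF m] in simp)
  have c_right: "c x (m \<otimes> y) = c x y" if x: "x \<in> carrier L" and y: "y \<in> carrier L" and m: "m \<in> M" for x y m
  proof (rule cancel[of _ "x \<otimes> (m \<otimes> y)"])
    let ?m = "x \<otimes> m \<otimes> inv x"
    have m': "?m \<in> M" by (rule conj_M[OF x m])
    have my: "m \<otimes> y \<in> carrier L" and xy: "x \<otimes> y \<in> carrier L" using x y M_L[OF m] by auto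
    note S = \<sigma>_carrier[OF m] and S' = \<sigma>_carrier[OF m']
    have "c x (m \<otimes> y) \<cdot>\<^sub>m B (x \<otimes> (m \<otimes> y)) = B x * \<sigma> m * B y"
      using c[OF x my] Bm[OF y m] as[OF B[OF x] S B[OF y]] by simp
    also have "\<dots> = \<sigma> ?m * (B x * B y)"
      unfolding B\<sigma>[OF x m] by (rule as[OF S' B[OF x] B[OF y]])
    also have "\<dots> = c x y \<cdot>\<^sub>m (\<sigma> ?m * B (x \<otimes> y))"
      unfolding c[OF x y] by (rule mult_smult_distrib[OF S' B[OF xy]])
    also have "\<sigma> ?m * B (x \<otimes> y) = B (x \<otimes> (m \<otimes> y))"
      using Bm[OF xy m'] x y M_L[OF m] by (simp add: m_assoc inv_cancel)
    finally show "c x (m \<otimes> y) \<cdot>\<^sub>m B (x \<otimes> (m \<otimes> y)) = c x y \<cdot>\<^sub>m B (x \<otimes> (m \<otimes> y))" .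
  qed (use x y M_L[OF m] in simp)
  \<comment> \<open>Associativity of \<open>B x * B y * B z\<close>.\<close>
  have cocycle: "c x y * c (x \<otimes> y) z = c y z * c x (y \<otimes> z)"
    if x: "x \<in> carrier L" and y: "y \<in> carrier L" and z: "z \<in> carrier L" for x y z
  proof (rule cancel[of _ "x \<otimes> y \<otimes> z"])
    have xy: "x \<otimes> y \<in> carrier L" and yz: "y \<otimes> z \<in> carrier L" using x y z by auto
    have "(c x y * c (x \<otimes> y) z) \<cdot>\<^sub>m B (x \<otimes> y \<otimes> z) = c x y \<cdot>\<^sub>m (B (x \<otimes> y) * B z)"
      unfolding c[OF xy z] smult_smult_mat ..
    also have "\<dots> = B x * B y * B z"
      unfolding c[OF x y] by (rule mult_smult_assoc_mat[OF B[OF xy] B[OF z], symmetric])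
    also have "\<dots> = B x * (c y z \<cdot>\<^sub>m B (y \<otimes> z))"
      unfolding as[OF B[OF x] B[OF y] B[OF z]] c[OF y z] ..
    also have "\<dots> = (c y z * c x (y \<otimes> z)) \<cdot>\<^sub>m B (x \<otimes> (y \<otimes> z))"
      unfolding mult_smult_distrib[OF B[OF x] B[OF yz]] c[OF x yz] smult_smult_mat ..
    finally show "(c x y * c (x \<otimes> y) z) \<cdot>\<^sub>m B (x \<otimes> y \<otimes> z) = (c y z * c x (y \<otimes> z)) \<cdot>\<^sub>m B (x \<otimes> y \<otimes> z)"
      using x y z by (simp add: m_assoc)
  qed (use x y z in simp)
  \<comment> \<open>The product of the cocycle over its last argument, which exhibits
    \<open>c ^ q\<close> as a coboundary.\<close>
  define \<mu> where "\<mu> = (\<lambda>x. \<Prod>z\<in>T. c x z)"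
  \<comment> \<open>Left multiplication by \<open>y\<close> permutes the cosets of \<open>M\<close>,
    and \<open>c x\<close> is constant on them.\<close>
  have \<mu>_shift: "(\<Prod>z\<in>T. c x (y \<otimes> z)) = \<mu> x" if x: "x \<in> carrier L" and y: "y \<in> carrier L" for x y
  proof -
    have inj: "inj_on (\<lambda>z. rr (y \<otimes> z)) T"
    proof (rule inj_onI)
      fix z z' assume z: "z \<in> T" "z' \<in> T" and eq: "rr (y \<otimes> z) = rr (y \<otimes> z')"
      have yz: "y \<otimes> z \<in> carrier L" "y \<otimes> z' \<in> carrier L" using y TL z by auto
      let ?h = "hh (y \<otimes> z)" and ?h' = "hh (y \<otimes> z')" and ?r = "rr (y \<otimes> z)"
      have h: "?h \<in> M" "?h' \<in> M" "?r \<in> carrier L" using dM[OF yz(1)] dM[OF yz(2)] TL[OF dT[OF yz(1)]] by auto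
      have e1: "y \<otimes> z = ?h \<otimes> ?r" by (rule dE[OF yz(1)])
      have e2: "y \<otimes> z' = ?h' \<otimes> ?r" unfolding eq by (rule dE[OF yz(2)])
      let ?k = "?h' \<otimes> inv ?h"
      have k: "?k \<in> M" using h by simp
      have "?k \<otimes> (y \<otimes> z) = ?k \<otimes> (?h \<otimes> ?r)" by (rule arg_cong[OF e1])
      also have "\<dots> = ?h' \<otimes> ?r"
        using h(3) M_L[OF h(1)] M_L[OF h(2)] by (simp add: m_assoc inv_cancel)
      also have "\<dots> = y \<otimes> z'" by (rule e2[symmetric])
      finally have "y \<otimes> z' = ?k \<otimes> (y \<otimes> z)" by (rule sym)
      hence "inv y \<otimes> (y \<otimes> z') = inv y \<otimes> (?k \<otimes> (y \<otimes> z))" by simp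
      hence "z' = (inv y \<otimes> ?k \<otimes> y) \<otimes> z"
        using y TL[OF z(1)] TL[OF z(2)] M_L[OF k] by (simp add: m_assoc inv_cancel)
      hence "rr z' = z" using uni[OF inv_op_closed1[OF y k] z(1)] by simp
      moreover have "rr z' = z'" using uni[OF subgroup.one_closed[OF subgroup_axioms] z(2)] TL[OF z(2)] by simp
      ultimately show "z = z'" by simp
    qed
    have sub: "(\<lambda>z. rr (y \<otimes> z)) ` T \<subseteq> T" using dT y TL by auto
    have bij: "bij_betw (\<lambda>z. rr (y \<otimes> z)) T T"
      using endo_inj_surj[OF T(2) sub inj] inj by (simp add: bij_betw_def)
    have "(\<Prod>z\<in>T. c x (y \<otimes> z)) = (\<Prod>z\<in>T. c x (rr (y \<otimes> z)))"
    proof (rule prod.cong)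
      fix z assume z: "z \<in> T"
      have yz: "y \<otimes> z \<in> carrier L" using y TL z by auto
      have "c x (hh (y \<otimes> z) \<otimes> rr (y \<otimes> z)) = c x (rr (y \<otimes> z))"
        by (rule c_right[OF x TL[OF dT[OF yz]] dM[OF yz]])
      thus "c x (y \<otimes> z) = c x (rr (y \<otimes> z))" using arg_cong[OF dE[OF yz], of "c x"] by (rule trans[rotated])
    qed simp
    also have "\<dots> = \<mu> x" unfolding \<mu>_def by (rule prod.reindex_bij_betw[OF bij])
    finally show ?thesis .
  qed
  \<comment> \<open>The cocycle identity multiplied over all \<open>z\<close> in the
    transversal.\<close>
  have \<mu>_mult: "c x y ^ q * \<mu> (x \<otimes> y) = \<mu> x * \<mu> y" if x: "x \<in> carrier L" and y: "y \<in> carrier L" for x y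
  proof -
    have "c x y ^ q * \<mu> (x \<otimes> y) = (\<Prod>z\<in>T. c x y * c (x \<otimes> y) z)"
      by (simp add: \<mu>_def prod.distrib cT)
    also have "\<dots> = (\<Prod>z\<in>T. c y z * c x (y \<otimes> z))"
      by (intro prod.cong refl cocycle[OF x y TL])
    also have "\<dots> = \<mu> y * \<mu> x" by (simp add: prod.distrib \<mu>_shift[OF x y]) (simp add: \<mu>_def)
    finally show ?thesis by simp
  qed
  have \<mu>0: "\<mu> x \<noteq> 0" if "x \<in> carrier L" for x unfolding \<mu>_def using T(2) c0[OF that TL] by simp
  have \<mu>_M: "\<mu> (m \<otimes> x) = \<mu> x" if "x \<in> carrier L" "m \<in> M" for x m
    unfolding \<mu>_def by (intro prod.cong refl c_left[OF that(1) TL that(2)])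
  \<comment> \<open>The complementary tensor factor: \<open>\<rho> x = A x * \<Phi> (B x)\<close>,
    with \<open>A x\<close> in the commutant of \<open>\<rho>\<close> on \<open>M\<close>.\<close>
  define A where "A = (\<lambda>x. \<rho> x * \<Phi> (Bi x))"
  have A: "A x \<in> carrier_mat n n" if "x \<in> carrier L" for x
    unfolding A_def by (rule mcn[OF \<rho>_carrier[OF that] \<Phi>_carrier])
  have A_comm: "A x * \<rho> m = \<rho> m * A x" if x: "x \<in> carrier L" and m: "m \<in> M" for x m
  proof -
    let ?m = "inv x \<otimes> m \<otimes> x"
    have m': "?m \<in> M" by (rule inv_op_closed1[OF x m])
    have e: "x \<otimes> ?m \<otimes> inv x = m" and e': "x \<otimes> ?m = m \<otimes> x"
      using x M_L[OF m] by (simp_all add: m_assoc inv_cancel)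
    note R = \<rho>_carrier[OF x] and Rm = \<rho>_carrier[OF M_L[OF m]] and Rm' = \<rho>_carrier[OF M_L[OF m']]
    have "A x * \<rho> m = \<rho> x * (\<Phi> (Bi x) * \<Phi> (\<sigma> m))"
      unfolding A_def \<Phi>_\<sigma>[OF m] by (rule asn[OF R \<Phi>_carrier Rm])
    also have "\<Phi> (Bi x) * \<Phi> (\<sigma> m) = \<Phi> (\<sigma> ?m * Bi x)"
      using \<Phi>_mult[OF Bi[OF x] \<sigma>_carrier[OF m]] Bi\<sigma>[OF x m'] unfolding e by simp
    also have "\<dots> = \<rho> ?m * \<Phi> (Bi x)" by (rule \<Phi>_left[OF m' Bi[OF x], symmetric])
    also have "\<rho> x * (\<rho> ?m * \<Phi> (Bi x)) = \<rho> x * \<rho> ?m * \<Phi> (Bi x)" by (rule asn[OF R Rm' \<Phi>_carrier, symmetric])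
    also have "\<rho> x * \<rho> ?m = \<rho> m * \<rho> x"
      using \<rho>_mult[OF x M_L[OF m']] \<rho>_mult[OF M_L[OF m] x] e' by simp
    also have "\<rho> m * \<rho> x * \<Phi> (Bi x) = \<rho> m * A x" unfolding A_def by (rule asn[OF Rm R \<Phi>_carrier])
    finally show ?thesis .
  qed
  \<comment> \<open>Since \<open>\<rho>\<close> is a true representation, the scalars of
    \<open>A\<close> are inverse to those of \<open>B\<close>.\<close>
  have A_mult: "c x y \<cdot>\<^sub>m (A x * A y) = A (x \<otimes> y)" if x: "x \<in> carrier L" and y: "y \<in> carrier L" for x y
  proof -
    have xy: "x \<otimes> y \<in> carrier L" using x y by simp
    note Rx = \<rho>_carrier[OF x] and Ry = \<rho>_carrier[OF y]
    have W: "Bi y * Bi x \<in> carrier_mat d d" by (rule mc[OF Bi[OF y] Bi[OF x]])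
    have "B (x \<otimes> y) * (c x y \<cdot>\<^sub>m (Bi y * Bi x)) = c x y \<cdot>\<^sub>m (B (x \<otimes> y) * (Bi y * Bi x))"
      by (rule mult_smult_distrib[OF B[OF xy] W])
    also have "\<dots> = B x * B y * (Bi y * Bi x)"
      unfolding c[OF x y] by (rule mult_smult_assoc_mat[OF B[OF xy] W, symmetric])
    also have "\<dots> = B x * (B y * (Bi y * Bi x))" by (rule as[OF B[OF x] B[OF y] W])
    also have "B y * (Bi y * Bi x) = Bi x"
      using as[OF B[OF y] Bi[OF y] Bi[OF x]] BBi[OF y] left_mult_one_mat[OF Bi[OF x]] by simp
    also have "B x * Bi x = 1\<^sub>m d" by (rule BBi[OF x])
    finally have inv: "Bi (x \<otimes> y) = c x y \<cdot>\<^sub>m (Bi y * Bi x)" using W by (intro unique_inv[OF xy]) auto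
    have "A x * A y = \<rho> x * (\<Phi> (Bi x) * A y)"
      unfolding A_def[of ] by (rule asn[OF Rx \<Phi>_carrier mcn[OF Ry \<Phi>_carrier]])
    also have "\<Phi> (Bi x) * A y = A y * \<Phi> (Bi x)" by (rule \<Phi>_commutes[OF A[OF y] A_comm[OF y], symmetric])
    also have "A y * \<Phi> (Bi x) = \<rho> y * \<Phi> (Bi y * Bi x)"
      unfolding A_def asn[OF Ry \<Phi>_carrier \<Phi>_carrier] \<Phi>_mult[OF Bi[OF y] Bi[OF x]] ..
    also have "\<rho> x * (\<rho> y * \<Phi> (Bi y * Bi x)) = \<rho> (x \<otimes> y) * \<Phi> (Bi y * Bi x)"
      using asn[OF Rx Ry \<Phi>_carrier] \<rho>_mult[OF x y] by simp
    finally have "c x y \<cdot>\<^sub>m (A x * A y) = \<rho> (x \<otimes> y) * (c x y \<cdot>\<^sub>m \<Phi> (Bi y * Bi x))"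
      using mult_smult_distrib[OF \<rho>_carrier[OF xy] \<Phi>_carrier] by simp
    thus ?thesis unfolding A_def inv \<Phi>_smult[OF W] .
  qed
  have A_inv: "A x * (\<Phi> (B x) * \<rho> (inv x)) = 1\<^sub>m n" and A_\<rho>: "A x * \<Phi> (B x) = \<rho> x" if x: "x \<in> carrier L" for x
  proof -
    note R = \<rho>_carrier[OF x] and Ri = \<rho>_carrier[OF inv_closed[OF x]]
    show A\<rho>: "A x * \<Phi> (B x) = \<rho> x"
      unfolding A_def asn[OF R \<Phi>_carrier \<Phi>_carrier] \<Phi>_mult[OF Bi[OF x] B[OF x]] BiB[OF x] \<Phi>_one
      by (rule right_mult_one_mat[OF R])
    show "A x * (\<Phi> (B x) * \<rho> (inv x)) = 1\<^sub>m n"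
      unfolding asn[OF A[OF x] \<Phi>_carrier Ri, symmetric] A\<rho> by (rule rep_inv(1)[OF rep grp x])
  qed
  \<comment> \<open>The determinant of an \<open>n \<times> n\<close> matrix turns the scalar
    \<open>c x y\<close> into \<open>c x y ^ n\<close>, so \<open>D\<close> exhibits the inverse of
    the \<open>n\<close>-th power of the cocycle as a coboundary.\<close>
  define D where "D = (\<lambda>x. det (A x))"
  have D0: "D x \<noteq> 0" if x: "x \<in> carrier L" for x
  proof -
    have "D x * det (\<Phi> (B x) * \<rho> (inv x)) = det (A x * (\<Phi> (B x) * \<rho> (inv x)))"
      unfolding D_def
      by (rule det_mult[OF A[OF x] mcn[OF \<Phi>_carrier \<rho>_carrier[OF inv_closed[OF x]]], symmetric])
    also have "\<dots> = 1" unfolding A_inv[OF x] by simp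
    finally have "D x * det (\<Phi> (B x) * \<rho> (inv x)) = 1" .
    thus ?thesis by auto
  qed
  have D_mult: "c x y ^ n * (D x * D y) = D (x \<otimes> y)" if x: "x \<in> carrier L" and y: "y \<in> carrier L" for x y
  proof -
    have "D (x \<otimes> y) = c x y ^ n * det (A x * A y)"
      unfolding D_def A_mult[OF x y, symmetric] using carrier_matD[OF mcn[OF A[OF x] A[OF y]]] by simp
    thus ?thesis using det_mult[OF A[OF x] A[OF y]] by (simp add: D_def)
  qed
  have D_M: "D (m \<otimes> x) = D x" if x: "x \<in> carrier L" and m: "m \<in> M" for x m
  proof -
    have im: "inv m \<in> M" using m by simp
    have mx: "m \<otimes> x \<in> carrier L" using x M_L[OF m] by simp
    note S = \<sigma>_carrier[OF m] and Si = \<sigma>_carrier[OF im]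
    note R = \<rho>_carrier[OF M_L[OF m]] and Ri = \<rho>_carrier[OF M_L[OF im]]
    have W: "Bi x * \<sigma> (inv m) \<in> carrier_mat d d" by (rule mc[OF Bi[OF x] Si])
    have "B (m \<otimes> x) * (Bi x * \<sigma> (inv m)) = \<sigma> m * (B x * (Bi x * \<sigma> (inv m)))"
      unfolding Bm[OF x m] by (rule as[OF S B[OF x] W])
    also have "B x * (Bi x * \<sigma> (inv m)) = \<sigma> (inv m)"
      using as[OF B[OF x] Bi[OF x] Si] BBi[OF x] left_mult_one_mat[OF Si] by simp
    also have "\<sigma> m * \<sigma> (inv m) = 1\<^sub>m d" by (rule \<sigma>_inv(1)[OF m])
    finally have inv: "Bi (m \<otimes> x) = Bi x * \<sigma> (inv m)" by (rule unique_inv[OF mx W])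
    have "A (m \<otimes> x) = \<rho> m * \<rho> x * (\<Phi> (Bi x) * \<rho> (inv m))"
      unfolding A_def inv \<rho>_mult[OF M_L[OF m] x] \<Phi>_\<sigma>[OF im, symmetric] \<Phi>_mult[OF Bi[OF x] Si] ..
    also have "\<dots> = \<rho> m * (\<rho> x * (\<Phi> (Bi x) * \<rho> (inv m)))"
      by (rule asn[OF R \<rho>_carrier[OF x] mcn[OF \<Phi>_carrier Ri]])
    also have "\<rho> x * (\<Phi> (Bi x) * \<rho> (inv m)) = A x * \<rho> (inv m)"
      unfolding A_def by (rule asn[OF \<rho>_carrier[OF x] \<Phi>_carrier Ri, symmetric])
    also have "\<dots> = \<rho> (inv m) * A x" by (rule A_comm[OF x im])
    also have "\<rho> m * (\<rho> (inv m) * A x) = A x"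
      using asn[OF R Ri A[OF x]] rep_inv(1)[OF rep grp M_L[OF m]] left_mult_one_mat[OF A[OF x]] by simp
    finally show ?thesis by (simp add: D_def)
  qed
  have "q \<noteq> 0" using q finite_L grp card_gt_0_iff one_closed by (metis mult_0 less_irrefl empty_iff)
  \<comment> \<open>Coprimality of \<open>n\<close> and \<open>q\<close> in the subtraction-free
    form of Bezout's identity.\<close>
  then obtain u v where uv: "q * u = n * v + 1"
    using bezout_nat[of q n] cop by (auto simp: coprime_iff_gcd_eq_1 gcd.commute)
  \<comment> \<open>As \<open>q * u - n * v = 1\<close>, the cocycle is \<open>c ^ (q * u)\<close>
    divided by \<open>c ^ (n * v)\<close>; \<open>\<mu> ^ u\<close> splits the first factor and
    \<open>D ^ v\<close>, which belongs to the inverse cocycle, the second.\<close>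
  define \<nu> where "\<nu> = (\<lambda>x. \<mu> x ^ u * D x ^ v)"
  have \<nu>0: "\<nu> x \<noteq> 0" if "x \<in> carrier L" for x using \<mu>0[OF that] D0[OF that] by (simp add: \<nu>_def)
  have \<nu>_mult: "\<nu> x * \<nu> y = c x y * \<nu> (x \<otimes> y)" if x: "x \<in> carrier L" and y: "y \<in> carrier L" for x y
  proof -
    let ?c = "c x y"
    have "?c ^ (n * v) * (\<nu> x * \<nu> y) = (\<mu> x * \<mu> y) ^ u * (?c ^ n * (D x * D y)) ^ v"
      by (simp add: \<nu>_def power_mult_distrib power_mult mult_ac)
    also have "\<dots> = (?c ^ q * \<mu> (x \<otimes> y)) ^ u * D (x \<otimes> y) ^ v"
      unfolding \<mu>_mult[OF x y] D_mult[OF x y] ..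
    also have "\<dots> = ?c ^ (q * u) * \<nu> (x \<otimes> y)"
      by (simp add: \<nu>_def power_mult_distrib power_mult mult_ac)
    also have "\<dots> = ?c ^ (n * v) * (?c * \<nu> (x \<otimes> y))" unfolding uv by (simp add: mult_ac)
    finally show ?thesis using c0[OF x y] by simp
  qed
  have \<nu>_M: "\<nu> (m \<otimes> x) = \<nu> x" if "x \<in> carrier L" "m \<in> M" for x m
    unfolding \<nu>_def \<mu>_M[OF that] D_M[OF that] ..
  let ?B = "\<lambda>x. (1 / \<nu> x) \<cdot>\<^sub>m B x"
  have repB: "representation L d ?B"
  proof (rule representationI_invertible[OF grp d_pos])
    show "?B x \<in> carrier_mat d d" if "x \<in> carrier L" for x using B[OF that] by simp
    show "\<nu> \<one> \<cdot>\<^sub>m Bi \<one> \<in> carrier_mat d d" using Bi[of \<one>] by simp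
    have o: "\<one> \<in> carrier L" by simp
    have "?B \<one> * (\<nu> \<one> \<cdot>\<^sub>m Bi \<one>) = \<nu> \<one> \<cdot>\<^sub>m (?B \<one> * Bi \<one>)"
      using B[OF o] Bi[OF o] by (intro mult_smult_distrib) auto
    also have "?B \<one> * Bi \<one> = (1 / \<nu> \<one>) \<cdot>\<^sub>m (B \<one> * Bi \<one>)"
      by (rule mult_smult_assoc_mat[OF B[OF o] Bi[OF o]])
    finally show "?B \<one> * (\<nu> \<one> \<cdot>\<^sub>m Bi \<one>) = 1\<^sub>m d"
      unfolding BBi[OF o] smult_smult_mat using \<nu>0[OF o] by (auto intro!: eq_matI)
    fix x y assume xy: "x \<in> carrier L" "y \<in> carrier L"
    have xyL: "x \<otimes> y \<in> carrier L" using xy by simp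
    have "?B x * ?B y = (1 / \<nu> y) \<cdot>\<^sub>m (?B x * B y)"
      using B[OF xy(1)] B[OF xy(2)] by (intro mult_smult_distrib) auto
    also have "?B x * B y = (1 / \<nu> x) \<cdot>\<^sub>m (B x * B y)"
      by (rule mult_smult_assoc_mat[OF B[OF xy(1)] B[OF xy(2)]])
    finally have "?B x * ?B y = (1 / \<nu> y * (1 / \<nu> x * c x y)) \<cdot>\<^sub>m B (x \<otimes> y)"
      unfolding c[OF xy] smult_smult_mat .
    moreover have "1 / \<nu> y * (1 / \<nu> x * c x y) = 1 / \<nu> (x \<otimes> y)"
      using \<nu>_mult[OF xy] \<nu>0[OF xy(1)] \<nu>0[OF xy(2)] \<nu>0[OF xyL] c0[OF xy] by (simp add: field_simps)
    ultimately show "?B (x \<otimes> y) = ?B x * ?B y" by simp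
  qed
  \<comment> \<open>The scaling is constant on cosets, so
    \<open>?B m = \<sigma> m * ?B \<one>\<close>, and a representation is the identity at
    \<open>\<one>\<close>.\<close>
  moreover have "?B m = \<sigma> m" if m: "m \<in> M" for m
  proof -
    have o: "\<one> \<in> carrier L" by simp
    have "?B (m \<otimes> \<one>) = (1 / \<nu> \<one>) \<cdot>\<^sub>m (\<sigma> m * B \<one>)"
      unfolding \<nu>_M[OF o m] Bm[OF o m] ..
    also have "\<dots> = \<sigma> m * ?B \<one>" by (rule mult_smult_distrib[OF \<sigma>_carrier[OF m] B[OF o], symmetric])
    also have "?B \<one> = 1\<^sub>m d" by (rule rep_one[OF repB grp])
    finally show ?thesis using right_mult_one_mat[OF \<sigma>_carrier[OF m]] M_L[OF m] by simp
  qed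
  \<comment> \<open>With the reciprocal scaling \<open>A\<close> becomes a representation of degree
    \<open>n\<close>, so its traces are at most \<open>n\<close> in modulus; the scalings cancel in
    the product of traces, which is \<open>d\<close> times the trace of
    \<open>\<rho> x\<close>.\<close>
  moreover have "real d * cmod (mat_trace (\<rho> x)) \<le> real n * cmod (mat_trace (?B x))" if x: "x \<in> carrier L" for x
  proof -
    let ?A = "\<lambda>x. \<nu> x \<cdot>\<^sub>m A x"
    have repA: "representation L n ?A"
    proof (rule representationI_invertible[OF grp n_pos])
      show "?A x \<in> carrier_mat n n" if "x \<in> carrier L" for x using A[OF that] by simp
      have o: "\<one> \<in> carrier L" by simp
      let ?Y = "\<Phi> (B \<one>) * \<rho> (inv \<one>)"
      have Y: "?Y \<in> carrier_mat n n" by (rule mcn[OF \<Phi>_carrier \<rho>_carrier[OF inv_closed[OF o]]])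
      show "(1 / \<nu> \<one>) \<cdot>\<^sub>m ?Y \<in> carrier_mat n n" using Y by simp
      have "?A \<one> * ((1 / \<nu> \<one>) \<cdot>\<^sub>m ?Y) = (1 / \<nu> \<one>) \<cdot>\<^sub>m (?A \<one> * ?Y)"
        using A[OF o] Y by (intro mult_smult_distrib) auto
      also have "?A \<one> * ?Y = \<nu> \<one> \<cdot>\<^sub>m (A \<one> * ?Y)" by (rule mult_smult_assoc_mat[OF A[OF o] Y])
      finally show "?A \<one> * ((1 / \<nu> \<one>) \<cdot>\<^sub>m ?Y) = 1\<^sub>m n"
        unfolding A_inv[OF o] smult_smult_mat using \<nu>0[OF o] by (auto intro!: eq_matI)
      fix x y assume xy: "x \<in> carrier L" "y \<in> carrier L"
      have "?A x * ?A y = \<nu> y \<cdot>\<^sub>m (?A x * A y)"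
        using A[OF xy(1)] A[OF xy(2)] by (intro mult_smult_distrib) auto
      also have "?A x * A y = \<nu> x \<cdot>\<^sub>m (A x * A y)"
        by (rule mult_smult_assoc_mat[OF A[OF xy(1)] A[OF xy(2)]])
      finally have "?A x * ?A y = (\<nu> x * \<nu> y) \<cdot>\<^sub>m (A x * A y)" by (simp add: smult_smult_mat mult.commute)
      also have "\<dots> = \<nu> (x \<otimes> y) \<cdot>\<^sub>m (c x y \<cdot>\<^sub>m (A x * A y))"
        unfolding \<nu>_mult[OF xy] smult_smult_mat by (simp add: mult.commute)
      finally show "?A (x \<otimes> y) = ?A x * ?A y" unfolding A_mult[OF xy] by simp
    qed
    have "cmod (afforded_char L ?A x) \<le> cmod (afforded_char L ?A \<one>)"
      by (rule char_norm_le[OF afforded_charI[OF repA] grp finite_L x])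
    hence bound: "cmod (mat_trace (?A x)) \<le> real n" using x afforded_char_one[OF repA grp] by simp
    have "of_nat d * mat_trace (\<rho> x) = mat_trace (A x) * mat_trace (B x)"
      using trace_commutant_mult[OF A[OF x] A_comm[OF x] B[OF x]] A_\<rho>[OF x] by simp
    also have "\<dots> = mat_trace (?A x) * mat_trace (?B x)"
      unfolding mat_trace_smult[OF A[OF x]] mat_trace_smult[OF B[OF x]] using \<nu>0[OF x] by simp
    finally have "real d * cmod (mat_trace (\<rho> x)) = cmod (mat_trace (?A x)) * cmod (mat_trace (?B x))"
      by (metis norm_mult norm_of_nat)
    thus ?thesis using bound by (simp add: mult_right_mono)
  qed
  ultimately show ?thesis by blast
qed

end

section \<open>The two inductive steps\<close>

text \<open>\<open>Irr\<close> only provides some irreducible representation with the given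
  character; this transfers irreducibility to the representation at hand. In a decomposition, a
  constituent of one summand would be the whole character by orthogonality, against the
  degrees.\<close>

lemma irr_char_rep_irreducible:
  assumes rep: "representation G n \<rho>" and G: "group G" "finite (carrier G)" and irr: "afforded_char G \<rho> \<in> Irr G"
  shows "irreducible_representation G n \<rho>"
proof (rule ccontr)
  let ?\<chi> = "afforded_char G \<rho>"
  assume "\<not> ?thesis"
  then obtain k l \<rho>1 \<rho>2 where r: "representation G k \<rho>1" "representation G l \<rho>2" "n = k + l"
    "\<And>g. g \<in> carrier G \<Longrightarrow> mat_trace (\<rho> g) = mat_trace (\<rho>1 g) + mat_trace (\<rho>2 g)"
  proof -
    assume a: "\<not> irreducible_representation G n \<rho>"
    show ?thesis by (rule reducible_decomposition[OF rep G(1) a]) (rule that, assumption+)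
  qed
  let ?\<chi>1 = "afforded_char G \<rho>1" and ?\<chi>2 = "afforded_char G \<rho>2"
  have sum: "?\<chi> = (\<lambda>g. ?\<chi>1 g + ?\<chi>2 g)" using r(4) by (auto simp: afforded_char_def)
  obtain \<psi>s where \<psi>s: "\<psi>s \<noteq> []" "set \<psi>s \<subseteq> Irr G" "?\<chi>1 = (\<lambda>g. \<Sum>\<psi>\<leftarrow>\<psi>s. \<psi> g)"
    by (rule char_is_sum_of_irr[OF afforded_charI[OF r(1)] G(1)])
  define \<psi> where "\<psi> = hd \<psi>s"
  have \<psi>: "\<psi> \<in> set \<psi>s" "\<psi> \<in> Irr G" using \<psi>s(1,2) by (auto simp: \<psi>_def)
  have c1: "\<psi> \<in> irr_constituents G ?\<chi>1" by (rule irr_constituents_of_sum[OF \<psi>s(2) \<psi>(1) \<psi>s(3) G(1)])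
  obtain k1 where k1: "char_ip G ?\<chi>1 \<psi> = of_nat k1" by (rule char_ip_nat[OF afforded_charI[OF r(1)] \<psi>(2) G])
  obtain k2 where k2: "char_ip G ?\<chi>2 \<psi> = of_nat k2" by (rule char_ip_nat[OF afforded_charI[OF r(2)] \<psi>(2) G])
  have "k1 \<noteq> 0" using constituent_ip[OF c1 G] k1 by simp
  have "char_ip G ?\<chi> \<psi> = of_nat (k1 + k2)"
    unfolding sum using k1 k2 by (simp add: char_ip_def sum.distrib distrib_right add_divide_distrib)
  hence "char_ip G ?\<chi> \<psi> \<noteq> 0" using \<open>k1 \<noteq> 0\<close> by (simp only: of_nat_eq_0_iff)
  hence eq: "?\<chi> = \<psi>" using char_ip_irr[OF irr \<psi>(2) G] by (metis (no_types))
  consider "?\<chi>1 = \<psi>" | \<phi> where "\<phi> \<in> characters G" "?\<chi>1 = (\<lambda>g. \<psi> g + \<phi> g)"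
    using c1 by (auto simp: irr_constituents_def)
  hence "\<exists>j. k = n + j"
  proof cases
    case 1
    hence "?\<chi>1 \<one>\<^bsub>G\<^esub> = ?\<chi> \<one>\<^bsub>G\<^esub>" using eq by simp
    thus ?thesis unfolding afforded_char_one[OF r(1) G(1)] afforded_char_one[OF rep G(1)] by simp
  next
    case 2
    obtain j where j: "\<phi> \<one>\<^bsub>G\<^esub> = of_nat j" using char_degree[OF 2(1) G(1)] by blast
    have "?\<chi>1 \<one>\<^bsub>G\<^esub> = ?\<chi> \<one>\<^bsub>G\<^esub> + of_nat j" using 2(2) eq j by metis
    hence "(of_nat k :: complex) = of_nat (n + j)"
      unfolding afforded_char_one[OF r(1) G(1)] afforded_char_one[OF rep G(1)] by simp
    thus ?thesis by (simp only: of_nat_eq_iff) blast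
  qed
  thus False using r(3) rep_dim_pos[OF r(2) G(1)] by auto
qed

lemma restrict_to_eqI:
  assumes "\<phi> \<in> Irr (G\<lparr>carrier := H\<rparr>)" "\<And>x. x \<in> H \<Longrightarrow> \<chi> x = \<phi> x"
  shows "restrict_to H \<chi> = \<phi>"
proof
  fix x
  show "restrict_to H \<chi> x = \<phi> x"
    using char_outside[OF subsetD[OF Irr_subset_characters assms(1)], of x] assms(2)[of x]
    by (cases "x \<in> H") (simp_all add: restrict_to_def)
qed

text \<open>Schur orthogonality for the restriction to \<open>M\<close>, with
  \<open>\<rho> x\<close> and its inverse as test matrices. They multiply to the identity, so every
  coset gives the same value as \<open>M\<close> itself.\<close>

lemma coset_norm_sum:
  fixes L (structure)
  assumes G: "group L" "finite (carrier L)" and M: "subgroup M L" and \<chi>: "\<chi> \<in> characters L"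
    and irr: "restrict_to M \<chi> \<in> Irr (L\<lparr>carrier := M\<rparr>)" and x: "x \<in> carrier L"
  shows "(\<Sum>m\<in>M. (cmod (\<chi> (x \<otimes> m)))\<^sup>2) = real (card M)"
proof -
  interpret group L by fact
  interpret M: subgroup M L by fact
  let ?K = "L\<lparr>carrier := M\<rparr>"
  have gr: "group ?K" by (rule M.subgroup_is_group[OF G(1)])
  have finK: "finite (carrier ?K)" using G(2) M.subset finite_subset by auto
  obtain n \<rho> where r: "representation L n \<rho>" "\<chi> = afforded_char L \<rho>"
    using characters_eq_afforded[OF \<chi>] by blast
  note R = rep_carrier[OF r(1) G(1)]
  have res: "restrict_to M \<chi> = afforded_char ?K \<rho>"
    using M.subset by (auto simp: restrict_to_def r(2) afforded_char_def)
  have ir: "irreducible_representation ?K n \<rho>"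
    by (rule irr_char_rep_irreducible[OF rep_restrict[OF r(1) G(1) M] gr finK]) (use irr res in simp)
  have ix: "inv x \<in> carrier L" using x by simp
  have "(of_real (\<Sum>m\<in>M. (cmod (\<chi> (x \<otimes> m)))\<^sup>2) :: complex) = (\<Sum>m\<in>M. \<chi> (x \<otimes> m) * cnj (\<chi> (x \<otimes> m)))"
    by (simp add: complex_norm_square[symmetric] del: of_real_power)
  also have "\<dots> = (\<Sum>m\<in>carrier ?K. mat_trace (\<rho> x * \<rho> m) * mat_trace (\<rho> (inv x) * \<rho> (inv\<^bsub>?K\<^esub> m)))"
  proof (rule sum.cong)
    fix m assume "m \<in> carrier ?K"
    hence m: "m \<in> M" "m \<in> carrier L" using M.subset by auto
    have xm: "x \<otimes> m \<in> carrier L" using x m by simp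
    have "cnj (\<chi> (x \<otimes> m)) = \<chi> (inv (x \<otimes> m))" by (rule char_inv[OF \<chi> G xm, symmetric])
    also have "\<dots> = mat_trace (\<rho> (inv m) * \<rho> (inv x))"
      using x m rep_mult[OF r(1) G(1), of "inv m" "inv x"] by (simp add: inv_mult_group r(2))
    also have "\<dots> = mat_trace (\<rho> (inv x) * \<rho> (inv m))"
      by (rule mat_trace_comm[OF R R]) (use x m in auto)
    finally have "cnj (\<chi> (x \<otimes> m)) = mat_trace (\<rho> (inv x) * \<rho> (inv\<^bsub>?K\<^esub> m))"
      using m_inv_consistent[OF M m(1)] by simp
    moreover have "\<chi> (x \<otimes> m) = mat_trace (\<rho> x * \<rho> m)"
      using xm rep_mult[OF r(1) G(1) x m(2)] by (simp add: r(2))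
    ultimately show "\<chi> (x \<otimes> m) * cnj (\<chi> (x \<otimes> m)) = mat_trace (\<rho> x * \<rho> m) * mat_trace (\<rho> (inv x) * \<rho> (inv\<^bsub>?K\<^esub> m))"
      by simp
  qed simp
  also have "\<dots> = of_nat (card M)"
    unfolding trace_orthogonality_same[OF ir gr R[OF x] R[OF ix]] rep_inv(1)[OF r(1) G(1) x]
    using rep_dim_pos[OF r(1) G(1)] by simp
  finally have "(of_real (\<Sum>m\<in>M. (cmod (\<chi> (x \<otimes> m)))\<^sup>2) :: complex) = of_real (real (card M))" by simp
  thus ?thesis by (simp only: of_real_eq_iff)
qed

text \<open>By \<open>rep_scalar_of_norm\<close>, an element \<open>m\<close> at which
  \<open>\<beta>\<close> has maximal modulus acts as the scalar
  \<open>\<beta> m / \<beta> \<one>\<close>.\<close>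

lemma scalar_char_values:
  fixes L (structure)
  assumes G: "group L" "finite (carrier L)" and M: "subgroup M L" and \<beta>: "\<beta> \<in> characters L"
    and ext: "\<And>m. m \<in> M \<Longrightarrow> cmod (\<beta> m) = cmod (\<beta> \<one>)" and m: "m \<in> M" and x: "x \<in> carrier L"
  shows "\<beta> (x \<otimes> m) = \<beta> m / \<beta> \<one> * \<beta> x"
proof -
  interpret group L by fact
  obtain n \<rho> where r: "representation L n \<rho>" "\<beta> = afforded_char L \<rho>"
    using characters_eq_afforded[OF \<beta>] by blast
  note R = rep_carrier[OF r(1) G(1)]
  have mL: "m \<in> carrier L" using m subgroup.subset[OF M] by blast
  have b1: "\<beta> \<one> = of_nat n" using afforded_char_one[OF r(1) G(1)] r(2) by simp
  have "cmod (mat_trace (\<rho> m)) = real n" using ext[OF m] mL unfolding b1 by (simp add: r(2))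
  from rep_scalar_of_norm[OF r(1) G mL this] have sc: "\<rho> m = (mat_trace (\<rho> m) / of_nat n) \<cdot>\<^sub>m 1\<^sub>m n" .
  have "\<rho> (x \<otimes> m) = (mat_trace (\<rho> m) / of_nat n) \<cdot>\<^sub>m (\<rho> x * 1\<^sub>m n)"
    unfolding rep_mult[OF r(1) G(1) x mL] using mult_smult_distrib[OF R[OF x] one_carrier_mat] sc by metis
  hence "mat_trace (\<rho> (x \<otimes> m)) = mat_trace (\<rho> m) / of_nat n * mat_trace (\<rho> x)"
    unfolding right_mult_one_mat[OF R[OF x]] using mat_trace_smult[OF R[OF x]] by simp
  thus ?thesis unfolding b1 using x mL by (simp add: r(2))
qed

text \<open>Since \<open>\<alpha>\<close> has degree coprime to \<open>q = |L : M|\<close>, the constituent of \<open>\<alpha>\<close> on \<open>M\<close> extends to \<open>L\<close>.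
  If \<open>\<tau>\<close> stays irreducible on \<open>M\<close>, comparing the sums of squared norms of \<open>\<alpha>\<close> and \<open>\<tau>\<close> over a coset
  of \<open>M\<close> forces \<open>\<bar>\<beta>\<bar>\<close> to be maximal there.\<close>

lemma coprime_degree_step:
  fixes L (structure)
  assumes N: "M \<lhd> L" and fin: "finite (carrier L)" and q: "card (carrier L) = q * card M"
    and \<alpha>: "\<alpha> \<in> characters L" "\<alpha> \<one> = of_nat n" and cop: "coprime n q"
    and \<beta>: "\<beta> \<in> characters L" and ext: "\<And>m. m \<in> M \<Longrightarrow> cmod (\<beta> m) = cmod (\<beta> \<one>)"
    and \<tau>: "\<tau> \<in> Irr L" "t > 0" "\<And>x. x \<in> carrier L \<Longrightarrow> \<alpha> x * \<beta> x = of_nat t * \<tau> x"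
    and \<tau>': "\<tau>' \<in> Irr (L\<lparr>carrier := M\<rparr>)" "t' > 0" "\<And>m. m \<in> M \<Longrightarrow> \<alpha> m * \<beta> m = of_nat t' * \<tau>' m"
  shows "\<exists>e>0. \<exists>\<theta>\<in>characters L. (\<forall>m\<in>M. \<tau> m = of_nat e * (\<beta> m / \<beta> \<one> * \<theta> m)) \<and>
    (e = 1 \<longrightarrow> (\<forall>x\<in>carrier L. cmod (\<beta> x) = cmod (\<beta> \<one>)))"
proof -
  interpret group L using N by (simp add: normal_def)
  interpret M: normal M L by fact
  have G: "group L" by (rule is_group)
  have M: "subgroup M L" by (rule M.subgroup_axioms)
  let ?K = "L\<lparr>carrier := M\<rparr>"
  have gr: "group ?K" by (rule M.subgroup_is_group[OF G])
  have finK: "finite (carrier ?K)" using fin M.subset finite_subset by auto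
  have cM: "card M > 0" proof -
    have "M \<noteq> {}" using M.one_closed by blast
    thus ?thesis using finK by (simp add: card_gt_0_iff)
  qed
  have mL: "m \<in> carrier L" if "m \<in> M" for m using that M.subset by blast
  obtain b where b: "b > 0" "\<beta> \<one> = of_nat b" by (rule char_degree[OF \<beta> G])
  \<comment> \<open>The linear character of \<open>M\<close> of which \<open>\<beta>\<close> is a
    multiple there.\<close>
  define l where "l = (\<lambda>m. \<beta> m / of_nat b)"
  have l_norm: "cmod (l m) = 1" if "m \<in> M" for m
    using ext[OF that] b by (simp add: l_def norm_divide)
  hence ll: "l m * cnj (l m) = 1" if "m \<in> M" for m
    using that by (simp add: complex_norm_square[symmetric])
  have l_mult: "l (m \<otimes> k) = l m * l k" if "m \<in> M" "k \<in> M" for m k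
    using scalar_char_values[OF G fin M \<beta> ext that(2) mL[OF that(1)]] b by (simp add: l_def)
  have l_one: "l \<one> = 1" using b by (simp add: l_def)
  \<comment> \<open>Dividing \<open>\<tau>'\<close> by \<open>l\<close> leaves the irreducible
    character of \<open>M\<close> below \<open>\<alpha>\<close>.\<close>
  define \<theta>0 where "\<theta>0 = (\<lambda>m. cnj (l m) * \<tau>' m)"
  have \<theta>0: "\<theta>0 \<in> Irr ?K"
    unfolding \<theta>0_def by (rule linear_twist_Irr[OF \<tau>'(1) gr]) (simp_all add: l_one l_mult)
  obtain d \<sigma> where s: "irreducible_representation ?K d \<sigma>" "\<theta>0 = afforded_char ?K \<sigma>"
    using Irr_eq_afforded[OF \<theta>0] by blast
  obtain n' \<rho> where r: "representation L n' \<rho>" "\<alpha> = afforded_char L \<rho>"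
    using characters_eq_afforded[OF \<alpha>(1)] by blast
  have n': "n' = n" using afforded_char_one[OF r(1) G] \<alpha>(2) r(2) by simp
  \<comment> \<open>From \<open>\<alpha> m * (b * l m) = t' * \<tau>' m\<close> on
    \<open>M\<close>.\<close>
  define a where "a = (of_nat t' / of_nat b :: complex)"
  have \<alpha>M: "\<alpha> m = a * \<theta>0 m" if m: "m \<in> M" for m
  proof -
    have "\<alpha> m * (of_nat b * l m) = of_nat t' * \<tau>' m" using \<tau>'(3)[OF m] b by (simp add: l_def)
    hence "\<alpha> m * of_nat b * (l m * cnj (l m)) = of_nat t' * \<theta>0 m"
      unfolding \<theta>0_def by (metis mult.assoc mult.commute)
    thus ?thesis unfolding ll[OF m] a_def using b by (simp add: field_simps)
  qed
  interpret hr: homogeneous_restriction M L \<rho> \<sigma> n d a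
  proof unfold_locales
    show "mat_trace (\<rho> m) = a * mat_trace (\<sigma> m)" if "m \<in> M" for m
      using \<alpha>M[OF that] that mL[OF that] by (simp add: r(2) s(2))
  qed (use fin r(1) s(1) n' in auto)
  obtain B where B: "representation L d B" "\<And>m. m \<in> M \<Longrightarrow> B m = \<sigma> m"
    "\<And>x. x \<in> carrier L \<Longrightarrow> real d * cmod (mat_trace (\<rho> x)) \<le> real n * cmod (mat_trace (B x))"
    using hr.extension[OF q cop] by blast
  define \<theta> where "\<theta> = afforded_char L B"
  have \<theta>: "\<theta> \<in> characters L" unfolding \<theta>_def by (rule afforded_charI[OF B(1)])
  have \<theta>M: "\<theta> m = \<theta>0 m" if "m \<in> M" for m
    using B(2)[OF that] mL[OF that] that by (simp add: \<theta>_def s(2))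
  have \<tau>'M: "\<tau>' m = l m * \<theta> m" if m: "m \<in> M" for m
    using ll[OF m] by (simp add: \<theta>M[OF m] \<theta>0_def mult.assoc[symmetric])
  have \<tau>M: "\<tau> m = (of_nat t' / of_nat t) * \<tau>' m" if m: "m \<in> M" for m
    using \<tau>(3)[OF mL[OF m]] \<tau>'(3)[OF m] \<tau>(2) by (simp add: field_simps)
  have \<tau>c: "\<tau> \<in> characters L" using \<tau>(1) Irr_subset_characters by blast
  \<comment> \<open>On \<open>M\<close> both \<open>\<tau>\<close> and \<open>\<tau>'\<close> are
    proportional to the product of \<open>\<alpha>\<close> and \<open>\<beta>\<close>. The ratio
    \<open>t' / t\<close> is a multiplicity and therefore a natural number.\<close>
  obtain e where e: "char_ip ?K (restrict_to M \<tau>) \<tau>' = of_nat e"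
    by (rule char_ip_nat[OF char_restrict[OF \<tau>c G M] \<tau>'(1) gr finK])
  have "char_ip ?K (restrict_to M \<tau>) \<tau>' = char_ip ?K (\<lambda>m. (of_nat t' / of_nat t) * \<tau>' m) \<tau>'"
    using \<tau>M by (simp add: char_ip_def restrict_to_def)
  also have "\<dots> = of_nat t' / of_nat t" unfolding char_ip_scale char_ip_irr[OF \<tau>'(1) \<tau>'(1) gr finK] by simp
  finally have et: "of_nat t' / of_nat t = (of_nat e :: complex)" using e by simp
  hence "e > 0" using \<tau>(2) \<tau>'(2) by (cases "e = 0") auto
  have \<tau>e: "\<tau> m = of_nat e * (\<beta> m / \<beta> \<one> * \<theta> m)" if m: "m \<in> M" for m
    unfolding \<tau>M[OF m] et \<tau>'M[OF m] using b by (simp add: l_def)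
  have "cmod (\<beta> x) = cmod (\<beta> \<one>)" if e1: "e = 1" and x: "x \<in> carrier L" for x
  proof -
    have irr: "restrict_to M \<tau> \<in> Irr ?K" "restrict_to M \<theta> \<in> Irr ?K"
    proof -
      have "restrict_to M \<tau> = \<tau>'"
      proof (rule restrict_to_eqI[OF \<tau>'(1)])
        show "\<tau> m = \<tau>' m" if "m \<in> M" for m using \<tau>M[OF that] e1 unfolding et by simp
      qed
      thus "restrict_to M \<tau> \<in> Irr ?K" using \<tau>'(1) by simp
      have "restrict_to M \<theta> = \<theta>0"
        by (rule restrict_to_eqI[OF \<theta>0 \<theta>M])
      thus "restrict_to M \<theta> \<in> Irr ?K" using \<theta>0 by simp
    qed
    have tt: "t' = t"
    proof -
      have "(of_nat t' :: complex) = of_nat t" using et e1 \<tau>(2) by (simp add: field_simps)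
      thus ?thesis by (simp only: of_nat_eq_iff)
    qed
    \<comment> \<open>Combines the bound of the extension theorem with
      \<open>t * \<tau> = \<alpha> * \<beta>\<close> and the constancy of \<open>|\<beta>|\<close>
      on the coset.\<close>
    have le: "real d * real t * cmod (\<tau> (x \<otimes> m)) \<le> real n * cmod (\<beta> x) * cmod (\<theta> (x \<otimes> m))" if m: "m \<in> M" for m
    proof -
      have xm: "x \<otimes> m \<in> carrier L" using x mL[OF m] by simp
      have "cmod (\<beta> (x \<otimes> m)) = cmod (\<beta> x)"
        using scalar_char_values[OF G fin M \<beta> ext m x] ext[OF m] b by (simp add: norm_mult norm_divide)
      hence "real t * cmod (\<tau> (x \<otimes> m)) = cmod (\<alpha> (x \<otimes> m)) * cmod (\<beta> x)"
        using arg_cong[OF \<tau>(3)[OF xm], of cmod] by (simp add: norm_mult)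
      hence "real d * real t * cmod (\<tau> (x \<otimes> m)) = (real d * cmod (\<alpha> (x \<otimes> m))) * cmod (\<beta> x)" by simp
      also have "\<dots> \<le> (real n * cmod (\<theta> (x \<otimes> m))) * cmod (\<beta> x)"
        using B(3)[OF xm] xm by (intro mult_right_mono) (simp_all add: r(2) \<theta>_def)
      finally show ?thesis by (simp add: mult_ac)
    qed
    \<comment> \<open>Both characters have sum of squared norms \<open>card M\<close> on the coset,
      so the pointwise bound reduces to its constants.\<close>
    have "(real d * real t)\<^sup>2 * real (card M) = (\<Sum>m\<in>M. (real d * real t * cmod (\<tau> (x \<otimes> m)))\<^sup>2)"
      unfolding coset_norm_sum[OF G fin M \<tau>c irr(1) x, symmetric] by (simp add: power_mult_distrib sum_distrib_left)
    also have "\<dots> \<le> (\<Sum>m\<in>M. (real n * cmod (\<beta> x) * cmod (\<theta> (x \<otimes> m)))\<^sup>2)"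
      by (intro sum_mono power_mono le) auto
    also have "\<dots> = (real n * cmod (\<beta> x))\<^sup>2 * real (card M)"
      unfolding coset_norm_sum[OF G fin M \<theta> irr(2) x, symmetric] by (simp add: power_mult_distrib sum_distrib_left)
    finally have "(real d * real t)\<^sup>2 \<le> (real n * cmod (\<beta> x))\<^sup>2" using cM by simp
    hence dt: "real d * real t \<le> real n * cmod (\<beta> x)" by (rule power2_le_imp_le) simp
    \<comment> \<open>The degree relation \<open>a * d = n\<close>, with
      \<open>a = t / b\<close>.\<close>
    have "of_nat t * of_nat d = (of_nat n * of_nat b :: complex)"
      using hr.a_eq b unfolding a_def tt by (simp add: field_simps)
    hence "(of_nat (t * d) :: complex) = of_nat (n * b)" by simp
    hence "t * d = n * b" by (simp only: of_nat_eq_iff)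
    hence "real n * real b = real d * real t" by (metis mult.commute of_nat_mult)
    hence "real n * real b \<le> real n * cmod (\<beta> x)" using dt by simp
    hence "real b \<le> cmod (\<beta> x)" using hr.n_pos by simp
    thus ?thesis using char_norm_le[OF \<beta> G fin x] b by simp
  qed
  thus ?thesis using \<open>e > 0\<close> \<theta> \<tau>e by blast
qed

section \<open>Linear characters, determinantal orders and special characters\<close>

lemma coprime_power_one:
  fixes r :: complex
  assumes "r ^ k = 1" "r ^ j = 1" "coprime k j" "k > 0"
  shows "r = 1"
proof -
  obtain u v where uv: "k * u = j * v + 1"
    using bezout_nat[of k j] assms(3,4) by (auto simp: coprime_iff_gcd_eq_1)
  have "r ^ (k * u) = r ^ (j * v) * r" unfolding uv by simp
  thus ?thesis using assms(1,2) by (simp add: power_mult)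
qed

lemma linear_char_mult:
  fixes G (structure)
  assumes "\<psi> \<in> characters G" "group G" "\<psi> \<one> = 1" "x \<in> carrier G" "y \<in> carrier G"
  shows "\<psi> (x \<otimes> y) = \<psi> x * \<psi> y"
proof -
  interpret group G by fact
  obtain n \<rho> where r: "representation G n \<rho>" "\<psi> = afforded_char G \<rho>"
    using characters_eq_afforded[OF assms(1)] by blast
  have n: "n = 1" using afforded_char_one[OF r(1) assms(2)] assms(3) r(2) by simp
  note R = rep_carrier[OF r(1) assms(2)]
  have "(\<rho> x * \<rho> y) $$ (0, 0) = (\<Sum>l<n. \<rho> x $$ (0, l) * \<rho> y $$ (l, 0))"
    by (rule index_mult_mat_sum[OF R[OF assms(4)] R[OF assms(5)]]) (simp_all add: n)
  hence "\<rho> (x \<otimes> y) $$ (0, 0) = \<rho> x $$ (0, 0) * \<rho> y $$ (0, 0)"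
    unfolding rep_mult[OF r(1) assms(2,4,5)] by (simp add: n)
  thus ?thesis
    using R[OF assms(4)] R[OF assms(5)] R[of "x \<otimes> y"] assms(4,5) n by (simp add: r(2) mat_trace_def)
qed

lemma linear_char_pow:
  fixes G (structure)
  assumes "\<psi> \<in> characters G" "group G" "\<psi> \<one> = 1" "x \<in> carrier G"
  shows "\<psi> (x [^] (k :: nat)) = \<psi> x ^ k"
proof -
  interpret group G by fact
  show ?thesis
    using assms(3,4) linear_char_mult[OF assms(1-3)] by (induction k) (auto simp: mult.commute)
qed

text \<open>In degree one the determinant is the trace, whichever affording representation is taken,
  so the definite description is settled.\<close>

lemma linear_det_char:
  fixes G (structure)
  assumes "\<psi> \<in> characters G" "group G" "\<psi> \<one> = 1"
  shows "det_char G \<psi> = \<psi>"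
proof -
  interpret group G by fact
  have det: "(\<lambda>g. if g \<in> carrier G then Determinant.det (\<rho> g) else 0) = \<psi>"
    if r: "representation G n \<rho>" "\<psi> = afforded_char G \<rho>" for n \<rho>
  proof
    fix g
    have n: "n = 1" using afforded_char_one[OF r(1) assms(2)] assms(3) r(2) by simp
    show "(if g \<in> carrier G then Determinant.det (\<rho> g) else 0) = \<psi> g"
      using rep_carrier[OF r(1) assms(2), of g] det_single[of "\<rho> g"]
      by (auto simp: r(2) afforded_char_def n mat_trace_def)
  qed
  show ?thesis unfolding det_char_def
    by (rule the_equality) (use characters_eq_afforded[OF assms(1)] det in \<open>force+\<close>)
qed

lemma linear_det_order:
  fixes G (structure)
  assumes "\<psi> \<in> characters G" "group G" "finite (carrier G)" "\<psi> \<one> = 1" "g \<in> carrier G"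
  shows "\<psi> g ^ det_order G \<psi> = 1"
proof -
  interpret group G by fact
  let ?P = "\<lambda>m. m > 0 \<and> (\<forall>g\<in>carrier G. \<psi> g ^ m = 1)"
  have "\<psi> h ^ card (carrier G) = 1" if "h \<in> carrier G" for h
    using linear_char_pow[OF assms(1,2,4) that, of "card (carrier G)"] pow_order_eq_1[OF that] assms(4)
    by (simp add: Coset.order_def)
  moreover have "card (carrier G) > 0" using assms(3) one_closed card_gt_0_iff by blast
  ultimately have "?P (card (carrier G))" by blast
  hence "?P (LEAST m. ?P m)" by (rule LeastI)
  thus ?thesis unfolding det_order_def linear_det_char[OF assms(1,2,4)] using assms(5) by blast
qed

lemma sum_list_eq_imp_eq:
  fixes f g :: "'x \<Rightarrow> real"
  assumes "\<And>x. x \<in> set xs \<Longrightarrow> f x \<le> g x" "(\<Sum>x\<leftarrow>xs. g x) \<le> (\<Sum>x\<leftarrow>xs. f x)" "x \<in> set xs"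
  shows "f x = g x"
  using assms
proof (induction xs)
  case (Cons y ys)
  have "(\<Sum>x\<leftarrow>ys. f x) \<le> (\<Sum>x\<leftarrow>ys. g x)" using Cons.prems(1) by (intro sum_list_mono) auto
  moreover have "f y \<le> g y" using Cons.prems(1) by simp
  ultimately have "f y = g y" "(\<Sum>x\<leftarrow>ys. g x) \<le> (\<Sum>x\<leftarrow>ys. f x)" using Cons.prems(2) by auto
  thus ?case using Cons by auto
qed simp

lemma norm_sum_list_le: "cmod (\<Sum>x\<leftarrow>xs. f x) \<le> (\<Sum>x\<leftarrow>xs. cmod (f x))"
proof (induction xs)
  case (Cons x xs)
  thus ?case using norm_triangle_ineq[of "f x" "\<Sum>x\<leftarrow>xs. f x"] by simp
qed simp

text \<open>A linear character is its own determinant, so the condition on determinantal orders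
  controls the orders of its values. A normal subgroup is subnormal in one step.\<close>

lemma special_linear_constituent_order:
  assumes "pi_special \<pi> G \<beta>" "group G" "finite (carrier G)" "L \<lhd> G"
    and "\<psi> \<in> irr_constituents (G\<lparr>carrier := L\<rparr>) (restrict_to L \<beta>)" "\<psi> \<one>\<^bsub>G\<^esub> = 1"
  obtains k where "pi_number \<pi> k" "\<And>x. x \<in> L \<Longrightarrow> \<psi> x ^ k = 1"
proof -
  let ?L = "G\<lparr>carrier := L\<rparr>"
  have sub: "subgroup L G" using assms(4) by (simp add: normal_def)
  have "L \<lhd> G\<lparr>carrier := carrier G\<rparr>" using assms(4) by simp
  hence "subnormal G L" using subnormal.step[OF subnormal.self] by blast
  hence 1: "pi_number \<pi> (det_order ?L \<psi>)"
    using assms(1,5) unfolding pi_special_def by blast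
  have \<psi>: "\<psi> \<in> characters ?L" using assms(5) Irr_subset_characters by (auto simp: irr_constituents_def)
  have fin: "finite (carrier ?L)" using assms(3) subgroup.subset[OF sub] finite_subset by auto
  have "\<psi> x ^ det_order ?L \<psi> = 1" if "x \<in> L" for x
    using linear_det_order[OF \<psi> subgroup.subgroup_is_group[OF sub assms(2)] fin] assms(6) that by simp
  with 1 that show ?thesis by blast
qed

text \<open>Used with the complementary set of primes, for a section whose order \<open>q\<close> is
  a \<pi>-number. The condition that \<open>x [^] q\<close> lies in \<open>M\<close> is the form in
  which the quotient of order \<open>q\<close> enters.\<close>

lemma special_degree_step:
  fixes G (structure)
  assumes sp: "pi_special \<pi> G \<beta>" and G: "group G" "finite (carrier G)" and L: "L \<lhd> G"
    and M: "subgroup M (G\<lparr>carrier := L\<rparr>)" and q: "card L = q * card M"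
    and cop: "\<And>k. pi_number \<pi> k \<Longrightarrow> coprime k q" and pow: "\<And>x. x \<in> L \<Longrightarrow> x [^] q \<in> M"
    and ext: "\<And>m. m \<in> M \<Longrightarrow> cmod (\<beta> m) = cmod (\<beta> \<one>)" and x: "x \<in> L"
  shows "cmod (\<beta> x) = cmod (\<beta> \<one>)"
proof -
  interpret group G by fact
  interpret L: normal L G by fact
  let ?L = "G\<lparr>carrier := L\<rparr>"
  have gr: "group ?L" by (rule L.subgroup_is_group[OF G(1)])
  have finL: "finite (carrier ?L)" using G(2) L.subset finite_subset by auto
  have LG: "y \<in> carrier G" if "y \<in> L" for y using that L.subset by blast
  have mL: "m \<in> L" if "m \<in> M" for m using that subgroup.subset[OF M] by auto
  have \<beta>: "\<beta> \<in> Irr G" using sp by (simp add: pi_special_def)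
  have \<beta>c: "\<beta> \<in> characters G" using \<beta> Irr_subset_characters by blast
  obtain b where b: "\<beta> \<one> = of_nat b" "pi_number \<pi> b" using sp by (auto simp: pi_special_def)
  obtain \<psi>s where \<psi>s: "\<psi>s \<noteq> []" "set \<psi>s \<subseteq> Irr ?L" "restrict_to L \<beta> = (\<lambda>g. \<Sum>\<psi>\<leftarrow>\<psi>s. \<psi> g)"
    by (rule char_is_sum_of_irr[OF char_restrict[OF \<beta>c G(1) L.subgroup_axioms] gr])
  have \<beta>L: "\<beta> y = (\<Sum>\<psi>\<leftarrow>\<psi>s. \<psi> y)" if "y \<in> L" for y
    using fun_cong[OF \<psi>s(3), of y] that by (simp add: restrict_to_def)
  have cons: "\<psi> \<in> irr_constituents ?L (restrict_to L \<beta>)" if "\<psi> \<in> set \<psi>s" for \<psi>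
    by (rule irr_constituents_of_sum[OF \<psi>s(2) that \<psi>s(3) gr])
  have ip: "char_ip ?L \<beta> \<psi> \<noteq> 0" if "\<psi> \<in> set \<psi>s" for \<psi>
    using constituent_ip[OF cons[OF that] gr finL] by (simp add: char_ip_restrict)
  have \<psi>c: "\<psi> \<in> characters ?L" if "\<psi> \<in> set \<psi>s" for \<psi> using that \<psi>s(2) Irr_subset_characters by blast
  define \<psi>0 where "\<psi>0 = hd \<psi>s"
  have \<psi>0: "\<psi>0 \<in> set \<psi>s" using \<psi>s(1) by (simp add: \<psi>0_def)
  obtain d where d: "d > 0" "\<psi>0 \<one> = of_nat d" using char_degree[OF \<psi>c[OF \<psi>0] gr] by auto
  \<comment> \<open>Constituents on a normal subgroup are conjugate, hence of equal degree
    \<open>d\<close>.\<close>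
  have deg: "\<psi> \<one> = of_nat d" if \<psi>: "\<psi> \<in> set \<psi>s" for \<psi>
  proof -
    obtain g where "g \<in> carrier G" "\<forall>x\<in>L. \<psi> x = \<psi>0 (g \<otimes> x \<otimes> inv g)"
      using clifford_conjugate[OF L G(2) \<beta> _ ip[OF \<psi>0] _ ip[OF \<psi>]] \<psi>s(2) \<psi> \<psi>0 by blast
    thus ?thesis using d L.one_closed by simp
  qed
  have "(of_nat b :: complex) = (\<Sum>\<psi>\<leftarrow>\<psi>s. of_nat d)"
    using \<beta>L[OF L.one_closed] b(1) deg by (metis (no_types, lifting) map_cong)
  also have "\<dots> = of_nat (length \<psi>s * d)" by (simp add: sum_list_triv)
  finally have bd: "b = length \<psi>s * d" by (simp only: of_nat_eq_iff)
  \<comment> \<open>At \<open>m\<close> the modulus of the sum is already the sum \<open>b\<close>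
    of the degrees, so each constituent attains its maximal modulus \<open>d\<close>.\<close>
  have norm: "cmod (\<psi> m) = real d" if m: "m \<in> M" and \<psi>: "\<psi> \<in> set \<psi>s" for m \<psi>
  proof (rule sum_list_eq_imp_eq[OF _ _ \<psi>])
    show "cmod (\<phi> m) \<le> real d" if "\<phi> \<in> set \<psi>s" for \<phi>
      using char_norm_le[OF \<psi>c[OF that] gr finL, of m] mL[OF m] deg[OF that] by simp
    have "(\<Sum>\<phi>\<leftarrow>\<psi>s. real d) = real b" using bd by (simp add: sum_list_triv)
    also have "\<dots> = cmod (\<Sum>\<psi>\<leftarrow>\<psi>s. \<psi> m)" using ext[OF m] b(1) \<beta>L[OF mL[OF m]] by simp
    also have "\<dots> \<le> (\<Sum>\<psi>\<leftarrow>\<psi>s. cmod (\<psi> m))" by (rule norm_sum_list_le)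
    finally show "(\<Sum>\<phi>\<leftarrow>\<psi>s. real d) \<le> (\<Sum>\<psi>\<leftarrow>\<psi>s. cmod (\<psi> m))" .
  qed
  have "d dvd q"
    by (rule irr_degree_dvd_index[OF subsetD[OF \<psi>s(2) \<psi>0] gr finL M])
      (use norm[OF _ \<psi>0] d q in auto)
  moreover have "d dvd b" using bd by simp
  ultimately have d1: "d = 1" using cop[OF b(2)] by (metis coprime_common_divisor_nat)
  hence lin: "\<psi> \<one> = 1" if "\<psi> \<in> set \<psi>s" for \<psi> using deg[OF that] by simp
  have len: "length \<psi>s = b" using bd d1 by simp
  \<comment> \<open>The equality case of the triangle inequality: \<open>b\<close> numbers of
    modulus 1 whose sum has modulus \<open>b\<close> are equal.\<close>
  have agree: "\<psi> m = \<beta> m / of_nat b" if m: "m \<in> M" and \<psi>: "\<psi> \<in> set \<psi>s" for m \<psi>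
  proof -
    obtain i where i: "i < b" "\<psi> = \<psi>s ! i" using \<psi> len by (auto simp: in_set_conv_nth)
    have s: "\<beta> m = (\<Sum>i<b. (\<psi>s ! i) m)"
      using \<beta>L[OF mL[OF m]] len by (simp add: sum_list_sum_nth atLeast0LessThan)
    have "(\<psi>s ! i) m = (\<Sum>i<b. (\<psi>s ! i) m) / of_nat b"
    proof (rule sum_unit_complex_extremal[OF _ _ i(1)])
      show "cmod ((\<psi>s ! j) m) = 1" if "j < b" for j using norm[OF m, of "\<psi>s ! j"] that len d1 by simp
      show "cmod (\<Sum>i<b. (\<psi>s ! i) m) = real b" using ext[OF m] b(1) s by simp
    qed
    thus ?thesis using s i by simp
  qed
  \<comment> \<open>The quotient of the two values at \<open>x\<close> has \<open>q\<close>-th power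
    1, because \<open>x [^] q\<close> lies in \<open>M\<close>; it also has power 1 for the exponent
    \<open>k * k0\<close>, which is coprime to \<open>q\<close>.\<close>
  have eq: "\<psi> x = \<psi>0 x" if \<psi>: "\<psi> \<in> set \<psi>s" for \<psi>
  proof -
    obtain k where k: "pi_number \<pi> k" "\<And>x. x \<in> L \<Longrightarrow> \<psi> x ^ k = 1"
      using special_linear_constituent_order[OF sp G L cons[OF \<psi>] lin[OF \<psi>]] by blast
    obtain k0 where k0: "pi_number \<pi> k0" "\<And>x. x \<in> L \<Longrightarrow> \<psi>0 x ^ k0 = 1"
      using special_linear_constituent_order[OF sp G L cons[OF \<psi>0] lin[OF \<psi>0]] by blast
    have kpos: "k > 0" "k0 > 0" using k(1) k0(1) by (auto simp: pi_number_def)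
    have nz: "\<psi>0 x \<noteq> 0" using k0(2)[OF x] kpos by (metis power_0_left zero_neq_one less_irrefl)
    have pw: "\<phi> x ^ q = \<phi> (x [^] q)" if "\<phi> \<in> set \<psi>s" for \<phi>
      using linear_char_pow[OF \<psi>c[OF that] gr, of x q] lin[OF that] x
      by (simp add: nat_pow_consistent[symmetric])
    have "\<psi> x ^ q = \<psi>0 x ^ q" using pw[OF \<psi>] pw[OF \<psi>0] agree[OF pow[OF x] \<psi>] agree[OF pow[OF x] \<psi>0] by simp
    hence "(\<psi> x / \<psi>0 x) ^ q = 1" using nz by (simp add: power_divide)
    moreover have "(\<psi> x / \<psi>0 x) ^ (k * k0) = 1"
    proof -
      have "\<psi> x ^ (k * k0) = 1" using k(2)[OF x] by (simp add: power_mult)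
      moreover have "\<psi>0 x ^ (k * k0) = 1" using k0(2)[OF x] by (simp add: power_mult mult.commute[of k])
      ultimately show ?thesis by (simp add: power_divide)
    qed
    moreover have "k * k0 > 0" using kpos by simp
    ultimately have "\<psi> x / \<psi>0 x = 1"
      using coprime_power_one[OF _ _ cop[OF pi_number_mult[OF k(1) k0(1)]]] by blast
    thus ?thesis using nz by simp
  qed
  obtain k0 where k0: "pi_number \<pi> k0" "\<And>x. x \<in> L \<Longrightarrow> \<psi>0 x ^ k0 = 1"
    using special_linear_constituent_order[OF sp G L cons[OF \<psi>0] lin[OF \<psi>0]] by blast
  have n1: "cmod (\<psi>0 x) = 1"
    using root_of_unity_norm[OF k0(2)[OF x]] k0(1) by (simp add: pi_number_def)
  have "\<beta> x = (\<Sum>\<psi>\<leftarrow>\<psi>s. \<psi>0 x)" using \<beta>L[OF x] eq by (metis (no_types, lifting) map_cong)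
  also have "\<dots> = of_nat b * \<psi>0 x" by (simp add: sum_list_triv len)
  finally show ?thesis using n1 b(1) by (simp add: norm_mult)
qed

lemma degree_one_irreducible:
  assumes "representation G 1 \<rho>" "group G"
  shows "irreducible_representation G 1 \<rho>"
proof (rule ccontr)
  assume "\<not> ?thesis"
  then obtain k l \<rho>1 \<rho>2 where r: "representation G k \<rho>1" "representation G l \<rho>2" "1 = k + l"
    "\<And>g. g \<in> carrier G \<Longrightarrow> mat_trace (\<rho> g) = mat_trace (\<rho>1 g) + mat_trace (\<rho>2 g)"
  proof -
    assume a: "\<not> irreducible_representation G 1 \<rho>"
    show ?thesis by (rule reducible_decomposition[OF assms a]) (rule that, assumption+)
  qed
  thus False using rep_dim_pos[OF r(1) assms(2)] rep_dim_pos[OF r(2) assms(2)] by simp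
qed

text \<open>On \<open>M\<close>, \<open>\<beta>\<close> is a multiple of a linear character, whose
  values are roots of unity of \<pi>'-order by speciality. At a \<pi>-element the value also has
  \<pi>-order, so it is 1.\<close>

lemma special_trivial_on_complementary_elements:
  fixes G (structure)
  assumes sp: "pi_special (pi_compl \<pi>) G \<beta>" and G: "group G" "finite (carrier G)" and M: "M \<lhd> G"
    and ext: "\<And>m. m \<in> M \<Longrightarrow> cmod (\<beta> m) = cmod (\<beta> \<one>)" and x: "x \<in> M" "x \<in> pi_elements \<pi> G"
  shows "\<beta> x = \<beta> \<one>"
proof -
  interpret group G by fact
  interpret M: normal M G by fact
  let ?M = "G\<lparr>carrier := M\<rparr>"
  have gr: "group ?M" by (rule M.subgroup_is_group[OF G(1)])
  have MG: "y \<in> carrier G" if "y \<in> M" for y using that M.subset by blast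
  have \<beta>c: "\<beta> \<in> characters G" using sp Irr_subset_characters by (auto simp: pi_special_def)
  obtain b where b: "b > 0" "\<beta> \<one> = of_nat b" by (rule char_degree[OF \<beta>c G(1)])
  \<comment> \<open>The scalars by which \<open>M\<close> acts, as a representation of degree
    one.\<close>
  let ?\<rho> = "\<lambda>m. mat 1 1 (\<lambda>_. \<beta> m / of_nat b)"
  have "representation ?M 1 ?\<rho>"
  proof (rule representationI[OF gr])
    show "?\<rho> \<one>\<^bsub>?M\<^esub> = 1\<^sub>m 1" using b by (intro eq_matI) auto
    fix g h assume "g \<in> carrier ?M" "h \<in> carrier ?M"
    hence gh: "g \<in> M" "h \<in> M" by auto
    show "?\<rho> (g \<otimes>\<^bsub>?M\<^esub> h) = ?\<rho> g * ?\<rho> h"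
      using scalar_char_values[OF G M.subgroup_axioms \<beta>c ext gh(2) MG[OF gh(1)]] b
      by (intro eq_matI) (auto simp: scalar_prod_def)
  qed auto
  hence irr: "afforded_char ?M ?\<rho> \<in> Irr ?M"
    using degree_one_irreducible[OF _ gr] afforded_char_IrrI by blast
  let ?l = "afforded_char ?M ?\<rho>"
  have l: "?l m = \<beta> m / of_nat b" if "m \<in> M" for m using that by (simp add: mat_trace_def)
  have "restrict_to M \<beta> = (\<lambda>g. \<Sum>\<psi>\<leftarrow>replicate b ?l. \<psi> g)"
    using b by (auto simp: restrict_to_def sum_list_replicate afforded_char_def mat_trace_def)
  hence "?l \<in> irr_constituents ?M (restrict_to M \<beta>)"
    using irr b by (intro irr_constituents_of_sum[OF _ _ _ gr, of "replicate b ?l"]) auto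
  moreover have "?l \<one> = 1" using l[OF M.one_closed] b by simp
  ultimately obtain k where k: "pi_number (pi_compl \<pi>) k" "\<And>x. x \<in> M \<Longrightarrow> ?l x ^ k = 1"
    using special_linear_constituent_order[OF sp G M] by blast
  obtain j where j: "pi_number \<pi> j" "x [^] j = \<one>" using x(2) by (auto simp: pi_elements_iff[OF G(2)])
  have "?l x ^ j = 1"
    using linear_char_pow[OF subsetD[OF Irr_subset_characters irr] gr, of x j] \<open>?l \<one> = 1\<close> x(1) j(2)
    by (simp add: nat_pow_consistent[symmetric] del: afforded_char_in)
  moreover have "j > 0" using j(1) by (simp add: pi_number_def)
  ultimately have "?l x = 1"
    using coprime_power_one[OF _ k(2)[OF x(1)] pi_number_coprime[OF j(1) k(1)]] by blast
  thus ?thesis using l[OF x(1)] b by simp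
qed

section \<open>Sections of a normal series\<close>

text \<open>\<open>q\<close> is the order of the image of \<open>V \<inter> N'\<close> in
  \<open>N' / N\<close>. It divides the order of that quotient, and the kernel of the map is
  \<open>V \<inter> N\<close>.\<close>

lemma section_index:
  fixes G (structure)
  assumes G: "group G" "finite (carrier G)" and N: "N \<lhd> G" "N' \<lhd> G" "N \<subseteq> N'" and V: "subgroup V G"
    and pg: "pi_group \<sigma> (G\<lparr>carrier := N'\<rparr> Mod N)"
  obtains q where "card (V \<inter> N') = q * card (V \<inter> N)" "pi_number \<sigma> q"
    "\<And>x. x \<in> V \<inter> N' \<Longrightarrow> x [^] q \<in> V \<inter> N"
proof -
  interpret group G by fact
  interpret V: subgroup V G by fact
  interpret N: normal N G by (rule N(1))
  interpret N': normal N' G by (rule N(2))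
  let ?K = "G\<lparr>carrier := N'\<rparr>"
  let ?L = "G\<lparr>carrier := V \<inter> N'\<rparr>"
  let ?Q = "?K Mod N"
  let ?h = "\<lambda>x. N #> x"
  have L: "subgroup (V \<inter> N') G" by (rule subgroups_Inter_pair[OF V N'.subgroup_axioms])
  have grL: "group ?L" by (rule subgroup.subgroup_is_group[OF L G(1)])
  have grQ: "group ?Q" using pg by (simp add: pi_group_def)
  have NK: "N \<lhd> ?K" by (rule normal_restrict_supergroup[OF N'.subgroup_axioms N(1,3)])
  have hK: "(\<lambda>x. N #>\<^bsub>?K\<^esub> x) \<in> hom ?K ?Q" by (rule normal.r_coset_hom_Mod[OF NK])
  have coset: "N #>\<^bsub>?K\<^esub> x = N #> x" for x by (simp add: r_coset_def)
  have hL: "?h \<in> hom ?L ?Q" using hK unfolding coset by (auto simp: hom_def)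
  interpret h: group_hom ?L ?Q ?h
    using grL grQ hL by (simp add: group_hom_def group_hom_axioms_def)
  let ?I = "?Q\<lparr>carrier := ?h ` (V \<inter> N')\<rparr>"
  have h': "group_hom ?L ?I ?h" using h.induced_group_hom[OF h.G.subgroup_self] by simp
  have "one ?Q = N" by (simp add: FactGroup_def)
  hence ker: "kernel ?L ?I ?h = V \<inter> N"
    using coset_join1[OF _ _ N.subgroup_axioms] N.rcos_const[OF G(1)] N(3) V.subset
    unfolding kernel_def by auto
  let ?q = "card (?h ` (V \<inter> N'))"
  have sub: "subgroup (V \<inter> N) ?L" using group_hom.subgroup_kernel[OF h'] unfolding ker .
  have "?L Mod (V \<inter> N) \<cong> ?I" using group_hom.FactGroup_iso[OF h'] unfolding ker by simp
  hence "card (rcosets\<^bsub>?L\<^esub> (V \<inter> N)) = ?q" using iso_same_card by (fastforce simp: FactGroup_def)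
  hence 1: "card (V \<inter> N') = ?q * card (V \<inter> N)"
    using h.G.lagrange[OF sub] by (simp add: Coset.order_def)
  have "subgroup (?h ` (V \<inter> N')) ?Q" using h.img_is_subgroup by simp
  hence "?q dvd Coset.order ?Q" using group.lagrange[OF grQ] by (metis dvd_triv_right)
  hence 2: "pi_number \<sigma> ?q" using pg pi_number_dvd by (simp add: pi_group_def) blast
  have 3: "x [^] ?q \<in> V \<inter> N" if x: "x \<in> V \<inter> N'" for x
  proof -
    interpret h': group_hom ?L ?I ?h by (rule h')
    have xq: "x [^]\<^bsub>?L\<^esub> ?q \<in> V \<inter> N'" using h.G.nat_pow_closed[of x ?q] x by simp
    have "?h (x [^]\<^bsub>?L\<^esub> ?q) = ?h x [^]\<^bsub>?I\<^esub> ?q" using h'.hom_nat_pow[of x ?q] x by simp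
    also have "\<dots> = \<one>\<^bsub>?I\<^esub>" using h'.H.pow_order_eq_1[of "?h x"] x by (simp add: Coset.order_def)
    finally have "x [^]\<^bsub>?L\<^esub> ?q \<in> kernel ?L ?I ?h" using xq by (simp add: kernel_def)
    thus ?thesis unfolding ker by (simp add: nat_pow_consistent[symmetric])
  qed
  show ?thesis by (rule that[OF 1 2 3])
qed

text \<open>\<open>x\<close> is a power of \<open>x [^] q\<close>, because \<open>q\<close> is
  coprime to an exponent that annihilates \<open>x\<close>.\<close>

lemma (in group) pi_element_in_subgroup:
  assumes fin: "finite (carrier G)" and M: "subgroup M G" and q: "pi_number (pi_compl \<pi>) q"
    and x: "x \<in> pi_elements \<pi> G" "x [^] q \<in> M"
  shows "x \<in> M"
proof -
  obtain k where k: "x \<in> carrier G" "pi_number \<pi> k" "x [^] k = \<one>"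
    using x(1) by (auto simp: pi_elements_iff[OF fin])
  have "q \<noteq> 0" using q by (simp add: pi_number_def)
  then obtain u v where uv: "q * u = k * v + 1"
    using bezout_nat[of q k] pi_number_coprime[OF k(2) q] by (metis coprime_iff_gcd_eq_1 gcd.commute)
  have "(x [^] q) [^] u = x [^] (k * v) \<otimes> x" using k(1) by (simp add: nat_pow_pow uv)
  also have "\<dots> = x" using k by (simp add: nat_pow_pow[symmetric])
  finally have "x = (x [^] q) [^] u" by simp
  moreover have "(x [^] q) [^] u \<in> M" using x(2)
    by (induction u) (simp_all add: subgroup.one_closed[OF M] subgroup.m_closed[OF M])
  ultimately show ?thesis by simp
qed

lemma linear_char_norm:
  fixes G (structure)
  assumes "\<psi> \<in> characters G" "group G" "finite (carrier G)" "\<psi> \<one> = 1" "x \<in> carrier G"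
  shows "cmod (\<psi> x) = 1"
proof -
  interpret group G by fact
  have "Coset.order G > 0" using assms(3) order_gt_0_iff_finite by simp
  thus ?thesis
    using root_of_unity_norm[of "\<psi> x" "Coset.order G"] linear_char_pow[OF assms(1,2,4,5), of "Coset.order G"]
      pow_order_eq_1[OF assms(5)] assms(4) by simp
qed

section \<open>Inductive pairs\<close>

lemma inductive_product_norm:
  fixes G (structure)
  assumes G: "group G" "finite (carrier G)" and ser: "normal_pi_series \<pi> G Ns" and V: "subgroup V G"
    and \<alpha>: "pi_special \<pi> (G\<lparr>carrier := V\<rparr>) \<alpha>" and \<beta>: "pi_special (pi_compl \<pi>) (G\<lparr>carrier := V\<rparr>) \<beta>"
    and ind: "inductive_pair \<pi> G Ns V (\<lambda>g. \<alpha> g * \<beta> g)"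
    and i: "i < length Ns" and x: "x \<in> V \<inter> Ns ! i"
  shows "cmod (\<beta> x) = cmod (\<beta> \<one>)"
  using i x
proof (induction i arbitrary: x)
  case 0
  have "Ns ! 0 = {\<one>}" using ser by (auto simp: normal_pi_series_def hd_conv_nth)
  thus ?case using 0 by simp
next
  case (Suc i)
  interpret group G by fact
  interpret V: subgroup V G by fact
  let ?H = "G\<lparr>carrier := V\<rparr>"
  let ?N = "Ns ! i" and ?N' = "Ns ! Suc i"
  let ?M = "V \<inter> ?N" and ?L = "V \<inter> ?N'"
  let ?GL = "G\<lparr>carrier := ?L\<rparr>" and ?K = "G\<lparr>carrier := ?N'\<rparr>"
  have grH: "group ?H" by (rule V.subgroup_is_group[OF G(1)])
  have finH: "finite (carrier ?H)" using G(2) V.subset finite_subset by auto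
  have inNs: "?N \<in> set Ns" "?N' \<in> set Ns" using Suc.prems by auto
  have N: "?N \<lhd> G" "?N' \<lhd> G" "?N \<subseteq> ?N'"
    using ser inNs Suc.prems(1) by (auto simp: normal_pi_series_def)
  have sN: "subgroup ?N G" "subgroup ?N' G" using N by (simp_all add: normal_def)
  have MH: "?M \<lhd> ?H" using normal_Int_subgroup[OF V N(1)] by (simp add: Int_commute)
  have LH: "?L \<lhd> ?H" using normal_Int_subgroup[OF V N(2)] by (simp add: Int_commute)
  have sM: "subgroup ?M G" by (rule subgroups_Inter_pair[OF V sN(1)])
  have sL: "subgroup ?L G" by (rule subgroups_Inter_pair[OF V sN(2)])
  have mL: "?M \<subseteq> ?L" using N(3) by blast
  have ext: "cmod (\<beta> m) = cmod (\<beta> \<one>)" if "m \<in> ?M" for m using Suc.IH that Suc.prems(1) by simp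
  consider (pi) "pi_group \<pi> (?K Mod ?N)" | (compl) "pi_group (pi_compl \<pi>) (?K Mod ?N)"
    using ser Suc.prems(1) by (auto simp: normal_pi_series_def)
  thus ?case
  proof cases
    case pi
    obtain q where q: "card ?L = q * card ?M" "pi_number \<pi> q" "\<And>x. x \<in> ?L \<Longrightarrow> x [^] q \<in> ?M"
      by (rule section_index[OF G N V pi]) (rule that, assumption+)
    have "cmod (\<beta> x) = cmod (\<beta> \<one>\<^bsub>?H\<^esub>)"
    proof (rule special_degree_step[OF \<beta> grH finH LH _ q(1)])
      show "subgroup ?M (?H\<lparr>carrier := ?L\<rparr>)" using subgroup_incl[OF sM sL mL] by simp
      show "coprime k q" if "pi_number (pi_compl \<pi>) k" for k
        using pi_number_coprime[OF q(2) that] by (simp add: coprime_commute)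
      show "y [^]\<^bsub>?H\<^esub> q \<in> ?M" if "y \<in> ?L" for y
        using q(3)[OF that] by (simp add: nat_pow_consistent[symmetric])
      show "cmod (\<beta> m) = cmod (\<beta> \<one>\<^bsub>?H\<^esub>)" if "m \<in> ?M" for m using ext[OF that] by simp
    qed (rule Suc.prems(2))
    thus ?thesis by simp
  next
    case compl
    obtain q where q: "card ?L = q * card ?M" "pi_number (pi_compl \<pi>) q" "\<And>x. x \<in> ?L \<Longrightarrow> x [^] q \<in> ?M"
      by (rule section_index[OF G N V compl]) (rule that, assumption+)
    obtain n where n: "\<alpha> \<one> = of_nat n" "pi_number \<pi> n" using \<alpha> by (auto simp: pi_special_def)
    have \<alpha>c: "\<alpha> \<in> characters ?H" and \<beta>c: "\<beta> \<in> characters ?H"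
      using \<alpha> \<beta> Irr_subset_characters by (auto simp: pi_special_def)
    have sLH: "subgroup ?L ?H" using LH by (simp add: normal_def)
    \<comment> \<open>By convention a character vanishes off its group, so the step lemma for
      \<open>?GL\<close> takes the truncations to \<open>?L\<close>.\<close>
    let ?\<alpha> = "restrict_to ?L \<alpha>" and ?\<beta> = "restrict_to ?L \<beta>"
    have \<alpha>L: "?\<alpha> \<in> characters ?GL" using char_restrict[OF \<alpha>c grH sLH] by simp
    have \<beta>L: "?\<beta> \<in> characters ?GL" using char_restrict[OF \<beta>c grH sLH] by simp
    have oneL: "\<one> \<in> ?L" by (rule subgroup.one_closed[OF sL])
    obtain t \<tau> where \<tau>: "t > 0" "\<tau> \<in> Irr ?GL"
      "restrict_to ?L (\<lambda>g. \<alpha> g * \<beta> g) = (\<lambda>g. of_nat t * \<tau> g)"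
      "restrict_to (pi_elements \<pi> ?K) (induced ?K ?L \<tau>) \<in> I_pi \<pi> ?K"
      using ind inNs(2) unfolding inductive_pair_def by blast
    obtain t' \<tau>' where \<tau>': "t' > 0" "\<tau>' \<in> Irr (G\<lparr>carrier := ?M\<rparr>)"
      "restrict_to ?M (\<lambda>g. \<alpha> g * \<beta> g) = (\<lambda>g. of_nat t' * \<tau>' g)"
      using ind inNs(1) unfolding inductive_pair_def by blast
    have \<tau>x: "\<alpha> y * \<beta> y = of_nat t * \<tau> y" if "y \<in> ?L" for y
      using fun_cong[OF \<tau>(3), of y] that by (simp add: restrict_to_def)
    have \<tau>'x: "\<alpha> y * \<beta> y = of_nat t' * \<tau>' y" if "y \<in> ?M" for y
      using fun_cong[OF \<tau>'(3), of y] that by (simp add: restrict_to_def)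
    have "\<exists>e>0. \<exists>\<theta>\<in>characters ?GL. (\<forall>m\<in>?M. \<tau> m = of_nat e * (?\<beta> m / ?\<beta> \<one>\<^bsub>?GL\<^esub> * \<theta> m)) \<and>
      (e = 1 \<longrightarrow> (\<forall>x\<in>carrier ?GL. cmod (?\<beta> x) = cmod (?\<beta> \<one>\<^bsub>?GL\<^esub>)))"
    proof (rule coprime_degree_step[where n = n and q = q and t = t and \<alpha> = ?\<alpha> and t' = t' and \<tau>' = \<tau>'])
      have "?M \<inter> ?L \<lhd> ?H\<lparr>carrier := ?L\<rparr>" by (rule group.normal_Int_subgroup[OF grH sLH MH])
      thus "?M \<lhd> ?GL" using mL by (simp add: Int_absorb2)
      show "finite (carrier ?GL)" using finite_subset[OF subgroup.subset[OF sL] G(2)] by simp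
      show "coprime n q" by (rule pi_number_coprime[OF n(2) q(2)])
      show "?\<alpha> y * ?\<beta> y = of_nat t * \<tau> y" if "y \<in> carrier ?GL" for y
        using \<tau>x[of y] that by (simp add: restrict_to_def)
      show "?\<alpha> y * ?\<beta> y = of_nat t' * \<tau>' y" if "y \<in> ?M" for y
        using \<tau>'x[OF that] subsetD[OF mL that] by (simp add: restrict_to_def)
      show "cmod (?\<beta> m) = cmod (?\<beta> \<one>\<^bsub>?GL\<^esub>)" if "m \<in> ?M" for m
        using ext[OF that] subsetD[OF mL that] oneL by (simp add: restrict_to_def)
      show "?\<alpha> \<one>\<^bsub>?GL\<^esub> = of_nat n" using n oneL by (simp add: restrict_to_def)
    qed (use q(1) \<alpha>L \<beta>L \<tau>(1,2) \<tau>'(1,2) in simp_all)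
    then obtain e \<theta> where e: "e > 0" "\<theta> \<in> characters ?GL"
      "\<forall>m\<in>?M. \<tau> m = of_nat e * (?\<beta> m / ?\<beta> \<one>\<^bsub>?GL\<^esub> * \<theta> m)"
      "e = 1 \<longrightarrow> (\<forall>x\<in>carrier ?GL. cmod (?\<beta> x) = cmod (?\<beta> \<one>\<^bsub>?GL\<^esub>))"
      by blast
    have grK: "group ?K" by (rule subgroup.subgroup_is_group[OF sN(2) G(1)])
    have finK: "finite (carrier ?K)" using finite_subset[OF subgroup.subset[OF sN(2)] G(2)] by simp
    obtain b where b: "b > 0" "\<beta> \<one>\<^bsub>?H\<^esub> = of_nat b" by (rule char_degree[OF \<beta>c grH])
    \<comment> \<open>Irreducibility is known only after induction from \<open>?L\<close> to the
      term of the series, so \<open>\<tau>\<close> and \<open>e * \<theta>\<close> are compared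
      through the induced characters.\<close>
    have "e = 1"
    proof (rule induced_multiple_reducible[OF grK finK _ _ _ \<tau>(4) e(1)])
      show "subgroup ?L ?K" using subgroup_incl[OF sL sN(2)] by simp
      show "\<theta> \<in> characters (?K\<lparr>carrier := ?L\<rparr>)" using e(2) by simp
      fix y assume y: "y \<in> ?L" "y \<in> pi_elements \<pi> ?K"
      have yG: "y \<in> pi_elements \<pi> G" using y(2) pi_elements_subgroup[OF G(2) sN(2)] by simp
      have yM: "y \<in> ?M" by (rule pi_element_in_subgroup[OF G(2) sM q(2) yG q(3)[OF y(1)]])
      have "y \<in> pi_elements \<pi> ?H" using yG yM pi_elements_subgroup[OF G(2) V] by simp
      hence "\<beta> y = \<beta> \<one>\<^bsub>?H\<^esub>"
        using special_trivial_on_complementary_elements[OF \<beta> grH finH MH _ yM] ext by simp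
      hence "?\<beta> y = ?\<beta> \<one>\<^bsub>?GL\<^esub>" "?\<beta> \<one>\<^bsub>?GL\<^esub> \<noteq> 0"
        using y(1) oneL b by (simp_all add: restrict_to_def)
      thus "\<tau> y = of_nat e * \<theta> y" using bspec[OF e(3) yM] by simp
    qed
    hence "cmod (?\<beta> x) = cmod (?\<beta> \<one>\<^bsub>?GL\<^esub>)" using e(4) Suc.prems(2) by simp
    thus ?thesis using Suc.prems(2) oneL by (simp add: restrict_to_def)
  qed
qed

text \<open>The inner product of \<open>\<beta>\<close> with itself is 1 by irreducibility and the
  square of the degree by constancy of the norm.\<close>

lemma constant_norm_Irr_linear:
  fixes G (structure)
  assumes G: "group G" "finite (carrier G)" and \<beta>: "\<beta> \<in> Irr G"
    and n: "\<And>x. x \<in> carrier G \<Longrightarrow> cmod (\<beta> x) = cmod (\<beta> \<one>)"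
  shows "linear_char G \<beta>"
proof -
  interpret group G by fact
  have \<beta>c: "\<beta> \<in> characters G" using \<beta> Irr_subset_characters by blast
  obtain b where b: "b > 0" "\<beta> \<one> = of_nat b" by (rule char_degree[OF \<beta>c G(1)])
  have "\<beta> x * cnj (\<beta> x) = of_nat (b * b)" if "x \<in> carrier G" for x
    using n[OF that] b by (simp add: complex_norm_square[symmetric] power2_eq_square)
  hence "char_ip G \<beta> \<beta> = of_nat (card (carrier G)) * of_nat (b * b) / of_nat (card (carrier G))"
    unfolding char_ip_def by simp
  moreover have "card (carrier G) \<noteq> 0" using G(2) one_closed by auto
  ultimately have "(of_nat (b * b) :: complex) = of_nat 1"
    using char_ip_irr[OF \<beta> \<beta> G] by simp
  hence "b = 1" by (simp only: of_nat_eq_iff) simp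
  thus ?thesis using \<beta>c b by (simp add: linear_char_def)
qed

text \<open>Twisting by \<open>lam\<close> changes no value at a \<pi>-element, so the induced
  partial characters stay the same. Used with \<open>\<beta>\<close> and with its complex conjugate
  to pass between \<open>\<alpha>\<close> and \<open>\<gamma>\<close>.\<close>

lemma inductive_pair_twist:
  fixes G (structure)
  assumes G: "group G" "finite (carrier G)" and ser: "normal_pi_series \<pi> G Ns"
    and ind: "inductive_pair \<pi> G Ns V \<gamma>" and l: "lam \<one> = 1"
    "\<And>x y. x \<in> V \<Longrightarrow> y \<in> V \<Longrightarrow> lam (x \<otimes> y) = lam x * lam y"
    "\<And>x. x \<in> V \<Longrightarrow> x \<in> pi_elements \<pi> G \<Longrightarrow> lam x = 1"
    and pair: "character_pair G V (\<lambda>g. lam g * \<gamma> g)"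
  shows "inductive_pair \<pi> G Ns V (\<lambda>g. lam g * \<gamma> g)"
  unfolding inductive_pair_def
proof (intro conjI ballI)
  interpret group G by fact
  fix N assume N: "N \<in> set Ns"
  let ?K = "G\<lparr>carrier := N\<rparr>"
  have V: "subgroup V G" using pair by (simp add: character_pair_def)
  have sN: "subgroup N G" using ser N by (simp add: normal_pi_series_def normal_def)
  have sVN: "subgroup (V \<inter> N) G" by (rule subgroups_Inter_pair[OF V sN])
  have grK: "group ?K" by (rule subgroup.subgroup_is_group[OF sN G(1)])
  have finK: "finite (carrier ?K)" using finite_subset[OF subgroup.subset[OF sN] G(2)] by simp
  obtain a \<eta> where \<eta>: "\<eta> \<in> Irr (G\<lparr>carrier := V \<inter> N\<rparr>)" "a > 0"
    "restrict_to (V \<inter> N) \<gamma> = (\<lambda>g. of_nat a * \<eta> g)"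
    "restrict_to (pi_elements \<pi> ?K) (induced ?K (V \<inter> N) \<eta>) \<in> I_pi \<pi> ?K"
    using ind N unfolding inductive_pair_def by blast
  let ?\<eta> = "\<lambda>g. lam g * \<eta> g"
  have 1: "?\<eta> \<in> Irr (G\<lparr>carrier := V \<inter> N\<rparr>)"
    by (rule linear_twist_Irr[OF \<eta>(1) subgroup.subgroup_is_group[OF sVN G(1)]]) (simp_all add: l(1,2))
  have 2: "restrict_to (V \<inter> N) (\<lambda>g. lam g * \<gamma> g) = (\<lambda>g. of_nat a * ?\<eta> g)"
  proof
    fix g
    have "restrict_to (V \<inter> N) (\<lambda>g. lam g * \<gamma> g) g = lam g * restrict_to (V \<inter> N) \<gamma> g"
      by (simp add: restrict_to_def)
    thus "restrict_to (V \<inter> N) (\<lambda>g. lam g * \<gamma> g) g = of_nat a * ?\<eta> g" unfolding \<eta>(3) by simp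
  qed
  have "induced ?K (V \<inter> N) ?\<eta> g = 1 * induced ?K (V \<inter> N) \<eta> g" if g: "g \<in> pi_elements \<pi> ?K" for g
  proof (rule induced_cong_on_pi_elements[OF grK finK _ g])
    fix x assume "x \<in> V \<inter> N" "x \<in> pi_elements \<pi> ?K"
    thus "?\<eta> x = 1 * \<eta> x" using l(3) pi_elements_subgroup[OF G(2) sN] by simp
  qed
  hence 3: "restrict_to (pi_elements \<pi> ?K) (induced ?K (V \<inter> N) ?\<eta>)
      = restrict_to (pi_elements \<pi> ?K) (induced ?K (V \<inter> N) \<eta>)"
    by (auto simp: restrict_to_def)
  show "\<exists>a::nat. \<exists>\<eta>\<in>Irr (G\<lparr>carrier := V \<inter> N\<rparr>). a > 0 \<and>
      restrict_to (V \<inter> N) (\<lambda>g. lam g * \<gamma> g) = (\<lambda>g. of_nat a * \<eta> g) \<and>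
      restrict_to (pi_elements \<pi> ?K) (induced ?K (V \<inter> N) \<eta>) \<in> I_pi \<pi> ?K"
    using 1 2 3 \<eta>(2,4) by (intro exI[of _ a] bexI[of _ ?\<eta>]) simp_all
qed (rule pair)

section \<open>Towers\<close>

text \<open>Conjugation by \<open>g\<close> permutes the partial characters of \<open>N\<close>, and
  conjugation by \<open>inv g\<close> carries a decomposition of the conjugate back to one of
  \<open>\<phi>\<close>.\<close>

lemma I_pi_conj:
  fixes G (structure)
  assumes N: "N \<lhd> G" and g: "g \<in> carrier G" and \<phi>: "\<phi> \<in> I_pi \<pi> (G\<lparr>carrier := N\<rparr>)"
    and fin: "finite (carrier G)"
  shows "(\<lambda>x. if x \<in> N then \<phi> (g \<otimes> x \<otimes> inv g) else 0) \<in> I_pi \<pi> (G\<lparr>carrier := N\<rparr>)"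
proof -
  interpret group G using N by (simp add: normal_def)
  interpret N: normal N G by fact
  let ?K = "G\<lparr>carrier := N\<rparr>"
  \<comment> \<open>Cut off outside \<open>N\<close>, so that conjugates are again functions
    vanishing off the subgroup and can be compared as functions.\<close>
  define C where "C = (\<lambda>g f x. if x \<in> N then f (g \<otimes> x \<otimes> inv g) else (0 :: complex))"
  have grK: "group ?K" by (rule N.subgroup_is_group[OF is_group])
  have NG: "x \<in> carrier G" if "x \<in> N" for x using that N.subset by blast
  have el: "pi_elements \<pi> ?K = pi_elements \<pi> G \<inter> N" by (rule pi_elements_subgroup[OF fin N.subgroup_axioms])
  have iff: "h \<otimes> x \<otimes> inv h \<in> pi_elements \<pi> ?K \<longleftrightarrow> x \<in> pi_elements \<pi> ?K"
    if h: "h \<in> carrier G" and x: "x \<in> N" for h x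
    using pi_elements_conj_iff[OF fin NG[OF x] h] N.inv_op_closed2[OF h x] x unfolding el by blast
  have part: "C h f \<in> partial_chars \<pi> ?K" if f: "f \<in> partial_chars \<pi> ?K" and h: "h \<in> carrier G" for f h
  proof -
    obtain \<chi> where \<chi>: "\<chi> \<in> characters ?K" "f = restrict_to (pi_elements \<pi> ?K) \<chi>"
      using f by (auto simp: partial_chars_def)
    have "C h \<chi> \<in> characters ?K"
      using char_hom_comp[OF \<chi>(1) grK grK N.conj_hom(1)[OF h]] by (simp add: C_def cong: if_cong)
    moreover have "C h f = restrict_to (pi_elements \<pi> ?K) (C h \<chi>)"
    proof
      fix x
      show "C h f x = restrict_to (pi_elements \<pi> ?K) (C h \<chi>) x"
        using iff[OF h, of x] by (cases "x \<in> N") (simp_all add: C_def \<chi>(2) restrict_to_def)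
    qed
    ultimately show ?thesis by (simp add: partial_chars_def)
  qed
  have out: "f x = 0" if "f \<in> partial_chars \<pi> ?K" "x \<notin> N" for f x
    using that by (auto simp: partial_chars_def restrict_to_def el)
  \<comment> \<open>\<open>C h\<close> applied to \<open>C k f\<close> conjugates by
    \<open>k \<otimes> h\<close>, in this order.\<close>
  have inv: "C h (C k f) = f" if f: "f \<in> partial_chars \<pi> ?K" and h: "h \<in> carrier G" "k \<in> carrier G" "k \<otimes> h = \<one>" for f h k
  proof
    fix x
    show "C h (C k f) x = f x"
    proof (cases "x \<in> N")
      case True
      have "inv h \<otimes> inv k = \<one>" using h inv_mult_group[of k h] by simp
      hence "k \<otimes> (h \<otimes> x \<otimes> inv h) \<otimes> inv k = x"
        using h NG[OF True] m_assoc[of k h "x \<otimes> inv h \<otimes> inv k"] by (simp add: m_assoc)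
      thus ?thesis using True N.inv_op_closed2[OF h(1) True] by (simp add: C_def)
    qed (use out[OF f] in \<open>simp add: C_def\<close>)
  qed
  have \<phi>p: "\<phi> \<in> partial_chars \<pi> ?K" using \<phi> by (simp add: I_pi_def)
  have ig: "inv g \<in> carrier G" "inv g \<otimes> g = \<one>" "g \<otimes> inv g = \<one>" using g by simp_all
  have "C g \<phi> \<in> I_pi \<pi> ?K"
    unfolding I_pi_def
  proof (intro CollectI conjI notI part[OF \<phi>p g])
    assume "\<exists>\<psi>s. set \<psi>s \<subseteq> partial_chars \<pi> ?K - {C g \<phi>} \<and> C g \<phi> = (\<lambda>x. \<Sum>\<psi>\<leftarrow>\<psi>s. \<psi> x)"
    then obtain \<psi>s where \<psi>s: "set \<psi>s \<subseteq> partial_chars \<pi> ?K - {C g \<phi>}" "C g \<phi> = (\<lambda>x. \<Sum>\<psi>\<leftarrow>\<psi>s. \<psi> x)" by blast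
    have "\<phi> = C (inv g) (C g \<phi>)" using inv[OF \<phi>p ig(1) g ig(3)] by simp
    also have "\<dots> = (\<lambda>x. \<Sum>\<psi>\<leftarrow>map (C (inv g)) \<psi>s. \<psi> x)"
    proof
      fix x
      show "C (inv g) (C g \<phi>) x = (\<Sum>\<psi>\<leftarrow>map (C (inv g)) \<psi>s. \<psi> x)"
        unfolding \<psi>s(2) by (cases "x \<in> N") (simp_all add: C_def o_def)
    qed
    finally have "\<phi> = (\<lambda>x. \<Sum>\<psi>\<leftarrow>map (C (inv g)) \<psi>s. \<psi> x)" .
    moreover have "set (map (C (inv g)) \<psi>s) \<subseteq> partial_chars \<pi> ?K - {\<phi>}"
    proof
      fix f assume "f \<in> set (map (C (inv g)) \<psi>s)"
      then obtain \<psi> where \<psi>: "f = C (inv g) \<psi>" "\<psi> \<in> partial_chars \<pi> ?K" "\<psi> \<noteq> C g \<phi>"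
        using \<psi>s(1) by auto
      have "C g f = \<psi>" unfolding \<psi>(1) by (rule inv[OF \<psi>(2) g ig(1,2)])
      thus "f \<in> partial_chars \<pi> ?K - {\<phi>}" using part[OF \<psi>(2) ig(1)] \<psi>(1,3) by auto
    qed
    ultimately show False using \<phi> unfolding I_pi_def by blast
  qed
  thus ?thesis by (simp add: C_def)
qed

lemma tower_stabilizer_subgroup:
  fixes G (structure)
  assumes G: "group G" and N: "\<And>N. N \<in> set Ns \<Longrightarrow> N \<lhd> G"
  shows "subgroup (tower_stabilizer G Ns \<nu>s) G"
proof -
  interpret group G by fact
  have NG: "x \<in> carrier G" if "i < length Ns" "x \<in> Ns ! i" for i x
    using N[OF nth_mem[OF that(1)]] that(2) normal_imp_subgroup subgroup.subset by blast
  have cl: "g \<otimes> x \<otimes> inv g \<in> Ns ! i" if "i < length Ns" "x \<in> Ns ! i" "g \<in> carrier G" for i x g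
    using normal.inv_op_closed2[OF N[OF nth_mem[OF that(1)]] that(3,2)] .
  show ?thesis
  proof (rule subgroupI)
    show "tower_stabilizer G Ns \<nu>s \<subseteq> carrier G" by (auto simp: tower_stabilizer_def)
    have "\<one> \<in> tower_stabilizer G Ns \<nu>s" using NG by (simp add: tower_stabilizer_def)
    thus "tower_stabilizer G Ns \<nu>s \<noteq> {}" by blast
  next
    fix g assume "g \<in> tower_stabilizer G Ns \<nu>s"
    hence g: "g \<in> carrier G" "\<And>i x. i < length Ns \<Longrightarrow> x \<in> Ns ! i \<Longrightarrow> (\<nu>s ! i) (g \<otimes> x \<otimes> inv g) = (\<nu>s ! i) x"
      by (auto simp: tower_stabilizer_def)
    have "(\<nu>s ! i) (inv g \<otimes> x \<otimes> inv (inv g)) = (\<nu>s ! i) x" if i: "i < length Ns" "x \<in> Ns ! i" for i x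
    proof -
      have "g \<otimes> (inv g \<otimes> x \<otimes> inv (inv g)) \<otimes> inv g = x"
        using g(1) NG[OF i] by (simp add: m_assoc inv_cancel)
      thus ?thesis using g(2)[OF i(1) cl[OF i, of "inv g"]] g(1) by simp
    qed
    thus "inv g \<in> tower_stabilizer G Ns \<nu>s" using g(1) by (simp add: tower_stabilizer_def)
  next
    fix g h assume "g \<in> tower_stabilizer G Ns \<nu>s" "h \<in> tower_stabilizer G Ns \<nu>s"
    hence gh: "g \<in> carrier G" "\<And>i x. i < length Ns \<Longrightarrow> x \<in> Ns ! i \<Longrightarrow> (\<nu>s ! i) (g \<otimes> x \<otimes> inv g) = (\<nu>s ! i) x"
      "h \<in> carrier G" "\<And>i x. i < length Ns \<Longrightarrow> x \<in> Ns ! i \<Longrightarrow> (\<nu>s ! i) (h \<otimes> x \<otimes> inv h) = (\<nu>s ! i) x"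
      by (auto simp: tower_stabilizer_def)
    have "(\<nu>s ! i) (g \<otimes> h \<otimes> x \<otimes> inv (g \<otimes> h)) = (\<nu>s ! i) x" if i: "i < length Ns" "x \<in> Ns ! i" for i x
    proof -
      have "g \<otimes> h \<otimes> x \<otimes> inv (g \<otimes> h) = g \<otimes> (h \<otimes> x \<otimes> inv h) \<otimes> inv g"
        using gh(1,3) NG[OF i] by (simp add: m_assoc inv_mult_group)
      thus ?thesis using gh(2)[OF i(1) cl[OF i gh(3)]] gh(4)[OF i] by simp
    qed
    thus "g \<otimes> h \<in> tower_stabilizer G Ns \<nu>s" using gh(1,3) by (simp add: tower_stabilizer_def)
  qed
qed

text \<open>Descends the tower from the top, where the character is \<open>\<chi>\<close> itself;
  being a constituent is transitive under restriction.\<close>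

lemma tower_constituent:
  fixes G (structure)
  assumes G: "group G" and N: "\<And>N. N \<in> set Ns \<Longrightarrow> N \<lhd> G" and sub: "\<And>i. Suc i < length Ns \<Longrightarrow> Ns ! i \<subseteq> Ns ! Suc i"
    and last: "Ns \<noteq> []" "last Ns = carrier G" and \<chi>: "\<chi> \<in> Irr G" and tower: "character_tower G Ns \<chi> \<nu>s"
    and i: "i < length Ns"
  shows "\<nu>s ! i \<in> irr_constituents (G\<lparr>carrier := Ns ! i\<rparr>) (restrict_to (Ns ! i) \<chi>)"
proof -
  interpret group G by fact
  have len: "length \<nu>s = length Ns" using tower by (simp add: character_tower_def)
  have "i \<le> length Ns - 1" using i by simp
  thus ?thesis
  proof (induction rule: inc_induct)
    case base
    have ne: "\<nu>s \<noteq> []" using len last(1) by auto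
    have "Ns ! (length Ns - 1) = carrier G" using last by (simp add: last_conv_nth)
    moreover have "\<nu>s ! (length Ns - 1) = \<chi>"
      using tower last_conv_nth[OF ne] len by (simp add: character_tower_def)
    moreover have "restrict_to (carrier G) \<chi> = \<chi>"
      using restrict_to_carrier \<chi> Irr_subset_characters by blast
    ultimately show ?case using \<chi> by (simp add: irr_constituents_def)
  next
    case (step n)
    hence n: "Suc n < length Ns" by simp
    let ?K = "G\<lparr>carrier := Ns ! Suc n\<rparr>"
    have s: "subgroup (Ns ! n) G" "subgroup (Ns ! Suc n) G"
      using N n by (simp_all add: normal_imp_subgroup)
    have "\<nu>s ! n \<in> irr_constituents (?K\<lparr>carrier := Ns ! n\<rparr>) (restrict_to (Ns ! n) (restrict_to (Ns ! Suc n) \<chi>))"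
    proof (rule constituent_trans[OF step.IH])
      show "\<nu>s ! n \<in> irr_constituents (?K\<lparr>carrier := Ns ! n\<rparr>) (restrict_to (Ns ! n) (\<nu>s ! Suc n))"
        using tower n by (simp add: character_tower_def)
      show "group ?K" by (rule subgroup.subgroup_is_group[OF s(2) G])
      show "subgroup (Ns ! n) ?K" by (rule subgroup_incl[OF s sub[OF n]])
    qed
    moreover have "restrict_to (Ns ! n) (restrict_to (Ns ! Suc n) \<chi>) = restrict_to (Ns ! n) \<chi>"
      using sub[OF n] by (auto simp: restrict_to_def fun_eq_iff)
    ultimately show ?case by simp
  qed
qed

text \<open>Pairing both sides with \<open>\<phi>\<close> gives \<open>c\<close> on the left,
  whereas orthogonality would make the right side zero if the characters differed.\<close>

lemma Irr_proportional:
  assumes "\<phi> \<in> Irr G" "\<psi> \<in> Irr G" "group G" "finite (carrier G)" "c \<noteq> 0"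
    and eq: "(\<lambda>g. c * \<phi> g) = (\<lambda>g. d * \<psi> g)"
  shows "\<phi> = \<psi>"
proof -
  have "c * char_ip G \<phi> \<phi> = d * char_ip G \<psi> \<phi>"
    using eq char_ip_scale[of G c \<phi> \<phi>] char_ip_scale[of G d \<psi> \<phi>] by simp
  thus ?thesis
    using char_ip_irr[OF assms(1,1,3,4)] char_ip_irr[OF assms(2,1,3,4)] assms(5) by (auto split: if_splits)
qed

text \<open>One constituent per term decides for all of them, because \<open>I_pi\<close> is stable
  under conjugation.\<close>

lemma series_pi_lift_iff:
  fixes G (structure)
  assumes G: "group G" "finite (carrier G)" and ser: "normal_pi_series \<pi> G Ns"
    and \<chi>: "\<chi> \<in> Irr G" and tower: "character_tower G Ns \<chi> \<nu>s"
  shows "series_pi_lift \<pi> G Ns \<chi> \<longleftrightarrow> (\<forall>i < length Ns.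
    restrict_to (pi_elements \<pi> (G\<lparr>carrier := Ns ! i\<rparr>)) (\<nu>s ! i) \<in> I_pi \<pi> (G\<lparr>carrier := Ns ! i\<rparr>))"
    (is "_ \<longleftrightarrow> (\<forall>i < _. ?P i)")
proof
  interpret group G by fact
  have N: "N \<lhd> G" if "N \<in> set Ns" for N using ser that by (simp add: normal_pi_series_def)
  have con: "\<nu>s ! i \<in> irr_constituents (G\<lparr>carrier := Ns ! i\<rparr>) (restrict_to (Ns ! i) \<chi>)"
    if "i < length Ns" for i
    by (rule tower_constituent[OF G(1) N _ _ _ \<chi> tower that])
      (use ser in \<open>auto simp: normal_pi_series_def\<close>)
  show "\<forall>i < length Ns. ?P i" if "series_pi_lift \<pi> G Ns \<chi>"
    using that con unfolding series_pi_lift_def pi_lift_def by auto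
  assume P: "\<forall>i < length Ns. ?P i"
  show "series_pi_lift \<pi> G Ns \<chi>"
    unfolding series_pi_lift_def
  proof (intro conjI \<chi> ballI)
    fix N \<psi> assume "N \<in> set Ns" and \<psi>: "\<psi> \<in> irr_constituents (G\<lparr>carrier := N\<rparr>) (restrict_to N \<chi>)"
    then obtain i where i: "i < length Ns" "N = Ns ! i" by (auto simp: in_set_conv_nth)
    have nN: "N \<lhd> G" using N i by simp
    interpret N: normal N G by fact
    let ?K = "G\<lparr>carrier := N\<rparr>"
    let ?\<nu> = "\<nu>s ! i"
    have \<nu>: "?\<nu> \<in> irr_constituents ?K (restrict_to N \<chi>)" using con[OF i(1)] i(2) by simp
    have grK: "group ?K" by (rule N.subgroup_is_group[OF G(1)])
    have finK: "finite (carrier ?K)" using finite_subset[OF N.subset G(2)] by simp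
    have irr: "\<psi> \<in> Irr ?K" "?\<nu> \<in> Irr ?K" using \<psi> \<nu> by (simp_all add: irr_constituents_def)
    obtain g where g: "g \<in> carrier G" "\<And>x. x \<in> N \<Longrightarrow> \<psi> x = ?\<nu> (g \<otimes> x \<otimes> inv g)"
      using clifford_conjugate[OF nN G(2) \<chi> irr(2) _ irr(1)]
        constituent_ip[OF \<psi> grK finK] constituent_ip[OF \<nu> grK finK] unfolding char_ip_restrict by blast
    have el: "pi_elements \<pi> ?K = pi_elements \<pi> G \<inter> N" by (rule pi_elements_subgroup[OF G(2) N.subgroup_axioms])
    have "restrict_to (pi_elements \<pi> ?K) \<psi>
        = (\<lambda>x. if x \<in> N then restrict_to (pi_elements \<pi> ?K) ?\<nu> (g \<otimes> x \<otimes> inv g) else 0)"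
    proof
      fix x
      have "g \<otimes> x \<otimes> inv g \<in> pi_elements \<pi> G \<longleftrightarrow> x \<in> pi_elements \<pi> G" if "x \<in> N"
        by (rule pi_elements_conj_iff[OF G(2) N.mem_carrier[OF that] g(1)])
      thus "restrict_to (pi_elements \<pi> ?K) \<psi> x
          = (if x \<in> N then restrict_to (pi_elements \<pi> ?K) ?\<nu> (g \<otimes> x \<otimes> inv g) else 0)"
        using g(2) N.inv_op_closed2[OF g(1), of x] by (simp add: restrict_to_def el)
    qed
    moreover have "restrict_to (pi_elements \<pi> ?K) ?\<nu> \<in> I_pi \<pi> ?K" using P i by simp
    ultimately have "restrict_to (pi_elements \<pi> ?K) \<psi> \<in> I_pi \<pi> ?K"
      using I_pi_conj[OF nN g(1) _ G(2)] by simp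
    thus "pi_lift \<pi> ?K \<psi>" using irr(1) Irr_subset_characters by (auto simp: pi_lift_def)
  qed
qed

text \<open>The irreducible character below \<open>\<gamma>\<close> on a term is unique by
  \<open>Irr_proportional\<close>, so the one in the definition of inductive pairs is the one of the
  tower pair, which induces to \<open>\<nu>s ! i\<close>.\<close>

lemma inductive_pair_tower_iff:
  fixes G (structure)
  assumes G: "group G" "finite (carrier G)" and ser: "normal_pi_series \<pi> G Ns"
    and pair: "tower_pair G Ns \<chi> \<nu>s V \<gamma>"
  shows "inductive_pair \<pi> G Ns V \<gamma> \<longleftrightarrow> (\<forall>i < length Ns.
    restrict_to (pi_elements \<pi> (G\<lparr>carrier := Ns ! i\<rparr>)) (\<nu>s ! i) \<in> I_pi \<pi> (G\<lparr>carrier := Ns ! i\<rparr>))"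
    (is "_ \<longleftrightarrow> (\<forall>i < _. ?P i)")
proof -
  interpret group G by fact
  have N: "N \<lhd> G" if "N \<in> set Ns" for N using ser that by (simp add: normal_pi_series_def)
  have V: "subgroup V G" using pair tower_stabilizer_subgroup[OF G(1) N] by (simp add: tower_pair_def)
  have "\<gamma> \<in> Irr (G\<lparr>carrier := V\<rparr>)" using pair unfolding tower_pair_def by blast
  hence cp: "character_pair G V \<gamma>" using V by (simp add: character_pair_def)
  define Q where "Q = (\<lambda>N. \<exists>a::nat. \<exists>\<eta> \<in> Irr (G\<lparr>carrier := V \<inter> N\<rparr>).
    a > 0 \<and> restrict_to (V \<inter> N) \<gamma> = (\<lambda>g. of_nat a * \<eta> g) \<and>
    restrict_to (pi_elements \<pi> (G\<lparr>carrier := N\<rparr>)) (induced (G\<lparr>carrier := N\<rparr>) (V \<inter> N) \<eta>)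
      \<in> I_pi \<pi> (G\<lparr>carrier := N\<rparr>))"
  have "Q (Ns ! i) \<longleftrightarrow> ?P i" if i: "i < length Ns" for i
  proof -
    let ?N = "Ns ! i"
    obtain t \<tau> where \<tau>: "\<tau> \<in> Irr (G\<lparr>carrier := V \<inter> ?N\<rparr>)" "t > 0"
      "restrict_to (V \<inter> ?N) \<gamma> = (\<lambda>g. of_nat t * \<tau> g)"
      "induced (G\<lparr>carrier := ?N\<rparr>) (V \<inter> ?N) \<tau> = \<nu>s ! i"
      using pair i unfolding tower_pair_def by blast
    have s: "subgroup (V \<inter> ?N) G"
      by (rule subgroups_Inter_pair[OF V normal_imp_subgroup[OF N[OF nth_mem[OF i]]]])
    have gr: "group (G\<lparr>carrier := V \<inter> ?N\<rparr>)" by (rule subgroup.subgroup_is_group[OF s G(1)])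
    have fin: "finite (carrier (G\<lparr>carrier := V \<inter> ?N\<rparr>))"
      using finite_subset[OF subgroup.subset[OF s] G(2)] by simp
    show ?thesis
    proof
      assume "Q ?N"
      then obtain a \<eta> where \<eta>: "\<eta> \<in> Irr (G\<lparr>carrier := V \<inter> ?N\<rparr>)" "a > (0::nat)"
        "restrict_to (V \<inter> ?N) \<gamma> = (\<lambda>g. of_nat a * \<eta> g)"
        "restrict_to (pi_elements \<pi> (G\<lparr>carrier := ?N\<rparr>)) (induced (G\<lparr>carrier := ?N\<rparr>) (V \<inter> ?N) \<eta>)
          \<in> I_pi \<pi> (G\<lparr>carrier := ?N\<rparr>)"
        unfolding Q_def by blast
      have "\<eta> = \<tau>"
        by (rule Irr_proportional[OF \<eta>(1) \<tau>(1) gr fin, where c = "of_nat a" and d = "of_nat t"]) (use \<eta>(2,3) \<tau>(3) in simp_all)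
      thus "?P i" using \<eta>(4) \<tau>(4) by simp
    next
      assume "?P i"
      thus "Q ?N" unfolding Q_def using \<tau> by (intro exI[of _ t] bexI[of _ \<tau>]) simp_all
    qed
  qed
  moreover have "inductive_pair \<pi> G Ns V \<gamma> \<longleftrightarrow> (\<forall>i < length Ns. Q (Ns ! i))"
    unfolding inductive_pair_def Q_def[symmetric] using cp by (auto simp: all_set_conv_all_nth)
  ultimately show ?thesis by simp
qed

theorem theorem1:
  fixes G :: "('a, 'b) monoid_scheme"
    and \<pi> :: "nat set"
    and Ns :: "'a set list"
    and V :: "'a set"
    and \<chi> \<gamma> \<alpha> \<beta> :: "'a \<Rightarrow> complex"
  assumes "\<And>p. p \<in> \<pi> \<Longrightarrow> prime p"
    and "group G" and "finite (carrier G)" and "pi_separable \<pi> G"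
    and "normal_pi_series \<pi> G Ns"
    and "\<chi> \<in> Irr G"
    and "self_stabilizing_pair G Ns \<chi> V \<gamma>"
    and "pi_special \<pi> (G\<lparr>carrier := V\<rparr>) \<alpha>"
    and "pi_special (pi_compl \<pi>) (G\<lparr>carrier := V\<rparr>) \<beta>"
    and "\<gamma> = (\<lambda>g. \<alpha> g * \<beta> g)"
  shows "(series_pi_lift \<pi> G Ns \<chi> \<longleftrightarrow> inductive_pair \<pi> G Ns V \<gamma>) \<and>
    (inductive_pair \<pi> G Ns V \<gamma> \<longleftrightarrow>
      inductive_pair \<pi> G Ns V \<alpha> \<and> linear_char (G\<lparr>carrier := V\<rparr>) \<beta>)"
proof -
  interpret group G by fact
  note G = assms(2,3)
  let ?H = "G\<lparr>carrier := V\<rparr>"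
  obtain \<nu>s where \<nu>s: "character_tower G Ns \<chi> \<nu>s" "tower_pair G Ns \<chi> \<nu>s V \<gamma>"
    using assms(7) by (auto simp: self_stabilizing_pair_def)
  have N: "N \<lhd> G" if "N \<in> set Ns" for N using assms(5) that by (simp add: normal_pi_series_def)
  have V: "subgroup V G" using \<nu>s(2) tower_stabilizer_subgroup[OF G(1) N] by (simp add: tower_pair_def)
  have grH: "group ?H" by (rule subgroup.subgroup_is_group[OF V G(1)])
  have finH: "finite (carrier ?H)" using finite_subset[OF subgroup.subset[OF V] G(2)] by simp
  have irr: "\<alpha> \<in> Irr ?H" "\<beta> \<in> Irr ?H" "\<gamma> \<in> Irr ?H"
    using assms(8,9) \<nu>s(2) unfolding pi_special_def tower_pair_def by blast+
  have \<beta>c: "\<beta> \<in> characters ?H" using irr(2) Irr_subset_characters by blast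
  have norm: "cmod (\<beta> x) = 1" if "linear_char ?H \<beta>" "x \<in> V" for x
    using linear_char_norm[OF \<beta>c grH finH, of x] that by (simp add: linear_char_def)
  have mult: "\<beta> (x \<otimes>\<^bsub>G\<^esub> y) = \<beta> x * \<beta> y" if "linear_char ?H \<beta>" "x \<in> V" "y \<in> V" for x y
    using linear_char_mult[OF \<beta>c grH, of x y] that by (simp add: linear_char_def)
  have one: "\<beta> \<one>\<^bsub>G\<^esub> = 1" if "linear_char ?H \<beta>" using that by (simp add: linear_char_def)
  \<comment> \<open>A linear \<open>\<beta>\<close> has constant norm on all of \<open>V\<close>, so
    \<open>special_trivial_on_complementary_elements\<close> applies with \<open>V\<close> itself as
    the normal subgroup.\<close>
  have triv: "\<beta> x = 1" if l: "linear_char ?H \<beta>" and x: "x \<in> V" "x \<in> pi_elements \<pi> G" for x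
  proof -
    have "x \<in> pi_elements \<pi> ?H" using x pi_elements_subgroup[OF G(2) V] by simp
    moreover have "carrier G \<lhd> G" using assms(5) unfolding normal_pi_series_def by (metis last_in_set)
    from normal_Int_subgroup[OF V this] have "V \<lhd> ?H"
      using subgroup.subset[OF V] by (simp add: Int_absorb1)
    ultimately have "\<beta> x = \<beta> \<one>\<^bsub>?H\<^esub>"
      using norm[OF l] one[OF l] x(1)
      by (intro special_trivial_on_complementary_elements[OF assms(9) grH finH, of V]) simp_all
    thus ?thesis using one[OF l] by simp
  qed
  \<comment> \<open>The last term of the series is the whole group, so the norm condition at the
    last index covers \<open>V\<close>.\<close>
  have "linear_char ?H \<beta>" if ind: "inductive_pair \<pi> G Ns V \<gamma>"
  proof (rule constant_norm_Irr_linear[OF grH finH irr(2)])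
    fix x assume x: "x \<in> carrier ?H"
    have ne: "Ns \<noteq> []" "last Ns = carrier G" using assms(5) by (simp_all add: normal_pi_series_def)
    have "x \<in> V \<inter> Ns ! (length Ns - 1)"
      using x subgroup.subset[OF V] ne by (auto simp: last_conv_nth)
    hence "cmod (\<beta> x) = cmod (\<beta> \<one>\<^bsub>G\<^esub>)"
      using ind ne(1) unfolding assms(10)
      by (intro inductive_product_norm[OF G assms(5) V assms(8,9), of "length Ns - 1"]) simp_all
    thus "cmod (\<beta> x) = cmod (\<beta> \<one>\<^bsub>?H\<^esub>)" by simp
  qed
  moreover have "inductive_pair \<pi> G Ns V \<alpha>" if ind: "inductive_pair \<pi> G Ns V \<gamma>" and l: "linear_char ?H \<beta>"
  proof -
    \<comment> \<open>\<open>\<beta>\<close> has norm 1 on \<open>V\<close>, so conjugation inverts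
      it there; off \<open>V\<close> both sides vanish.\<close>
    have \<alpha>: "\<alpha> = (\<lambda>g. cnj (\<beta> g) * \<gamma> g)"
    proof
      fix g
      show "\<alpha> g = cnj (\<beta> g) * \<gamma> g"
      proof (cases "g \<in> V")
        case True
        hence "cnj (\<beta> g) * \<beta> g = 1"
          using norm[OF l] by (simp add: complex_norm_square[symmetric] mult.commute[of "cnj _"])
        thus ?thesis unfolding assms(10) by simp
      next
        case False
        thus ?thesis using char_outside[of \<alpha> ?H g] irr(1) Irr_subset_characters unfolding assms(10) by auto
      qed
    qed
    have "inductive_pair \<pi> G Ns V (\<lambda>g. cnj (\<beta> g) * \<gamma> g)"
      by (rule inductive_pair_twist[OF G assms(5) ind])
        (use one[OF l] mult[OF l] triv[OF l] V irr(1) in \<open>simp_all add: \<alpha>[symmetric] character_pair_def\<close>)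
    thus ?thesis unfolding \<alpha>[symmetric] .
  qed
  moreover have "inductive_pair \<pi> G Ns V \<gamma>" if ind: "inductive_pair \<pi> G Ns V \<alpha>" and l: "linear_char ?H \<beta>"
  proof -
    have \<gamma>: "\<gamma> = (\<lambda>g. \<beta> g * \<alpha> g)" unfolding assms(10) by (simp add: mult.commute)
    show ?thesis unfolding \<gamma>
      by (rule inductive_pair_twist[OF G assms(5) ind])
        (use one[OF l] mult[OF l] triv[OF l] V irr(3) in \<open>simp_all add: \<gamma>[symmetric] character_pair_def\<close>)
  qed
  moreover have "series_pi_lift \<pi> G Ns \<chi> \<longleftrightarrow> inductive_pair \<pi> G Ns V \<gamma>"
    unfolding series_pi_lift_iff[OF G assms(5,6) \<nu>s(1)] inductive_pair_tower_iff[OF G assms(5) \<nu>s(2)] ..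
  ultimately show ?thesis by blast
qed

end
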